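(* Let $\lambda_0$ be a critical point of $A$ and set $t_0:=\arccos(D(\lambda_0)/2)$. Then the following assertions are equivalent. (i) $\lambda_0$ is a regular critical point of $A$. (ii) $D(\lambda_0)\in\{-2,2\}$, $\psi_{\lambda_0}(a)=(p\varphi_{\lambda_0}')(a)=0$ and $\ddot D(\lambda_0)\neq0$. (iii) $\ker\big((A(t_0)-\lambda_0)^2\big)=\ker(A(t_0)-\lambda_0)$.
   Context: Setting. Let $a>0$ and let $w,p,q:\mathbb R\to\mathbb R$ be measurable and $a$-periodic, with $w,q,p^{-1}$ integrable over $(0,a)$, $w\neq0$ a.e. and $p>0$ a.e. Put $\mathfrak a(f):=\frac1w\big(-(pf')'+qf\big)$. $L^2_{|w|}(\mathbb R)$ has scalar product $(f,g)=\int_{\mathbb R}f\overline g|w|\,dx$. The maximal operator $A$ is $Af:=\mathfrak a(f)$, $\operatorname{dom}A=\{f\in L^2_{|w|}(\mathbb R): f,pf'\in AC_{\rm loc}(\mathbb R),\ \mathfrak a(f)\in L^2_{|w|}(\mathbb R)\}$. Let $\mathcal H_a:=L^2_{|w|}(0,a)$ (scalar product $\int_0^af\overline g|w|\,dx$), and for $t\in\mathbb R$ let $A(t)f:=\mathfrak a(f)$ with $\operatorname{dom}A(t)=\{f\in\mathcal H_a: f,pf'\in AC([0,a]),\ \mathfrak a(f)\in\mathcal H_a,\ f(a)=e^{it}f(0),\ (pf')(a)=e^{it}(pf')(0)\}$. Discriminant. For $\lambda\in\mathbb C$, $\varphi_\lambda,\psi_\lambda$ are the solutions of $\mathfrak a(u)=\lambda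 u$ with $\varphi_\lambda(0)=1$, $(p\varphi_\lambda')(0)=0$, $\psi_\lambda(0)=0$, $(p\psi_\lambda')(0)=1$. The Floquet discriminant is the entire function $D(\lambda)=\varphi_\lambda(a)+(p\psi_\lambda')(a)$; dots denote complex derivatives in $\lambda$. One has $\sigma(A)=\{\lambda: D(\lambda)\in[-2,2]\}$. The set of critical points of $A$ is $c(A):=\{\lambda\in\sigma(A):\dot D(\lambda)=0\}$. Curves. A curve is a continuous map $\gamma:\mathcal J\to\mathbb C$ on a real interval $\mathcal J$, identified with its image; it is analytic if it is injective and analytic at each interior point of $\mathcal J$. A regular spectral curve of $A$ is an analytic curve $\gamma:\mathcal J\to\sigma(A)$ with $\dot D\neq0$ on $\gamma$. $\mathfrak B_0(\gamma)$ is the system of Borel subsets of $\gamma$ whose closure is contained in $\gamma$. Spectral function. With $\mathcal I:=[-\pi,\pi]$, the Gelfand transform $\mathcal G:L^2_{|w|}(\mathbb R)\to L^2(\mathcal I,\mathcal H_a)$, $(\mathcal Gf)(t)=\lim_{N\to\infty}\frac1{\sqrt{2\pi}}\sum_{n=-N}^Ne^{-int}f(\cdot+na)$ (limit in $L^2(\mathcal I,\mathcal H_a)$), is unitary. For $\Delta\in\mathfrak B_0(\gamma)$, $\gamma$ a regular spectral curve, the value $E(\Delta)$ of the spectral function of $A$ is $E(\Delta)=\mathcal G^{-1}\widetilde E(\Delta)\mathcal G$, where $(\widetilde E(\Delta)F)(t)=E(t;\Delta)F(t)$ and $E(t;\Delta)$ is the Riesz–Dunford spectral projection of $A(t)$ corresponding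 to $\sigma(A(t))\cap\Delta$ (and $0$ if this set is empty). Regular critical point. A critical point $\lambda_0$ of $A$ is called regular if for some domain $\mathcal U\subset\mathbb C$ with $\lambda_0\in\mathcal U$ and $\overline{\mathcal U}\cap c(A)=\{\lambda_0\}$ one has $\sup_\gamma\sup_{\Delta\subset\mathcal U,\,\Delta\in\mathfrak B_0(\gamma)}\|E(\Delta)\|<\infty$, the first supremum running over all regular spectral curves $\gamma$ of $A$ with $\lambda_0$ in the boundary of $\gamma$ relative to $\sigma(A)$. Otherwise it is called singular. *)

theory Defs
  imports "HOL-Complex_Analysis.Complex_Analysis"
begin

section \<open>Square-integrable functions and operators between them\<close>

text \<open>
  Elements of an \<open>L\<^sup>2\<close>-space are represented by functions, two functions being the same element
  iff they agree almost everywhere.  A (partial, unbounded) linear operator is represented by its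
  graph, a set of pairs of representatives.  All concrete graphs below are saturated, i.e.
  they contain, with a pair, every pair that agrees with it almost everywhere; so composing
  them with \<open>O\<close> is composition of operators.
\<close>

type_synonym cfun = "real \<Rightarrow> complex"
type_synonym oper = "(cfun \<times> cfun) set"

definition L2 :: "real measure \<Rightarrow> cfun set" where
  "L2 M = {f \<in> borel_measurable M. integrable M (\<lambda>x. (norm (f x))\<^sup>2)}"

definition l2_inner :: "real measure \<Rightarrow> cfun \<Rightarrow> cfun \<Rightarrow> complex" where
  "l2_inner M f g = (\<integral>x. f x * cnj (g x) \<partial>M)"

definition l2_norm :: "real measure \<Rightarrow> cfun \<Rightarrow> real" where
  "l2_norm M f = sqrt (\<integral>x. (norm (f x))\<^sup>2 \<partial>M)"

definition op_minus :: "oper \<Rightarrow> complex \<Rightarrow> oper" where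
  "op_minus T z = {(f, \<lambda>x. h x - z * f x) | f h. (f, h) \<in> T}"

definition op_ker :: "oper \<Rightarrow> cfun set" where
  "op_ker T = {f. (f, \<lambda>_. 0) \<in> T}"

definition op_norm :: "real measure \<Rightarrow> oper \<Rightarrow> ennreal" where
  "op_norm M T = (SUP (f, g) \<in> {(f, g) \<in> T. l2_norm M f \<le> 1}. ennreal (l2_norm M g))"

text \<open>
  \<open>z\<close> is in the resolvent set iff \<open>T - z\<close> is a bijection from its domain onto
  \<open>L2 M\<close> with bounded inverse; the norm bound contains injectivity.
\<close>

definition resolvent_set :: "real measure \<Rightarrow> oper \<Rightarrow> complex set" where
  "resolvent_set M T =
     {z. (\<forall>h \<in> L2 M. \<exists>f. (f, h) \<in> op_minus T z) \<and>
         (\<exists>C. \<forall>(f, h) \<in> op_minus T z. l2_norm M f \<le> C * l2_norm M h)}"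

definition op_spectrum :: "real measure \<Rightarrow> oper \<Rightarrow> complex set" where
  "op_spectrum M T = - resolvent_set M T"

text \<open>A representative of \<open>(T - z)\<^sup>-\<^sup>1 h\<close>, for \<open>z\<close> in the resolvent set.\<close>

definition op_resolvent :: "oper \<Rightarrow> complex \<Rightarrow> cfun \<Rightarrow> cfun" where
  "op_resolvent T z h = (SOME f. (f, h) \<in> op_minus T z)"

text \<open>
  A cycle in the resolvent set (a finite list of closed paths, taken as a formal sum) that
  surrounds the part \<open>S\<close> of the spectrum once and no other point of the spectrum.
\<close>

definition separating_cycle ::
    "real measure \<Rightarrow> oper \<Rightarrow> complex set \<Rightarrow> (real \<Rightarrow> complex) list \<Rightarrow> bool" where
  "separating_cycle M T S cs \<longleftrightarrow>
     (\<forall>c \<in> set cs. valid_path c \<and> pathfinish c = pathstart c \<and>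
                   path_image c \<subseteq> resolvent_set M T) \<and>
     (\<forall>z \<in> op_spectrum M T.
        (\<Sum>c\<leftarrow>cs. winding_number c z) = (if z \<in> S then 1 else 0))"

text \<open>
  The Riesz-Dunford projection \<open>-(2\<pi>\<i>)\<^sup>-\<^sup>1 \<ointegral> (T - z)\<^sup>-\<^sup>1 dz\<close> of \<open>T\<close> corresponding to the part
  \<open>S\<close> of its spectrum.  The operator-valued contour integral is taken in the weak sense.
  For empty \<open>S\<close> the empty cycle is admissible, and the projection is \<open>0\<close>.
\<close>

definition riesz_projection :: "real measure \<Rightarrow> oper \<Rightarrow> complex set \<Rightarrow> oper" where
  "riesz_projection M T S =
     {(f, g). f \<in> L2 M \<and> g \<in> L2 M \<and>
        (\<exists>cs. separating_cycle M T S cs \<and>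
          (\<forall>h \<in> L2 M. l2_inner M g h =
             - (1 / (2 * of_real pi * \<i>)) *
               (\<Sum>c\<leftarrow>cs. contour_integral c (\<lambda>z. l2_inner M (op_resolvent T z f) h))))}"

text \<open>
  The Bochner space of square-integrable functions on a set \<open>I\<close> of reals with values in
  \<open>L2 M\<close>; strong measurability is approximability by simple functions almost everywhere.
\<close>

definition bochner_L2 :: "real set \<Rightarrow> real measure \<Rightarrow> (real \<Rightarrow> cfun) set" where
  "bochner_L2 I M =
     {F. (\<forall>t \<in> I. F t \<in> L2 M) \<and>
         (\<exists>s. (\<forall>n::nat. simple_function (lebesgue_on I) (s n) \<and> s n ` I \<subseteq> L2 M) \<and>
              (AE t in lebesgue_on I.
                 (\<lambda>n. l2_norm M (\<lambda>x. F t x - s n t x)) \<longlonglongrightarrow> 0)) \<and>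
         (\<integral>\<^sup>+t. ennreal ((l2_norm M (F t))\<^sup>2) \<partial>lebesgue_on I) < \<infinity>}"

section \<open>Absolutely continuous functions\<close>

definition abs_continuous_on :: "real set \<Rightarrow> cfun \<Rightarrow> bool" where
  "abs_continuous_on S f \<longleftrightarrow>
     (\<forall>e>0. \<exists>d>0. \<forall>P :: (real \<times> real) set.
        finite P \<longrightarrow>
        (\<forall>(s, t) \<in> P. s \<le> t \<and> {s..t} \<subseteq> S) \<longrightarrow>
        disjoint_family_on (\<lambda>(s, t). {s<..<t}) P \<longrightarrow>
        (\<Sum>(s, t) \<in> P. t - s) < d \<longrightarrow>
        (\<Sum>(s, t) \<in> P. norm (f t - f s)) < e)"

section \<open>Analytic curves\<close>

definition real_analytic_at :: "(real \<Rightarrow> complex) \<Rightarrow> real \<Rightarrow> bool" where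
  "real_analytic_at f s \<longleftrightarrow>
     (\<exists>c. \<exists>e>0. \<forall>r. \<bar>r - s\<bar> < e \<longrightarrow> (\<lambda>n. c n * of_real (r - s) ^ n) sums f r)"

definition analytic_curve :: "real set \<Rightarrow> (real \<Rightarrow> complex) \<Rightarrow> bool" where
  "analytic_curve J c \<longleftrightarrow>
     is_interval J \<and> continuous_on J c \<and> inj_on c J \<and>
     (\<forall>s \<in> interior J. real_analytic_at c s)"

text \<open>\<open>B0\<close> is applied to the image \<open>K\<close> of a curve.\<close>

definition B0 :: "complex set \<Rightarrow> complex set set" where
  "B0 K = {\<Delta> \<in> sets borel. \<Delta> \<subseteq> K \<and> closure \<Delta> \<subseteq> K}"

section \<open>Periodic Sturm-Liouville operators with indefinite weight\<close>

locale periodic_SL =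
  fixes a :: real and w p q :: "real \<Rightarrow> real"
  assumes a_pos: "a > 0"
    and w_measurable: "w \<in> borel_measurable lebesgue"
    and p_measurable: "p \<in> borel_measurable lebesgue"
    and q_measurable: "q \<in> borel_measurable lebesgue"
    and w_periodic: "w (x + a) = w x"
    and p_periodic: "p (x + a) = p x"
    and q_periodic: "q (x + a) = q x"
    and w_integrable: "set_integrable lebesgue {0<..<a} w"
    and q_integrable: "set_integrable lebesgue {0<..<a} q"
    and inverse_p_integrable: "set_integrable lebesgue {0<..<a} (\<lambda>x. inverse (p x))"
    and w_nonzero: "AE x in lebesgue. w x \<noteq> 0"
    and p_positive: "AE x in lebesgue. p x > 0"
begin

text \<open>The measures \<open>|w| dx\<close> on the real line and on \<open>(0, a)\<close>.\<close>

definition MR :: "real measure" where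
  "MR = density lebesgue (\<lambda>x. ennreal \<bar>w x\<bar>)"

definition Ma :: "real measure" where
  "Ma = density (lebesgue_on {0<..<a}) (\<lambda>x. ennreal \<bar>w x\<bar>)"

text \<open>
  \<open>u\<close> is absolutely continuous on \<open>S\<close> and \<open>v\<close> is the absolutely continuous representative
  of \<open>p u'\<close> there.
\<close>

definition quasi_derivative_on :: "real set \<Rightarrow> cfun \<Rightarrow> cfun \<Rightarrow> bool" where
  "quasi_derivative_on S u v \<longleftrightarrow>
     abs_continuous_on S u \<and> abs_continuous_on S v \<and>
     (AE x in lebesgue_on S. v x = of_real (p x) * vector_derivative u (at x))"

definition quasi_derivative_loc :: "cfun \<Rightarrow> cfun \<Rightarrow> bool" where
  "quasi_derivative_loc u v \<longleftrightarrow> (\<forall>c d. quasi_derivative_on {c..d} u v)"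

text \<open>The differential expression applied to \<open>u\<close>, where \<open>v\<close> stands for \<open>p u'\<close>.\<close>

definition sl_expr :: "cfun \<Rightarrow> cfun \<Rightarrow> cfun" where
  "sl_expr u v = (\<lambda>x. 1 / of_real (w x) * (- vector_derivative v (at x) + of_real (q x) * u x))"

text \<open>
  An element \<open>f\<close> of \<open>L\<^sup>2\<close> is in the domain iff it has a representative \<open>u\<close> with the
  required properties.
\<close>

definition A :: oper where
  "A = {(f, h). f \<in> L2 MR \<and> h \<in> L2 MR \<and>
         (\<exists>u v. (AE x in MR. f x = u x) \<and> quasi_derivative_loc u v \<and>
                (AE x in MR. h x = sl_expr u v x))}"

definition A_fiber :: "real \<Rightarrow> oper" where
  "A_fiber t = {(f, h). f \<in> L2 Ma \<and> h \<in> L2 Ma \<and>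
         (\<exists>u v. (AE x in Ma. f x = u x) \<and> quasi_derivative_on {0..a} u v \<and>
                (AE x in Ma. h x = sl_expr u v x) \<and>
                u a = exp (\<i> * of_real t) * u 0 \<and> v a = exp (\<i> * of_real t) * v 0)}"

text \<open>
  \<open>fund_sol z c d\<close> is the pair \<open>(u, p u')\<close> for the solution \<open>u\<close> on the real line with
  \<open>u(0) = c\<close> and \<open>(p u')(0) = d\<close>.
\<close>

definition fund_sol :: "complex \<Rightarrow> complex \<Rightarrow> complex \<Rightarrow> cfun \<times> cfun" where
  "fund_sol z c d = (THE uv. quasi_derivative_loc (fst uv) (snd uv) \<and>
       (AE x in lebesgue. sl_expr (fst uv) (snd uv) x = z * fst uv x) \<and>
       fst uv 0 = c \<and> snd uv 0 = d)"

definition phi :: "complex \<Rightarrow> cfun" where "phi z = fst (fund_sol z 1 0)"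
definition p_phi' :: "complex \<Rightarrow> cfun" where "p_phi' z = snd (fund_sol z 1 0)"
definition psi :: "complex \<Rightarrow> cfun" where "psi z = fst (fund_sol z 0 1)"
definition p_psi' :: "complex \<Rightarrow> cfun" where "p_psi' z = snd (fund_sol z 0 1)"

definition D :: "complex \<Rightarrow> complex" where
  "D z = phi z a + p_psi' z a"

definition critical_points :: "complex set" where
  "critical_points = {z \<in> op_spectrum MR A. deriv D z = 0}"

definition regular_spectral_curve :: "real set \<Rightarrow> (real \<Rightarrow> complex) \<Rightarrow> bool" where
  "regular_spectral_curve J c \<longleftrightarrow>
     analytic_curve J c \<and> c ` J \<subseteq> op_spectrum MR A \<and> (\<forall>z \<in> c ` J. deriv D z \<noteq> 0)"

text \<open>The \<open>N\<close>-th partial sum and the (graph of the) Gelfand transform.\<close>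

definition gelfand_sum :: "nat \<Rightarrow> cfun \<Rightarrow> real \<Rightarrow> cfun" where
  "gelfand_sum N f t =
     (\<lambda>x. of_real (1 / sqrt (2 * pi)) *
            (\<Sum>n = - int N..int N. exp (- \<i> * of_int n * of_real t) * f (x + of_int n * a)))"

definition gelfand :: "(cfun \<times> (real \<Rightarrow> cfun)) set" where
  "gelfand = {(f, F). f \<in> L2 MR \<and> F \<in> bochner_L2 {-pi..pi} Ma \<and>
     (\<lambda>N. \<integral>\<^sup>+t. ennreal ((l2_norm Ma (\<lambda>x. F t x - gelfand_sum N f t x))\<^sup>2)
             \<partial>lebesgue_on {-pi..pi}) \<longlonglongrightarrow> 0}"

definition E_fiber :: "real \<Rightarrow> complex set \<Rightarrow> oper" where
  "E_fiber t \<Delta> = riesz_projection Ma (A_fiber t) (op_spectrum Ma (A_fiber t) \<inter> \<Delta>)"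

definition E :: "complex set \<Rightarrow> oper" where
  "E \<Delta> = {(f, g). \<exists>F G. (f, F) \<in> gelfand \<and> (g, G) \<in> gelfand \<and>
                   (AE t in lebesgue_on {-pi..pi}. (F t, G t) \<in> E_fiber t \<Delta>)}"

definition regular_critical_point :: "complex \<Rightarrow> bool" where
  "regular_critical_point z0 \<longleftrightarrow>
     z0 \<in> critical_points \<and>
     (\<exists>U. open U \<and> connected U \<and> z0 \<in> U \<and> closure U \<inter> critical_points = {z0} \<and>
        (SUP (J, c) \<in> {(J, c). regular_spectral_curve J c \<and>
                          z0 \<in> top_of_set (op_spectrum MR A) frontier_of (c ` J)}.
           SUP \<Delta> \<in> {\<Delta> \<in> B0 (c ` J). \<Delta> \<subseteq> U}. op_norm MR (E \<Delta>)) < \<infinity>)"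

end

end

theory Submission
 imports Defs
begin

text \<open>
  On one period the equation is a 2x2 system, so the resolvent of \<open>A(t)\<close> is explicit: up to an
  entire part it is \<open>N / (2 cos t - D)\<close>, where \<open>N\<close> is built from \<open>M - e^(-it)\<close>, \<open>M\<close> being the
  monodromy matrix.  At a simple zero the Riesz projection thus has norm of the order of
  \<open>|M - e^(-it)| / |D'|\<close>, and by Plancherel for the Gelfand transform \<open>E\<close> is bounded near \<open>z0\<close> iff
  \<open>M - e^(-it) = O(D')\<close> along the spectrum.  Write \<open>D - D(z0) = h^k\<close> with \<open>h\<close> conformal.  Boundedness
  forces \<open>M(z0)\<close> to be scalar, and then \<open>(tr (M - e^(-it)))^2 = D^2 - 4\<close> is of order \<open>h^k\<close> and is
  \<open>O(h^(2k-2))\<close>, hence \<open>k = 2\<close>; conversely, for scalar \<open>M(z0)\<close> and \<open>k = 2\<close> both sides are of order \<open>h\<close>.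
  A generalized eigenvector amounts to a solution of \<open>(M - e^(it)) c + M' x = 0\<close> with \<open>x\<close> a nonzero
  element of the kernel of \<open>M - e^(it)\<close>, which \<open>det M = 1\<close> and \<open>tr M' = 0\<close> allow to discuss.
\<close>

section \<open>Monotone and absolutely continuous functions\<close>

text \<open>The coefficients are merely integrable, while \<open>sl_expr\<close> and
  \<open>quasi_derivative_on\<close> use \<open>vector_derivative\<close>, which is meaningful only
  at points of differentiability. Hence Lebesgue's theorem on absolutely continuous functions is the
  base: it makes the differential expression equivalent to an integral system, solvable by a
  contraction. The Gelfand transform enters through norm estimates in both directions with factor 2
  and through the attainment of every continuous function of \<open>(t, x)\<close> with equal values
  at t = - pi and t = pi. Constant factors do not affect boundedness of \<open>E\<close>, and such
  functions suffice to test a single fibre: hat functions in t, concentrated at one quasimomentum,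
  turn the bound for \<open>E\<close> on short arcs into a bound for one Riesz projection.
  Regularity concerns all regular spectral curves approaching \<open>z0\<close>. In the upper bound
  the curve itself plays no part, since for \<open>k = 2\<close> a fibre has at most two eigenvalues
  near \<open>z0\<close>. In the converse a single curve is tested, the preimage under
  \<open>h\<close> of a segment from 0 in a direction in which \<open>D\<close> moves into (-2,
  2).\<close>

abbreviation "disjoint_Iccs == pairwise (%(s, t) (s', t'). disjnt {s..t} {s'..t'})"
abbreviation "disjoint_Ioos == disjoint_family_on (%(s, t). {s<..<t})"

section \<open>Vitali coverings and the derivative of a monotone function\<close>

lemma sum_increments_le:
 fixes F :: "real => real"
 assumes "finite P" "\<forall>(s, t)\<in>P. s < t & {s..t} <= {A..B}"
  and "disjoint_Iccs P" "A <= B"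
  and "mono_on {A..B} F"
 shows "(\<Sum>(s, t)\<in>P. F t - F s) <= F B - F A"
 using assms
proof (induction "card P" arbitrary: P B)
 case 0
 then have "P = {}" by auto
 then show ?case using 0(5,6) by (auto simp: mono_on_def)
next
 case (Suc n)
 then have "P ~= {}" by auto
 \<comment> \<open>The interval with the largest right end is split off. The others then lie in
   \<open>{A..s}\<close>, which is why \<open>B\<close> varies in the induction.\<close>
 define m where "m = Max (snd ` P)"
 have "m \<in> snd ` P" unfolding m_def using \<open>P ~= {}\<close> Suc.prems(1) by (intro Max_in) auto
 then obtain s where st: "(s, m) \<in> P" by auto
 have le: "t' <= m" if "(s', t') \<in> P" for s' t'
  unfolding m_def using that Suc.prems(1) by (intro Max_ge) force+
 have s: "s < m" "A <= s" "m <= B" using Suc.prems(2) st by fastforce+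
 define Q where "Q = P - {(s, m)}"
 have Q: "finite Q" "card Q = n" unfolding Q_def using Suc.prems(1) Suc.hyps(2) st by auto
 have sub: "\<forall>(s', t')\<in>Q. s' < t' & {s'..t'} <= {A..s}"
 proof clarify
  fix s' t' assume q: "(s', t') \<in> Q"
  then have P: "(s', t') \<in> P" "(s', t') ~= (s, m)" by (auto simp: Q_def)
  then have lt: "s' < t'" "{s'..t'} <= {A..B}" using Suc.prems(2) by auto
  have "disjnt {s'..t'} {s..m}" using pairwiseD[OF Suc.prems(3) P(1) st P(2)] by simp
  then have "t' \<notin> {s..m}" using lt by (auto simp: disjnt_iff)
  then have "t' < s" using le[OF P(1)] by auto
  then show "s' < t' & {s'..t'} <= {A..s}" using lt by auto
 qed
 have "(\<Sum>(s, t)\<in>Q. F t - F s) <= F s - F A"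
 proof (rule Suc.hyps(1))
  show "disjoint_Iccs Q"
   using Suc.prems(3) by (rule pairwise_subset) (auto simp: Q_def)
  show "mono_on {A..s} F" using Suc.prems(5) s by (auto simp: mono_on_def)
 qed (use Q sub s in auto)
 moreover have "(\<Sum>(s, t)\<in>P. F t - F s) = F m - F s + (\<Sum>(s, t)\<in>Q. F t - F s)"
  unfolding Q_def using Suc.prems(1) st by (subst sum.remove) auto
 moreover have "F m <= F B" using Suc.prems(5) s by (auto simp: mono_on_def)
 ultimately show ?case by linarith
qed

lemma negligible_countable:
 fixes S :: "'a::euclidean_space set"
 assumes "countable S"
 shows "negligible S"
proof -
 have "negligible (\<Union>((%x. {x}) ` S))"
  using assms by (intro negligible_countable_Union) auto
 then show ?thesis by simp
qed

lemma lmeasurable_outer_open: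
 assumes "S \<in> lmeasurable" "e > 0"
 obtains T where "open T" "S <= T" "T \<in> lmeasurable" "measure lebesgue T < measure lebesgue S + e"
proof -
 obtain T where T: "open T" "S <= T" "(T - S) \<in> lmeasurable" "emeasure lebesgue (T - S) < ennreal e"
  using sets_lebesgue_outer_open[of S e] assms by (auto simp: fmeasurableD)
 have eq: "T = S Un (T - S)" using T by auto
 have Tm: "T \<in> lmeasurable" by (subst eq) (use T assms in \<open>intro fmeasurable.Un, auto\<close>)
 have "measure lebesgue T <= measure lebesgue S + measure lebesgue (T - S)"
  by (subst eq, rule measure_Un_le) (use T assms in auto)
 moreover have "measure lebesgue (T - S) < e"
  using T(3,4) assms by (simp add: emeasure_eq_measure2 ennreal_less_iff)
 ultimately show ?thesis using that T Tm by auto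
qed

text \<open>Vitali's covering theorem for balls, read for intervals with centre \<open>ce\<close>
  and radius \<open>ra\<close>. The predicate \<open>Q\<close> on the endpoints is later an
  inequality for a difference quotient.\<close>

lemma Vitali_intervals:
 fixes E :: "real set"
 assumes "open O1" "E <= O1"
  and fine: "!!x e. x \<in> E ==> e > 0 ==> \<exists>s t. s < t & x \<in> {s..t} & t - s < e & Q s t"
 obtains C where "countable C" "!!s t. (s, t) \<in> C ==> s < t & {s..t} <= O1 & Q s t"
  and "disjoint_Iccs C"
  and "negligible (E - (\<Union>(s, t)\<in>C. {s..t}))"
proof -
 define K where "K = {(s, t). s < t & {s..t} <= O1 & Q s t}"
 define ce where "ce = (%(s, t). (s + t) / 2 :: real)"
 define ra where "ra = (%(s, t). (t - s) / 2 :: real)"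
 have cb: "cball (ce i) (ra i) = {fst i..snd i}" if "i \<in> K" for i
  using that by (auto simp: K_def ce_def ra_def cball_eq_atLeastAtMost field_simps split: prod.splits)
 obtain C where C: "countable C" "C <= K"
  "pairwise (%i j. disjnt (cball (ce i) (ra i)) (cball (ce j) (ra j))) C"
  "negligible(E - (\<Union>i \<in> C. cball (ce i) (ra i)))"
 proof (rule Vitali_covering_theorem_cballs[of K ra E ce])
  fix x d :: real assume x: "x \<in> E" "0 < d"
  then obtain r where r: "r > 0" "ball x r <= O1" using assms(1,2) by (meson openE subsetD)
  obtain s t where st: "s < t" "x \<in> {s..t}" "t - s < min d r" "Q s t"
   using fine[OF x(1), of "min d r"] r x by auto
  have "{s..t} <= ball x r" using st by (auto simp: dist_real_def)
  then have "(s, t) \<in> K" using st r by (auto simp: K_def)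
  moreover have "x \<in> cball (ce (s, t)) (ra (s, t))" using cb[OF calculation] st by auto
  moreover have "ra (s, t) < d" using st by (auto simp: ra_def)
  ultimately show "\<exists>i. i \<in> K & x \<in> cball (ce i) (ra i) & ra i < d" by (intro exI[of _ "(s, t)"] conjI)
 next
  show "0 < ra i" if "i \<in> K" for i using that by (auto simp: K_def ra_def)
 qed
 have eq: "cball (ce i) (ra i) = {fst i..snd i}" if "i \<in> C" for i by (rule cb) (use C that in auto)
 show ?thesis
 proof (rule that[of C])
  show "disjoint_Iccs C"
  proof (rule pairwiseI)
   fix i j assume "i \<in> C" "j \<in> C" "i ~= j"
   then show "(case i of (s, t) => %(s', t'). disjnt {s..t} {s'..t'}) j"
    using pairwiseD[OF C(3), of i j] eq[of i] eq[of j] by (simp add: case_prod_unfold)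
  qed
  have "(\<Union>i \<in> C. cball (ce i) (ra i)) = (\<Union>(s, t)\<in>C. {s..t})" using eq by (force split: prod.splits)
  then show "negligible (E - (\<Union>(s, t)\<in>C. {s..t}))" using C(4) by simp
 qed (use C in \<open>auto simp: K_def\<close>)
qed

lemma disjoint_intervals_measure:
 fixes C :: "(real \<times> real) set"
 assumes "finite C" "!!s t. (s, t) \<in> C ==> s <= t"
  and "disjoint_Iccs C"
 shows "measure lebesgue (\<Union>(s, t)\<in>C. {s..t}) = (\<Sum>(s, t)\<in>C. t - s)"
proof -
 have "measure lebesgue (\<Union>i\<in>C. {fst i..snd i}) = (\<Sum>i\<in>C. measure lebesgue {fst i..snd i})"
 proof (rule measure_finite_Union)
  show "disjoint_family_on (%i. {fst i..snd i}) C"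
   using assms(3) by (fastforce simp: disjoint_family_on_def pairwise_def disjnt_def)
 qed (use assms in auto)
 also have "... = (\<Sum>i\<in>C. snd i - fst i)"
  by (rule sum.cong) (use assms(2) in auto)
 finally show ?thesis by (simp add: case_prod_unfold)
qed

text \<open>A finite part of the Vitali family carries \<open>E\<close> up to measure
  \<open>e\<close>. This is expressed by an open set \<open>T\<close> around \<open>E\<close>, that
  is as a statement on outer measure, because the sets of points with large or small derivates come
  without a measurability proof.\<close>

lemma Vitali_intervals_finite:
 fixes E :: "real set"
 assumes "open O1" "O1 \<in> lmeasurable" "E <= O1" "e > 0"
  and fine: "!!x e. x \<in> E ==> e > 0 ==> \<exists>s t. s < t & x \<in> {s..t} & t - s < e & Q s t"
 obtains C T where "finite C" "!!s t. (s, t) \<in> C ==> s < t & {s..t} <= O1 & Q s t"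
  and "disjoint_Iccs C"
  and "E <= T" "open T" "T \<in> lmeasurable" "measure lebesgue T < (\<Sum>(s, t)\<in>C. t - s) + e"
  and "(\<Sum>(s, t)\<in>C. t - s) <= measure lebesgue O1"
proof -
 obtain C where C: "countable C" "!!s t. (s, t) \<in> C ==> s < t & {s..t} <= O1 & Q s t"
  "disjoint_Iccs C"
  "negligible (E - (\<Union>(s, t)\<in>C. {s..t}))"
  using Vitali_intervals[OF assms(1,3) fine] by metis
 define I where "I = (%(s::real, t). {s..t})"
 have inj: "inj_on I C" using C(2) by (auto simp: inj_on_def I_def Icc_eq_Icc) fastforce+
 have sub: "(\<Union>(I ` C)) <= O1" using C(2) by (auto simp: I_def)
 have Im: "d \<in> lmeasurable" if "d \<in> I ` C" for d using that by (auto simp: I_def)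
 have Um: "\<Union>(I ` C) \<in> lmeasurable"
 proof (rule fmeasurableI2[OF assms(2) sub])
  show "\<Union>(I ` C) \<in> sets lebesgue" by (intro sets.countable_UN' C(1)) (auto simp: I_def)
 qed
 obtain D' where D': "D' <= I ` C" "finite D'" "measure lebesgue (\<Union>(I ` C)) - e/2 < measure lebesgue (\<Union>D')"
 proof (rule measure_countable_Union_approachable[of "I ` C" "e/2" "measure lebesgue (\<Union>(I ` C))"])
  show "measure lebesgue (\<Union>D') <= measure lebesgue (\<Union>(I ` C))" if "D' <= I ` C" "finite D'" for D'
   by (rule measure_mono_fmeasurable[OF _ _ Um])
    (use that Im in \<open>auto intro!: sets.finite_Union simp: fmeasurableD\<close>)
 qed (use C assms Im in auto)
 then obtain P where P: "P <= C" "finite P" "D' = I ` P"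
  by (meson finite_subset_image)
 have pw: "disjoint_Iccs P"
  using C(3) P(1) by (rule pairwise_subset)
 have mP: "measure lebesgue (\<Union>D') = (\<Sum>(s, t)\<in>P. t - s)"
  unfolding P(3) I_def by (rule disjoint_intervals_measure[OF P(2) _ pw]) (use C(2) P in force)
 obtain T where T: "open T" "\<Union>(I ` C) Un (E - (\<Union>(s, t)\<in>C. {s..t})) <= T" "T \<in> lmeasurable"
  "measure lebesgue T < measure lebesgue (\<Union>(I ` C) Un (E - (\<Union>(s, t)\<in>C. {s..t}))) + e/2"
  using lmeasurable_outer_open[of "\<Union>(I ` C) Un (E - (\<Union>(s, t)\<in>C. {s..t}))" "e/2"] Um C(4) assms(4)
  by (metis fmeasurable.Un half_gt_zero negligible_imp_measurable)
 have "measure lebesgue (\<Union>(I ` C) Un (E - (\<Union>(s, t)\<in>C. {s..t}))) = measure lebesgue (\<Union>(I ` C))"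
  using C(4) by (intro measure_Un_null_set) (use Um in \<open>auto simp: negligible_iff_null_sets\<close>)
 then have "measure lebesgue T < (\<Sum>(s, t)\<in>P. t - s) + e" using T(4) D'(3) mP by linarith
 moreover have "E <= T" using T(2) by (auto simp: I_def)
 moreover have "measure lebesgue (\<Union>D') <= measure lebesgue O1"
  by (rule measure_mono_fmeasurable)
   (use P sub assms Im D' in \<open>auto simp: fmeasurableD intro!: sets.finite_UN\<close>)
 moreover have "s < t & {s..t} <= O1 & Q s t" if "(s, t) \<in> P" for s t
  using C(2) P(1) that by blast
 ultimately show ?thesis using that[OF P(2) _ pw _ T(1) T(3)] mP by simp
qed

text \<open>Lebesgue's comparison argument. Intervals on which \<open>F\<close> grows slower than
  \<open>al\<close> cover almost all of \<open>E\<close> with total length close to the outer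
  measure \<open>m\<close>; inside them, intervals on which \<open>F\<close> grows faster than
  \<open>be\<close> again fill almost all of \<open>E\<close>. Monotonicity compares the increments
  of the two families: \<open>be * m <= al * m\<close> up to small errors, hence
  \<open>m = 0\<close>.\<close>

lemma mono_derivate_gap_negligible:
 fixes F :: "real => real"
 assumes mono: "mono_on {c..d} F" and ab: "0 <= al" "al < be" and E: "E <= {c<..<d}"
  and lo: "!!x e. x \<in> E ==> e > 0 ==> \<exists>s t. s < t & x \<in> {s..t} & t - s < e & F t - F s < al * (t - s)"
  and hi: "!!x e. x \<in> E ==> e > 0 ==> \<exists>s t. s < t & x \<in> {s..t} & t - s < e & F t - F s > be * (t - s)"
 shows "negligible E"
proof -
 define Os where "Os = {T. open T & T \<in> lmeasurable & E <= T}"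
 have "{c<..<d} \<in> Os" using E by (auto simp: Os_def)
 define m where "m = Inf (measure lebesgue ` Os)"
 have bdd: "bdd_below (measure lebesgue ` Os)" by (auto intro!: bdd_belowI[of _ 0])
 have m_le: "m <= measure lebesgue T" if "T \<in> Os" for T
  unfolding m_def using bdd that by (intro cInf_lower) auto
 have key: "be * (m - 2 * e) <= al * (m + e)" if e0: "e > 0" for e
 proof -
  have "\<exists>x\<in>measure lebesgue ` Os. x < m + e"
   using cInf_lessD[of "measure lebesgue ` Os" "m + e"] \<open>{c<..<d} \<in> Os\<close> that by (auto simp: m_def)
  then obtain T where T: "T \<in> Os" "measure lebesgue T < m + e" by auto
  define O1 where "O1 = T \<inter> {c<..<d}"
  have O1: "open O1" "E <= O1" "O1 \<in> lmeasurable" "O1 <= {c<..<d}"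
   using T E by (auto simp: O1_def Os_def fmeasurable.Int)
  have "measure lebesgue O1 <= measure lebesgue T"
   by (rule measure_mono_fmeasurable) (use O1 T in \<open>auto simp: O1_def Os_def\<close>)
  then have O1m: "measure lebesgue O1 <= m + e" using T(2) by simp
  obtain C1 where C1: "countable C1"
   "!!s t. (s, t) \<in> C1 ==> s < t & {s..t} <= O1 & F t - F s < al * (t - s)"
   "disjoint_Iccs C1"
   "negligible (E - (\<Union>(s, t)\<in>C1. {s..t}))"
   by (rule Vitali_intervals[OF O1(1,2), of "%s t. F t - F s < al * (t - s)"]) (use lo in blast)+
  \<comment> \<open>Open intervals are taken so that the second family can be chosen inside them.
    The endpoints lost in this way are countably many.\<close>
  define O2 where "O2 = (\<Union>(s, t)\<in>C1. {s<..<t})"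
  have O2: "open O2" "O2 <= O1" using C1(2) by (auto simp: O2_def) fastforce
  have O2m: "O2 \<in> lmeasurable"
   by (rule fmeasurableI2[OF O1(3) O2(2)]) (use O2(1) in auto)
  have "negligible (E - O2)"
  proof (rule negligible_subset)
   show "negligible ((E - (\<Union>(s, t)\<in>C1. {s..t})) Un (fst ` C1 Un snd ` C1))"
    by (intro negligible_Un[OF C1(4)] negligible_countable) (use C1(1) in auto)
   show "E - O2 <= (E - (\<Union>(s, t)\<in>C1. {s..t})) Un (fst ` C1 Un snd ` C1)"
    by (force simp: O2_def less_le)
  qed
  obtain C2 T2 where C2: "finite C2"
   "!!s t. (s, t) \<in> C2 ==> s < t & {s..t} <= O2 & F t - F s > be * (t - s)"
   "disjoint_Iccs C2"
   and T2: "E \<inter> O2 <= T2" "open T2" "T2 \<in> lmeasurable" "measure lebesgue T2 < (\<Sum>(s, t)\<in>C2. t - s) + e"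
   by (rule Vitali_intervals_finite[OF O2(1) O2m _ e0, of "E \<inter> O2" "%s t. F t - F s > be * (t - s)"])
    (use hi in blast)+
  obtain T3 where T3: "open T3" "E - O2 <= T3" "T3 \<in> lmeasurable" "measure lebesgue T3 < e"
   using lmeasurable_outer_open[of "E - O2" e] \<open>negligible (E - O2)\<close> e0
   by (metis add_0 negligible_imp_measurable negligible_imp_measure0)
  have "T2 Un T3 \<in> Os" using T2 T3 by (auto simp: Os_def)
  then have "m <= measure lebesgue (T2 Un T3)" by (rule m_le)
  also have "... <= measure lebesgue T2 + measure lebesgue T3"
   using T2 T3 by (intro measure_Un_le) auto
  finally have m1: "m - 2 * e <= (\<Sum>(s, t)\<in>C2. t - s)" using T2 T3 by linarith
  \<comment> \<open>An interval \<open>J\<close> of the second family lies in one interval of the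
    first. Otherwise it would contain the right end of that interval, a point of \<open>O2\<close>,
    which would then belong to a further interval of \<open>C1\<close>, against
    disjointness.\<close>
  have ex: "\<exists>I\<in>C1. {fst J..snd J} <= {fst I<..<snd I}" if "J \<in> C2" for J
  proof -
   have J: "fst J < snd J" "{fst J..snd J} <= O2" using C2(2)[of "fst J" "snd J"] that by auto
   then have "fst J \<in> O2" by auto
   then obtain I where I: "I \<in> C1" "fst J \<in> {fst I<..<snd I}" by (auto simp: O2_def)
   have "{fst J..snd J} <= {fst I<..<snd I}"
   proof (rule ccontr)
    assume "~ ?thesis"
    then have "snd I \<in> {fst J..snd J}" using I(2) by (auto simp: subset_iff)
    then have "snd I \<in> O2" using J by auto
    then obtain I' where I': "I' \<in> C1" "snd I \<in> {fst I'<..<snd I'}" by (auto simp: O2_def)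
    have "I' ~= I" using I' by auto
    then have "disjnt {fst I'..snd I'} {fst I..snd I}"
     using pairwiseD[OF C1(3) I'(1) I(1)] by (auto simp: case_prod_unfold)
    moreover have "snd I \<in> {fst I..snd I}" using I(2) by auto
    ultimately show False using I' by (auto simp: disjnt_iff)
   qed
   then show ?thesis using I by auto
  qed
  then obtain h where h: "!!J. J \<in> C2 ==> h J \<in> C1 & {fst J..snd J} <= {fst (h J)<..<snd (h J)}" by metis
  have "be * (\<Sum>(s, t)\<in>C2. t - s) = (\<Sum>J\<in>C2. be * (snd J - fst J))" by (simp add: sum_distrib_left case_prod_unfold)
  also have "... <= (\<Sum>J\<in>C2. F (snd J) - F (fst J))"
   by (rule sum_mono) (use C2(2) in \<open>auto intro: less_imp_le\<close>)
  also have "... = (\<Sum>I\<in>h ` C2. \<Sum>J\<in>{J\<in>C2. h J = I}. F (snd J) - F (fst J))"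
   using C2(1) by (intro sum.group[symmetric]) auto
  also have "... <= (\<Sum>I\<in>h ` C2. al * (snd I - fst I))"
  proof (rule sum_mono)
   fix I assume "I \<in> h ` C2"
   then have I: "I \<in> C1" using h by auto
   have I2: "fst I < snd I" "{fst I..snd I} <= O1" "F (snd I) - F (fst I) < al * (snd I - fst I)"
    using C1(2)[of "fst I" "snd I"] I by auto
   have "(\<Sum>(s, t)\<in>{J\<in>C2. h J = I}. F t - F s) <= F (snd I) - F (fst I)"
   proof (rule sum_increments_le)
    show "mono_on {fst I..snd I} F" using mono by (rule mono_on_subset) (use I2 O1 in fastforce)
    show "disjoint_Iccs {J\<in>C2. h J = I}"
     using C2(3) by (rule pairwise_subset) auto
   qed (use C2 I2 h in \<open>auto, fastforce+\<close>)
   then show "(\<Sum>J\<in>{J\<in>C2. h J = I}. F (snd J) - F (fst J)) <= al * (snd I - fst I)"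
    using I2 by (simp add: case_prod_unfold)
  qed
  also have "... = al * (\<Sum>(s, t)\<in>h ` C2. t - s)" by (simp add: sum_distrib_left case_prod_unfold)
  also have "... <= al * (m + e)"
  proof (rule mult_left_mono)
   have sub: "h ` C2 <= C1" using h by auto
   have C1': "s <= t" "{s..t} <= O1" if "(s, t) \<in> h ` C2" for s t
    using C1(2)[of s t] sub that by auto
   have "(\<Sum>(s, t)\<in>h ` C2. t - s) = measure lebesgue (\<Union>(s, t)\<in>h ` C2. {s..t})"
    by (rule disjoint_intervals_measure[symmetric])
     (use C2(1) C1'(1) pairwise_subset[OF C1(3) sub] in simp_all)
   also have "... <= measure lebesgue O1"
   proof (rule measure_mono_fmeasurable)
    show "(\<Union>(s, t)\<in>h ` C2. {s..t}) <= O1" using C1'(2) by (simp add: UN_subset_iff case_prod_unfold)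
    show "(\<Union>(s, t)\<in>h ` C2. {s..t}) \<in> sets lebesgue"
     using C2(1) by (intro sets.finite_UN) auto
   qed (rule O1(3))
   finally show "(\<Sum>(s, t)\<in>h ` C2. t - s) <= m + e" using O1m by simp
  qed (use ab in simp)
  finally have "be * (\<Sum>(s, t)\<in>C2. t - s) <= al * (m + e)" .
  then show ?thesis using m1 ab by (smt (verit) mult_left_mono)
 qed
 have "m * (be - al) <= 0"
 proof (rule field_le_epsilon)
  fix e :: real assume "e > 0"
  have "al + 2 * be > 0" using ab by simp
  moreover have "m * (be - al) <= (al + 2 * be) * x" if "x > 0" for x
   using key[OF that] by (simp add: algebra_simps)
  ultimately have "m * (be - al) <= (al + 2 * be) * (e / (al + 2 * be))"
   using \<open>e > 0\<close> divide_pos_pos by blast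
  then show "m * (be - al) <= 0 + e" using \<open>al + 2 * be > 0\<close> by simp
 qed
 then have "m <= 0" using ab by (simp add: mult_le_0_iff)
 show ?thesis
 proof (rule iffD2[OF negligible_outer], intro allI impI)
  fix e :: real assume "e > 0"
  then have "\<exists>x\<in>measure lebesgue ` Os. x < e"
   using cInf_lessD[of "measure lebesgue ` Os" e] \<open>{c<..<d} \<in> Os\<close> \<open>m <= 0\<close> by (auto simp: m_def)
  then show "\<exists>T. E <= T & T \<in> lmeasurable & measure lebesgue T < e" by (auto simp: Os_def)
 qed
qed

text \<open>\<open>N1\<close> collects the points where rational numbers separate lower and upper
  derivate, \<open>N2\<close> those where the upper derivate is infinite. Elsewhere the limits
  inferior and superior of the difference quotient agree and are finite. Intervals with
  \<open>x\<close> as an endpoint count as intervals around \<open>x\<close>, so \<open>low\<close>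
  and \<open>high\<close> govern the quotients at \<open>x\<close> itself.\<close>

lemma mono_on_differentiable_ae:
 fixes F :: "real => real"
 assumes mono: "mono_on {c..d} F"
 obtains N where "negligible N" "!!x. x \<in> {c<..<d} - N ==> F differentiable (at x)"
proof -
 define low where "low = (%al x. \<forall>e>0. \<exists>s t. s < t & x \<in> {s..t} & t - s < e & F t - F s < al * (t - s))"
 define high where "high = (%be x. \<forall>e>0. \<exists>s t. s < t & x \<in> {s..t} & t - s < e & F t - F s > be * (t - s))"
 define N1 where "N1 = (\<Union>(al, be)\<in>{(al, be). al \<in> \<rat> & be \<in> \<rat> & 0 <= al & al < be}. {x\<in>{c<..<d}. low al x & high be x})"
 define N2 where "N2 = {x\<in>{c<..<d}. \<forall>n::nat. high (real n) x}"
 have N1: "negligible N1"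
 proof -
  have "negligible {x\<in>{c<..<d}. low al x & high be x}" if "0 <= al" "al < be" for al be
   by (rule mono_derivate_gap_negligible[OF mono that]) (auto simp: low_def high_def)
  moreover have "countable {(al, be). al \<in> \<rat> & be \<in> (\<rat> :: real set) & 0 <= al & al < be}"
   by (rule countable_subset[of _ "\<rat> \<times> \<rat>"]) (auto simp: countable_rat)
  ultimately show ?thesis unfolding N1_def
   by (intro negligible_countable_Union) auto
 qed
 have N2: "negligible N2"
 proof (cases "c < d")
  case True
  show ?thesis
  proof (rule iffD2[OF negligible_outer], intro allI impI)
   fix e :: real assume e: "e > 0"
   \<comment> \<open>Disjoint intervals with difference quotient above \<open>n\<close> have total
     length at most \<open>(F d - F c) / n\<close>, and \<open>n\<close> is chosen to make this at
     most \<open>e / 2\<close>.\<close>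
   obtain n :: nat where n: "real n > (F d - F c) / (e / 2)" using reals_Archimedean2 by blast
   have Fcd: "F d - F c >= 0" using mono True by (auto simp: mono_on_def)
   then have n0: "real n > 0" using n e by (smt (verit) divide_nonneg_nonneg half_gt_zero)
   obtain C T where C: "finite C" "!!s t. (s, t) \<in> C ==> s < t & {s..t} <= {c<..<d} & F t - F s > real n * (t - s)"
    "disjoint_Iccs C"
    "N2 <= T" "open T" "T \<in> lmeasurable" "measure lebesgue T < (\<Sum>(s, t)\<in>C. t - s) + e / 2"
    by (rule Vitali_intervals_finite[of "{c<..<d}" N2 "e / 2" "%s t. F t - F s > real n * (t - s)"])
     (use e in \<open>auto simp: N2_def high_def\<close>)
   have "real n * (\<Sum>(s, t)\<in>C. t - s) = (\<Sum>(s, t)\<in>C. real n * (t - s))"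
    by (simp add: sum_distrib_left case_prod_unfold)
   also have "... <= (\<Sum>(s, t)\<in>C. F t - F s)" by (rule sum_mono) (use C(2) in \<open>force intro: less_imp_le\<close>)
   also have "... <= F d - F c"
    by (rule sum_increments_le[OF C(1) _ C(3) _ mono]) (use C(2) True in fastforce)+
   also have "... <= real n * (e / 2)" using n e by (simp add: field_simps)
   finally have "(\<Sum>(s, t)\<in>C. t - s) <= e / 2" using n0 by simp
   then show "\<exists>T. N2 <= T & T \<in> lmeasurable & measure lebesgue T < e" using C by (intro exI[of _ T]) auto
  qed
 qed (auto simp: N2_def)
 show ?thesis
 proof (rule that[of "N1 Un N2"])
  fix x assume x: "x \<in> {c<..<d} - (N1 Un N2)"
  define quo where "quo = (%y. (F y - F x) / (y - x))"
  define Q where "Q = (%y. ereal (quo y))"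
  have ev: "eventually P (at x)" if P: "\<exists>e>0. \<forall>y\<in>{c<..<d}. y ~= x & \<bar>y - x\<bar> < e --> P y" for P
  proof -
   obtain e where e: "e > 0" "\<forall>y\<in>{c<..<d}. y ~= x & \<bar>y - x\<bar> < e --> P y" using P by auto
   have "min e (min (x - c) (d - x)) > 0" using e x by auto
   then show ?thesis
    using e unfolding eventually_at
    by (intro exI[of _ "min e (min (x - c) (d - x))"]) (auto simp: dist_real_def abs_less_iff)
  qed
  have quo0: "0 <= quo y" if "y \<in> {c<..<d}" for y
  proof -
   have "F y <= F x" if "y <= x" using mono that x \<open>y \<in> {c<..<d}\<close> by (auto simp: mono_on_def)
   moreover have "F x <= F y" if "x <= y" using mono that x \<open>y \<in> {c<..<d}\<close> by (auto simp: mono_on_def)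
   ultimately show ?thesis unfolding quo_def
    by (cases "y <= x") (auto simp: zero_le_divide_iff)
  qed
  have iv: "\<exists>s t. s < t & x \<in> {s..t} & t - s < e & F t - F s = quo y * (t - s)" if "y ~= x" "\<bar>y - x\<bar> < e" for y e
   using that by (intro exI[of _ "min x y"] exI[of _ "max x y"]) (auto simp: quo_def min_def max_def field_simps)
  have not_high: "Limsup (at x) Q <= ereal be" if "~ high be x" for be
  proof (rule Limsup_bounded, rule ev)
   obtain e where e: "e > 0" "!!s t. s < t ==> x \<in> {s..t} ==> t - s < e ==> F t - F s <= be * (t - s)"
    using \<open>~ high be x\<close> unfolding high_def by (meson not_less)
   have "Q y <= ereal be" if y: "y ~= x" "\<bar>y - x\<bar> < e" for y
   proof -
    obtain s t where st: "s < t" "x \<in> {s..t}" "t - s < e" "F t - F s = quo y * (t - s)" using iv[OF y] by auto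
    then have "quo y * (t - s) <= be * (t - s)" using e(2)[of s t] by auto
    then show ?thesis using st(1) by (simp add: Q_def)
   qed
   then show "\<exists>e>0. \<forall>y\<in>{c<..<d}. y ~= x & \<bar>y - x\<bar> < e --> Q y <= ereal be" using e by auto
  qed
  have not_low: "Liminf (at x) Q >= ereal al" if "~ low al x" for al
  proof (rule Liminf_bounded, rule ev)
   obtain e where e: "e > 0" "!!s t. s < t ==> x \<in> {s..t} ==> t - s < e ==> F t - F s >= al * (t - s)"
    using \<open>~ low al x\<close> unfolding low_def by (meson not_less)
   have "Q y >= ereal al" if y: "y ~= x" "\<bar>y - x\<bar> < e" for y
   proof -
    obtain s t where st: "s < t" "x \<in> {s..t}" "t - s < e" "F t - F s = quo y * (t - s)" using iv[OF y] by auto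
    then have "quo y * (t - s) >= al * (t - s)" using e(2)[of s t] by auto
    then show ?thesis using st(1) by (simp add: Q_def)
   qed
   then show "\<exists>e>0. \<forall>y\<in>{c<..<d}. y ~= x & \<bar>y - x\<bar> < e --> Q y >= ereal al" using e by auto
  qed
  have Linf0: "Liminf (at x) Q >= 0"
   by (rule Liminf_bounded, rule ev) (use quo0 in \<open>auto simp: Q_def intro!: exI[of _ 1]\<close>)
  obtain n :: nat where "~ high (real n) x" using x by (auto simp: N2_def)
  then have Lsup: "Limsup (at x) Q <= ereal (real n)" by (rule not_high)
  have le: "Liminf (at x) Q <= Limsup (at x) Q" by (rule Liminf_le_Limsup) simp
  have "~ Liminf (at x) Q < Limsup (at x) Q"
  proof
   assume "Liminf (at x) Q < Limsup (at x) Q"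
   moreover obtain l where l: "Liminf (at x) Q = ereal l" "l >= 0"
    using Linf0 Lsup le by (cases "Liminf (at x) Q") auto
   moreover obtain u where u: "Limsup (at x) Q = ereal u"
    using Linf0 Lsup le by (cases "Limsup (at x) Q") auto
   ultimately have "l < u" by simp
   obtain al where al: "al \<in> \<rat>" "l < al" "al < u" using Rats_dense_in_real[OF \<open>l < u\<close>] by auto
   obtain be where be: "be \<in> \<rat>" "al < be" "be < u" using Rats_dense_in_real[OF al(3)] by auto
   have "low al x" using not_low[of al] l al by (cases "low al x") auto
   moreover have "high be x" using not_high[of be] u be by (cases "high be x") auto
   ultimately have "x \<in> N1" using al be l x unfolding N1_def by fastforce
   then show False using x by simp
  qed
  then have eq: "Liminf (at x) Q = Limsup (at x) Q" using le by simp
  obtain D where D: "Limsup (at x) Q = ereal D"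
   using Linf0 Lsup eq by (cases "Limsup (at x) Q") auto
  have "(Q \<longlongrightarrow> ereal D) (at x)"
   by (subst tendsto_iff_Liminf_eq_Limsup) (use eq D in auto)
  then have "(quo \<longlongrightarrow> D) (at x)" by (simp add: Q_def)
  then have "(F has_field_derivative D) (at x)"
   by (simp add: has_field_derivative_iff quo_def)
  then show "F differentiable (at x)" by (auto simp: real_differentiable_def)
 qed (use N1 N2 in auto)
qed

section \<open>Absolute continuity, differentiability almost everywhere and the fundamental
  theorem\<close>

lemma abs_continuous_onE:
 assumes "abs_continuous_on S f" "e > 0"
 obtains d where "d > 0" "!!P :: (real \<times> real) set. finite P ==> \<forall>(s, t) \<in> P. s <= t & {s..t} <= S ==>
  disjoint_Ioos P ==> (\<Sum>(s, t) \<in> P. t - s) < d ==> (\<Sum>(s, t) \<in> P. norm (f t - f s)) < e"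
proof -
 from assms(1)[unfolded abs_continuous_on_def, rule_format, OF assms(2)]
 obtain d where d: "d > 0" and *: "\<forall>P. finite P --> (\<forall>(s, t)\<in>P. s <= t & {s..t} <= S) -->
  disjoint_Ioos P --> (\<Sum>(s, t)\<in>P. t - s) < d --> (\<Sum>(s, t)\<in>P. norm (f t - f s)) < e"
  by (elim exE conjE) (rule that)
 show ?thesis by (rule that[OF d]) (rule *[THEN spec, THEN mp, THEN mp, THEN mp, THEN mp])
qed

lemma abs_continuous_onI:
 assumes "!!e. e > 0 ==> \<exists>d>0. \<forall>P :: (real \<times> real) set. finite P --> (\<forall>(s, t) \<in> P. s <= t & {s..t} <= S) -->
  disjoint_Ioos P --> (\<Sum>(s, t) \<in> P. t - s) < d --> (\<Sum>(s, t) \<in> P. norm (f t - f s)) < e"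
 shows "abs_continuous_on S f"
 using assms unfolding abs_continuous_on_def by (intro allI impI)

lemma abs_continuous_on_subset:
 assumes "abs_continuous_on S f" "T <= S"
 shows "abs_continuous_on T f"
proof (rule abs_continuous_onI)
 fix e :: real assume "e > 0"
 obtain d where d: "d > 0" "!!P :: (real \<times> real) set. finite P ==> \<forall>(s, t) \<in> P. s <= t & {s..t} <= S ==>
  disjoint_Ioos P ==> (\<Sum>(s, t) \<in> P. t - s) < d ==> (\<Sum>(s, t) \<in> P. norm (f t - f s)) < e"
  by (rule abs_continuous_onE[OF assms(1) \<open>e > 0\<close>], rule that)
 have "\<forall>(s, t) \<in> P. s <= t & {s..t} <= S" if "\<forall>(s, t) \<in> P. s <= t & {s..t} <= T" for P
  using that assms(2) unfolding case_prod_unfold by (meson order_trans)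
 then show "\<exists>d>0. \<forall>P. finite P --> (\<forall>(s, t)\<in>P. s <= t & {s..t} <= T) -->
  disjoint_Ioos P --> (\<Sum>(s, t)\<in>P. t - s) < d --> (\<Sum>(s, t)\<in>P. norm (f t - f s)) < e"
  by (intro exI[of _ d] conjI allI impI d)
qed

text \<open>Closure under sums, products, real and imaginary parts and, for the Gronwall weight, the
  exponential all reduce to an increment estimate of this form.\<close>

lemma abs_continuous_on_dominated:
 assumes "abs_continuous_on S f" "abs_continuous_on S g" "C >= 0"
  and le: "!!s t. s <= t ==> {s..t} <= S ==> norm (h t - h s) <= C * (norm (f t - f s) + norm (g t - g s))"
 shows "abs_continuous_on S h"
proof (rule abs_continuous_onI)
 fix e :: real assume e: "e > 0"
 define e' where "e' = e / (2 * (C + 1))"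
 have e': "e' > 0" using e assms(3) by (simp add: e'_def)
 obtain d1 where d1: "d1 > 0" "!!P :: (real \<times> real) set. finite P ==> \<forall>(s, t) \<in> P. s <= t & {s..t} <= S ==>
  disjoint_Ioos P ==> (\<Sum>(s, t) \<in> P. t - s) < d1 ==> (\<Sum>(s, t) \<in> P. norm (f t - f s)) < e'"
  by (rule abs_continuous_onE[OF assms(1) e'], rule that)
 obtain d2 where d2: "d2 > 0" "!!P :: (real \<times> real) set. finite P ==> \<forall>(s, t) \<in> P. s <= t & {s..t} <= S ==>
  disjoint_Ioos P ==> (\<Sum>(s, t) \<in> P. t - s) < d2 ==> (\<Sum>(s, t) \<in> P. norm (g t - g s)) < e'"
  by (rule abs_continuous_onE[OF assms(2) e'], rule that)
 have "(\<Sum>(s, t)\<in>P. norm (h t - h s)) < e"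
  if P: "finite P" "\<forall>(s, t)\<in>P. s <= t & {s..t} <= S" "disjoint_Ioos P"
   "(\<Sum>(s, t)\<in>P. t - s) < min d1 d2" for P
 proof -
  have "(\<Sum>(s, t)\<in>P. norm (h t - h s)) <= (\<Sum>(s, t)\<in>P. C * (norm (f t - f s) + norm (g t - g s)))"
   by (rule sum_mono) (use P(2) le in auto)
  also have "... = C * ((\<Sum>(s, t)\<in>P. norm (f t - f s)) + (\<Sum>(s, t)\<in>P. norm (g t - g s)))"
   by (simp add: case_prod_unfold sum.distrib flip: sum_distrib_left)
  also have "... <= C * (e' + e')"
   by (rule mult_left_mono[OF add_mono[OF less_imp_le[OF d1(2)] less_imp_le[OF d2(2)]]]) (use P assms in auto)
  also have "C * (e' + e') < (C + 1) * (e' + e')" using e' by simp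
  also have "... = e" using assms(3) by (simp add: e'_def divide_simps)
  finally show ?thesis .
 qed
 then show "\<exists>d>0. \<forall>P. finite P --> (\<forall>(s, t)\<in>P. s <= t & {s..t} <= S) -->
  disjoint_Ioos P --> (\<Sum>(s, t)\<in>P. t - s) < d --> (\<Sum>(s, t)\<in>P. norm (h t - h s)) < e"
  using d1 d2 by (intro exI[of _ "min d1 d2"] conjI allI impI) auto
qed

lemma abs_continuous_on_continuous:
 assumes "abs_continuous_on {c..d} f"
 shows "continuous_on {c..d} f"
 unfolding continuous_on_iff
proof (intro ballI allI impI)
 fix x e :: real assume x: "x \<in> {c..d}" and e: "e > 0"
 obtain de where de: "de > 0" "!!P :: (real \<times> real) set. finite P ==> \<forall>(s, t) \<in> P. s <= t & {s..t} <= {c..d} ==>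
  disjoint_Ioos P ==> (\<Sum>(s, t) \<in> P. t - s) < de ==> (\<Sum>(s, t) \<in> P. norm (f t - f s)) < e"
  by (rule abs_continuous_onE[OF assms e], rule that)
 have "dist (f y) (f x) < e" if "y \<in> {c..d}" "dist y x < de" for y
 proof -
  have "(\<Sum>(s, t) \<in> {(min x y, max x y)}. norm (f t - f s)) < e"
   by (rule de(2)) (use x that in \<open>auto simp: dist_real_def disjoint_family_on_def min_def max_def split: if_splits\<close>)
  then show ?thesis by (auto simp: min_def max_def dist_norm norm_minus_commute split: if_splits)
 qed
 then show "\<exists>d'>0. \<forall>x'\<in>{c..d}. dist x' x < d' --> dist (f x') (f x) < e" using de(1) by blast
qed

lemma abs_continuous_on_const: "abs_continuous_on S (%_. k)"
 unfolding abs_continuous_on_def by (auto intro!: exI[of _ 1] simp: case_prod_unfold)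

lemma abs_continuous_on_add:
 "abs_continuous_on S f ==> abs_continuous_on S g ==> abs_continuous_on S (%x. f x + g x)"
 by (rule abs_continuous_on_dominated[of S f g 1]) (auto simp: norm_triangle_ineq add_diff_add)

lemma abs_continuous_on_cmult:
 "abs_continuous_on S f ==> abs_continuous_on S (%x. k * f x)"
 by (rule abs_continuous_on_dominated[of S f f "norm k"])
  (auto simp: norm_mult right_diff_distrib[symmetric] intro!: mult_left_mono)

lemma abs_continuous_on_mult:
 assumes "abs_continuous_on {c..d} f" "abs_continuous_on {c..d} g"
 shows "abs_continuous_on {c..d} (%x. f x * g x)"
proof -
 have "bounded (f ` {c..d})" "bounded (g ` {c..d})"
  by (intro compact_imp_bounded compact_continuous_image abs_continuous_on_continuous assms compact_Icc)+
 then obtain B1 B2 where B: "!!x. x \<in> {c..d} ==> norm (f x) <= B1" "!!x. x \<in> {c..d} ==> norm (g x) <= B2"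
  by (meson bounded_iff imageI)
 define C where "C = \<bar>B1\<bar> + \<bar>B2\<bar>"
 have C: "norm (f x) <= C" "norm (g x) <= C" if "x \<in> {c..d}" for x using B[OF that] by (auto simp: C_def)
 show ?thesis
 proof (rule abs_continuous_on_dominated[OF assms, of C])
  fix s t assume st: "s <= t" "{s..t} <= {c..d}"
  then have st': "s \<in> {c..d}" "t \<in> {c..d}" by auto
  have "norm (f t * g t - f s * g s) = norm (f t * (g t - g s) + (f t - f s) * g s)" by (simp add: algebra_simps)
  also have "... <= norm (f t) * norm (g t - g s) + norm (f t - f s) * norm (g s)"
   by (metis norm_mult norm_triangle_ineq)
  also have "... <= C * norm (g t - g s) + norm (f t - f s) * C"
   by (intro add_mono mult_left_mono mult_right_mono C st') auto
  finally show "norm (f t * g t - f s * g s) <= C * (norm (f t - f s) + norm (g t - g s))" by (simp add: algebra_simps)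
 qed (auto simp: C_def)
qed

lemma sum_disjoint_lengths_le:
 fixes P :: "(real \<times> real) set"
 assumes "finite P" "\<forall>(s, t)\<in>P. s <= t & {s..t} <= {A..B}" "disjoint_Ioos P" "A <= B"
 shows "(\<Sum>(s, t)\<in>P. t - s) <= B - A"
proof -
 have "(\<Sum>(s, t)\<in>P. t - s) = (\<Sum>i\<in>P. measure lebesgue ((%(s, t). {s<..<t}) i))"
  by (rule sum.cong) (use assms(2) in auto)
 also have "... = measure lebesgue (\<Union>i\<in>P. (%(s, t). {s<..<t}) i)"
  by (rule measure_finite_Union[symmetric]) (use assms in \<open>auto split: prod.splits\<close>)
 also have "... <= measure lebesgue {A..B}"
 proof (rule measure_mono_fmeasurable)
  show "(\<Union>i\<in>P. (%(s, t). {s<..<t}) i) <= {A..B}" using assms(2) by fastforce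
  show "(\<Union>i\<in>P. (%(s, t). {s<..<t}) i) \<in> sets lebesgue"
   using assms(1) by (intro sets.finite_UN) (auto split: prod.splits)
 qed auto
 finally show ?thesis using assms(4) by simp
qed

text \<open>A function of bounded variation is a difference of increasing functions,
  \<open>u = V - (V - u)\<close>, to which Lebesgue's theorem applies. This is done on short
  intervals, and countably many of them, with rational endpoints, cover
  \<open>{c<..<d}\<close>.\<close>

lemma abs_continuous_on_differentiable_ae_real:
 fixes u :: "real => real"
 assumes "abs_continuous_on {c..d} (%x. of_real (u x))"
 obtains N where "negligible N" "!!x. x \<in> {c<..<d} - N ==> u differentiable (at x)"
proof -
 obtain de where de: "de > 0" "!!P :: (real \<times> real) set. finite P ==> \<forall>(s, t) \<in> P. s <= t & {s..t} <= {c..d} ==>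
  disjoint_Ioos P ==> (\<Sum>(s, t) \<in> P. t - s) < de ==>
  (\<Sum>(s, t) \<in> P. norm (complex_of_real (u t) - of_real (u s))) < 1"
  by (rule abs_continuous_onE[OF assms zero_less_one], rule that)
 \<comment> \<open>On an interval shorter than the \<open>de\<close> belonging to 1, every sum of
   increments is at most 1, so the variation \<open>V\<close> over \<open>{r..x}\<close> is
   finite.\<close>
 have loc: "\<exists>N. negligible N & (\<forall>x \<in> {r<..<s} - N. u differentiable (at x))"
  if rs: "c <= r" "r < s" "s <= d" "s - r < de" for r s
 proof -
  define Fam :: "real => (real \<times> real) set set" where "Fam = (%x. {P. finite P & (\<forall>(s, t)\<in>P. s <= t & {s..t} <= {r..x}) & disjoint_Ioos P})"
  define S where "S = (%P. \<Sum>(s, t)\<in>P. \<bar>u t - u s\<bar>)"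
  define V where "V = (%x. Sup (S ` Fam x))"
  have S1: "S P <= 1" if "P \<in> Fam x" "r <= x" "x <= s" for P x
  proof -
   have P: "finite P" "\<forall>(s, t)\<in>P. s <= t & {s..t} <= {r..x}" "disjoint_Ioos P"
    using that by (auto simp: Fam_def)
   have "(\<Sum>(s, t) \<in> P. t - s) < de" using sum_disjoint_lengths_le[OF P that(2)] rs that by simp
   moreover have "\<forall>(s, t) \<in> P. s <= t & {s..t} <= {c..d}" using P(2) rs that by fastforce
   ultimately have "(\<Sum>(s, t) \<in> P. norm (complex_of_real (u t) - of_real (u s))) < 1"
    using de(2)[OF P(1) _ P(3)] by blast
   then show ?thesis by (simp add: S_def of_real_diff[symmetric] del: of_real_diff)
  qed
  have bdd: "bdd_above (S ` Fam x)" if "r <= x" "x <= s" for x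
   using S1[OF _ that] by (auto intro!: bdd_aboveI[of _ 1])
  have ne: "{} \<in> Fam x" for x by (auto simp: Fam_def disjoint_family_on_def)
  have V: "V x + \<bar>u y - u x\<bar> <= V y" if xy: "r <= x" "x < y" "y <= s" for x y
  proof -
   have "V x <= V y - \<bar>u y - u x\<bar>" unfolding V_def[of]
   proof (rule cSup_least)
    show "S ` Fam x ~= {}" using ne by auto
    fix v assume "v \<in> S ` Fam x"
    then obtain P where P: "P \<in> Fam x" "v = S P" by auto
    have P': "finite P" "\<forall>(s, t)\<in>P. s <= t & {s..t} <= {r..x}" "disjoint_Ioos P"
     using P by (auto simp: Fam_def)
    have le: "t <= x" if "(s, t) \<in> P" for s t using P'(2) that by fastforce
    have nin: "(x, y) \<notin> P" using le xy by force
    have "insert (x, y) P \<in> Fam y"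
     unfolding Fam_def mem_Collect_eq disjoint_family_on_insert[OF nin]
    proof (intro conjI)
     show "\<forall>(s, t)\<in>insert (x, y) P. s <= t & {s..t} <= {r..y}" using P'(2) xy by fastforce
     show "(case (x, y) of (s, t) => {s<..<t}) \<inter> (\<Union>i\<in>P. case i of (s, t) => {s<..<t}) = {}" using le by fastforce
    qed (use P' in auto)
    then have "S (insert (x, y) P) <= V y" unfolding V_def using bdd[of y] xy by (intro cSup_upper) auto
    then show "v <= Sup (S ` Fam y) - \<bar>u y - u x\<bar>" using P'(1) nin P(2) by (simp add: S_def V_def)
   qed
   then show ?thesis by simp
  qed
  have m1: "mono_on {r..s} V" using V by (intro mono_onI) (smt (verit) atLeastAtMost_iff)
  have m2: "mono_on {r..s} (%x. V x - u x)" using V by (intro mono_onI) (smt (verit) atLeastAtMost_iff)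
  obtain N1 where N1: "negligible N1" "!!x. x \<in> {r<..<s} - N1 ==> V differentiable (at x)"
   using mono_on_differentiable_ae[OF m1] by metis
  obtain N2 where N2: "negligible N2" "!!x. x \<in> {r<..<s} - N2 ==> (%x. V x - u x) differentiable (at x)"
   using mono_on_differentiable_ae[OF m2] by metis
  show ?thesis
  proof (intro exI[of _ "N1 Un N2"] conjI ballI)
   fix x assume "x \<in> {r<..<s} - (N1 Un N2)"
   then have "x \<in> {r<..<s} - N1" "x \<in> {r<..<s} - N2" by auto
   then have "(%x. V x - (V x - u x)) differentiable (at x)" by (intro differentiable_diff[OF N1(2) N2(2)])
   then show "u differentiable (at x)" by simp
  qed (use N1 N2 in auto)
 qed
 define I where "I = {(r, s). r \<in> \<rat> & s \<in> \<rat> & c <= r & r < s & s <= d & s - r < de}"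
 have "\<forall>i\<in>I. \<exists>N. negligible N & (\<forall>x \<in> {fst i<..<snd i} - N. u differentiable (at x))"
  using loc by (auto simp: I_def)
 then obtain N where N: "!!i. i \<in> I ==> negligible (N i) & (\<forall>x \<in> {fst i<..<snd i} - N i. u differentiable (at x))" by metis
 show ?thesis
 proof (rule that[of "\<Union>(N ` I)"])
  have "countable I" by (rule countable_subset[of _ "\<rat> \<times> \<rat>"]) (auto simp: I_def countable_rat)
  then show "negligible (\<Union>(N ` I))" using N by (intro negligible_countable_Union) auto
  fix x assume x: "x \<in> {c<..<d} - \<Union>(N ` I)"
  have "max c (x - de / 2) < x" "x < min d (x + de / 2)" using x de by auto
  then obtain r s where "r \<in> \<rat>" "s \<in> \<rat>" "max c (x - de / 2) < r" "r < x" "x < s" "s < min d (x + de / 2)"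
   by (meson Rats_dense_in_real)
  then have "(r, s) \<in> I" "x \<in> {r<..<s}" by (auto simp: I_def)
  then show "u differentiable (at x)" using N[of "(r, s)"] x by auto
 qed
qed

lemma abs_continuous_on_differentiable_ae:
 assumes "abs_continuous_on {c..d} f"
 obtains N where "negligible N" "!!x. x \<in> {c<..<d} - N ==> (f has_vector_derivative vector_derivative f (at x)) (at x)"
proof -
 have "abs_continuous_on {c..d} (%x. of_real (Re (f x)))" "abs_continuous_on {c..d} (%x. of_real (Im (f x)))"
  by (rule abs_continuous_on_dominated[OF assms assms, of 1],
    auto simp: of_real_diff[symmetric] minus_complex.sel[symmetric] simp del: of_real_diff minus_complex.sel
      intro: order_trans[OF abs_Re_le_cmod] order_trans[OF abs_Im_le_cmod])+
 then obtain N1 N2 where N: "negligible N1" "!!x. x \<in> {c<..<d} - N1 ==> (%x. Re (f x)) differentiable (at x)"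
  "negligible N2" "!!x. x \<in> {c<..<d} - N2 ==> (%x. Im (f x)) differentiable (at x)"
  using abs_continuous_on_differentiable_ae_real by metis
 show ?thesis
 proof (rule that[of "N1 Un N2"])
  fix x assume "x \<in> {c<..<d} - (N1 Un N2)"
  then have "(%x. Re (f x)) differentiable (at x)" "(%x. Im (f x)) differentiable (at x)" using N by auto
  then obtain a b where "((%x. Re (f x)) has_field_derivative a) (at x)" "((%x. Im (f x)) has_field_derivative b) (at x)"
   by (auto simp: real_differentiable_def)
  then have "(f has_vector_derivative Complex a b) (at x)"
   by (simp add: has_vector_derivative_complex_iff)
  then show "(f has_vector_derivative vector_derivative f (at x)) (at x)"
   using vector_derivative_at by metis
 qed (use N in auto)
qed

text \<open>Proved from the definition of the gauge integral. At tags outside \<open>N\<close> the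
  gauge makes each error at most \<open>e1\<close> times the length; tags in \<open>N\<close> are
  confined to an open set of measure below \<open>de\<close>, where absolute continuity bounds the
  sum of the increments. Setting \<open>g\<close> to zero on \<open>N\<close> leaves exactly these
  increments as errors.\<close>

lemma abs_continuous_on_ftc:
 assumes "c <= d" and AC: "abs_continuous_on {c..d} f" and N: "negligible N"
  and der: "!!x. x \<in> {c..d} - N ==> (f has_vector_derivative g x) (at x within {c..d})"
 shows "(g has_integral (f d - f c)) {c..d}"
proof -
 define g' where "g' = (%x. if x \<in> N then 0 else g x)"
 have "(g' has_integral (f d - f c)) (cbox c d)"
  unfolding has_integral
 proof (intro allI impI)
  fix e :: real assume e: "e > 0"
  define e1 where "e1 = e / (2 * (d - c + 1))"
  have e1: "e1 > 0" "e1 * (d - c) <= e / 2" using e \<open>c <= d\<close> by (auto simp: e1_def field_simps)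
  obtain de where de: "de > 0" "!!P :: (real \<times> real) set. finite P ==> \<forall>(s, t) \<in> P. s <= t & {s..t} <= {c..d} ==>
   disjoint_Ioos P ==> (\<Sum>(s, t) \<in> P. t - s) < de ==> (\<Sum>(s, t) \<in> P. norm (f t - f s)) < e / 2"
   by (rule abs_continuous_onE[OF AC half_gt_zero[OF e]], rule that)
  obtain T where T: "open T" "N <= T" "T \<in> lmeasurable" "measure lebesgue T < de"
   using lmeasurable_outer_open[of N de] N de(1)
   by (metis add_0 negligible_imp_measurable negligible_imp_measure0)
  have "\<exists>r>0. \<forall>y\<in>{c..d}. \<bar>y - x\<bar> < r --> norm (f y - f x - (y - x) *\<^sub>R g x) <= e1 * \<bar>y - x\<bar>" if "x \<in> {c..d} - N" for x
   using der[OF that] e1(1) unfolding has_vector_derivative_def has_derivative_within_alt by (auto simp: real_norm_def)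
  then obtain r where r: "!!x. x \<in> {c..d} - N ==> r x > 0"
   "!!x y. x \<in> {c..d} - N ==> y \<in> {c..d} ==> \<bar>y - x\<bar> < r x ==> norm (f y - f x - (y - x) *\<^sub>R g x) <= e1 * \<bar>y - x\<bar>"
   by metis
  define ga where "ga = (%x. if x \<in> N then T else if x \<in> {c..d} then ball x (r x) else ball x 1)"
  have ga: "gauge ga" unfolding gauge_def ga_def using T r(1) by auto
  show "\<exists>ga. gauge ga & (\<forall>\<D>. \<D> tagged_division_of cbox c d & ga fine \<D> -->
      norm ((\<Sum>(x, k)\<in>\<D>. measure lborel k *\<^sub>R g' x) - (f d - f c)) < e)"
  proof (intro exI[of _ ga] conjI allI impI ga)
   fix p assume "p tagged_division_of cbox c d & ga fine p"
   then have p: "p tagged_division_of {c..d}" and fine: "ga fine p" by auto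
   have fin: "finite p" using tagged_division_ofD(1)[OF p] .
   have K: "\<exists>s t. s <= t & K = {s..t} & x \<in> {s..t} & {s..t} <= {c..d}" if xK: "(x, K) \<in> p" for x K
   proof -
    obtain s t where "K = cbox s t" using tagged_division_ofD(4)[OF p xK] by blast
    moreover have "x \<in> K" "K <= {c..d}" using tagged_division_ofD(2,3)[OF p xK] by auto
    ultimately show ?thesis by (intro exI[of _ s] exI[of _ t]) auto
   qed
   define inc where "inc = (%K::real set. f (Sup K) - f (Inf K))"
   define err where "err = (%(x, K). measure lborel K *\<^sub>R g' x - inc K)"
   \<comment> \<open>Only nondegenerate intervals with an exceptional tag. For these the pair of
     endpoints determines the tagged interval, so the sum can be transported to the sets of pairs
     used in \<open>abs_continuous_on\<close>.\<close>
   define pN where "pN = {(x, K) \<in> p. x \<in> N & Inf K < Sup K}"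
   have "(\<Sum>(x, K)\<in>p. inc K) = f d - f c"
    unfolding inc_def using additive_tagged_division_1[OF \<open>c <= d\<close> p] .
   then have err: "(\<Sum>(x, K)\<in>p. measure lborel K *\<^sub>R g' x) - (f d - f c) = sum err p"
    by (simp add: err_def case_prod_unfold sum_subtractf)
   have "norm (sum err p) <= (\<Sum>i\<in>p. norm (err i))" by (rule norm_sum)
   moreover have "(\<Sum>i\<in>p. norm (err i)) = (\<Sum>i\<in>pN. norm (err i)) + (\<Sum>i\<in>p - pN. norm (err i))"
    using fin by (subst add.commute, intro sum.subset_diff) (auto simp: pN_def)
   moreover have "(\<Sum>i\<in>p - pN. norm (err i)) <= e / 2"
   proof -
    have "(\<Sum>i\<in>p - pN. norm (err i)) <= (\<Sum>(x, K)\<in>p - pN. e1 * (Sup K - Inf K))"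
    proof (rule sum_mono, clarify)
     fix x K assume xK: "(x, K) \<in> p" "(x, K) \<notin> pN"
     obtain s t where st: "s <= t" "K = {s..t}" "x \<in> {s..t}" "{s..t} <= {c..d}" using K[OF xK(1)] by auto
     show "norm (err (x, K)) <= e1 * (Sup K - Inf K)"
     proof (cases "x \<in> N")
      case True
      then have "s = t" using xK st by (auto simp: pN_def)
      then show ?thesis by (simp add: err_def inc_def st)
     next
      case False
      have "K <= ga x" using fine xK(1) by (auto simp: fine_def)
      moreover have x: "x \<in> {c..d} - N" using False st by auto
      ultimately have "{s..t} <= ball x (r x)" using st False by (simp add: ga_def)
      moreover have "s \<in> {s..t}" "t \<in> {s..t}" using st(1) by auto
      ultimately have "s \<in> ball x (r x)" "t \<in> ball x (r x)" by blast+
      then have "\<bar>s - x\<bar> < r x" "\<bar>t - x\<bar> < r x" by (auto simp: dist_real_def)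
      then have "norm (f s - f x - (s - x) *\<^sub>R g x) <= e1 * \<bar>s - x\<bar>" "norm (f t - f x - (t - x) *\<^sub>R g x) <= e1 * \<bar>t - x\<bar>"
       using r(2)[OF x, of s] r(2)[OF x, of t] st by auto
      moreover have "err (x, K) = (t - s) *\<^sub>R g x - (f t - f s)"
       using st(1) False by (simp add: err_def inc_def g'_def st(2))
      then have "err (x, K) = (f s - f x - (s - x) *\<^sub>R g x) - (f t - f x - (t - x) *\<^sub>R g x)"
       by (simp add: scaleR_left_diff_distrib)
      ultimately have "norm (err (x, K)) <= e1 * \<bar>s - x\<bar> + e1 * \<bar>t - x\<bar>"
       using norm_triangle_ineq4[of "f s - f x - (s - x) *\<^sub>R g x" "f t - f x - (t - x) *\<^sub>R g x"]
       by simp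
      also have "... = e1 * (Sup K - Inf K)" using st by (simp add: algebra_simps)
      finally show ?thesis .
     qed
    qed
    also have "... <= (\<Sum>(x, K)\<in>p. e1 * (Sup K - Inf K))"
    proof (rule sum_mono2[OF fin])
     fix i assume "i \<in> p - (p - pN)"
     then show "0 <= (case i of (x, K) => e1 * (Sup K - Inf K))" using e1(1) by (auto simp: pN_def)
    qed auto
    also have "... = e1 * (d - c)"
     using additive_tagged_division_1[OF \<open>c <= d\<close> p, of "%x. x"]
     by (simp add: case_prod_unfold flip: sum_distrib_left)
    finally show ?thesis using e1(2) by simp
   qed
   moreover have "(\<Sum>i\<in>pN. norm (err i)) < e / 2"
   proof -
    define ep where "ep = (%(x::real, K::real set). (Inf K, Sup K))"
    have KpN: "\<exists>s t. s < t & K = {s..t} & {s..t} <= {c..d} & {s..t} <= T" if "(x, K) \<in> pN" for x K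
    proof -
     have xK: "(x, K) \<in> p" "x \<in> N" "Inf K < Sup K" using that by (auto simp: pN_def)
     obtain s t where st: "s <= t" "K = {s..t}" "x \<in> {s..t}" "{s..t} <= {c..d}" using K[OF xK(1)] by auto
     moreover have "K <= ga x" using fine xK(1) by (auto simp: fine_def)
     then have "K <= T" using xK(2) by (simp add: ga_def)
     moreover have "s < t" using st xK by auto
     ultimately show ?thesis by blast
    qed
    have disj: "{Inf K<..<Sup K} \<inter> {Inf K'<..<Sup K'} = {}" if a: "(x, K) \<in> pN" "(x', K') \<in> pN" "(x, K) ~= (x', K')" for x K x' K'
    proof -
     have "interior K \<inter> interior K' = {}" using tagged_division_ofD(5)[OF p, of x K x' K'] a by (auto simp: pN_def)
     moreover obtain s t where "s < t" "K = {s..t}" using KpN[OF a(1)] by auto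
     moreover obtain s' t' where "s' < t'" "K' = {s'..t'}" using KpN[OF a(2)] by auto
     ultimately show ?thesis by simp
    qed
    have inj: "inj_on ep pN"
    proof (rule inj_onI, clarify)
     fix x K x' K' assume a: "(x, K) \<in> pN" "(x', K') \<in> pN" "ep (x, K) = ep (x', K')"
     show "x = x' & K = K'"
     proof (rule ccontr)
      assume "~ ?thesis"
      then have "{Inf K<..<Sup K} = {}" using disj[OF a(1,2)] a(3) by (auto simp: ep_def)
      then show False using KpN[OF a(1)] by auto
     qed
    qed
    have finN: "finite pN" using fin by (rule rev_finite_subset) (auto simp: pN_def)
    have epP: "\<forall>(s, t)\<in>ep ` pN. s <= t & {s..t} <= {c..d}" using KpN by (fastforce simp: ep_def)
    have epD: "disjoint_Ioos (ep ` pN)"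
     unfolding disjoint_family_on_def using disj by (fastforce simp: ep_def)
    have "(\<Sum>(s, t)\<in>ep ` pN. t - s) = (\<Sum>i\<in>ep ` pN. measure lebesgue ((%(s, t). {s<..<t}) i))"
     by (rule sum.cong) (use epP in auto)
    also have "... = measure lebesgue (\<Union>i\<in>ep ` pN. (%(s, t). {s<..<t}) i)"
     by (rule measure_finite_Union[symmetric]) (use finN epD epP in \<open>auto split: prod.splits\<close>)
    also have "... <= measure lebesgue T"
    proof (rule measure_mono_fmeasurable)
     show "(\<Union>i\<in>ep ` pN. (%(s, t). {s<..<t}) i) <= T"
     proof
      fix y assume "y \<in> (\<Union>i\<in>ep ` pN. (%(s, t). {s<..<t}) i)"
      then obtain x K where "(x, K) \<in> pN" "y \<in> {Inf K<..<Sup K}" by (auto simp: ep_def)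
      then show "y \<in> T" using KpN[of x K] by (auto simp: subset_iff)
     qed
     show "(\<Union>i\<in>ep ` pN. (%(s, t). {s<..<t}) i) \<in> sets lebesgue"
      using finN by (intro sets.finite_UN) (auto split: prod.splits)
    qed (rule T(3))
    finally have "(\<Sum>(s, t)\<in>ep ` pN. norm (f t - f s)) < e / 2"
     using T(4) by (intro de(2)[OF _ epP epD]) (use finN in auto)
    also have "(\<Sum>(s, t)\<in>ep ` pN. norm (f t - f s)) = (\<Sum>i\<in>pN. norm (err i))"
     by (subst sum.reindex[OF inj], rule sum.cong) (auto simp: ep_def err_def inc_def g'_def pN_def norm_minus_commute)
    finally show ?thesis .
   qed
   ultimately show "norm ((\<Sum>(x, k)\<in>p. measure lborel k *\<^sub>R g' x) - (f d - f c)) < e"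
    unfolding err by linarith
  qed
 qed
 then show ?thesis
  by (subst (asm) has_integral_spike_eq[OF N, of "cbox c d" g]) (auto simp: g'_def)
qed

text \<open>The modulus of the integrand is cut at height \<open>n\<close>: the excess
  \<open>k n\<close> has a small integral by dominated convergence, and the rest contributes at most
  \<open>n\<close> times the total length of the intervals.\<close>

lemma abs_continuous_on_integral:
 fixes f :: "real => complex"
 assumes f: "f absolutely_integrable_on {c..d}"
 shows "abs_continuous_on {c..d} (%x. integral {c..x} f)"
proof (rule abs_continuous_onI)
 fix e :: real assume e: "e > 0"
 define h where "h = (%x. indicator {c..d} x * norm (f x) :: real)"
 have h: "integrable lebesgue h" "!!x. h x >= 0"
  using f[THEN set_integrable_norm] by (auto simp: h_def set_integrable_def)
 define k where "k = (%n x. max 0 (h x - real n))"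
 have kint: "integrable lebesgue (k n)" for n
 proof (rule Bochner_Integration.integrable_bound[OF h(1)])
  show "k n \<in> borel_measurable lebesgue" using h(1) unfolding k_def by (intro borel_measurable_max borel_measurable_diff) auto
  show "AE x in lebesgue. norm (k n x) <= norm (h x)" using h(2) by (intro AE_I2) (auto simp: k_def max_def)
 qed
 note kind = integrable_real_mult_indicator[where f = "k n" for n, unfolded mult.commute[of "k _ _"]]
 have "(%n. LINT x|lebesgue. k n x) \<longlonglongrightarrow> (LINT x::real|lebesgue. 0)"
 proof (rule integral_dominated_convergence[where f = "%_. 0" and w = h, OF _ _ h(1)])
  show "AE x in lebesgue. (%n. k n x) \<longlonglongrightarrow> 0"
  proof (intro AE_I2)
   fix x
   obtain m :: nat where "h x <= real m" using real_arch_simple by blast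
   then have "\<forall>\<^sub>F n in sequentially. k n x = 0" by (intro eventually_sequentiallyI[of m]) (auto simp: k_def)
   then show "(%n. k n x) \<longlonglongrightarrow> 0" by (rule tendsto_eventually)
  qed
  show "AE x in lebesgue. norm (k n x) <= h x" for n using h(2) by (intro AE_I2) (auto simp: k_def max_def)
 qed (use kint in auto)
 then have "\<forall>\<^sub>F n in sequentially. (LINT x|lebesgue. k n x) < e / 2"
  using e by (intro order_tendstoD(2)) auto
 then obtain n where n: "(LINT x|lebesgue. k n x) < e / 2" by (auto simp: eventually_sequentially)
 have incr: "norm (integral {c..t} f - integral {c..s} f) <= (LINT x|lebesgue. indicator {s<..<t} x * k n x) + real n * (t - s)"
  if st: "s <= t" "{s..t} <= {c..d}" for s t
 proof -
  have fi: "f integrable_on {c..t}"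
   using set_lebesgue_integral_eq_integral(1)[OF f] by (rule integrable_on_subinterval) (use st in auto)
  have "integral {c..t} f - integral {c..s} f = integral {s..t} f"
   using Henstock_Kurzweil_Integration.integral_combine[OF _ st(1) fi] st by (auto simp: algebra_simps)
  also have "... = integral {s<..<t} f" by (rule integral_open_interval_real)
  finally have eq: "integral {c..t} f - integral {c..s} f = integral {s<..<t} f" .
  have fo: "f absolutely_integrable_on {s<..<t}"
   by (rule set_integrable_subset[OF f]) (use st in auto)
  have "norm (integral {s<..<t} f) <= integral {s<..<t} (%x. norm (f x))"
   using fo by (intro integral_norm_bound_integral) (auto simp: absolutely_integrable_on_def)
  also have "... = (LINT x:{s<..<t}|lebesgue. norm (f x))"
   using set_integrable_norm[OF fo] by (rule set_lebesgue_integral_eq_integral(2)[symmetric])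
  also have "... = (LINT x|lebesgue. indicator {s<..<t} x * h x)"
   unfolding set_lebesgue_integral_def
   by (rule Bochner_Integration.integral_cong) (use st in \<open>auto simp: h_def indicator_def subset_iff\<close>)
  also have "... <= (LINT x|lebesgue. indicator {s<..<t} x * k n x + real n * indicator {s<..<t} x)"
  proof (rule integral_mono)
   show "integrable lebesgue (%x. indicator {s<..<t} x * h x)"
    using h(1) by (intro integrable_real_mult_indicator[where f = h, unfolded mult.commute[of "h _"]]) auto
   show "integrable lebesgue (%x. indicator {s<..<t} x * k n x + real n * indicator {s<..<t} x)"
    using kint[of n] by (intro Bochner_Integration.integrable_add kind integrable_mult_right integrable_real_indicator) (auto simp: st(1))
   show "indicator {s<..<t} x * h x <= indicator {s<..<t} x * k n x + real n * indicator {s<..<t} x" for x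
    by (auto simp: indicator_def k_def)
  qed
  also have "... = (LINT x|lebesgue. indicator {s<..<t} x * k n x) + real n * (t - s)"
   using kint[of n] st by (subst Bochner_Integration.integral_add)
    (auto intro: kind)
  finally show ?thesis by (simp add: eq)
 qed
 show "\<exists>d'>0. \<forall>P. finite P --> (\<forall>(s, t)\<in>P. s <= t & {s..t} <= {c..d}) -->
  disjoint_Ioos P --> (\<Sum>(s, t)\<in>P. t - s) < d' -->
  (\<Sum>(s, t)\<in>P. norm (integral {c..t} f - integral {c..s} f)) < e"
 proof (intro exI[of _ "e / (2 * (real n + 1))"] conjI allI impI)
  show "e / (2 * (real n + 1)) > 0" using e by simp
  fix P :: "(real \<times> real) set"
  assume P: "finite P" "\<forall>(s, t)\<in>P. s <= t & {s..t} <= {c..d}" "disjoint_Ioos P"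
   "(\<Sum>(s, t)\<in>P. t - s) < e / (2 * (real n + 1))"
  have P0: "0 <= (\<Sum>(s, t)\<in>P. t - s)" by (rule sum_nonneg) (use P(2) in auto)
  have "(\<Sum>(s, t)\<in>P. norm (integral {c..t} f - integral {c..s} f)) <=
     (\<Sum>(s, t)\<in>P. (LINT x|lebesgue. indicator {s<..<t} x * k n x) + real n * (t - s))"
   by (rule sum_mono) (use P(2) incr in auto)
  also have "... = (\<Sum>i\<in>P. LINT x|lebesgue. indicator ((%(s, t). {s<..<t}) i) x * k n x) + real n * (\<Sum>(s, t)\<in>P. t - s)"
   by (simp add: case_prod_unfold sum.distrib sum_distrib_left)
  also have "(\<Sum>i\<in>P. LINT x|lebesgue. indicator ((%(s, t). {s<..<t}) i) x * k n x)
    = (LINT x|lebesgue. (\<Sum>i\<in>P. indicator ((%(s, t). {s<..<t}) i) x * k n x))"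
   by (rule Bochner_Integration.integral_sum[symmetric])
    (auto intro!: kind kint split: prod.splits)
  also have "... = (LINT x|lebesgue. indicator (\<Union>i\<in>P. (%(s, t). {s<..<t}) i) x * k n x)"
   using P(1,3) by (simp add: indicator_UN_disjoint sum_distrib_right)
  also have "... <= (LINT x|lebesgue. k n x)"
  proof (rule integral_mono)
   show "integrable lebesgue (%x. indicator (\<Union>i\<in>P. (%(s, t). {s<..<t}) i) x * k n x)"
    by (intro kind kint sets.finite_UN P(1))
     (auto split: prod.splits)
   show "integrable lebesgue (k n)" by (rule kint)
   show "indicator (\<Union>i\<in>P. (%(s, t). {s<..<t}) i) x * k n x <= k n x" for x
    by (simp add: indicator_def k_def)
  qed
  also have "real n * (\<Sum>(s, t)\<in>P. t - s) <= real n * (e / (2 * (real n + 1)))"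
   using P(4) by (intro mult_left_mono) auto
  also have "... <= e / 2" using e by (simp add: field_simps)
  finally show "(\<Sum>(s, t)\<in>P. norm (integral {c..t} f - integral {c..s} f)) < e" using n by linarith
 qed
qed

text \<open>The averages over \<open>{x..x + h}\<close> give the right derivative, and those of the
  reflected function give the left derivative. The extension \<open>g\<close> by zero makes the
  averages meaningful on the whole line.\<close>

lemma integral_has_vector_derivative_ae:
 fixes f :: "real => complex"
 assumes f: "f integrable_on {c..d}"
 obtains N where "negligible N"
  "!!x. x \<in> {c<..<d} - N ==> ((%x. integral {c..x} f) has_vector_derivative f x) (at x)"
proof -
 define g where "g = (%x. if x \<in> {c..d} then f x else 0)"
 have "g integrable_on UNIV" unfolding g_def integrable_restrict_UNIV by (rule f)
 then have g: "g integrable_on cbox s t" for s t by (rule integrable_on_subcbox) auto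
 have g': "(%x. g (- x)) integrable_on cbox s t" for s t
  using g[of "- t" "- s"] Henstock_Kurzweil_Integration.integrable_reflect_real[where f = g and a = "- t" and b = "- s"] by simp
 obtain N1 where N1: "negligible N1" "!!x e. x \<notin> N1 ==> 0 < e ==>
   \<exists>de>0. \<forall>h. 0 < h & h < de --> norm(integral (cbox x (x + h *\<^sub>R One)) g /\<^sub>R h ^ DIM(real) - g x) < e"
  using integrable_ccontinuous_explicit[of g] g by metis
 obtain N2 where N2: "negligible N2" "!!x e. x \<notin> N2 ==> 0 < e ==>
   \<exists>de>0. \<forall>h. 0 < h & h < de --> norm(integral (cbox x (x + h *\<^sub>R One)) (%x. g (- x)) /\<^sub>R h ^ DIM(real) - g (- x)) < e"
  using integrable_ccontinuous_explicit[of "%x. g (- x)"] g' by metis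
 show ?thesis
 proof (rule that[of "N1 Un uminus ` N2"])
  show "negligible (N1 Un uminus ` N2)"
   using N1 N2 by (intro negligible_Un negligible_differentiable_image_negligible)
    (auto intro!: differentiable_on_minus differentiable_on_ident)
  fix x assume x: "x \<in> {c<..<d} - (N1 Un uminus ` N2)"
  then have xN: "x \<notin> N1" "- x \<notin> N2" by (force simp: image_iff)+
  have gx: "g x = f x" using x by (simp add: g_def)
  show "((%x. integral {c..x} f) has_vector_derivative f x) (at x)"
   unfolding has_vector_derivative_def has_derivative_at_alt
  proof (intro conjI allI impI bounded_linear_scaleR_left)
   fix e :: real assume e: "e > 0"
   obtain d1 where d1: "d1 > 0" "!!h. 0 < h ==> h < d1 ==> norm (integral {x..x + h} g /\<^sub>R h - f x) < e"
    using N1(2)[OF xN(1) e] by (auto simp: gx)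
   obtain d2 where d2: "d2 > 0" "!!h. 0 < h ==> h < d2 ==> norm (integral {-x..-x + h} (%x. g (- x)) /\<^sub>R h - f x) < e"
    using N2(2)[OF xN(2) e] by (auto simp: gx)
   have scale: "norm (I - h *\<^sub>R f x) <= e * h" if "norm (I /\<^sub>R h - f x) < e" "h > 0" for I h
   proof -
    have "I - h *\<^sub>R f x = h *\<^sub>R (I /\<^sub>R h - f x)" using that(2) by (simp add: scaleR_diff_right)
    then have "norm (I - h *\<^sub>R f x) = h * norm (I /\<^sub>R h - f x)" using that(2) by simp
    then show ?thesis using that by (simp add: mult.commute)
   qed
   define de where "de = Min {d1, d2, x - c, d - x}"
   have "de > 0" using d1 d2 x by (auto simp: de_def)
   moreover have "norm (integral {c..y} f - integral {c..x} f - (y - x) *\<^sub>R f x) <= e * norm (y - x)" if y: "norm (y - x) < de" for y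
   proof -
    have y': "\<bar>y - x\<bar> < d1" "\<bar>y - x\<bar> < d2" "c < y" "y < d" using y x by (auto simp: de_def)
    have fi: "f integrable_on {c..z}" if "z <= d" for z
     using f by (rule integrable_on_subinterval) (use that in auto)
    consider "y = x" | "x < y" | "y < x" by linarith
    then show ?thesis
    proof cases
     case 2
     have "integral {c..y} f - integral {c..x} f = integral {x..y} f"
      using Henstock_Kurzweil_Integration.integral_combine[of c x y f] fi[of y] x y' 2 by (auto simp: algebra_simps)
     also have "... = integral {x..x + (y - x)} g"
      by simp (rule Henstock_Kurzweil_Integration.integral_cong, use x y' in \<open>auto simp: g_def\<close>)
     finally show ?thesis using scale[OF d1(2)[of "y - x"]] 2 y' by simp
    next
     case 3
     have "integral {c..x} f - integral {c..y} f = integral {y..x} f"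
      using Henstock_Kurzweil_Integration.integral_combine[of c y x f] fi[of x] x y' 3 by (auto simp: algebra_simps)
     also have "... = integral {y..x} g"
      by (rule Henstock_Kurzweil_Integration.integral_cong) (use x y' in \<open>auto simp: g_def\<close>)
     also have "... = integral {-x..-x + (x - y)} (%x. g (- x))"
      using Henstock_Kurzweil_Integration.integral_reflect_real[of x y g] by simp
     finally have eq: "integral {c..x} f - integral {c..y} f = integral {-x..-x + (x - y)} (%x. g (- x))" .
     have "norm (integral {c..x} f - integral {c..y} f - (x - y) *\<^sub>R f x) <= e * (x - y)"
      unfolding eq using scale[OF d2(2)[of "x - y"]] 3 y' by simp
     moreover have "norm (integral {c..y} f - integral {c..x} f - (y - x) *\<^sub>R f x)
      = norm (integral {c..x} f - integral {c..y} f - (x - y) *\<^sub>R f x)"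
      by (subst norm_minus_cancel[symmetric]) (simp add: algebra_simps)
     ultimately show ?thesis using 3 by simp
    qed simp
   qed
   ultimately show "\<exists>d>0. \<forall>y. norm (y - x) < d --> norm (integral {c..y} f - integral {c..x} f - (y - x) *\<^sub>R f x) <= e * norm (y - x)"
    by blast
  qed
 qed
qed

lemma absolutely_integrable_times_continuous:
 fixes r V :: "real => complex"
 assumes "r absolutely_integrable_on {c..d}" "continuous_on {c..d} V"
 shows "(%y. r y * V y) absolutely_integrable_on {c..d}"
proof -
 have "(%y. V y * r y) absolutely_integrable_on {c..d}"
 proof (rule absolutely_integrable_bounded_measurable_product[OF bilinear_times])
  show "V \<in> borel_measurable (lebesgue_on {c..d})"
   by (rule continuous_imp_measurable_on_sets_lebesgue[OF assms(2)]) auto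
  show "bounded (V ` {c..d})" by (intro compact_imp_bounded compact_continuous_image assms compact_Icc)
 qed (use assms in auto)
 then show ?thesis by (simp add: mult.commute)
qed

lemma abs_continuous_on_eq:
 assumes "abs_continuous_on S f" "!!x. x \<in> S ==> f x = g x"
 shows "abs_continuous_on S g"
proof (rule abs_continuous_on_dominated[OF assms(1) assms(1), of 1])
 fix s t :: real assume "s <= t" "{s..t} <= S"
 then have "s \<in> S" "t \<in> S" by auto
 then show "norm (g t - g s) <= 1 * (norm (f t - f s) + norm (f t - f s))" using assms(2) by auto
qed simp

section \<open>Linear systems with integrable coefficients\<close>

text \<open>Solutions of U' = r V, V' = s U + g in integrated form, as is appropriate for integrable
  coefficients. For the Sturm-Liouville equation \<open>V\<close> is the quasi-derivative p
  U'.\<close>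

definition lin_sol :: "real => real => cfun => cfun => cfun => cfun => cfun => bool" where
 "lin_sol c d r s g U V \<longleftrightarrow> continuous_on {c..d} U & continuous_on {c..d} V &
  (\<forall>x\<in>{c..d}. U x = U c + integral {c..x} (%y. r y * V y) &
         V x = V c + integral {c..x} (%y. s y * U y + g y))"

lemma lin_solD:
 assumes "lin_sol c d r s g U V"
 shows "continuous_on {c..d} U" "continuous_on {c..d} V"
  "x \<in> {c..d} ==> U c + integral {c..x} (%y. r y * V y) = U x"
  "x \<in> {c..d} ==> V c + integral {c..x} (%y. s y * U y + g y) = V x"
 using assms unfolding lin_sol_def by metis+

locale lin_sys =
 fixes c d :: real and r s g :: cfun
 assumes cd: "c <= d"
  and r: "r absolutely_integrable_on {c..d}"
  and s: "s absolutely_integrable_on {c..d}"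
  and g: "g absolutely_integrable_on {c..d}"
begin

lemma rhs_integrable:
 assumes "continuous_on {c..d} U" "continuous_on {c..d} V"
 shows "(%y. r y * V y) absolutely_integrable_on {c..d}" "(%y. s y * U y + g y) absolutely_integrable_on {c..d}"
 using assms r s g by (auto intro!: absolutely_integrable_times_continuous set_integral_add(1))

lemma lin_sol_ac:
 assumes "lin_sol c d r s g U V"
 shows "abs_continuous_on {c..d} U" "abs_continuous_on {c..d} V"
proof -
 note * = lin_solD(1,2)[OF assms]
 show "abs_continuous_on {c..d} U"
  by (rule abs_continuous_on_eq[OF abs_continuous_on_add[OF abs_continuous_on_const[of _ "U c"] abs_continuous_on_integral[OF rhs_integrable(1)[OF *]]]])
   (rule lin_solD(3)[OF assms])
 show "abs_continuous_on {c..d} V"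
  by (rule abs_continuous_on_eq[OF abs_continuous_on_add[OF abs_continuous_on_const[of _ "V c"] abs_continuous_on_integral[OF rhs_integrable(2)[OF *]]]])
   (rule lin_solD(4)[OF assms])
qed

lemma lin_sol_deriv:
 assumes "lin_sol c d r s g U V"
 obtains N where "negligible N"
  "!!x. x \<in> {c<..<d} - N ==> (U has_vector_derivative r x * V x) (at x)"
  "!!x. x \<in> {c<..<d} - N ==> (V has_vector_derivative s x * U x + g x) (at x)"
proof -
 note * = lin_solD(1,2)[OF assms]
 note i = rhs_integrable[OF *, THEN set_lebesgue_integral_eq_integral(1)]
 obtain N1 where N1: "negligible N1" "!!x. x \<in> {c<..<d} - N1 ==>
  ((%x. integral {c..x} (%y. r y * V y)) has_vector_derivative r x * V x) (at x)"
  by (rule integral_has_vector_derivative_ae[OF i(1)], rule that)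
 obtain N2 where N2: "negligible N2" "!!x. x \<in> {c<..<d} - N2 ==>
  ((%x. integral {c..x} (%y. s y * U y + g y)) has_vector_derivative s x * U x + g x) (at x)"
  by (rule integral_has_vector_derivative_ae[OF i(2)], rule that)
 show ?thesis
 proof (rule that[of "N1 Un N2"])
  fix x assume x: "x \<in> {c<..<d} - (N1 Un N2)"
  have "((%x. U c + integral {c..x} (%y. r y * V y)) has_vector_derivative 0 + r x * V x) (at x)"
   using N1(2)[of x] x by (intro has_vector_derivative_add has_vector_derivative_const) auto
  then have "((%x. U c + integral {c..x} (%y. r y * V y)) has_vector_derivative r x * V x) (at x)" by simp
  then show "(U has_vector_derivative r x * V x) (at x)"
   by (rule has_vector_derivative_transform_within_open[of _ _ x "{c<..<d}"])
    (use x lin_solD(3,4)[OF assms] in auto)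
  have "((%x. V c + integral {c..x} (%y. s y * U y + g y)) has_vector_derivative 0 + (s x * U x + g x)) (at x)"
   using N2(2)[of x] x by (intro has_vector_derivative_add has_vector_derivative_const) auto
  then have "((%x. V c + integral {c..x} (%y. s y * U y + g y)) has_vector_derivative s x * U x + g x) (at x)" by simp
  then show "(V has_vector_derivative s x * U x + g x) (at x)"
   by (rule has_vector_derivative_transform_within_open[of _ _ x "{c<..<d}"])
    (use x lin_solD(3,4)[OF assms] in auto)
 qed (use N1 N2 in auto)
qed

end

text \<open>Together with \<open>lin_sol_deriv\<close> and \<open>lin_sol_ac\<close> this passes
  between the integrated system and the system almost everywhere; this direction is the fundamental
  theorem for absolutely continuous functions.\<close>

lemma lin_solI:
 assumes "abs_continuous_on {c..d} U" "abs_continuous_on {c..d} V" "negligible N"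
  "!!x. x \<in> {c<..<d} - N ==> (U has_vector_derivative r x * V x) (at x)"
  "!!x. x \<in> {c<..<d} - N ==> (V has_vector_derivative s x * U x + g x) (at x)"
 shows "lin_sol c d r s g U V"
 unfolding lin_sol_def
proof (intro conjI ballI)
 fix x assume x: "x \<in> {c..d}"
 have N: "negligible (N Un {c, d})" using assms(3) by (simp add: negligible_insert)
 have sub: "{c..x} <= {c..d}" using x by auto
 have "((%y. r y * V y) has_integral (U x - U c)) {c..x}"
  by (rule abs_continuous_on_ftc[OF _ abs_continuous_on_subset[OF assms(1) sub] N])
   (use x in \<open>auto intro!: has_vector_derivative_at_within[OF assms(4)]\<close>)
 then show "U x = U c + integral {c..x} (%y. r y * V y)" by (simp add: integral_unique)
 have "((%y. s y * U y + g y) has_integral (V x - V c)) {c..x}"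
  by (rule abs_continuous_on_ftc[OF _ abs_continuous_on_subset[OF assms(2) sub] N])
   (use x in \<open>auto intro!: has_vector_derivative_at_within[OF assms(5)]\<close>)
 then show "V x = V c + integral {c..x} (%y. s y * U y + g y)" by (simp add: integral_unique)
qed (use assms abs_continuous_on_continuous in auto)

text \<open>The weight \<open>exp (2 * K)\<close> has derivative \<open>2 * k * exp (2 * K)\<close>,
  so integration against \<open>k\<close> at most halves it. In the norm weighted with
  \<open>exp (- 2 * K)\<close> the integral operator of the system therefore has bound 1/2 on the
  whole interval at once.\<close>

lemma gronwall_weight:
 fixes k :: "real => real"
 assumes k: "k absolutely_integrable_on {c..d}" "!!x. k x >= 0" and x: "x \<in> {c..d}"
 defines "K \<equiv> %x. integral {c..x} k"
 shows "(%y. k y * exp (2 * K y)) absolutely_integrable_on {c..d}"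
  and "integral {c..x} (%y. k y * exp (2 * K y)) <= exp (2 * K x) / 2"
  and "continuous_on {c..d} K" and "K x >= 0" and "K x <= K d"
proof -
 have ki: "k integrable_on {c..d}" using k(1) set_lebesgue_integral_eq_integral(1) by blast
 have kc: "(%y. complex_of_real (k y)) absolutely_integrable_on {c..d}"
  using k(1) by (rule absolutely_integrable_linear[OF _ bounded_linear_of_real, unfolded o_def])
 have Kc: "integral {c..y} (%y. complex_of_real (k y)) = of_real (K y)" if "y \<in> {c..d}" for y
 proof -
  have "k integrable_on {c..y}" using ki by (rule integrable_on_subinterval) (use that in auto)
  from integral_linear[OF this bounded_linear_of_real[where 'a = complex]] show ?thesis by (simp add: o_def K_def)
 qed
 have acK: "abs_continuous_on {c..d} (%x. of_real (K x))"
  using abs_continuous_on_integral[OF kc] by (rule abs_continuous_on_eq) (use Kc in auto)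
 show contK: "continuous_on {c..d} K" unfolding K_def by (rule indefinite_integral_continuous_1[OF ki])
 have mono: "K y <= K z" if "c <= y" "y <= z" "z <= d" for y z
  unfolding K_def by (rule integral_subset_le) (use that k(2) ki in \<open>auto intro: integrable_on_subinterval\<close>)
 show "K x >= 0" unfolding K_def using k(2) by (intro integral_nonneg) (use ki x in \<open>auto intro: integrable_on_subinterval\<close>)
 show "K x <= K d" using mono x by auto
 \<comment> \<open>The exponential inherits absolute continuity from the increasing function
   \<open>K\<close> by the tangent inequality \<open>1 + x <= exp x\<close>.\<close>
 have ac: "abs_continuous_on {c..d} (%x. of_real (exp (2 * K x)))"
 proof (rule abs_continuous_on_dominated[OF acK acK, of "exp (2 * K d)"])
  fix y z assume yz: "y <= z" "{y..z} <= {c..d}"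
  then have le: "K y <= K z" "K z <= K d" using mono by auto
  have "1 + (2 * K y - 2 * K z) <= exp (2 * K y - 2 * K z)" by (rule exp_ge_add_one_self)
  then have "exp (2 * K z) * (1 + (2 * K y - 2 * K z)) <= exp (2 * K y)"
   by (metis exp_diff mult_left_mono exp_ge_zero nonzero_mult_div_cancel_left exp_not_eq_zero times_divide_eq_right)
  then have "exp (2 * K z) - exp (2 * K y) <= exp (2 * K z) * (2 * (K z - K y))" by (simp add: algebra_simps)
  also have "... <= exp (2 * K d) * (2 * (K z - K y))" using le by (intro mult_right_mono) auto
  finally have "exp (2 * K z) - exp (2 * K y) <= exp (2 * K d) * (2 * (K z - K y))" .
  moreover have "exp (2 * K y) <= exp (2 * K z)" using le by simp
  ultimately show "norm (complex_of_real (exp (2 * K z)) - of_real (exp (2 * K y))) <= exp (2 * K d) *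
    (norm (complex_of_real (K z) - of_real (K y)) + norm (complex_of_real (K z) - of_real (K y)))"
   using le by (simp only: of_real_diff[symmetric] norm_of_real) (simp add: algebra_simps)
 qed simp
 obtain N where N: "negligible N" "!!x. x \<in> {c<..<d} - N ==>
  ((%x. integral {c..x} (%y. complex_of_real (k y))) has_vector_derivative of_real (k x)) (at x)"
  by (rule integral_has_vector_derivative_ae[OF set_lebesgue_integral_eq_integral(1)[OF kc]], rule that)
 have der: "((%x. complex_of_real (exp (2 * K x))) has_vector_derivative of_real (2 * (k y * exp (2 * K y)))) (at y)"
  if y: "y \<in> {c<..<d} - N" for y
 proof -
  have "((%x. complex_of_real (K x)) has_vector_derivative of_real (k y)) (at y)"
   by (rule has_vector_derivative_transform_within_open[OF N(2)[OF y], of "{c<..<d}"]) (use y Kc in auto)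
  then have "((%x. Re (complex_of_real (K x))) has_vector_derivative Re (of_real (k y))) (at y)"
   by (rule bounded_linear.has_vector_derivative[OF bounded_linear_Re])
  then have "(K has_field_derivative k y) (at y)" by (simp add: has_real_derivative_iff_has_vector_derivative)
  then have "((%x. exp (2 * K x)) has_field_derivative (2 * (k y * exp (2 * K y)))) (at y)"
   by (auto intro!: derivative_eq_intros)
  then have "((%x. exp (2 * K x)) has_vector_derivative (2 * (k y * exp (2 * K y)))) (at y)"
   by (simp add: has_real_derivative_iff_has_vector_derivative)
  then show ?thesis by (rule bounded_linear.has_vector_derivative[OF bounded_linear_of_real])
 qed
 have "((%y. complex_of_real (2 * (k y * exp (2 * K y)))) has_integral
  (of_real (exp (2 * K x)) - of_real (exp (2 * K c)))) {c..x}"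
 proof (rule abs_continuous_on_ftc)
  show "abs_continuous_on {c..x} (%x. complex_of_real (exp (2 * K x)))"
   using ac by (rule abs_continuous_on_subset) (use x in auto)
  show "negligible (N Un {c, d})" using N(1) by (simp add: negligible_insert)
  show "((%x. complex_of_real (exp (2 * K x))) has_vector_derivative of_real (2 * (k y * exp (2 * K y)))) (at y within {c..x})"
   if "y \<in> {c..x} - (N Un {c, d})" for y
   using x that by (intro has_vector_derivative_at_within[OF der]) auto
 qed (use x in auto)
 then have "((%y. Re (complex_of_real (2 * (k y * exp (2 * K y))))) has_integral
  Re (of_real (exp (2 * K x)) - of_real (exp (2 * K c)))) {c..x}"
  by (rule has_integral_linear[OF _ bounded_linear_Re, unfolded o_def])
 then have "((%y. 2 * (k y * exp (2 * K y))) has_integral (exp (2 * K x) - exp (2 * K c))) {c..x}" by simp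
 from has_integral_divide[OF this, of 2]
 have "integral {c..x} (%y. k y * exp (2 * K y)) = (exp (2 * K x) - exp (2 * K c)) / 2"
  by (simp add: integral_unique)
 then show "integral {c..x} (%y. k y * exp (2 * K y)) <= exp (2 * K x) / 2" by simp
 have "(%y. exp (2 * K y) * k y) absolutely_integrable_on {c..d}"
 proof (rule absolutely_integrable_bounded_measurable_product[OF bilinear_times])
  have c: "continuous_on {c..d} (%y. exp (2 * K y))" using contK by (intro continuous_intros)
  show "(%y. exp (2 * K y)) \<in> borel_measurable (lebesgue_on {c..d})"
   by (rule continuous_imp_measurable_on_sets_lebesgue[OF c]) auto
  show "bounded ((%y. exp (2 * K y)) ` {c..d})" by (intro compact_imp_bounded compact_continuous_image c compact_Icc)
 qed (use k in auto)
 then show "(%y. k y * exp (2 * K y)) absolutely_integrable_on {c..d}" by (simp add: mult.commute)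
qed

context lin_sys
begin

definition kap :: "real => real" where "kap x = norm (r x) + norm (s x)"
definition Kap :: "real => real" where "Kap x = integral {c..x} kap"
definition gnorm :: real where "gnorm = integral {c..d} (%x. norm (g x))"

lemma kap_integrable: "kap absolutely_integrable_on {c..d}"
 unfolding kap_def using set_integrable_norm[OF r] set_integrable_norm[OF s] by (rule set_integral_add(1))

lemma kap_nonneg: "kap x >= 0" by (simp add: kap_def)

lemmas gron = gronwall_weight[OF kap_integrable kap_nonneg, folded Kap_def]

lemma gnorm_integrable: "(%x. norm (g x)) integrable_on {c..d}"
 using set_integrable_norm[OF g] set_lebesgue_integral_eq_integral(1) by blast

lemma gnorm_ge: "x \<in> {c..d} ==> integral {c..x} (%x. norm (g x)) <= gnorm"
 unfolding gnorm_def using gnorm_integrable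
 by (intro integral_subset_le) (auto intro: integrable_on_subinterval)

text \<open>The contraction estimate in the weighted norm; the factor 1/2 is that of
  \<open>gronwall_weight\<close>.\<close>

lemma volterra_bound:
 assumes UV: "continuous_on {c..d} U" "continuous_on {c..d} V"
  and B: "!!y. y \<in> {c..d} ==> norm (U y) + norm (V y) <= B * exp (2 * Kap y)" and x: "x \<in> {c..d}" and B0: "B >= 0"
 shows "norm (integral {c..x} (%y. r y * V y)) + norm (integral {c..x} (%y. s y * U y)) <= B * exp (2 * Kap x) / 2"
proof -
 have sub: "{c..x} <= {c..d}" using x by auto
 note i1 = absolutely_integrable_times_continuous[OF r UV(2), THEN set_integrable_subset, OF _ sub]
 note i2 = absolutely_integrable_times_continuous[OF s UV(1), THEN set_integrable_subset, OF _ sub]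
 have I1: "(%y. r y * V y) absolutely_integrable_on {c..x}" by (rule i1) auto
 have I2: "(%y. s y * U y) absolutely_integrable_on {c..x}" by (rule i2) auto
 have I3: "(%y. kap y * exp (2 * Kap y)) absolutely_integrable_on {c..x}"
  by (rule set_integrable_subset[OF gron(1)[OF x]]) (use x in auto)
 have n1: "(%y. norm (r y * V y)) integrable_on {c..x}" using I1 by (simp only: absolutely_integrable_on_def)
 have n2: "(%y. norm (s y * U y)) integrable_on {c..x}" using I2 by (simp only: absolutely_integrable_on_def)
 have n3: "(%y. kap y * exp (2 * Kap y)) integrable_on {c..x}" using I3 by (simp only: absolutely_integrable_on_def)
 have "norm (integral {c..x} (%y. r y * V y)) + norm (integral {c..x} (%y. s y * U y))
  <= integral {c..x} (%y. norm (r y * V y)) + integral {c..x} (%y. norm (s y * U y))"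
  using I1 I2 n1 n2 by (intro add_mono integral_norm_bound_integral) (auto simp: absolutely_integrable_on_def)
 also have "... = integral {c..x} (%y. norm (r y * V y) + norm (s y * U y))"
  using n1 n2 by (rule Henstock_Kurzweil_Integration.integral_add[symmetric])
 also have "... <= integral {c..x} (%y. B * (kap y * exp (2 * Kap y)))"
 proof (rule integral_le)
  show "(%y. norm (r y * V y) + norm (s y * U y)) integrable_on {c..x}" using n1 n2 by (rule integrable_add)
  show "(%y. B * (kap y * exp (2 * Kap y))) integrable_on {c..x}" using n3 by (rule integrable_on_mult_right)
  fix y assume "y \<in> {c..x}"
  then have y: "y \<in> {c..d}" using sub by auto
  have "norm (V y) <= B * exp (2 * Kap y)" "norm (U y) <= B * exp (2 * Kap y)"
   using B[OF y] norm_ge_zero[of "U y"] norm_ge_zero[of "V y"] by linarith+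
  then have "norm (r y) * norm (V y) + norm (s y) * norm (U y) <= norm (r y) * (B * exp (2 * Kap y)) + norm (s y) * (B * exp (2 * Kap y))"
   by (intro add_mono mult_left_mono) auto
  then show "norm (r y * V y) + norm (s y * U y) <= B * (kap y * exp (2 * Kap y))"
   by (simp add: kap_def norm_mult algebra_simps)
 qed
 also have "... = B * integral {c..x} (%y. kap y * exp (2 * Kap y))" by simp
 also have "... <= B * (exp (2 * Kap x) / 2)" using gron(2)[OF x] B0 by (intro mult_left_mono)
 finally show ?thesis by simp
qed

lemma inhom_bound:
 assumes "x \<in> {c..d}"
 shows "norm (integral {c..x} g) <= gnorm"
proof -
 have gx: "g absolutely_integrable_on {c..x}" by (rule set_integrable_subset[OF g]) (use assms in auto)
 then have "norm (integral {c..x} g) <= integral {c..x} (%x. norm (g x))"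
  by (intro integral_norm_bound_integral) (auto simp: absolutely_integrable_on_def)
 then show ?thesis using gnorm_ge[OF assms] by simp
qed

lemma split_integral:
 assumes "continuous_on {c..d} U" "x \<in> {c..d}"
 shows "integral {c..x} (%y. s y * U y + g y) = integral {c..x} (%y. s y * U y) + integral {c..x} g"
proof -
 have "(%y. s y * U y) integrable_on {c..d}"
  using absolutely_integrable_times_continuous[OF s assms(1)] set_lebesgue_integral_eq_integral(1) by blast
 then have "(%y. s y * U y) integrable_on {c..x}" by (rule integrable_on_subinterval) (use assms in auto)
 moreover have "g integrable_on {c..x}"
  by (rule integrable_on_subinterval[OF set_lebesgue_integral_eq_integral(1)[OF g]]) (use assms in auto)
 ultimately show ?thesis by (rule Henstock_Kurzweil_Integration.integral_add)
qed

text \<open>At the point \<open>m\<close> where the weighted norm \<open>n\<close> is largest,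
  \<open>volterra_bound\<close> estimates the integrals by half of this maximum, and this half is
  absorbed on the left.\<close>

lemma lin_sol_bound:
 assumes sol: "lin_sol c d r s g U V" and x: "x \<in> {c..d}"
 shows "norm (U x) + norm (V x) <= 2 * (norm (U c) + norm (V c) + gnorm) * exp (2 * Kap d)"
proof -
 note c = lin_solD(1,2)[OF sol]
 define n where "n = (%y. exp (- (2 * Kap y)) * (norm (U y) + norm (V y)))"
 have "continuous_on {c..d} n" unfolding n_def using c gron(3)[OF x] by (intro continuous_intros)
 then obtain m where m: "m \<in> {c..d}" "!!y. y \<in> {c..d} ==> n y <= n m"
  using continuous_attains_sup[of "{c..d}" n] x by auto
 have n0: "n y >= 0" for y by (simp add: n_def)
 have eqn: "norm (U y) + norm (V y) = n y * exp (2 * Kap y)" for y by (simp add: n_def exp_minus field_simps)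
 define N0 where "N0 = norm (U c) + norm (V c) + gnorm"
 have g0: "gnorm >= 0" unfolding gnorm_def using gnorm_integrable by (intro integral_nonneg) auto
 have "norm (U m) + norm (V m) <= N0 + n m * exp (2 * Kap m) / 2"
 proof -
  have 1: "norm (integral {c..m} (%y. r y * V y)) + norm (integral {c..m} (%y. s y * U y)) <= n m * exp (2 * Kap m) / 2"
  proof (rule volterra_bound[OF c _ m(1) n0])
   fix y assume "y \<in> {c..d}"
   then show "norm (U y) + norm (V y) <= n m * exp (2 * Kap y)" unfolding eqn using m(2) by (intro mult_right_mono) auto
  qed
  have "norm (U m) <= norm (U c) + norm (integral {c..m} (%y. r y * V y))"
   by (subst lin_solD(3)[OF sol m(1), symmetric]) (rule norm_triangle_ineq)
  moreover have "norm (V m) <= norm (V c) + (norm (integral {c..m} (%y. s y * U y)) + norm (integral {c..m} g))"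
   by (subst lin_solD(4)[OF sol m(1), symmetric], subst split_integral[OF c(1) m(1)])
    (meson norm_triangle_ineq norm_triangle_le add_left_mono order_trans)
  ultimately show ?thesis using 1 inhom_bound[OF m(1)] unfolding N0_def by linarith
 qed
 then have "n m * exp (2 * Kap m) <= 2 * N0" unfolding eqn by simp
 moreover have "n m * 1 <= n m * exp (2 * Kap m)" using gron(4)[OF m(1)] n0 by (intro mult_left_mono) auto
 ultimately have nm: "n m <= 2 * N0" by simp
 have N00: "N0 >= 0" using g0 by (simp add: N0_def)
 have "norm (U x) + norm (V x) <= n m * exp (2 * Kap x)" unfolding eqn using m(2)[OF x] by (intro mult_right_mono) auto
 also have "... <= (2 * N0) * exp (2 * Kap d)"
  using nm gron(5)[OF x] N00 by (intro mult_mono) auto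
 finally show ?thesis by (simp add: N0_def)
qed

text \<open>Banach's fixed point theorem in the bounded continuous functions on the line. The
  unknown \<open>Z\<close> is the solution divided by the weight \<open>exp (2 * Kap)\<close>;
  composition with the retraction \<open>cl\<close> onto \<open>{c..d}\<close> carries functions on
  the interval to functions on the line.\<close>

lemma lin_sol_exists_left: "\<exists>U V. lin_sol c d r s g U V & U c = al & V c = be"
proof -
 define cl where "cl = (%x. max c (min d x))"
 have cl: "cl x \<in> {c..d}" "x \<in> {c..d} ==> cl x = x" for x using cd by (auto simp: cl_def)
 have cl_cont: "continuous_on UNIV cl" unfolding cl_def by (intro continuous_intros)
 have cI: "c \<in> {c..d}" using cd by simp
 define uu where "uu = (%(Z :: real \<Rightarrow>\<^sub>C (complex \<times> complex)) y. exp (2 * Kap y) *\<^sub>R fst (apply_bcontfun Z y))"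
 define vv where "vv = (%(Z :: real \<Rightarrow>\<^sub>C (complex \<times> complex)) y. exp (2 * Kap y) *\<^sub>R snd (apply_bcontfun Z y))"
 define P where "P = (%Z x. (al + integral {c..x} (%y. r y * vv Z y), be + integral {c..x} (%y. s y * uu Z y + g y)))"
 define T where "T = (%Z x. exp (- (2 * Kap (cl x))) *\<^sub>R P Z (cl x))"
 have cont_Z: "continuous_on {c..d} (apply_bcontfun Z)" for Z :: "real \<Rightarrow>\<^sub>C (complex \<times> complex)"
  by (rule continuous_on_subset[of UNIV]) (use apply_bcontfun[of Z] in \<open>auto simp: bcontfun_def\<close>)
 have cont_uv: "continuous_on {c..d} (uu Z)" "continuous_on {c..d} (vv Z)" for Z
  unfolding uu_def vv_def
  by (intro continuous_on_scaleR continuous_on_exp continuous_on_mult continuous_on_const gron(3)[OF cI]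
    continuous_on_fst continuous_on_snd cont_Z)+
 have cont_P: "continuous_on {c..d} (P Z)" for Z
  unfolding P_def
  by (intro continuous_on_Pair continuous_on_add continuous_on_const indefinite_integral_continuous_1
     set_lebesgue_integral_eq_integral(1) rhs_integrable(1)[OF cont_uv] rhs_integrable(2)[OF cont_uv])
 have cont_TI: "continuous_on {c..d} (%x. exp (- (2 * Kap x)) *\<^sub>R P Z x)" for Z
  by (intro continuous_on_scaleR continuous_on_exp continuous_on_mult continuous_on_const gron(3)[OF cI]
    continuous_on_minus cont_P)
 have T_eq: "T Z = (%x. exp (- (2 * Kap x)) *\<^sub>R P Z x) \<circ> cl" for Z by (auto simp: T_def)
 have T_b: "T Z \<in> bcontfun" for Z
 proof -
  have "continuous_on UNIV (T Z)" unfolding T_eq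
   by (rule continuous_on_compose[OF cl_cont]) (rule continuous_on_subset[OF cont_TI], use cl in auto)
  moreover have "bounded (range (T Z))"
  proof (rule bounded_subset)
   show "bounded ((%x. exp (- (2 * Kap x)) *\<^sub>R P Z x) ` {c..d})"
    by (intro compact_imp_bounded compact_continuous_image cont_TI compact_Icc)
   show "range (T Z) <= (%x. exp (- (2 * Kap x)) *\<^sub>R P Z x) ` {c..d}" unfolding T_def using cl by auto
  qed
  ultimately show ?thesis by (simp add: bcontfun_def)
 qed
 define TT where "TT = (%Z. Bcontfun (T Z))"
 have TT: "apply_bcontfun (TT Z) = T Z" for Z unfolding TT_def using T_b by (simp add: Bcontfun_inverse)
 have contr: "dist (TT Z) (TT W) <= sqrt 2 / 2 * dist Z W" for Z W
 proof (rule dist_bound)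
  fix x0 :: real
  define x where "x = cl x0"
  have x: "x \<in> {c..d}" using cl by (simp add: x_def)
  \<comment> \<open>Passing from the Euclidean norm of a pair to the sum of the norms costs
    \<open>sqrt 2\<close>. With the factor 1/2 of \<open>volterra_bound\<close> the contraction
    constant becomes \<open>sqrt 2 / 2 < 1\<close>.\<close>
  define B where "B = sqrt 2 * dist Z W"
  have 1: "norm (integral {c..x} (%y. r y * (vv Z y - vv W y))) + norm (integral {c..x} (%y. s y * (uu Z y - uu W y))) <= B * exp (2 * Kap x) / 2"
  proof (rule volterra_bound[OF _ _ _ x])
   show "continuous_on {c..d} (%y. uu Z y - uu W y)" "continuous_on {c..d} (%y. vv Z y - vv W y)"
    using cont_uv by (auto intro!: continuous_intros)
   fix y
   have d: "norm (apply_bcontfun Z y - apply_bcontfun W y) <= dist Z W" using dist_bounded[of Z y W] by (simp add: dist_norm)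
   have "norm (uu Z y - uu W y) + norm (vv Z y - vv W y) = exp (2 * Kap y) * (norm (fst (Z y - W y)) + norm (snd (Z y - W y)))"
    by (simp add: uu_def vv_def distrib_left flip: scaleR_diff_right)
   also have "... <= exp (2 * Kap y) * (sqrt 2 * norm (Z y - W y))"
   proof (rule mult_left_mono)
    have "(norm (fst (Z y - W y)) + norm (snd (Z y - W y)))^2 <= 2 * ((norm (fst (Z y - W y)))^2 + (norm (snd (Z y - W y)))^2)"
     using sum_squares_bound[of "norm (fst (Z y - W y))" "norm (snd (Z y - W y))"] by (simp add: power2_sum)
    also have "... = (sqrt 2 * norm (Z y - W y))^2" by (simp add: norm_prod_def power_mult_distrib)
    finally show "norm (fst (Z y - W y)) + norm (snd (Z y - W y)) <= sqrt 2 * norm (Z y - W y)"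
     by (rule power2_le_imp_le) simp
   qed simp
   also have "... <= exp (2 * Kap y) * B" using d unfolding B_def by (intro mult_left_mono) auto
   finally show "norm (uu Z y - uu W y) + norm (vv Z y - vv W y) <= B * exp (2 * Kap y)" by (simp add: mult.commute)
  qed (simp add: B_def)
  have ir: "(%y. r y * vv Z y) integrable_on {c..x}" for Z
   by (rule integrable_on_subinterval[OF set_lebesgue_integral_eq_integral(1)[OF rhs_integrable(1)[OF cont_uv[of Z]]]]) (use x in auto)
  have is': "(%y. s y * uu Z y) integrable_on {c..x}" for Z
   by (rule integrable_on_subinterval[OF set_lebesgue_integral_eq_integral(1)[OF absolutely_integrable_times_continuous[OF s cont_uv(1)[of Z]]]]) (use x in auto)
  have eqP: "P Z x - P W x = (integral {c..x} (%y. r y * (vv Z y - vv W y)), integral {c..x} (%y. s y * (uu Z y - uu W y)))"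
  proof -
   have "integral {c..x} (%y. r y * (vv Z y - vv W y)) = integral {c..x} (%y. r y * vv Z y) - integral {c..x} (%y. r y * vv W y)"
    unfolding right_diff_distrib by (rule Henstock_Kurzweil_Integration.integral_diff[OF ir ir])
   moreover have "integral {c..x} (%y. s y * (uu Z y - uu W y)) = integral {c..x} (%y. s y * uu Z y) - integral {c..x} (%y. s y * uu W y)"
    unfolding right_diff_distrib by (rule Henstock_Kurzweil_Integration.integral_diff[OF is' is'])
   ultimately show ?thesis
    unfolding P_def split_integral[OF cont_uv(1)[of Z] x] split_integral[OF cont_uv(1)[of W] x] by simp
  qed
  have "norm (P Z x - P W x) <= B * exp (2 * Kap x) / 2" unfolding eqP by (rule order_trans[OF norm_Pair_le 1])
  then have "exp (- (2 * Kap x)) * norm (P Z x - P W x) <= exp (- (2 * Kap x)) * (B * exp (2 * Kap x) / 2)"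
   by (intro mult_left_mono) auto
  also have "... = sqrt 2 / 2 * dist Z W" by (simp add: B_def exp_minus field_simps)
  finally have "exp (- (2 * Kap x)) * norm (P Z x - P W x) <= sqrt 2 / 2 * dist Z W" .
  then show "dist (TT Z x0) (TT W x0) <= sqrt 2 / 2 * dist Z W"
   by (simp add: TT T_def x_def dist_norm scaleR_diff_right[symmetric])
 qed
 have "sqrt 2 / 2 < 1" using real_sqrt_less_mono[of 2 4] by simp
 then have "\<exists>!Z. TT Z = Z" by (intro banach_fix_type[of "sqrt 2 / 2"]) (use contr in auto)
 then obtain Z where Z: "TT Z = Z" by auto
 have fix_eq: "Z x = exp (- (2 * Kap x)) *\<^sub>R P Z x" if "x \<in> {c..d}" for x
  using TT[of Z] cl(2)[OF that] by (simp add: Z T_def)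
 have uP: "uu Z x = fst (P Z x)" "vv Z x = snd (P Z x)" if "x \<in> {c..d}" for x
  unfolding uu_def vv_def fix_eq[OF that] by (simp_all add: exp_minus)
 have "uu Z c = al" "vv Z c = be" using uP[OF cI] by (simp_all add: P_def)
 moreover from this have "lin_sol c d r s g (uu Z) (vv Z)"
  unfolding lin_sol_def using cont_uv uP by (simp add: P_def)
 ultimately show ?thesis by blast
qed

end

section \<open>Superposition, Wronskian and variation of constants\<close>

lemma lin_sys_zero: "lin_sys c d r s g ==> lin_sys c d r s (%_. 0)"
 by (auto simp: lin_sys_def)

lemma lin_sol_comb:
 assumes "lin_sys c d r s g1" "lin_sys c d r s g2" "lin_sol c d r s g1 U1 V1" "lin_sol c d r s g2 U2 V2"
 shows "lin_sol c d r s (%x. k1 * g1 x + k2 * g2 x) (%x. k1 * U1 x + k2 * U2 x) (%x. k1 * V1 x + k2 * V2 x)"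
proof -
 interpret l1: lin_sys c d r s g1 by fact
 interpret l2: lin_sys c d r s g2 by fact
 obtain N1 where N1: "negligible N1"
  "!!x. x \<in> {c<..<d} - N1 ==> (U1 has_vector_derivative r x * V1 x) (at x)"
  "!!x. x \<in> {c<..<d} - N1 ==> (V1 has_vector_derivative s x * U1 x + g1 x) (at x)"
  by (rule l1.lin_sol_deriv[OF assms(3)], rule that)
 obtain N2 where N2: "negligible N2"
  "!!x. x \<in> {c<..<d} - N2 ==> (U2 has_vector_derivative r x * V2 x) (at x)"
  "!!x. x \<in> {c<..<d} - N2 ==> (V2 has_vector_derivative s x * U2 x + g2 x) (at x)"
  by (rule l2.lin_sol_deriv[OF assms(4)], rule that)
 show ?thesis
 proof (rule lin_solI[of _ _ _ _ "N1 Un N2"])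
  fix x assume x: "x \<in> {c<..<d} - (N1 Un N2)"
  have "((%x. k1 * U1 x + k2 * U2 x) has_vector_derivative k1 * (r x * V1 x) + k2 * (r x * V2 x)) (at x)"
   by (intro has_vector_derivative_add has_vector_derivative_mult_right N1 N2) (use x in auto)
  then show "((%x. k1 * U1 x + k2 * U2 x) has_vector_derivative r x * (k1 * V1 x + k2 * V2 x)) (at x)"
   by (simp add: algebra_simps)
  have "((%x. k1 * V1 x + k2 * V2 x) has_vector_derivative k1 * (s x * U1 x + g1 x) + k2 * (s x * U2 x + g2 x)) (at x)"
   by (intro has_vector_derivative_add has_vector_derivative_mult_right N1 N2) (use x in auto)
  then show "((%x. k1 * V1 x + k2 * V2 x) has_vector_derivative s x * (k1 * U1 x + k2 * U2 x) + (k1 * g1 x + k2 * g2 x)) (at x)"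
   by (simp add: algebra_simps)
 qed (use N1 N2 in \<open>auto intro!: abs_continuous_on_add abs_continuous_on_cmult l1.lin_sol_ac[OF assms(3)] l2.lin_sol_ac[OF assms(4)]\<close>)
qed

lemma lin_sol_cong:
 assumes "lin_sol c d r s g U V" "!!x. x \<in> {c..d} ==> U x = U' x" "!!x. x \<in> {c..d} ==> V x = V' x"
  "!!x. x \<in> {c..d} ==> g x = g' x" "c <= d"
 shows "lin_sol c d r s g' U' V'"
 unfolding lin_sol_def
proof (intro conjI ballI)
 show "continuous_on {c..d} U'" "continuous_on {c..d} V'"
  using continuous_on_eq[OF lin_solD(1)[OF assms(1)]] continuous_on_eq[OF lin_solD(2)[OF assms(1)]] assms(2,3) by auto
 fix x assume x: "x \<in> {c..d}"
 have 1: "integral {c..x} (%y. r y * V y) = integral {c..x} (%y. r y * V' y)"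
  by (rule Henstock_Kurzweil_Integration.integral_cong) (use x assms(3) in auto)
 have 2: "integral {c..x} (%y. s y * U y + g y) = integral {c..x} (%y. s y * U' y + g' y)"
  by (rule Henstock_Kurzweil_Integration.integral_cong) (use x assms(2,4) in auto)
 show "U' x = U' c + integral {c..x} (%y. r y * V' y)"
  using lin_solD(3)[OF assms(1) x] assms(2)[of x] assms(2)[of c] x assms(5) 1 by simp
 show "V' x = V' c + integral {c..x} (%y. s y * U' y + g' y)"
  using lin_solD(4)[OF assms(1) x] assms(3)[of x] assms(3)[of c] x assms(5) 2 by simp
qed

lemma lin_sol_subinterval:
 assumes "lin_sys c d r s g" "lin_sol c d r s g U V" "c <= c'" "d' <= d"
 shows "lin_sol c' d' r s g U V"
proof -
 interpret lin_sys c d r s g by fact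
 obtain N where N: "negligible N"
  "!!x. x \<in> {c<..<d} - N ==> (U has_vector_derivative r x * V x) (at x)"
  "!!x. x \<in> {c<..<d} - N ==> (V has_vector_derivative s x * U x + g x) (at x)"
  by (rule lin_sol_deriv[OF assms(2)], rule that)
 show ?thesis
  by (rule lin_solI[of _ _ _ _ N])
   (use assms N in \<open>auto intro: abs_continuous_on_subset[OF lin_sol_ac(1)[OF assms(2)]] abs_continuous_on_subset[OF lin_sol_ac(2)[OF assms(2)]]\<close>)
qed

context lin_sys
begin

lemma lin_sol_unique_left:
 assumes "lin_sol c d r s g U V" "lin_sol c d r s g U' V'" "U c = U' c" "V c = V' c" "x \<in> {c..d}"
 shows "U x = U' x" "V x = V' x"
proof -
 have ls: "lin_sys c d r s g" by (rule lin_sys_axioms)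
 interpret h: lin_sys c d r s "%_. 0" using lin_sys_zero[OF ls] .
 have "lin_sol c d r s (%x. 1 * g x + (-1) * g x) (%x. 1 * U x + (-1) * U' x) (%x. 1 * V x + (-1) * V' x)"
  by (rule lin_sol_comb[OF ls ls assms(1,2)])
 then have "lin_sol c d r s (%_. 0) (%x. U x - U' x) (%x. V x - V' x)" by simp
 moreover have "h.gnorm = 0" by (simp add: h.gnorm_def)
 ultimately have "norm (U x - U' x) + norm (V x - V' x) <= 0"
  using h.lin_sol_bound[OF _ assms(5)] assms(3,4) by fastforce
 then have "norm (U x - U' x) = 0" "norm (V x - V' x) = 0"
  using norm_ge_zero[of "U x - U' x"] norm_ge_zero[of "V x - V' x"] by linarith+
 then show "U x = U' x" "V x = V' x" by auto
qed

text \<open>The coefficient matrix of the system has trace zero, so the Wronskian has derivative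
  zero almost everywhere; being absolutely continuous, it is constant.\<close>

lemma wronskian_const:
 assumes "lin_sol c d r s (%_. 0) U1 V1" "lin_sol c d r s (%_. 0) U2 V2" "x \<in> {c..d}"
 shows "U1 x * V2 x - U2 x * V1 x = U1 c * V2 c - U2 c * V1 c"
proof -
 interpret h: lin_sys c d r s "%_. 0" by (rule lin_sys_zero[OF lin_sys_axioms])
 obtain N1 where N1: "negligible N1"
  "!!x. x \<in> {c<..<d} - N1 ==> (U1 has_vector_derivative r x * V1 x) (at x)"
  "!!x. x \<in> {c<..<d} - N1 ==> (V1 has_vector_derivative s x * U1 x + 0) (at x)"
  by (rule h.lin_sol_deriv[OF assms(1)], rule that)
 obtain N2 where N2: "negligible N2"
  "!!x. x \<in> {c<..<d} - N2 ==> (U2 has_vector_derivative r x * V2 x) (at x)"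
  "!!x. x \<in> {c<..<d} - N2 ==> (V2 has_vector_derivative s x * U2 x + 0) (at x)"
  by (rule h.lin_sol_deriv[OF assms(2)], rule that)
 note ac = h.lin_sol_ac[OF assms(1)] h.lin_sol_ac[OF assms(2)]
 define W where "W = (%x. U1 x * V2 x + (-1) * (U2 x * V1 x))"
 have acW: "abs_continuous_on {c..d} W" unfolding W_def
  by (intro abs_continuous_on_add abs_continuous_on_cmult abs_continuous_on_mult ac)
 have der: "(W has_vector_derivative 0) (at y)" if y: "y \<in> {c<..<d} - (N1 Un N2)" for y
 proof -
  have "(W has_vector_derivative (U1 y * (s y * U2 y + 0) + r y * V1 y * V2 y) + (-1) * (U2 y * (s y * U1 y + 0) + r y * V2 y * V1 y)) (at y)"
   unfolding W_def
   by (intro has_vector_derivative_add has_vector_derivative_mult_right has_vector_derivative_mult N1 N2) (use y in auto)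
  then show ?thesis by (simp add: algebra_simps)
 qed
 have "((%_. 0) has_integral (W x - W c)) {c..x}"
 proof (rule abs_continuous_on_ftc)
  show "abs_continuous_on {c..x} W" using acW by (rule abs_continuous_on_subset) (use assms in auto)
  show "negligible (N1 Un N2 Un {c, d})" using N1(1) N2(1) by (simp add: negligible_insert)
  show "(W has_vector_derivative 0) (at y within {c..x})" if "y \<in> {c..x} - (N1 Un N2 Un {c, d})" for y
   using that assms(3) by (intro has_vector_derivative_at_within[OF der]) auto
 qed (use assms in auto)
 then have "W x - W c = 0" by (metis has_integral_0 has_integral_unique)
 then show ?thesis by (simp add: W_def)
qed

text \<open>The coefficients satisfy A' = - g U2 and B' = g U1. Their derivatives cancel in the
  first component and contribute \<open>g\<close> times the Wronskian, which is 1, in the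
  second.\<close>

lemma variation_of_constants:
 assumes "lin_sol c d r s (%_. 0) U1 V1" "lin_sol c d r s (%_. 0) U2 V2"
  and det: "U1 c * V2 c - U2 c * V1 c = 1"
 shows "lin_sol c d r s g
  (%x. U1 x * (al - integral {c..x} (%y. g y * U2 y)) + U2 x * (be + integral {c..x} (%y. g y * U1 y)))
  (%x. V1 x * (al - integral {c..x} (%y. g y * U2 y)) + V2 x * (be + integral {c..x} (%y. g y * U1 y)))"
proof -
 interpret h: lin_sys c d r s "%_. 0" by (rule lin_sys_zero[OF lin_sys_axioms])
 obtain N1 where N1: "negligible N1"
  "!!x. x \<in> {c<..<d} - N1 ==> (U1 has_vector_derivative r x * V1 x) (at x)"
  "!!x. x \<in> {c<..<d} - N1 ==> (V1 has_vector_derivative s x * U1 x + 0) (at x)"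
  by (rule h.lin_sol_deriv[OF assms(1)], rule that)
 obtain N2 where N2: "negligible N2"
  "!!x. x \<in> {c<..<d} - N2 ==> (U2 has_vector_derivative r x * V2 x) (at x)"
  "!!x. x \<in> {c<..<d} - N2 ==> (V2 has_vector_derivative s x * U2 x + 0) (at x)"
  by (rule h.lin_sol_deriv[OF assms(2)], rule that)
 note ac = h.lin_sol_ac[OF assms(1)] h.lin_sol_ac[OF assms(2)]
 have a1: "(%y. g y * U1 y) absolutely_integrable_on {c..d}" and a2: "(%y. g y * U2 y) absolutely_integrable_on {c..d}"
  using absolutely_integrable_times_continuous[OF g] lin_solD(1)[OF assms(1)] lin_solD(1)[OF assms(2)] by auto
 obtain N3 where N3: "negligible N3" "!!x. x \<in> {c<..<d} - N3 ==>
  ((%x. integral {c..x} (%y. g y * U1 y)) has_vector_derivative g x * U1 x) (at x)"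
  by (rule integral_has_vector_derivative_ae[OF set_lebesgue_integral_eq_integral(1)[OF a1]], rule that)
 obtain N4 where N4: "negligible N4" "!!x. x \<in> {c<..<d} - N4 ==>
  ((%x. integral {c..x} (%y. g y * U2 y)) has_vector_derivative g x * U2 x) (at x)"
  by (rule integral_has_vector_derivative_ae[OF set_lebesgue_integral_eq_integral(1)[OF a2]], rule that)
 define A where "A = (%x. al + (-1) * integral {c..x} (%y. g y * U2 y))"
 define B where "B = (%x. be + integral {c..x} (%y. g y * U1 y))"
 have acAB: "abs_continuous_on {c..d} A" "abs_continuous_on {c..d} B" unfolding A_def B_def
  by (intro abs_continuous_on_add abs_continuous_on_cmult abs_continuous_on_const abs_continuous_on_integral a1 a2)+
 have dA: "(A has_vector_derivative - (g x * U2 x)) (at x)" if "x \<in> {c<..<d} - N4" for x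
 proof -
  have "(A has_vector_derivative 0 + (-1) * (g x * U2 x)) (at x)" unfolding A_def
   by (intro has_vector_derivative_add has_vector_derivative_mult_right has_vector_derivative_const N4 that)
  then show ?thesis by simp
 qed
 have dB: "(B has_vector_derivative (g x * U1 x)) (at x)" if "x \<in> {c<..<d} - N3" for x
 proof -
  have "(B has_vector_derivative 0 + (g x * U1 x)) (at x)" unfolding B_def
   by (intro has_vector_derivative_add has_vector_derivative_const N3 that)
  then show ?thesis by simp
 qed
 have "lin_sol c d r s g (%x. U1 x * A x + U2 x * B x) (%x. V1 x * A x + V2 x * B x)"
 proof (rule lin_solI[of _ _ _ _ "N1 Un N2 Un N3 Un N4"])
  fix x assume x: "x \<in> {c<..<d} - (N1 Un N2 Un N3 Un N4)"
  have "((%x. U1 x * A x + U2 x * B x) has_vector_derivative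
   (U1 x * (- (g x * U2 x)) + r x * V1 x * A x) + (U2 x * (g x * U1 x) + r x * V2 x * B x)) (at x)"
   by (intro has_vector_derivative_add has_vector_derivative_mult N1 N2 dA dB) (use x in auto)
  then show "((%x. U1 x * A x + U2 x * B x) has_vector_derivative r x * (V1 x * A x + V2 x * B x)) (at x)"
   by (simp add: algebra_simps)
  have "((%x. V1 x * A x + V2 x * B x) has_vector_derivative
   (V1 x * (- (g x * U2 x)) + (s x * U1 x + 0) * A x) + (V2 x * (g x * U1 x) + (s x * U2 x + 0) * B x)) (at x)"
   by (intro has_vector_derivative_add has_vector_derivative_mult N1 N2 dA dB) (use x in auto)
  moreover have "(V1 x * (- (g x * U2 x)) + (s x * U1 x + 0) * A x) + (V2 x * (g x * U1 x) + (s x * U2 x + 0) * B x)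
   = s x * (U1 x * A x + U2 x * B x) + g x * (U1 x * V2 x - U2 x * V1 x)" by (simp add: algebra_simps)
  moreover have "U1 x * V2 x - U2 x * V1 x = 1" using wronskian_const[OF assms(1,2), of x] x det by simp
  ultimately show "((%x. V1 x * A x + V2 x * B x) has_vector_derivative s x * (U1 x * A x + U2 x * B x) + g x) (at x)" by simp
 qed (use N1 N2 N3 N4 in \<open>auto intro!: abs_continuous_on_add abs_continuous_on_mult ac acAB\<close>)
 then show ?thesis by (simp add: A_def B_def)
qed

text \<open>A combination of the fundamental system is added to one solution. The linear equations
  for its coefficients have the Wronskian, which is 1, as determinant.\<close>

lemma lin_sol_exists_at:
 assumes x0: "x0 \<in> {c..d}"
 shows "\<exists>U V. lin_sol c d r s g U V & U x0 = al & V x0 = be"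
proof -
 have ls: "lin_sys c d r s g" by (rule lin_sys_axioms)
 interpret h: lin_sys c d r s "%_. 0" by (rule lin_sys_zero[OF ls])
 obtain U1 V1 where 1: "lin_sol c d r s (%_. 0) U1 V1" "U1 c = 1" "V1 c = 0" using h.lin_sol_exists_left by blast
 obtain U2 V2 where 2: "lin_sol c d r s (%_. 0) U2 V2" "U2 c = 0" "V2 c = 1" using h.lin_sol_exists_left by blast
 obtain U3 V3 where 3: "lin_sol c d r s g U3 V3" "U3 c = 0" "V3 c = 0" using lin_sol_exists_left by blast
 have det: "U1 x0 * V2 x0 - U2 x0 * V1 x0 = 1" using wronskian_const[OF 1(1) 2(1) x0] 1 2 by simp
 define A B where "A = V2 x0 * (al - U3 x0) - U2 x0 * (be - V3 x0)" and "B = U1 x0 * (be - V3 x0) - V1 x0 * (al - U3 x0)"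
 have "lin_sol c d r s (%x. A * 0 + B * 0) (%x. A * U1 x + B * U2 x) (%x. A * V1 x + B * V2 x)"
  by (rule lin_sol_comb[OF h.lin_sys_axioms h.lin_sys_axioms 1(1) 2(1)])
 then have "lin_sol c d r s (%x. 0) (%x. A * U1 x + B * U2 x) (%x. A * V1 x + B * V2 x)" by simp
 from lin_sol_comb[OF h.lin_sys_axioms ls this 3(1), of 1 1]
 have sol: "lin_sol c d r s g (%x. A * U1 x + B * U2 x + U3 x) (%x. A * V1 x + B * V2 x + V3 x)" by simp
 have "A * U1 x0 + B * U2 x0 = (U1 x0 * V2 x0 - U2 x0 * V1 x0) * (al - U3 x0)" by (simp add: A_def B_def algebra_simps)
 moreover have "A * V1 x0 + B * V2 x0 = (U1 x0 * V2 x0 - U2 x0 * V1 x0) * (be - V3 x0)" by (simp add: A_def B_def algebra_simps)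
 ultimately show ?thesis using sol det
  by (intro exI[of _ "%x. A * U1 x + B * U2 x + U3 x"] exI[of _ "%x. A * V1 x + B * V2 x + V3 x"]) simp
qed

text \<open>The Wronskians of the difference with the two fundamental solutions vanish at
  \<open>x0\<close>, hence at \<open>c\<close>, where they are up to sign the two components of the
  difference.\<close>

lemma lin_sol_unique_at:
 assumes "lin_sol c d r s g U V" "lin_sol c d r s g U' V'" "x0 \<in> {c..d}" "U x0 = U' x0" "V x0 = V' x0" "x \<in> {c..d}"
 shows "U x = U' x" "V x = V' x"
proof -
 have ls: "lin_sys c d r s g" by (rule lin_sys_axioms)
 interpret h: lin_sys c d r s "%_. 0" by (rule lin_sys_zero[OF ls])
 obtain U1 V1 where 1: "lin_sol c d r s (%_. 0) U1 V1" "U1 c = 1" "V1 c = 0" using h.lin_sol_exists_left by blast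
 obtain U2 V2 where 2: "lin_sol c d r s (%_. 0) U2 V2" "U2 c = 0" "V2 c = 1" using h.lin_sol_exists_left by blast
 have "lin_sol c d r s (%x. 1 * g x + (-1) * g x) (%x. 1 * U x + (-1) * U' x) (%x. 1 * V x + (-1) * V' x)"
  by (rule lin_sol_comb[OF ls ls assms(1,2)])
 then have 3: "lin_sol c d r s (%x. 0) (%x. U x - U' x) (%x. V x - V' x)" by simp
 have w1: "U1 c * (V c - V' c) - (U c - U' c) * V1 c = U1 x0 * (V x0 - V' x0) - (U x0 - U' x0) * V1 x0"
  using wronskian_const[OF 1(1) 3 assms(3)] by simp
 have w2: "U2 c * (V c - V' c) - (U c - U' c) * V2 c = U2 x0 * (V x0 - V' x0) - (U x0 - U' x0) * V2 x0"
  using wronskian_const[OF 2(1) 3 assms(3)] by simp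
 have "V c = V' c" "U c = U' c" using w1 w2 assms(4,5) 1 2 by auto
 then show "U x = U' x" "V x = V' x" using lin_sol_unique_left[OF assms(1,2)] assms(6) by auto
qed

end

section \<open>The Sturm-Liouville equation as a system\<close>

lemma has_integral_shift_real:
 fixes f :: "real => 'a::banach"
 assumes "(f has_integral i) {c..d}"
 shows "((%x. f (x + h)) has_integral i) {c - h..d - h}"
proof -
 have "((%x. f (1 *\<^sub>R x + h)) has_integral ((1 / (\<bar>1\<bar> ^ DIM(real))) *\<^sub>R i)) ((%x. (1 / 1) *\<^sub>R x + -((1 / 1) *\<^sub>R h)) ` cbox c d)"
  by (rule has_integral_affinity) (use assms in auto)
 moreover have "(%x. (1 / 1) *\<^sub>R x + -((1 / 1) *\<^sub>R h)) ` cbox c d = {c - h..d - h}"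
  by (auto simp: image_iff algebra_simps intro!: bexI[of _ "_ + h"])
 ultimately show ?thesis by simp
qed

lemma integral_shift_real:
 fixes f :: "real => 'a::banach"
 shows "integral {c..d} (%x. f (x + h)) = integral {c + h..d + h} f"
proof (cases "f integrable_on {c + h..d + h}")
 case True
 from has_integral_shift_real[OF integrable_integral[OF this], of h] show ?thesis by (simp add: integral_unique)
next
 case False
 have "~ (%x. f (x + h)) integrable_on {c..d}"
 proof
  assume "(%x. f (x + h)) integrable_on {c..d}"
  from has_integral_shift_real[OF integrable_integral[OF this], of "- h"] False show False
   by (auto simp: integrable_on_def)
 qed
 with False show ?thesis by (simp add: not_integrable_integral)
qed

lemma absolutely_integrable_shift_real:
 fixes f :: "real => 'a::euclidean_space"
 assumes "f absolutely_integrable_on {c..d}"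
 shows "(%x. f (x + h)) absolutely_integrable_on {c - h..d - h}"
proof -
 have "f integrable_on {c..d}" "(%x. norm (f x)) integrable_on {c..d}" using assms by (auto simp: absolutely_integrable_on_def)
 from this[THEN integrable_integral, THEN has_integral_shift_real, of h] show ?thesis
  by (auto simp: absolutely_integrable_on_def integrable_on_def)
qed

lemma absolutely_integrable_Icc_iff_Ioo:
 fixes f :: "real => 'a::euclidean_space"
 shows "f absolutely_integrable_on {c..d} \<longleftrightarrow> f absolutely_integrable_on {c<..<d}"
 unfolding absolutely_integrable_on_def by (simp add: integrable_on_Icc_iff_Ioo)

lemma periodic_absolutely_integrable:
 fixes f :: "real => real"
 assumes a: "a > 0" and per: "!!x. f (x + a) = f x" and int: "f absolutely_integrable_on {0<..<a}"
 shows "f absolutely_integrable_on {c..d}"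
proof -
 have base: "f absolutely_integrable_on {0..a}" using int by (simp add: absolutely_integrable_Icc_iff_Ioo)
 have shift: "(f absolutely_integrable_on {c + a..d + a}) = (f absolutely_integrable_on {c..d})" for c d
  using absolutely_integrable_shift_real[where f = f and c = "c + a" and d = "d + a" and h = a]
   absolutely_integrable_shift_real[where f = f and c = c and d = d and h = "- a"] per
   per[of "_ - a"] by (auto simp: algebra_simps)
 have right: "f absolutely_integrable_on {real n * a..real n * a + a}" for n
 proof (induction n)
  case (Suc n)
  then show ?case using shift[of "real n * a" "real n * a + a"] by (simp add: algebra_simps)
 qed (use base in simp)
 have left: "f absolutely_integrable_on {- (real n * a)..- (real n * a) + a}" for n
 proof (induction n)
  case (Suc n)
  then show ?case using shift[of "- (real (Suc n) * a)" "- (real (Suc n) * a) + a"] by (simp add: algebra_simps)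
 qed (use base in simp)
 have R: "f absolutely_integrable_on {0..real n * a}" for n
 proof (induction n)
  case (Suc n)
  have "{0..real (Suc n) * a} = {0..real n * a} Un {real n * a..real n * a + a}"
   using ivl_disj_un_two_touch(4)[of 0 "real n * a" "real n * a + a"] a by (simp add: algebra_simps)
  then show ?case using set_integrable_Un[OF Suc right[of n]] by simp
 qed (use absolutely_integrable_Icc_iff_Ioo[where f = f and c = 0 and d = 0] in \<open>simp add: set_integrable_def\<close>)
 have L: "f absolutely_integrable_on {- (real n * a)..0}" for n
 proof (induction n)
  case (Suc n)
  have "{- (real (Suc n) * a)..0} = {- (real n * a)..0} Un {- (real (Suc n) * a)..- (real (Suc n) * a) + a}"
   using ivl_disj_un_two_touch(4)[of "- (real (Suc n) * a)" "- (real n * a)" 0] a by (simp add: algebra_simps Un_commute)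
  then show ?case using set_integrable_Un[OF Suc left[of "Suc n"]] by simp
 qed (use absolutely_integrable_Icc_iff_Ioo[where f = f and c = 0 and d = 0] in \<open>simp add: set_integrable_def\<close>)
 obtain n :: nat where n: "real n * a >= max \<bar>c\<bar> \<bar>d\<bar>" using a reals_Archimedean3 less_imp_le by blast
 have "f absolutely_integrable_on ({- (real n * a)..0} Un {0..real n * a})" using L R by (intro set_integrable_Un) auto
 then show ?thesis by (rule set_integrable_subset) (use n in auto)
qed

lemma AE_lebesgue_iff_negligible: "(AE x in lebesgue. P x) \<longleftrightarrow> (\<exists>N. negligible N & (\<forall>x. x \<notin> N --> P x))"
proof
 assume "AE x in lebesgue. P x"
 then obtain N where "{x. ~ P x} <= N" "N \<in> null_sets lebesgue"
  by (auto simp: eventually_ae_filter)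
 then show "\<exists>N. negligible N & (\<forall>x. x \<notin> N --> P x)" by (auto simp: negligible_iff_null_sets)
next
 assume "\<exists>N. negligible N & (\<forall>x. x \<notin> N --> P x)"
 then show "AE x in lebesgue. P x" by (auto simp: negligible_iff_null_sets intro!: AE_I')
qed

lemma AE_lebesgue_on_iff_negligible:
 assumes "S \<in> sets lebesgue"
 shows "(AE x in lebesgue_on S. P x) \<longleftrightarrow> (\<exists>N. negligible N & (\<forall>x\<in>S - N. P x))"
proof -
 have "(AE x in lebesgue_on S. P x) \<longleftrightarrow> (AE x in lebesgue. x \<in> S --> P x)"
  using assms by (intro AE_restrict_space_iff) auto
 then show ?thesis unfolding AE_lebesgue_iff_negligible by auto
qed

lemma AE_lebesgue_on_Ioo_iff:
 fixes c d :: real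
 shows "(AE x in lebesgue_on {c<..<d}. P x) \<longleftrightarrow> (AE x in lebesgue_on {c..d}. P x)"
proof -
 have "(\<exists>N. negligible N & (\<forall>x\<in>{c<..<d} - N. P x)) ==> (\<exists>N. negligible N & (\<forall>x\<in>{c..d} - N. P x))"
 proof (elim exE conjE)
  fix N assume "negligible N" "\<forall>x\<in>{c<..<d} - N. P x"
  then show ?thesis by (intro exI[of _ "N Un {c, d}"]) (auto simp: negligible_insert)
 qed
 moreover have "(\<exists>N. negligible N & (\<forall>x\<in>{c..d} - N. P x)) ==> (\<exists>N. negligible N & (\<forall>x\<in>{c<..<d} - N. P x))" by fastforce
 ultimately show ?thesis by (auto simp: AE_lebesgue_on_iff_negligible)
qed

lemma lin_sol_shift:
 assumes "lin_sol c d r s g U V"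
 shows "lin_sol (c - h) (d - h) (%x. r (x + h)) (%x. s (x + h)) (%x. g (x + h)) (%x. U (x + h)) (%x. V (x + h))"
 unfolding lin_sol_def
proof (intro conjI ballI)
 have im: "(%x. x + h) ` {c - h..d - h} <= {c..d}" by auto
 show "continuous_on {c - h..d - h} (%x. U (x + h))" "continuous_on {c - h..d - h} (%x. V (x + h))"
  by (rule continuous_on_compose2[OF lin_solD(1)[OF assms] _ im] continuous_on_compose2[OF lin_solD(2)[OF assms] _ im], intro continuous_intros)+
 fix x assume "x \<in> {c - h..d - h}"
 then have x: "x + h \<in> {c..d}" by auto
 show "U (x + h) = U (c - h + h) + integral {c - h..x} (%y. r (y + h) * V (y + h))"
  using lin_solD(3)[OF assms x] integral_shift_real[of "c - h" x "%y. r y * V y" h] by simp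
 show "V (x + h) = V (c - h + h) + integral {c - h..x} (%y. s (y + h) * U (y + h) + g (y + h))"
  using lin_solD(4)[OF assms x] integral_shift_real[of "c - h" x "%y. s y * U y + g y" h] by simp
qed

context periodic_SL
begin

text \<open>With v = p u', the equation \<open>sl_expr u v = z * u + h\<close> becomes the system u'
  = \<open>rr\<close> v, v' = \<open>ss z\<close> u + \<open>gg h\<close>.\<close>

definition rr :: cfun where "rr x = of_real (inverse (p x))"
definition cw :: cfun where "cw x = of_real (w x)"
definition ss :: "complex => cfun" where "ss z x = of_real (q x) - z * cw x"
definition gg :: "cfun => cfun" where "gg h x = - (cw x * h x)"

definition hloc :: "cfun => bool" where "hloc h \<longleftrightarrow> (\<forall>c d. gg h absolutely_integrable_on {c..d})"

definition gsol :: "complex => cfun => cfun => cfun => bool" where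
 "gsol z h U V \<longleftrightarrow> (\<forall>c d. c <= d --> lin_sol c d rr (ss z) (gg h) U V)"

lemma w_loc: "w absolutely_integrable_on {c..d}"
 by (rule periodic_absolutely_integrable[OF a_pos w_periodic w_integrable])

lemma q_loc: "q absolutely_integrable_on {c..d}"
 by (rule periodic_absolutely_integrable[OF a_pos q_periodic q_integrable])

lemma ip_loc: "(%x. inverse (p x)) absolutely_integrable_on {c..d}"
 by (rule periodic_absolutely_integrable[OF a_pos _ inverse_p_integrable]) (simp add: p_periodic)

lemma rr_int: "rr absolutely_integrable_on {c..d}"
 using absolutely_integrable_linear[OF ip_loc[of c d] bounded_linear_of_real[where 'a = complex]] by (simp add: o_def rr_def[abs_def])

lemma cw_int: "cw absolutely_integrable_on {c..d}"
 using absolutely_integrable_linear[OF w_loc[of c d] bounded_linear_of_real[where 'a = complex]] by (simp add: o_def cw_def[abs_def])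

lemma ss_int: "ss z absolutely_integrable_on {c..d}"
proof -
 have "(%x. complex_of_real (q x)) absolutely_integrable_on {c..d}"
  using absolutely_integrable_linear[OF q_loc[of c d] bounded_linear_of_real[where 'a = complex]] by (simp add: o_def)
 then show ?thesis unfolding ss_def by (intro set_integral_diff(1) set_integrable_mult_right cw_int) auto
qed

lemma lin_sys_loc: "c <= d ==> gg h absolutely_integrable_on {c..d} ==> lin_sys c d rr (ss z) (gg h)"
 by (rule lin_sys.intro[OF _ rr_int ss_int])

lemma ae_good:
 obtains N where "negligible N" "!!x. x \<notin> N ==> w x ~= 0 & p x > 0"
proof -
 have "AE x in lebesgue. w x ~= 0 & p x > 0" using w_nonzero p_positive by simp
 then have "\<exists>N. negligible N & (\<forall>x. x \<notin> N --> w x ~= 0 & p x > 0)" unfolding AE_lebesgue_iff_negligible .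
 then show ?thesis using that by blast
qed

text \<open>For the direction from left to right both identities speak of
  \<open>vector_derivative\<close>, and Lebesgue's theorem ensures that this is a true derivative
  almost everywhere. Solving for the derivatives divides by \<open>p\<close> and multiplies by
  \<open>w\<close>; the converse also divides by \<open>w\<close>, hence
  \<open>ae_good\<close>.\<close>

lemma quasi_derivative_on_iff:
 assumes cd: "c <= d" and h: "gg h absolutely_integrable_on {c..d}"
 shows "quasi_derivative_on {c..d} u v & (AE x in lebesgue_on {c..d}. sl_expr u v x = z * u x + h x)
  \<longleftrightarrow> lin_sol c d rr (ss z) (gg h) u v"
proof
 obtain N0 where N0: "negligible N0" "!!x. x \<notin> N0 ==> w x ~= 0 & p x > 0" by (rule ae_good, rule that)
 assume a: "quasi_derivative_on {c..d} u v & (AE x in lebesgue_on {c..d}. sl_expr u v x = z * u x + h x)"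
 then have ac: "abs_continuous_on {c..d} u" "abs_continuous_on {c..d} v" by (auto simp: quasi_derivative_on_def)
 obtain N1 where N1: "negligible N1" "!!x. x \<in> {c<..<d} - N1 ==> (u has_vector_derivative vector_derivative u (at x)) (at x)"
  by (rule abs_continuous_on_differentiable_ae[OF ac(1)], rule that)
 obtain N2 where N2: "negligible N2" "!!x. x \<in> {c<..<d} - N2 ==> (v has_vector_derivative vector_derivative v (at x)) (at x)"
  by (rule abs_continuous_on_differentiable_ae[OF ac(2)], rule that)
 obtain N3 where N3: "negligible N3" "!!x. x \<in> {c..d} - N3 ==> v x = of_real (p x) * vector_derivative u (at x)"
  using a by (auto simp: quasi_derivative_on_def AE_lebesgue_on_iff_negligible)
 obtain N4 where N4: "negligible N4" "!!x. x \<in> {c..d} - N4 ==> sl_expr u v x = z * u x + h x"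
  using a by (auto simp: AE_lebesgue_on_iff_negligible)
 show "lin_sol c d rr (ss z) (gg h) u v"
 proof (rule lin_solI[OF ac, of "N0 Un N1 Un N2 Un N3 Un N4"])
  show "negligible (N0 Un N1 Un N2 Un N3 Un N4)" by (intro negligible_Un N0 N1 N2 N3 N4)
  fix x assume x: "x \<in> {c<..<d} - (N0 Un N1 Un N2 Un N3 Un N4)"
  have "vector_derivative u (at x) = rr x * v x"
   using N3(2)[of x] N0(2)[of x] x by (simp add: rr_def)
  then show "(u has_vector_derivative rr x * v x) (at x)" using N1(2)[of x] x by simp
  have "1 / of_real (w x) * (- vector_derivative v (at x) + of_real (q x) * u x) = z * u x + h x"
   using N4(2)[of x] x by (simp add: sl_expr_def)
  moreover have "w x ~= 0" using N0(2)[of x] x by simp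
  ultimately have "- vector_derivative v (at x) + of_real (q x) * u x = of_real (w x) * (z * u x + h x)"
   by (simp add: field_simps)
  then have "vector_derivative v (at x) = ss z x * u x + gg h x"
   by (simp add: ss_def gg_def cw_def algebra_simps)
  then show "(v has_vector_derivative ss z x * u x + gg h x) (at x)" using N2(2)[of x] x by simp
 qed
next
 obtain N0 where N0: "negligible N0" "!!x. x \<notin> N0 ==> w x ~= 0 & p x > 0" by (rule ae_good, rule that)
 assume sol: "lin_sol c d rr (ss z) (gg h) u v"
 interpret lin_sys c d rr "ss z" "gg h" by (rule lin_sys_loc[OF cd h])
 obtain N where N: "negligible N"
  "!!x. x \<in> {c<..<d} - N ==> (u has_vector_derivative rr x * v x) (at x)"
  "!!x. x \<in> {c<..<d} - N ==> (v has_vector_derivative ss z x * u x + gg h x) (at x)"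
  by (rule lin_sol_deriv[OF sol], rule that)
 have Nn: "negligible (N Un N0 Un {c, d})" using N N0 by (simp add: negligible_insert)
 have "v x = of_real (p x) * vector_derivative u (at x)" "sl_expr u v x = z * u x + h x"
  if "x \<in> {c..d} - (N Un N0 Un {c, d})" for x
 proof -
  have x: "x \<in> {c<..<d} - N" "w x ~= 0" "p x > 0" using that N0(2)[of x] by auto
  have "vector_derivative u (at x) = rr x * v x" using N(2)[OF x(1)] by (rule vector_derivative_at)
  then show "v x = of_real (p x) * vector_derivative u (at x)" using x by (simp add: rr_def)
  have "vector_derivative v (at x) = ss z x * u x + gg h x" using N(3)[OF x(1)] by (rule vector_derivative_at)
  then show "sl_expr u v x = z * u x + h x" using x by (simp add: sl_expr_def ss_def gg_def cw_def field_simps)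
 qed
 then have "AE x in lebesgue_on {c..d}. v x = of_real (p x) * vector_derivative u (at x)"
  "AE x in lebesgue_on {c..d}. sl_expr u v x = z * u x + h x"
  using Nn by (subst AE_lebesgue_on_iff_negligible, simp, blast)+
 then show "quasi_derivative_on {c..d} u v & (AE x in lebesgue_on {c..d}. sl_expr u v x = z * u x + h x)"
  using lin_sol_ac[OF sol] by (simp add: quasi_derivative_on_def)
qed

lemma gsol_sub: "gsol z h U V ==> c <= d ==> lin_sol c d rr (ss z) (gg h) U V"
 by (simp add: gsol_def)

lemma hloc_sys: "hloc h ==> c <= d ==> lin_sys c d rr (ss z) (gg h)"
 by (rule lin_sys_loc) (auto simp: hloc_def)

lemma gg_zero [simp]: "gg (%_. 0) = (%_. 0)" by (simp add: gg_def[abs_def])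

lemma hloc_zero [simp]: "hloc (%_. 0)" by (simp add: hloc_def)

lemma gsol_iff:
 assumes h: "hloc h"
 shows "quasi_derivative_loc u v & (AE x in lebesgue. sl_expr u v x = z * u x + h x) \<longleftrightarrow> gsol z h u v"
proof
 have h': "gg h absolutely_integrable_on {c..d}" for c d using h by (simp add: hloc_def)
 {
  assume a: "quasi_derivative_loc u v & (AE x in lebesgue. sl_expr u v x = z * u x + h x)"
  show "gsol z h u v"
   unfolding gsol_def
  proof (intro allI impI)
   fix c d :: real assume cd: "c <= d"
   have "AE x in lebesgue_on {c..d}. sl_expr u v x = z * u x + h x"
    using a by (subst AE_lebesgue_on_iff_negligible) (auto simp: AE_lebesgue_iff_negligible)
   then show "lin_sol c d rr (ss z) (gg h) u v"
    using quasi_derivative_on_iff[OF cd h', of u v z] a by (simp add: quasi_derivative_loc_def)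
  qed
 }
 assume a: "gsol z h u v"
 have *: "quasi_derivative_on {c..d} u v" "AE x in lebesgue_on {c..d}. sl_expr u v x = z * u x + h x" if "c <= d" for c d
  using quasi_derivative_on_iff[OF that h'] gsol_sub[OF a that] by auto
 have "quasi_derivative_on {c..d} u v" for c d
 proof (cases "c <= d")
  case False
  then have "{c..d} <= {d..c}" "{c..d} = {}" by auto
  then show ?thesis using *(1)[of d c] False unfolding quasi_derivative_on_def
   by (auto intro: abs_continuous_on_subset simp: AE_lebesgue_on_iff_negligible intro!: exI[of _ "{}"])
 qed (use * in auto)
 moreover have "AE x in lebesgue. sl_expr u v x = z * u x + h x"
 proof -
  have "\<forall>n. \<exists>N. negligible N & (\<forall>x\<in>{- real n..real n} - N. sl_expr u v x = z * u x + h x)"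
  proof
   fix n :: nat
   have "- real n <= real n" by simp
   from *(2)[OF this] show "\<exists>N. negligible N & (\<forall>x\<in>{- real n..real n} - N. sl_expr u v x = z * u x + h x)"
    by (subst (asm) AE_lebesgue_on_iff_negligible) auto
  qed
  then obtain N where N: "!!n. negligible (N n)" "!!n x. x \<in> {- real n..real n} - N n ==> sl_expr u v x = z * u x + h x"
   by metis
  show ?thesis unfolding AE_lebesgue_iff_negligible
  proof (intro exI[of _ "\<Union>(range N)"] conjI allI impI)
   show "negligible (\<Union>(range N))" using N(1) by (intro negligible_countable_Union) auto
   fix x assume x: "x \<notin> \<Union>(range N)"
   obtain n :: nat where "\<bar>x\<bar> <= real n" using real_arch_simple by blast
   then have "- real n <= x" "x <= real n" by linarith+
   then show "sl_expr u v x = z * u x + h x" using N(2)[of x n] x by auto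
  qed
 qed
 ultimately show "quasi_derivative_loc u v & (AE x in lebesgue. sl_expr u v x = z * u x + h x)"
  by (simp add: quasi_derivative_loc_def)
qed

lemma gsol_unique:
 assumes "hloc h" "gsol z h U V" "gsol z h U' V'" "U x0 = U' x0" "V x0 = V' x0"
 shows "U = U'" "V = V'"
proof -
 have "U x = U' x & V x = V' x" for x
 proof -
  define c d where "c = min x x0" and "d = max x x0"
  have iv: "c <= d" "x0 \<in> {c..d}" "x \<in> {c..d}" by (auto simp: c_def d_def)
  show ?thesis
   using lin_sys.lin_sol_unique_at[OF hloc_sys[OF assms(1) iv(1)] gsol_sub[OF assms(2) iv(1)] gsol_sub[OF assms(3) iv(1)] iv(2) assms(4,5) iv(3)] by simp
 qed
 then show "U = U'" "V = V'" by auto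
qed

text \<open>The solutions on the intervals \<open>{- (n + 1)..n + 1}\<close> agree where they
  overlap by uniqueness, and the value at \<open>x\<close> is taken from the one with index
  \<open>k x\<close>.\<close>

lemma gsol_exists:
 assumes h: "hloc h"
 obtains U V where "gsol z h U V" "U 0 = al" "V 0 = be"
proof -
 have le: "- real (Suc n) <= real (Suc n)" and z0: "0 \<in> {- real (Suc n)..real (Suc n)}" for n by auto
 have "\<forall>n. \<exists>UV. lin_sol (- real (Suc n)) (real (Suc n)) rr (ss z) (gg h) (fst UV) (snd UV) & fst UV 0 = al & snd UV 0 = be"
  using lin_sys.lin_sol_exists_at[OF hloc_sys[OF h le] z0] by fastforce
 then obtain F where F: "!!n. lin_sol (- real (Suc n)) (real (Suc n)) rr (ss z) (gg h) (fst (F n)) (snd (F n))"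
  "!!n. fst (F n) 0 = al" "!!n. snd (F n) 0 = be" by metis
 have agree: "fst (F m) x = fst (F n) x & snd (F m) x = snd (F n) x"
  if mn: "m <= n" and x: "x \<in> {- real (Suc m)..real (Suc m)}" for m n x
 proof -
  have s: "lin_sol (- real (Suc m)) (real (Suc m)) rr (ss z) (gg h) (fst (F n)) (snd (F n))"
   by (rule lin_sol_subinterval[OF hloc_sys[OF h le] F(1)]) (use mn in auto)
  show ?thesis
   using lin_sys.lin_sol_unique_at[OF hloc_sys[OF h le] F(1) s z0 _ _ x] F by auto
 qed
 define k where "k = (%x::real. nat \<lceil>\<bar>x\<bar>\<rceil>)"
 define U V where "U = (%x. fst (F (k x)) x)" and "V = (%x. snd (F (k x)) x)"
 have k: "\<bar>x\<bar> <= real (k x)" for x unfolding k_def by linarith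
 have UV: "U x = fst (F n) x & V x = snd (F n) x" if x: "x \<in> {- real (Suc n)..real (Suc n)}" for x n
 proof (cases "k x <= n")
  case True
  then show ?thesis using agree[of "k x" n x] k[of x] unfolding U_def V_def by (simp add: abs_le_iff)
 next
  case False
  then show ?thesis using agree[of n "k x" x] x by (auto simp: U_def V_def)
 qed
 show ?thesis
 proof (rule that[of U V])
  show "gsol z h U V" unfolding gsol_def
  proof (intro allI impI)
   fix c d :: real assume cd: "c <= d"
   obtain n :: nat where n: "max \<bar>c\<bar> \<bar>d\<bar> <= real n" using real_arch_simple by blast
   have sub: "x \<in> {- real (Suc n)..real (Suc n)}" if "x \<in> {c..d}" for x using that n by auto
   have e: "fst (F n) x = U x" "snd (F n) x = V x" if "x \<in> {c..d}" for x using UV[OF sub[OF that]] by auto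
   have "lin_sol c d rr (ss z) (gg h) (fst (F n)) (snd (F n))"
    by (rule lin_sol_subinterval[OF hloc_sys[OF h le] F(1)]) (use n in auto)
   then show "lin_sol c d rr (ss z) (gg h) U V"
    by (rule lin_sol_cong) (use e cd in auto)
  qed
  show "U 0 = al" "V 0 = be" using UV[of 0 0] F by auto
 qed
qed

text \<open>Existence and uniqueness give the definite description in \<open>fund_sol\<close> its
  meaning.\<close>

lemma fund_sol_gsol:
 shows "gsol z (%_. 0) (fst (fund_sol z c d)) (snd (fund_sol z c d))"
  and "fst (fund_sol z c d) 0 = c" "snd (fund_sol z c d) 0 = d"
proof -
 obtain U V where UV: "gsol z (%_. 0) U V" "U 0 = c" "V 0 = d" using gsol_exists[OF hloc_zero] by metis
 have "fund_sol z c d = (U, V)" unfolding fund_sol_def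
 proof (rule the_equality)
  show "quasi_derivative_loc (fst (U, V)) (snd (U, V)) & (AE x in lebesgue. sl_expr (fst (U, V)) (snd (U, V)) x = z * fst (U, V) x) &
   fst (U, V) 0 = c & snd (U, V) 0 = d"
   using gsol_iff[OF hloc_zero, of U V z] UV by simp
  fix uv assume a: "quasi_derivative_loc (fst uv) (snd uv) & (AE x in lebesgue. sl_expr (fst uv) (snd uv) x = z * fst uv x) &
   fst uv 0 = c & snd uv 0 = d"
  then have "gsol z (%_. 0) (fst uv) (snd uv)" using gsol_iff[OF hloc_zero, of "fst uv" "snd uv" z] by simp
  from gsol_unique[OF hloc_zero this UV(1), of 0] show "uv = (U, V)" using a UV by (metis prod.collapse)
 qed
 then show "gsol z (%_. 0) (fst (fund_sol z c d)) (snd (fund_sol z c d))"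
  "fst (fund_sol z c d) 0 = c" "snd (fund_sol z c d) 0 = d" using UV by auto
qed

lemma phi_gsol: "gsol z (%_. 0) (phi z) (p_phi' z)" "phi z 0 = 1" "p_phi' z 0 = 0"
 unfolding phi_def p_phi'_def by (rule fund_sol_gsol)+

lemma psi_gsol: "gsol z (%_. 0) (psi z) (p_psi' z)" "psi z 0 = 0" "p_psi' z 0 = 1"
 unfolding psi_def p_psi'_def by (rule fund_sol_gsol)+

lemma periodic_int:
 "w (x + of_int n * a) = w x" "q (x + of_int n * a) = q x" "p (x + of_int n * a) = p x"
proof -
 have nat: "f (x + real n * a) = f x" if "!!x. f (x + a) = f x" for f :: "real => real" and n x
 proof (induction n)
  case (Suc n)
  then show ?case using that[of "x + real n * a"] by (simp add: algebra_simps)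
 qed simp
 have int: "f (x + of_int n * a) = f x" if per: "!!x. f (x + a) = f x" for f :: "real => real"
 proof (cases "n >= 0")
  case True
  then show ?thesis using nat[where f = f and n = "nat n" and x = x, OF per] by simp
 next
  case False
  then show ?thesis using nat[where f = f and n = "nat (- n)" and x = "x + of_int n * a", OF per] by simp
 qed
 show "w (x + of_int n * a) = w x" "q (x + of_int n * a) = q x" "p (x + of_int n * a) = p x"
  by (intro int w_periodic q_periodic p_periodic)+
qed

lemma gsol_shift:
 assumes "gsol z h U V"
 shows "gsol z (%x. h (x + of_int n * a)) (%x. U (x + of_int n * a)) (%x. V (x + of_int n * a))"
 unfolding gsol_def
proof (intro allI impI)
 fix c d :: real assume "c <= d"
 then have "lin_sol (c + of_int n * a) (d + of_int n * a) rr (ss z) (gg h) U V" by (intro gsol_sub[OF assms]) simp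
 from lin_sol_shift[OF this, of "of_int n * a"]
 show "lin_sol c d rr (ss z) (gg (%x. h (x + of_int n * a))) (%x. U (x + of_int n * a)) (%x. V (x + of_int n * a))"
  by (simp add: rr_def[abs_def] ss_def[abs_def] gg_def[abs_def] cw_def periodic_int)
qed

section \<open>Solutions on one period and their dependence on the spectral parameter\<close>

definition I0 :: "complex => cfun => real => complex" where "I0 z k x = integral {0..x} (%y. cw y * k y * phi z y)"
definition I1 :: "complex => cfun => real => complex" where "I1 z k x = integral {0..x} (%y. cw y * k y * psi z y)"
text \<open>Variation of constants: the solution on a period with data \<open>al\<close>, \<open>be\<close> and right-hand side \<open>k\<close>.\<close>
definition usol :: "complex => complex => complex => cfun => cfun" where
 "usol z al be k x = phi z x * (al + I1 z k x) + psi z x * (be - I0 z k x)"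
definition usol' :: "complex => complex => complex => cfun => cfun" where
 "usol' z al be k x = p_phi' z x * (al + I1 z k x) + p_psi' z x * (be - I0 z k x)"

definition hper :: "cfun => bool" where "hper k \<longleftrightarrow> gg k absolutely_integrable_on {0..a}"

lemma hper_zero [simp]: "hper (%_. 0)" by (simp add: hper_def)

lemma hper_sys: "hper k ==> lin_sys 0 a rr (ss z) (gg k)"
 using a_pos by (intro lin_sys_loc) (auto simp: hper_def)

lemmas sys0 = hper_sys[OF hper_zero, simplified]

lemma phi_sol: "lin_sol 0 a rr (ss z) (%_. 0) (phi z) (p_phi' z)"
 using gsol_sub[OF phi_gsol(1), of 0 a] a_pos by simp

lemma psi_sol: "lin_sol 0 a rr (ss z) (%_. 0) (psi z) (p_psi' z)"
 using gsol_sub[OF psi_gsol(1), of 0 a] a_pos by simp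

lemma det1: "x \<in> {0..a} ==> phi z x * p_psi' z x - psi z x * p_phi' z x = 1"
 using lin_sys.wronskian_const[OF sys0 phi_sol psi_sol, of x] phi_gsol psi_gsol by simp

lemma usol_0 [simp]: "usol z al be k 0 = al" "usol' z al be k 0 = be"
 by (simp_all add: usol_def usol'_def I0_def I1_def phi_gsol psi_gsol)

lemma usol_sol:
 assumes "hper k"
 shows "lin_sol 0 a rr (ss z) (gg k) (usol z al be k) (usol' z al be k)"
proof -
 have "usol z al be k = (%x. phi z x * (al - integral {0..x} (%y. gg k y * psi z y)) + psi z x * (be + integral {0..x} (%y. gg k y * phi z y)))"
  "usol' z al be k = (%x. p_phi' z x * (al - integral {0..x} (%y. gg k y * psi z y)) + p_psi' z x * (be + integral {0..x} (%y. gg k y * phi z y)))"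
  by (simp_all add: usol_def[abs_def] usol'_def[abs_def] I0_def I1_def gg_def)
 then show ?thesis
  using lin_sys.variation_of_constants[OF hper_sys[OF assms] phi_sol psi_sol, of z al be]
  by (simp add: phi_gsol psi_gsol)
qed

lemma usol_unique:
 assumes "hper k" "lin_sol 0 a rr (ss z) (gg k) U V" "x \<in> {0..a}"
 shows "U x = usol z (U 0) (V 0) k x" "V x = usol' z (U 0) (V 0) k x"
 using lin_sys.lin_sol_unique_left[OF hper_sys[OF assms(1)] assms(2) usol_sol[OF assms(1)], of "U 0" "V 0" x] assms(3) by auto

lemma usol_zero: "usol z al be (%_. 0) x = phi z x * al + psi z x * be" "usol' z al be (%_. 0) x = p_phi' z x * al + p_psi' z x * be"
 by (simp_all add: usol_def usol'_def I0_def I1_def)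

lemma hper_comb:
 assumes "hper k1" "hper k2"
 shows "hper (%x. c1 * k1 x + c2 * k2 x)"
proof -
 have "(%x. c1 * gg k1 x + c2 * gg k2 x) absolutely_integrable_on {0..a}"
  using assms unfolding hper_def by (intro set_integral_add(1) set_integrable_mult_right) auto
 moreover have "gg (%x. c1 * k1 x + c2 * k2 x) = (%x. c1 * gg k1 x + c2 * gg k2 x)"
  by (auto simp: gg_def algebra_simps)
 ultimately show ?thesis unfolding hper_def by simp
qed

lemma hper_continuous: "continuous_on {0..a} k ==> hper k"
 unfolding hper_def gg_def using absolutely_integrable_times_continuous[OF cw_int, of 0 a k]
 by (simp add: set_integrable_def)

lemma usol_continuous: "hper k ==> continuous_on {0..a} (usol z al be k)" "hper k ==> continuous_on {0..a} (usol' z al be k)"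
 using lin_solD(1,2)[OF usol_sol] by auto

text \<open>A solution for \<open>z\<close> with right-hand side \<open>k\<close> solves the
  equation for \<open>mu\<close> with right-hand side \<open>k + (z - mu) * u\<close>. All
  regularity in the spectral parameter comes from this identity.\<close>

lemma usol_expand:
 assumes k: "hper k" and x: "x \<in> {0..a}"
 shows "usol z al be k x = usol mu al be k x + (z - mu) * usol mu 0 0 (usol z al be k) x"
  and "usol' z al be k x = usol' mu al be k x + (z - mu) * usol' mu 0 0 (usol z al be k) x"
proof -
 have hu: "hper (usol z al be k)" by (rule hper_continuous[OF usol_continuous(1)[OF k]])
 define K where "K = (%x. 1 * k x + (z - mu) * usol z al be k x)"
 have hK: "hper K" unfolding K_def by (rule hper_comb[OF k hu])
 have gK: "gg K = (%x. 1 * gg k x + (z - mu) * gg (usol z al be k) x)"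
  by (auto simp: gg_def K_def algebra_simps)
 have s1: "lin_sol 0 a rr (ss mu) (gg K) (usol z al be k) (usol' z al be k)"
 proof -
  have "ss z y * usol z al be k y + gg k y = ss mu y * usol z al be k y + gg K y" for y
   by (simp add: gK ss_def gg_def algebra_simps)
  then show ?thesis using usol_sol[OF k, of z al be] by (simp add: lin_sol_def)
 qed
 have s2: "lin_sol 0 a rr (ss mu) (gg K) (%x. 1 * usol mu al be k x + (z - mu) * usol mu 0 0 (usol z al be k) x)
   (%x. 1 * usol' mu al be k x + (z - mu) * usol' mu 0 0 (usol z al be k) x)"
  unfolding gK by (rule lin_sol_comb[OF hper_sys[OF k] hper_sys[OF hu] usol_sol[OF k] usol_sol[OF hu]])
 from lin_sys.lin_sol_unique_left[OF hper_sys[OF hK] s1 s2 _ _ x]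
 show "usol z al be k x = usol mu al be k x + (z - mu) * usol mu 0 0 (usol z al be k) x"
  "usol' z al be k x = usol' mu al be k x + (z - mu) * usol' mu 0 0 (usol z al be k) x" by simp_all
qed

lemma usol_comb:
 assumes k: "hper k1" "hper k2" and x: "x \<in> {0..a}"
 shows "usol mu (c1 * al1 + c2 * al2) (c1 * be1 + c2 * be2) (%x. c1 * k1 x + c2 * k2 x) x
   = c1 * usol mu al1 be1 k1 x + c2 * usol mu al2 be2 k2 x"
  and "usol' mu (c1 * al1 + c2 * al2) (c1 * be1 + c2 * be2) (%x. c1 * k1 x + c2 * k2 x) x
   = c1 * usol' mu al1 be1 k1 x + c2 * usol' mu al2 be2 k2 x"
proof -
 have g: "gg (%x. c1 * k1 x + c2 * k2 x) = (%x. c1 * gg k1 x + c2 * gg k2 x)" by (auto simp: gg_def algebra_simps)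
 have "lin_sol 0 a rr (ss mu) (gg (%x. c1 * k1 x + c2 * k2 x)) (%x. c1 * usol mu al1 be1 k1 x + c2 * usol mu al2 be2 k2 x)
  (%x. c1 * usol' mu al1 be1 k1 x + c2 * usol' mu al2 be2 k2 x)"
  unfolding g by (rule lin_sol_comb[OF hper_sys[OF k(1)] hper_sys[OF k(2)] usol_sol[OF k(1)] usol_sol[OF k(2)]])
 from usol_unique[OF hper_comb[OF k] this x]
 show "usol mu (c1 * al1 + c2 * al2) (c1 * be1 + c2 * be2) (%x. c1 * k1 x + c2 * k2 x) x
   = c1 * usol mu al1 be1 k1 x + c2 * usol mu al2 be2 k2 x"
  "usol' mu (c1 * al1 + c2 * al2) (c1 * be1 + c2 * be2) (%x. c1 * k1 x + c2 * k2 x) x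
   = c1 * usol' mu al1 be1 k1 x + c2 * usol' mu al2 be2 k2 x" by simp_all
qed

text \<open>Constants for the estimates: \<open>gn k\<close> is the integral of |w k| over a period,
  and \<open>cB R\<close> is the constant of \<open>lin_sol_bound\<close> valid for all |z| <= R,
  since \<open>KR R\<close> dominates the integral of the coefficients.\<close>

definition gn :: "cfun => real" where "gn k = integral {0..a} (%x. norm (gg k x))"
definition Wn :: real where "Wn = integral {0..a} (%x. \<bar>w x\<bar>)"
definition KR :: "real => real" where "KR R = integral {0..a} (%x. \<bar>inverse (p x)\<bar> + (\<bar>q x\<bar> + R * \<bar>w x\<bar>))"
definition cB :: "real => real" where "cB R = 2 * exp (2 * KR R)"

lemma cB_pos: "cB R > 0" by (simp add: cB_def)

lemma usol_bound:
 assumes k: "hper k" and x: "x \<in> {0..a}" and z: "norm z <= R"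
 shows "norm (usol z al be k x) + norm (usol' z al be k x) <= cB R * (norm al + norm be + gn k)"
proof -
 interpret lin_sys 0 a rr "ss z" "gg k" by (rule hper_sys[OF k])
 have ai: "(%x. \<bar>inverse (p x)\<bar>) absolutely_integrable_on {0..a}" "(%x. \<bar>q x\<bar>) absolutely_integrable_on {0..a}"
  "(%x. \<bar>w x\<bar>) absolutely_integrable_on {0..a}"
  using set_integrable_norm[OF ip_loc[of 0 a]] set_integrable_norm[OF q_loc[of 0 a]] set_integrable_norm[OF w_loc[of 0 a]] by simp_all
 have i: "(%x. \<bar>inverse (p x)\<bar> + (\<bar>q x\<bar> + R * \<bar>w x\<bar>)) integrable_on {0..a}"
  using ai by (intro integrable_add integrable_on_mult_right) (auto simp: absolutely_integrable_on_def)
 have "Kap a <= KR R" unfolding Kap_def KR_def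
 proof (rule integral_le)
  show "kap integrable_on {0..a}" using kap_integrable set_lebesgue_integral_eq_integral(1) by blast
  fix x assume "x \<in> {0..a}"
  have "norm (ss z x) <= \<bar>q x\<bar> + norm z * \<bar>w x\<bar>"
   unfolding ss_def cw_def using norm_triangle_ineq4[of "complex_of_real (q x)" "z * of_real (w x)"] by (simp add: norm_mult)
  also have "... <= \<bar>q x\<bar> + R * \<bar>w x\<bar>" using z by (intro add_left_mono mult_right_mono) auto
  finally show "kap x <= \<bar>inverse (p x)\<bar> + (\<bar>q x\<bar> + R * \<bar>w x\<bar>)" by (simp add: kap_def rr_def norm_inverse)
 qed (rule i)
 have gn0: "gn k >= 0" unfolding gn_def by (rule integral_nonneg) (use gnorm_integrable in auto)
 have "norm (usol z al be k x) + norm (usol' z al be k x) <= 2 * (norm al + norm be + gn k) * exp (2 * Kap a)"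
  using lin_sol_bound[OF usol_sol[OF k] x, of al be] by (simp add: gnorm_def gn_def)
 also have "... <= 2 * (norm al + norm be + gn k) * exp (2 * KR R)"
  using \<open>Kap a <= KR R\<close> gn0 by (intro mult_left_mono) auto
 finally show ?thesis by (simp add: cB_def algebra_simps)
qed

lemma gn_bound:
 assumes "continuous_on {0..a} k" "!!x. x \<in> {0..a} ==> norm (k x) <= B"
 shows "gn k <= Wn * B"
proof -
 have "hper k" by (rule hper_continuous[OF assms(1)])
 have "gn k <= integral {0..a} (%x. \<bar>w x\<bar> * B)" unfolding gn_def
 proof (rule integral_le)
  show "(%x. norm (gg k x)) integrable_on {0..a}" using \<open>hper k\<close> by (simp add: hper_def absolutely_integrable_on_def)
  show "(%x. \<bar>w x\<bar> * B) integrable_on {0..a}"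
   using set_integrable_norm[OF w_loc[of 0 a]] by (intro integrable_on_mult_left) (auto simp: absolutely_integrable_on_def)
 qed (use assms(2) in \<open>auto simp: gg_def cw_def norm_mult intro!: mult_left_mono\<close>)
 then show ?thesis by (simp add: Wn_def)
qed

lemma gn_nonneg: "hper k ==> gn k >= 0"
 unfolding gn_def hper_def absolutely_integrable_on_def by (intro integral_nonneg) auto

lemma Wn_nonneg: "Wn >= 0"
 unfolding Wn_def using set_integrable_norm[OF w_loc[of 0 a]] by (intro integral_nonneg) (auto simp: absolutely_integrable_on_def)

lemma usol_lipschitz:
 assumes k: "hper k" and x: "x \<in> {0..a}" and z: "norm z <= R" "norm mu <= R"
 shows "norm (usol z al be k x - usol mu al be k x) + norm (usol' z al be k x - usol' mu al be k x)
   <= norm (z - mu) * (cB R * (Wn * (cB R * (norm al + norm be + gn k))))"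
proof -
 define C1 where "C1 = cB R * (norm al + norm be + gn k)"
 have b: "norm (usol z al be k y) <= C1" if "y \<in> {0..a}" for y
  using usol_bound[OF k that z(1), of al be] norm_ge_zero[of "usol' z al be k y"] unfolding C1_def by linarith
 have c: "continuous_on {0..a} (usol z al be k)" by (rule usol_continuous[OF k])
 have hu: "hper (usol z al be k)" by (rule hper_continuous[OF c])
 have "norm (usol mu 0 0 (usol z al be k) x) + norm (usol' mu 0 0 (usol z al be k) x) <= cB R * gn (usol z al be k)"
  using usol_bound[OF hu x z(2), of 0 0] by simp
 also have "... <= cB R * (Wn * C1)" using gn_bound[OF c b] cB_pos[of R] by (intro mult_left_mono) auto
 finally have "norm (z - mu) * (norm (usol mu 0 0 (usol z al be k) x) + norm (usol' mu 0 0 (usol z al be k) x)) <= norm (z - mu) * (cB R * (Wn * C1))"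
  by (rule mult_left_mono) simp
 moreover have "usol z al be k x - usol mu al be k x = (z - mu) * usol mu 0 0 (usol z al be k) x"
  "usol' z al be k x - usol' mu al be k x = (z - mu) * usol' mu 0 0 (usol z al be k) x"
  using usol_expand[OF k x, of z al be mu] by simp_all
 ultimately show ?thesis unfolding C1_def by (simp only: norm_mult distrib_left)
qed

text \<open>\<open>usol_expand\<close> is combined with itself: the remainder is
  \<open>z - mu\<close> times the solution with right-hand side \<open>df\<close>, and
  \<open>df\<close> is itself of order \<open>z - mu\<close> by \<open>usol_lipschitz\<close>. The
  estimate is uniform on the period, which later allows integration against a test function.\<close>

lemma usol_taylor:
 assumes k: "hper k" and x: "x \<in> {0..a}" and z: "norm z <= R" "norm mu <= R"
 shows "norm (usol z al be k x - usol mu al be k x - (z - mu) * usol mu 0 0 (usol mu al be k) x)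
   + norm (usol' z al be k x - usol' mu al be k x - (z - mu) * usol' mu 0 0 (usol mu al be k) x)
   <= (norm (z - mu))^2 * (cB R * (Wn * (cB R * (Wn * (cB R * (norm al + norm be + gn k))))))"
proof -
 define L where "L = cB R * (Wn * (cB R * (norm al + norm be + gn k)))"
 define df where "df = (%y. 1 * usol z al be k y + (-1) * usol mu al be k y)"
 have c: "continuous_on {0..a} (usol z al be k)" "continuous_on {0..a} (usol mu al be k)" by (intro usol_continuous[OF k])+
 have cd: "continuous_on {0..a} df" unfolding df_def by (intro continuous_intros c)
 note hp = hper_continuous[OF c(1)] hper_continuous[OF c(2)] hper_continuous[OF cd]
 have b: "norm (df y) <= norm (z - mu) * L" if "y \<in> {0..a}" for y
  using usol_lipschitz[OF k that z, of al be] norm_ge_zero[of "usol' z al be k y - usol' mu al be k y"]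
  unfolding L_def df_def by (simp, linarith)
 have e1: "usol z al be k x - usol mu al be k x - (z - mu) * usol mu 0 0 (usol mu al be k) x = (z - mu) * usol mu 0 0 df x"
 proof -
  have "usol mu 0 0 df x = usol mu 0 0 (usol z al be k) x - usol mu 0 0 (usol mu al be k) x"
   using usol_comb(1)[OF hp(1,2) x, of mu 1 0 "-1" 0 0 0] by (simp add: df_def)
  then show ?thesis using usol_expand(1)[OF k x, of z al be mu] by (simp add: right_diff_distrib)
 qed
 have e2: "usol' z al be k x - usol' mu al be k x - (z - mu) * usol' mu 0 0 (usol mu al be k) x = (z - mu) * usol' mu 0 0 df x"
 proof -
  have "usol' mu 0 0 df x = usol' mu 0 0 (usol z al be k) x - usol' mu 0 0 (usol mu al be k) x"
   using usol_comb(2)[OF hp(1,2) x, of mu 1 0 "-1" 0 0 0] by (simp add: df_def)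
  then show ?thesis using usol_expand(2)[OF k x, of z al be mu] by (simp add: right_diff_distrib)
 qed
 have "norm (usol mu 0 0 df x) + norm (usol' mu 0 0 df x) <= cB R * gn df"
  using usol_bound[OF hp(3) x z(2), of 0 0] by simp
 also have "... <= cB R * (Wn * (norm (z - mu) * L))" using gn_bound[OF cd b] cB_pos[of R] by (intro mult_left_mono) auto
 finally have "norm (z - mu) * (norm (usol mu 0 0 df x) + norm (usol' mu 0 0 df x)) <= norm (z - mu) * (cB R * (Wn * (norm (z - mu) * L)))"
  by (rule mult_left_mono) simp
 then show ?thesis unfolding e1 e2 L_def[symmetric] norm_mult distrib_left[symmetric] by (simp only: power2_eq_square ac_simps)
qed

end

section \<open>Square-integrable functions\<close>

lemma continuous_zero_off_negligible:
 fixes f :: "real => complex"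
 assumes f: "continuous_on {c..d} f" and N: "negligible N" and z: "!!x. x \<in> {c<..<d} - N ==> f x = 0"
  and x: "x \<in> {c..d}" and cd: "c < d"
 shows "f x = 0"
proof (rule ccontr)
 assume nz: "f x ~= 0"
 obtain r where r: "r > 0" "!!y. y \<in> {c..d} ==> dist y x < r ==> dist (f y) (f x) < norm (f x)"
  using f x nz unfolding continuous_on_iff by (metis zero_less_norm_iff)
 have nzy: "f y ~= 0" if "y \<in> {c..d}" "dist y x < r" for y using r(2)[OF that] by (auto simp: dist_norm)
 define O1 where "O1 = {c<..<d} \<inter> ball x r"
 have "x \<in> closure {c<..<d}" using x cd by simp
 then have "O1 ~= {}" unfolding O1_def using r(1) by (metis closure_iff_nhds_not_empty centre_in_ball open_ball Int_commute order_refl)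
 moreover have "O1 <= N" using z nzy by (force simp: O1_def dist_commute)
 moreover have "open O1" by (auto simp: O1_def)
 ultimately show False using open_not_negligible negligible_subset[OF N] by blast
qed

lemma has_field_derivative_quadratic:
 fixes F :: "complex => complex"
 assumes "!!z. norm (z - mu) <= 1 ==> norm (F z - F mu - (z - mu) * G) <= (norm (z - mu))^2 * C"
 shows "(F has_field_derivative G) (at mu)"
 unfolding has_field_derivative_def has_derivative_at_alt
proof (intro conjI allI impI bounded_linear_mult_right)
 fix e :: real assume e: "e > 0"
 define d where "d = min 1 (e / (\<bar>C\<bar> + 1))"
 have d: "d > 0" using e by (auto simp: d_def)
 have "norm (F z - F mu - G * (z - mu)) <= e * norm (z - mu)" if z: "norm (z - mu) < d" for z
 proof -
  have "norm (F z - F mu - G * (z - mu)) <= norm (z - mu) * (norm (z - mu) * C)"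
   using assms[of z] z by (simp add: d_def power2_eq_square ac_simps)
  also have "... <= norm (z - mu) * e"
  proof (rule mult_left_mono)
   have "norm (z - mu) * C <= norm (z - mu) * (\<bar>C\<bar> + 1)" by (intro mult_left_mono) auto
   also have "... <= e / (\<bar>C\<bar> + 1) * (\<bar>C\<bar> + 1)" using z by (intro mult_right_mono) (auto simp: d_def)
   also have "... = e" by simp
   finally show "norm (z - mu) * C <= e" .
  qed simp
  finally show ?thesis by (simp add: mult.commute)
 qed
 then show "\<exists>d>0. \<forall>y. norm (y - mu) < d --> norm (F y - F mu - G * (y - mu)) <= e * norm (y - mu)" using d by blast
qed

lemma borel_measurable_cnj' [measurable (raw)]:
 "f \<in> borel_measurable M ==> (%x. cnj (f x)) \<in> borel_measurable M"
 by (rule borel_measurable_continuous_on[of cnj]) (auto intro: continuous_intros)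

lemma L2D: "f \<in> L2 M ==> f \<in> borel_measurable M" "f \<in> L2 M ==> integrable M (%x. (norm (f x))^2)"
 by (auto simp: L2_def)

lemma integrable_L2_mult:
 assumes "f \<in> L2 M" "g \<in> L2 M"
 shows "integrable M (%x. f x * cnj (g x))" "integrable M (%x. norm (f x) * norm (g x))"
proof -
 have i: "integrable M (%x. (norm (f x))^2 + (norm (g x))^2)" using assms by (intro Bochner_Integration.integrable_add L2D)
 have le: "norm (f x) * norm (g x) <= (norm (f x))^2 + (norm (g x))^2" for x
 proof -
  have "2 * (norm (f x) * norm (g x)) <= (norm (f x))^2 + (norm (g x))^2"
   using sum_squares_bound[of "norm (f x)" "norm (g x)"] by (simp add: mult.assoc)
  moreover have "0 <= norm (f x) * norm (g x)" by simp
  ultimately show ?thesis by linarith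
 qed
 note [measurable] = assms[THEN L2D(1)]
 show "integrable M (%x. f x * cnj (g x))"
  by (rule Bochner_Integration.integrable_bound[OF i]) (use le in \<open>auto simp: norm_mult intro: order_trans[OF le]\<close>)
 show "integrable M (%x. norm (f x) * norm (g x))"
  by (rule Bochner_Integration.integrable_bound[OF i]) (use le in \<open>auto simp: norm_mult intro: order_trans[OF le]\<close>)
qed

lemma L2_add:
 assumes "f \<in> L2 M" "g \<in> L2 M"
 shows "(%x. f x + g x) \<in> L2 M"
proof -
 note [measurable] = assms[THEN L2D(1)]
 have i: "integrable M (%x. 2 * (norm (f x))^2 + 2 * (norm (g x))^2)"
  using assms by (intro Bochner_Integration.integrable_add integrable_mult_right L2D)
 have "(norm (f x + g x))^2 <= 2 * (norm (f x))^2 + 2 * (norm (g x))^2" for x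
 proof -
  have "(norm (f x + g x))^2 <= (norm (f x) + norm (g x))^2" by (intro power_mono norm_triangle_ineq) auto
  also have "... <= 2 * (norm (f x))^2 + 2 * (norm (g x))^2"
   using sum_squares_bound[of "norm (f x)" "norm (g x)"] by (simp add: power2_sum)
  finally show ?thesis .
 qed
 then have "integrable M (%x. (norm (f x + g x))^2)"
  by (intro Bochner_Integration.integrable_bound[OF i]) auto
 then show ?thesis by (simp add: L2_def)
qed

lemma L2_cmult:
 assumes "f \<in> L2 M"
 shows "(%x. k * f x) \<in> L2 M"
proof -
 note [measurable] = L2D(1)[OF assms]
 show ?thesis using L2D(2)[OF assms] by (auto simp: L2_def norm_mult power_mult_distrib)
qed

lemma L2_diff: "f \<in> L2 M ==> g \<in> L2 M ==> (%x. f x - g x) \<in> L2 M"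
 using L2_add[OF _ L2_cmult[of g M "-1"], of f] by simp

lemma L2_zero [simp]: "(%_. 0) \<in> L2 M" by (simp add: L2_def)

lemma l2_norm_nonneg [simp]: "l2_norm M f >= 0" by (simp add: l2_norm_def)

lemma l2_norm_sq: "(l2_norm M f)^2 = (\<integral>x. (norm (f x))^2 \<partial>M)" by (simp add: l2_norm_def)

lemma l2_norm_cmult: "l2_norm M (%x. k * f x) = norm k * l2_norm M f"
 by (simp add: l2_norm_def norm_mult power_mult_distrib real_sqrt_mult)

text \<open>From \<open>0 <= (s * |f| - t * |g|)^2\<close>, integrated, with \<open>s = G\<close>
  and \<open>t = F\<close> if both norms are positive.\<close>

lemma L2_cauchy_schwarz:
 assumes "f \<in> L2 M" "g \<in> L2 M"
 shows "(\<integral>x. norm (f x) * norm (g x) \<partial>M) <= l2_norm M f * l2_norm M g"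
proof -
 define F G where "F = l2_norm M f" and "G = l2_norm M g"
 define I where "I = (\<integral>x. norm (f x) * norm (g x) \<partial>M)"
 have FG: "F >= 0" "G >= 0" by (auto simp: F_def G_def)
 have key: "2 * (s * t) * I <= s^2 * F^2 + t^2 * G^2" for s t :: real
 proof -
  have "2 * (s * t) * I = (\<integral>x. 2 * (s * t) * (norm (f x) * norm (g x)) \<partial>M)" by (simp add: I_def)
  also have "... <= (\<integral>x. s^2 * (norm (f x))^2 + t^2 * (norm (g x))^2 \<partial>M)"
  proof (rule integral_mono)
   show "integrable M (%x. 2 * (s * t) * (norm (f x) * norm (g x)))"
    using integrable_L2_mult(2)[OF assms] by (rule integrable_mult_right)
   show "integrable M (%x. s^2 * (norm (f x))^2 + t^2 * (norm (g x))^2)"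
    using assms by (intro Bochner_Integration.integrable_add integrable_mult_right L2D)
   show "2 * (s * t) * (norm (f x) * norm (g x)) <= s^2 * (norm (f x))^2 + t^2 * (norm (g x))^2" for x
    using sum_squares_bound[of "s * norm (f x)" "t * norm (g x)"] by (simp add: power_mult_distrib algebra_simps)
  qed
  also have "... = s^2 * F^2 + t^2 * G^2"
   using assms by (subst Bochner_Integration.integral_add) (auto simp: F_def G_def l2_norm_sq L2D)
  finally show ?thesis .
 qed
 have "I <= F * G"
 proof (cases "F * G = 0")
  case False
  then have "F > 0" "G > 0" using FG by auto
  have "2 * (G * F) * I <= (G * F) * (2 * (F * G))" using key[of G F] by (simp add: algebra_simps power2_eq_square)
  then show ?thesis using \<open>F > 0\<close> \<open>G > 0\<close> by simp
 next
  case True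
  have "I <= 0"
  proof (rule ccontr)
   assume "~ I <= 0"
   then have I: "I > 0" by simp
   from True consider "F = 0" | "G = 0" by auto
   then show False
   proof cases
    case 1
    \<comment> \<open>If one norm is zero, its coefficient can be taken arbitrarily large; here it
      is chosen so that \<open>key\<close> reads \<open>G^2 + 1 <= G^2\<close>.\<close>
    have "2 * ((G^2 + 1) / (2 * I) * 1) * I <= G^2" using key[of "(G^2 + 1) / (2 * I)" 1] 1 by simp
    then show False using I by simp
   next
    case 2
    have "2 * (1 * ((F^2 + 1) / (2 * I))) * I <= F^2" using key[of 1 "(F^2 + 1) / (2 * I)"] 2 by simp
    then show False using I by simp
   qed
  qed
  then show ?thesis unfolding True .
 qed
 then show ?thesis by (simp add: I_def F_def G_def)
qed

lemma l2_inner_bound: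
 assumes "f \<in> L2 M" "g \<in> L2 M"
 shows "norm (l2_inner M f g) <= l2_norm M f * l2_norm M g"
proof -
 have "norm (l2_inner M f g) <= (\<integral>x. norm (f x * cnj (g x)) \<partial>M)" unfolding l2_inner_def by (rule integral_norm_bound)
 then show ?thesis using L2_cauchy_schwarz[OF assms] by (simp add: norm_mult)
qed

lemma l2_inner_self:
 assumes "f \<in> L2 M"
 shows "l2_inner M f f = of_real ((l2_norm M f)^2)"
proof -
 have "l2_inner M f f = (\<integral>x. complex_of_real ((norm (f x))^2) \<partial>M)"
  unfolding l2_inner_def by (intro Bochner_Integration.integral_cong refl) (simp only: complex_norm_square)
 also have "... = of_real (\<integral>x. (norm (f x))^2 \<partial>M)" by (rule integral_complex_of_real)
 finally show ?thesis by (simp add: l2_norm_sq)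
qed

lemma l2_inner_comb:
 assumes "f \<in> L2 M" "g \<in> L2 M" "h \<in> L2 M"
 shows "l2_inner M (%x. c * f x + d * g x) h = c * l2_inner M f h + d * l2_inner M g h"
proof -
 have "l2_inner M (%x. c * f x + d * g x) h = (\<integral>x. c * (f x * cnj (h x)) + d * (g x * cnj (h x)) \<partial>M)"
  unfolding l2_inner_def by (simp add: algebra_simps)
 also have "... = c * l2_inner M f h + d * l2_inner M g h"
  unfolding l2_inner_def using integrable_L2_mult(1)[OF assms(1,3)] integrable_L2_mult(1)[OF assms(2,3)]
  by (subst Bochner_Integration.integral_add) auto
 finally show ?thesis .
qed

lemma l2_norm_cong_AE:
 assumes "AE x in M. f x = g x" "f \<in> borel_measurable M" "g \<in> borel_measurable M"
 shows "l2_norm M f = l2_norm M g"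
proof -
 have "(\<integral>x. (norm (f x))^2 \<partial>M) = (\<integral>x. (norm (g x))^2 \<partial>M)"
  by (rule integral_cong_AE) (use assms in auto)
 then show ?thesis by (simp add: l2_norm_def)
qed

lemma l2_inner_cong_AE:
 assumes "AE x in M. f x = g x" "f \<in> borel_measurable M" "g \<in> borel_measurable M" "h \<in> borel_measurable M"
 shows "l2_inner M f h = l2_inner M g h"
 unfolding l2_inner_def by (rule integral_cong_AE) (use assms in auto)

lemma l2_norm_zero_iff:
 assumes "f \<in> L2 M"
 shows "l2_norm M f = 0 \<longleftrightarrow> (AE x in M. f x = 0)"
proof -
 have "l2_norm M f = 0 \<longleftrightarrow> (\<integral>x. (norm (f x))^2 \<partial>M) = 0" by (simp add: l2_norm_def)
 also have "... \<longleftrightarrow> (AE x in M. (norm (f x))^2 = 0)"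
  by (rule integral_nonneg_eq_0_iff_AE[OF L2D(2)[OF assms]]) auto
 finally show ?thesis by simp
qed

text \<open>The test function is \<open>f\<close> itself. The second alternative takes care of a
  negative \<open>C\<close>.\<close>

lemma l2_norm_le_of_inner:
 assumes "f \<in> L2 M" "!!h. h \<in> L2 M ==> norm (l2_inner M f h) <= C * l2_norm M h"
 shows "l2_norm M f <= C \<or> l2_norm M f = 0"
proof -
 have "(l2_norm M f)^2 <= C * l2_norm M f"
  using assms(2)[OF assms(1)] l2_inner_self[OF assms(1)] by (simp add: norm_power)
 then show ?thesis using l2_norm_nonneg[of M f] by (auto simp: power2_eq_square mult_le_cancel_right less_le)
qed

section \<open>Square-integrable functions over one period\<close>

context periodic_SL
begin

abbreviation "nrm == l2_norm Ma"
abbreviation "La \<equiv> lebesgue_on {0<..<a}"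

lemma aw_measurable [measurable]: "(%x. ennreal \<bar>w x\<bar>) \<in> borel_measurable La"
 using measurable_restrict_space1[OF w_measurable] by measurable

lemma w_measurable_La [measurable]: "w \<in> borel_measurable La"
 using measurable_restrict_space1[OF w_measurable] .

lemma measurable_Ma: "borel_measurable Ma = borel_measurable La"
 unfolding Ma_def by (rule measurable_cong_sets) auto

text \<open>As \<open>w\<close> vanishes only on a null set, the measure |w| dx on the period has
  the null sets of Lebesgue measure.\<close>

lemma AE_Ma: "(AE x in Ma. P x) \<longleftrightarrow> (AE x in La. P x)"
proof -
 have "AE x in La. w x ~= 0" using w_nonzero
  by (subst AE_restrict_space_iff) auto
 moreover have "(AE x in Ma. P x) \<longleftrightarrow> (AE x in La. 0 < ennreal \<bar>w x\<bar> --> P x)"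
  unfolding Ma_def by (rule AE_density) measurable
 ultimately show ?thesis by auto
qed

lemma AE_Ma_iff: "(AE x in Ma. P x) \<longleftrightarrow> (\<exists>N. negligible N & (\<forall>x\<in>{0<..<a} - N. P x))"
 unfolding AE_Ma by (rule AE_lebesgue_on_iff_negligible) auto

text \<open>With \<open>integral_Ma\<close> this connects the measure \<open>Ma\<close> of the
  Hilbert space with the integrals over \<open>{0..a}\<close> in which the linear systems are
  written.\<close>

lemma integrable_Ma:
 fixes F :: "real => 'b::euclidean_space"
 assumes "F \<in> borel_measurable La"
 shows "integrable Ma F \<longleftrightarrow> (%x. \<bar>w x\<bar> *\<^sub>R F x) absolutely_integrable_on {0..a}"
proof -
 have "integrable Ma F \<longleftrightarrow> integrable La (%x. \<bar>w x\<bar> *\<^sub>R F x)"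
  unfolding Ma_def by (rule integrable_density[OF assms]) auto
 also have "... \<longleftrightarrow> (%x. \<bar>w x\<bar> *\<^sub>R F x) absolutely_integrable_on {0<..<a}"
  unfolding set_integrable_def by (rule integrable_restrict_space) auto
 finally show ?thesis by (simp add: absolutely_integrable_Icc_iff_Ioo)
qed

lemma integral_Ma:
 fixes F :: "real => 'b::euclidean_space"
 assumes "F \<in> borel_measurable La" "integrable Ma F"
 shows "integral\<^sup>L Ma F = integral {0..a} (%x. \<bar>w x\<bar> *\<^sub>R F x)"
proof -
 have "integrable La (%x. \<bar>w x\<bar> *\<^sub>R F x)"
  using assms(2) unfolding Ma_def by (subst (asm) integrable_density[OF assms(1)]) auto
 moreover have "integral\<^sup>L Ma F = integral\<^sup>L La (%x. \<bar>w x\<bar> *\<^sub>R F x)"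
  unfolding Ma_def by (rule integral_density[OF assms(1)]) auto
 ultimately show ?thesis
  by (simp add: lebesgue_integral_eq_integral integral_open_interval_real)
qed

lemma bounded_L2:
 assumes "k \<in> borel_measurable La" "!!x. x \<in> {0<..<a} ==> norm (k x) <= B"
 shows "k \<in> L2 Ma" "B >= 0 ==> nrm k <= B * sqrt Wn"
proof -
 note [measurable] = assms(1)
 have Bi: "(%x. \<bar>w x\<bar> *\<^sub>R B^2) absolutely_integrable_on {0..a}"
  using set_integrable_norm[OF w_loc[of 0 a]] by (simp add: set_integrable_mult_left)
 then have i1: "integrable Ma (%_. B^2)" by (subst integrable_Ma) auto
 have kB: "(norm (k x))^2 <= B^2" if "x \<in> {0<..<a}" for x using assms(2)[OF that] by (intro power_mono) auto
 have sp: "space Ma = {0<..<a}" by (simp add: Ma_def)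
 have "integrable Ma (%x. (norm (k x))^2)"
  by (rule Bochner_Integration.integrable_bound[OF i1]) (use kB in \<open>auto simp: measurable_Ma sp intro!: AE_I2\<close>)
 then show L: "k \<in> L2 Ma" using assms(1) by (simp add: L2_def measurable_Ma)
 assume B: "B >= 0"
 have "(nrm k)^2 <= (\<integral>x. B^2 \<partial>Ma)"
  unfolding l2_norm_sq by (rule integral_mono[OF L2D(2)[OF L] i1]) (use kB sp in auto)
 also have "... = integral {0..a} (%x. \<bar>w x\<bar> *\<^sub>R B^2)" by (rule integral_Ma[OF _ i1]) auto
 also have "... = (B * sqrt Wn)^2" using Wn_nonneg by (simp add: Wn_def power_mult_distrib)
 finally show "nrm k <= B * sqrt Wn" by (rule power2_le_imp_le) (use B Wn_nonneg in auto)
qed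

lemma continuous_measurable_La: "continuous_on {0..a} k ==> (k :: real => complex) \<in> borel_measurable La"
 by (rule continuous_imp_measurable_on_sets_lebesgue) (auto intro: continuous_on_subset)

lemma continuous_L2:
 assumes "continuous_on {0..a} k"
 shows "k \<in> L2 Ma"
proof -
 have "bounded (k ` {0..a})" by (intro compact_imp_bounded compact_continuous_image assms compact_Icc)
 then obtain B where "!!x. x \<in> {0..a} ==> norm (k x) <= B" by (meson bounded_iff imageI)
 then show ?thesis by (intro bounded_L2(1)[OF continuous_measurable_La[OF assms], of B]) auto
qed

text \<open>Cauchy-Schwarz with the constant function 1: the total weight \<open>Wn\<close> of the
  period is finite, so w k is integrable, as a right-hand side of the system has to be.\<close>

lemma L2_hper:
 assumes "k \<in> L2 Ma"
 shows "hper k" "gn k <= sqrt Wn * nrm k"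
proof -
 have m: "k \<in> borel_measurable La" using L2D(1)[OF assms] by (simp add: measurable_Ma)
 have one: "(%_. 1) \<in> L2 Ma" "nrm (%_. 1) <= 1 * sqrt Wn" using bounded_L2[of "%_. 1" 1] by auto
 have i: "integrable Ma (%x. norm (k x))" using integrable_L2_mult(2)[OF assms one(1)] by simp
 have mk: "(%x. norm (k x)) \<in> borel_measurable La" using m by simp
 have ai: "(%x. \<bar>w x\<bar> *\<^sub>R norm (k x)) absolutely_integrable_on {0..a}" using i integrable_Ma[OF mk] by simp
 have "integrable Ma k" using i m by (simp add: integrable_norm_iff measurable_Ma)
 then have "(%x. \<bar>w x\<bar> *\<^sub>R k x) absolutely_integrable_on {0<..<a}"
  using integrable_Ma[OF m] absolutely_integrable_Icc_iff_Ioo by blast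
 then have i2: "integrable La (%x. \<bar>w x\<bar> *\<^sub>R k x)" by (subst integrable_restrict_space) (auto simp: set_integrable_def)
 have "integrable La (gg k)"
 proof (rule Bochner_Integration.integrable_bound[OF i2])
  show "gg k \<in> borel_measurable La" using m unfolding gg_def[abs_def] cw_def by measurable
 qed (auto simp: gg_def cw_def norm_mult)
 then have "gg k absolutely_integrable_on {0<..<a}" by (subst (asm) integrable_restrict_space) (auto simp: set_integrable_def)
 then show "hper k" by (simp add: hper_def absolutely_integrable_Icc_iff_Ioo)
 have "gn k = integral {0..a} (%x. \<bar>w x\<bar> *\<^sub>R norm (k x))" by (simp add: gn_def gg_def cw_def norm_mult)
 also have "... = (\<integral>x. norm (k x) * norm (1::complex) \<partial>Ma)" using integral_Ma[OF mk i] by simp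
 also have "... <= nrm k * nrm (%_. 1)" by (rule L2_cauchy_schwarz[OF assms one(1)])
 also have "... <= nrm k * sqrt Wn" using one(2) by (intro mult_left_mono) auto
 finally show "gn k <= sqrt Wn * nrm k" by (simp add: mult.commute)
qed

end

lemma holomorphic_on_from_derivative:
 assumes "!!x. (f has_field_derivative g x) (at x)"
 shows "f holomorphic_on S"
 by (rule holomorphic_onI) (use assms in \<open>auto simp: field_differentiable_def intro: has_field_derivative_at_within\<close>)

section \<open>Independence of phi and psi, holomorphy in the spectral parameter\<close>

context periodic_SL
begin

lemma Ma_zero_continuous:
 assumes "continuous_on {0..a} u" "nrm u = 0" "x \<in> {0..a}"
 shows "u x = 0"
proof -
 have "AE x in Ma. u x = 0" using l2_norm_zero_iff[OF continuous_L2[OF assms(1)]] assms(2) by simp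
 then obtain N where "negligible N" "\<forall>x\<in>{0<..<a} - N. u x = 0" by (auto simp: AE_Ma_iff)
 then show ?thesis using continuous_zero_off_negligible[OF assms(1), of N x] assms(3) a_pos by auto
qed

text \<open>If \<open>u\<close> vanishes, then \<open>rr x * v x\<close>, the derivative of
  \<open>u\<close>, vanishes almost everywhere, where \<open>rr\<close> is nonzero; continuity of
  \<open>v\<close> does the rest.\<close>

lemma lin_sol_zero_snd:
 assumes sol: "lin_sol 0 a rr (ss z) (%_. 0) u v" and u: "!!x. x \<in> {0..a} ==> u x = 0" and x: "x \<in> {0..a}"
 shows "v x = 0"
proof -
 obtain N where N: "negligible N" "!!x. x \<in> {0<..<a} - N ==> (u has_vector_derivative rr x * v x) (at x)"
  by (rule lin_sys.lin_sol_deriv[OF sys0 sol], rule that)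
 obtain N0 where N0: "negligible N0" "!!x. x \<notin> N0 ==> w x ~= 0 & p x > 0" by (rule ae_good, rule that)
 show ?thesis
 proof (rule continuous_zero_off_negligible[OF lin_solD(2)[OF sol] _ _ x a_pos])
  show "negligible (N Un N0)" using N N0 by auto
  fix y assume y: "y \<in> {0<..<a} - (N Un N0)"
  have "((%_. 0) has_vector_derivative rr y * v y) (at y)"
   by (rule has_vector_derivative_transform_within_open[OF N(2), of _ "{0<..<a}"]) (use y u in auto)
  then have "rr y * v y = 0" using vector_derivative_unique_at has_vector_derivative_const by blast
  then show "v y = 0" using N0(2)[of y] y by (simp add: rr_def)
 qed
qed

lemma phi_psi_independent:
 assumes "!!x. x \<in> {0..a} ==> al * phi z x + be * psi z x = 0"
 shows "al = 0" "be = 0"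
proof -
 have s: "lin_sol 0 a rr (ss z) (%_. 0) (%x. al * phi z x + be * psi z x) (%x. al * p_phi' z x + be * p_psi' z x)"
  using lin_sol_comb[OF sys0 sys0 phi_sol psi_sol, of z al be] by simp
 show "al = 0" using assms[of 0] a_pos by (simp add: phi_gsol psi_gsol)
 show "be = 0" using lin_sol_zero_snd[OF s assms, of 0] a_pos by (simp add: phi_gsol psi_gsol)
qed

lemma phi_continuous: "continuous_on {0..a} (phi z)" and psi_continuous: "continuous_on {0..a} (psi z)"
 using lin_solD(1)[OF phi_sol] lin_solD(1)[OF psi_sol] by auto

text \<open>The dual basis of \<open>phi z\<close>, \<open>psi z\<close> in their span, from the
  inverse of the Gram matrix with entries \<open>A\<close>, \<open>B\<close>, \<open>C\<close>.
  Pairing with \<open>k1\<close> and \<open>k2\<close> reads off the initial values of a solution,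
  and later the entries of a matrix from the form \<open>Num\<close>.\<close>

lemma biorthogonal:
 obtains k1 k2 where "continuous_on {0..a} k1" "continuous_on {0..a} k2"
  "l2_inner Ma (phi z) k1 = 1" "l2_inner Ma (psi z) k1 = 0"
  "l2_inner Ma (phi z) k2 = 0" "l2_inner Ma (psi z) k2 = 1"
proof -
 define ip where "ip = l2_inner Ma"
 have L: "phi z \<in> L2 Ma" "psi z \<in> L2 Ma" by (intro continuous_L2 phi_continuous psi_continuous)+
 define A B C where "A = ip (phi z) (phi z)" and "B = ip (phi z) (psi z)" and "C = ip (psi z) (psi z)"
 have herm: "ip f g = cnj (ip g f)" if "f \<in> L2 Ma" "g \<in> L2 Ma" for f g
  unfolding ip_def l2_inner_def by (subst Bochner_Integration.integral_cnj[symmetric]) (simp add: mult.commute)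
 have c1: "ip (%x. c * f x + d * g x) h = c * ip f h + d * ip g h" if "f \<in> L2 Ma" "g \<in> L2 Ma" "h \<in> L2 Ma" for c d f g h
  unfolding ip_def by (rule l2_inner_comb[OF that])
 have c2: "ip h (%x. c * f x + d * g x) = cnj c * ip h f + cnj d * ip h g" if "f \<in> L2 Ma" "g \<in> L2 Ma" "h \<in> L2 Ma" for c d f g h
 proof -
  have m: "(%x. c * f x + d * g x) \<in> L2 Ma" using that by (intro L2_add L2_cmult)
  show ?thesis using herm[OF that(3) m] c1[OF that, of c d] herm[OF that(3,1)] herm[OF that(3,2)] by simp
 qed
 have CB: "ip (psi z) (phi z) = cnj B" using herm[OF L(2,1)] by (simp add: B_def)
 have real: "cnj A = A" "cnj C = C" using herm[OF L(1,1)] herm[OF L(2,2)] by (simp_all add: A_def C_def)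
 have nz: "C ~= 0"
 proof
  assume "C = 0"
  then have "nrm (psi z) = 0" using l2_inner_self[OF L(2)] by (simp add: C_def ip_def)
  then have "!!x. x \<in> {0..a} ==> 0 * phi z x + 1 * psi z x = 0" using Ma_zero_continuous[OF psi_continuous] by simp
  from phi_psi_independent(2)[of 0 z 1, OF this] show False by simp
 qed
 define G where "G = A * C - B * cnj B"
 have G: "G ~= 0"
 proof
  assume G0: "G = 0"
  \<comment> \<open>This \<open>f\<close> is orthogonal to \<open>psi z\<close>, and its product
    with \<open>phi z\<close> is the Gram determinant \<open>G\<close>. So \<open>G = 0\<close>
    would force \<open>f = 0\<close>, against independence.\<close>
  define f where "f = (%x. C * phi z x + (- B) * psi z x)"
  have cf: "continuous_on {0..a} f" unfolding f_def by (intro continuous_intros phi_continuous psi_continuous)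
  have Lf: "f \<in> L2 Ma" by (rule continuous_L2[OF cf])
  have "ip f f = C * ip (phi z) f + (- B) * ip (psi z) f" unfolding f_def by (rule c1[OF L Lf[unfolded f_def]])
  also have "ip (phi z) f = C * A - cnj B * B" unfolding f_def c2[OF L L(1)] by (simp add: real A_def B_def)
  also have "ip (psi z) f = 0" unfolding f_def c2[OF L L(2)] by (simp add: real CB C_def[symmetric] mult.commute)
  finally have "ip f f = 0" using G0 by (simp add: G_def mult.commute)
  then have "nrm f = 0" using l2_inner_self[OF Lf] by (simp add: ip_def)
  then have "!!x. x \<in> {0..a} ==> C * phi z x + (- B) * psi z x = 0" using Ma_zero_continuous[OF cf] by (simp add: f_def)
  from phi_psi_independent(1)[of C z "- B", OF this] show False using nz by simp
 qed
 have cG: "cnj G = G" by (simp add: G_def real mult.commute)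
 define k1 where "k1 = (%x. (C / G) * phi z x + (- B / G) * psi z x)"
 define k2 where "k2 = (%x. (- cnj B / G) * phi z x + (A / G) * psi z x)"
 show ?thesis
 proof (rule that[of k1 k2])
  show "continuous_on {0..a} k1" "continuous_on {0..a} k2" unfolding k1_def k2_def
   by (intro continuous_intros phi_continuous psi_continuous)+
  have "ip (phi z) k1 = (A * C - B * cnj B) / G" unfolding k1_def c2[OF L L(1)] by (simp add: real cG A_def[symmetric] B_def[symmetric] diff_divide_distrib mult.commute)
  then show "l2_inner Ma (phi z) k1 = 1" using G by (simp add: ip_def G_def)
  have "ip (psi z) k1 = 0" unfolding k1_def c2[OF L L(2)] by (simp add: real cG CB C_def[symmetric])
  then show "l2_inner Ma (psi z) k1 = 0" by (simp add: ip_def)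
  have "ip (phi z) k2 = 0" unfolding k2_def c2[OF L L(1)] by (simp add: real cG A_def[symmetric] B_def[symmetric])
  then show "l2_inner Ma (phi z) k2 = 0" by (simp add: ip_def)
  have "ip (psi z) k2 = (A * C - B * cnj B) / G" unfolding k2_def c2[OF L L(2)] by (simp add: real cG CB C_def[symmetric] diff_divide_distrib)
  then show "l2_inner Ma (psi z) k2 = 1" using G by (simp add: ip_def G_def)
 qed
qed

lemma usol_has_field_derivative:
 assumes k: "hper k" and x: "x \<in> {0..a}"
 shows "((%z. usol z al be k x) has_field_derivative usol mu 0 0 (usol mu al be k) x) (at mu)"
  and "((%z. usol' z al be k x) has_field_derivative usol' mu 0 0 (usol mu al be k) x) (at mu)"
proof -
 define R where "R = norm mu + 1"
 define K where "K = cB R * (Wn * (cB R * (Wn * (cB R * (norm al + norm be + gn k)))))"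
 have T: "norm (usol z al be k x - usol mu al be k x - (z - mu) * usol mu 0 0 (usol mu al be k) x)
   + norm (usol' z al be k x - usol' mu al be k x - (z - mu) * usol' mu 0 0 (usol mu al be k) x) <= (norm (z - mu))^2 * K"
  if "norm (z - mu) <= 1" for z
 proof -
  have "norm z <= R" using that norm_triangle_sub[of z mu] by (simp add: R_def)
  then show ?thesis unfolding K_def by (intro usol_taylor[OF k x]) (auto simp: R_def)
 qed
 show "((%z. usol z al be k x) has_field_derivative usol mu 0 0 (usol mu al be k) x) (at mu)"
 proof (rule has_field_derivative_quadratic[of _ _ _ K])
  fix z assume "norm (z - mu) <= 1"
  from T[OF this] show "norm (usol z al be k x - usol mu al be k x - (z - mu) * usol mu 0 0 (usol mu al be k) x) <= (norm (z - mu))^2 * K"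
   by (smt (verit) norm_ge_zero)
 qed
 show "((%z. usol' z al be k x) has_field_derivative usol' mu 0 0 (usol mu al be k) x) (at mu)"
 proof (rule has_field_derivative_quadratic[of _ _ _ K])
  fix z assume "norm (z - mu) <= 1"
  from T[OF this] show "norm (usol' z al be k x - usol' mu al be k x - (z - mu) * usol' mu 0 0 (usol mu al be k) x) <= (norm (z - mu))^2 * K"
   by (smt (verit) norm_ge_zero)
 qed
qed

lemma usol_L2: "hper k ==> usol z al be k \<in> L2 Ma"
 by (intro continuous_L2 usol_continuous)

text \<open>Weak differentiability in \<open>z\<close> of the solution as an element of the Hilbert
  space: the remainder of \<open>usol_taylor\<close> is uniform in \<open>x\<close> and survives the
  pairing with \<open>h\<close>.\<close>

lemma l2_inner_usol_has_field_derivative: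
 assumes k: "hper k" and h: "h \<in> L2 Ma"
 shows "((%z. l2_inner Ma (usol z al be k) h) has_field_derivative l2_inner Ma (usol mu 0 0 (usol mu al be k)) h) (at mu)"
proof -
 define R where "R = norm mu + 1"
 define K where "K = cB R * (Wn * (cB R * (Wn * (cB R * (norm al + norm be + gn k)))))"
 have K0: "K >= 0" unfolding K_def using cB_pos[of R] Wn_nonneg gn_nonneg[OF k] by (intro mult_nonneg_nonneg add_nonneg_nonneg) auto
 have hu: "hper (usol mu al be k)" by (intro hper_continuous usol_continuous k)
 show ?thesis
 proof (rule has_field_derivative_quadratic[of _ _ _ "K * sqrt Wn * nrm h"])
  fix z assume z: "norm (z - mu) <= 1"
  have zR: "norm z <= R" using z norm_triangle_sub[of z mu] by (simp add: R_def)
  define f where "f = (%x. 1 * (1 * usol z al be k x + (-1) * usol mu al be k x) + (- (z - mu)) * usol mu 0 0 (usol mu al be k) x)"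
  have cf: "continuous_on {0..a} f" unfolding f_def by (intro continuous_intros usol_continuous k hu)
  have b: "norm (f x) <= (norm (z - mu))^2 * K" if "x \<in> {0<..<a}" for x
  proof -
   have xa: "x \<in> {0..a}" and mR: "norm mu <= R" using that by (auto simp: R_def)
   have "norm (f x) = norm (usol z al be k x - usol mu al be k x - (z - mu) * usol mu 0 0 (usol mu al be k) x)"
    unfolding f_def by (rule arg_cong[of _ _ norm]) (simp add: left_diff_distrib)
   then show ?thesis using usol_taylor[OF k xa zR mR, of al be]
    norm_ge_zero[of "usol' z al be k x - usol' mu al be k x - (z - mu) * usol' mu 0 0 (usol mu al be k) x"]
    unfolding K_def[symmetric] by linarith
  qed
  have Lf: "f \<in> L2 Ma" by (rule continuous_L2[OF cf])
  have L12: "(%x. 1 * usol z al be k x + (-1) * usol mu al be k x) \<in> L2 Ma" by (intro L2_add L2_cmult usol_L2 k)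
  have "l2_inner Ma f h = 1 * (1 * l2_inner Ma (usol z al be k) h + (-1) * l2_inner Ma (usol mu al be k) h) + (- (z - mu)) * l2_inner Ma (usol mu 0 0 (usol mu al be k)) h"
   unfolding f_def l2_inner_comb[OF L12 usol_L2[OF hu] h] l2_inner_comb[OF usol_L2[OF k] usol_L2[OF k] h] ..
  then have "l2_inner Ma (usol z al be k) h - l2_inner Ma (usol mu al be k) h - (z - mu) * l2_inner Ma (usol mu 0 0 (usol mu al be k)) h
   = l2_inner Ma f h" by (simp add: left_diff_distrib)
  then have "norm (l2_inner Ma (usol z al be k) h - l2_inner Ma (usol mu al be k) h - (z - mu) * l2_inner Ma (usol mu 0 0 (usol mu al be k)) h)
   = norm (l2_inner Ma f h)" by simp
  also have "... <= nrm f * nrm h" by (rule l2_inner_bound[OF Lf h])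
  also have "... <= (norm (z - mu))^2 * K * sqrt Wn * nrm h"
   using bounded_L2(2)[OF continuous_measurable_La[OF cf] b] K0 by (intro mult_right_mono) auto
  finally show "norm (l2_inner Ma (usol z al be k) h - l2_inner Ma (usol mu al be k) h - (z - mu) * l2_inner Ma (usol mu 0 0 (usol mu al be k)) h)
   <= (norm (z - mu))^2 * (K * sqrt Wn * nrm h)" by (simp add: mult.assoc)
 qed
qed

lemma phi_usol: "phi z = usol z 1 0 (%_. 0)" "p_phi' z = usol' z 1 0 (%_. 0)"
 and psi_usol: "psi z = usol z 0 1 (%_. 0)" "p_psi' z = usol' z 0 1 (%_. 0)"
 by (auto simp: usol_zero)

lemma D_has_field_derivative: "(D has_field_derivative (usol mu 0 0 (phi mu) a + usol' mu 0 0 (psi mu) a)) (at mu)"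
proof -
 have a: "a \<in> {0..a}" using a_pos by simp
 have "((%z. usol z 1 0 (%_. 0) a + usol' z 0 1 (%_. 0) a) has_field_derivative
  (usol mu 0 0 (usol mu 1 0 (%_. 0)) a + usol' mu 0 0 (usol mu 0 1 (%_. 0)) a)) (at mu)"
  by (intro DERIV_add usol_has_field_derivative a) auto
 then show ?thesis by (simp add: D_def[abs_def] phi_usol[symmetric] psi_usol[symmetric])
qed

lemma D_holomorphic: "D holomorphic_on S"
 by (rule holomorphic_on_from_derivative[OF D_has_field_derivative])

lemma entries_holomorphic:
 assumes "hper k" "x \<in> {0..a}"
 shows "(%z. usol z al be k x) holomorphic_on S" "(%z. usol' z al be k x) holomorphic_on S"
 by (rule holomorphic_on_from_derivative, rule usol_has_field_derivative[OF assms])+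

lemma l2_inner_holomorphic:
 assumes "hper k" "h \<in> L2 Ma"
 shows "(%z. l2_inner Ma (usol z al be k) h) holomorphic_on S"
 by (rule holomorphic_on_from_derivative, rule l2_inner_usol_has_field_derivative[OF assms])

end

section \<open>The fibre operators: resolvent and Riesz projections\<close>

text \<open>The equation is \<open>M (x + b) = e x\<close>, that is \<open>(e - M) x = M b\<close>.
  By Cayley-Hamilton and \<open>det M = 1\<close> one has
  \<open>(e - M) (M - e') = (e + e' - tr M) M\<close>, so \<open>x = (M - e') b / Dt\<close>. This
  is why the resolvent of a fibre contains M minus the inverse of the Floquet multiplier.\<close>

lemma twobytwo_solve:
 fixes m11 m12 m21 m22 e e' b1 b2 al be :: complex
 assumes det: "m11 * m22 - m12 * m21 = 1" and e: "e * e' = 1" and Dt: "e + e' - (m11 + m22) = Dt" "Dt ~= 0"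
 shows "(m11 * (al + b1) + m12 * (be + b2) = e * al & m21 * (al + b1) + m22 * (be + b2) = e * be)
  \<longleftrightarrow> (al = ((m11 - e') * b1 + m12 * b2) / Dt & be = (m21 * b1 + (m22 - e') * b2) / Dt)"
proof -
 have "(m11 * (al + b1) + m12 * (be + b2) = e * al & m21 * (al + b1) + m22 * (be + b2) = e * be)
  \<longleftrightarrow> (al * Dt = (m11 - e') * b1 + m12 * b2 & be * Dt = m21 * b1 + (m22 - e') * b2)" (is "?L \<longleftrightarrow> ?R")
 proof
  assume L: ?L
  have "al * Dt = (m11 - e') * b1 + m12 * b2" using L det e Dt(1) by algebra
  moreover have "be * Dt = m21 * b1 + (m22 - e') * b2" using L det e Dt(1) by algebra
  ultimately show ?R by simp
 next
  assume R: ?R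
  have "Dt * (m11 * (al + b1) + m12 * (be + b2) - e * al) = 0" using R det e Dt(1) by algebra
  moreover have "Dt * (m21 * (al + b1) + m22 * (be + b2) - e * be) = 0" using R det e Dt(1) by algebra
  ultimately show ?L using Dt(2) by simp
 qed
 also have "... \<longleftrightarrow> (al = ((m11 - e') * b1 + m12 * b2) / Dt & be = (m21 * b1 + (m22 - e') * b2) / Dt)"
  using Dt(2) by (simp add: eq_divide_eq)
 finally show ?thesis .
qed

text \<open>A nonzero row of the singular matrix determines the kernel vector; if both rows vanish,
  any vector will do.\<close>

lemma twobytwo_eigenvector:
 fixes m11 m12 m21 m22 e :: complex
 assumes "(m11 - e) * (m22 - e) = m12 * m21"
 obtains al be where "al ~= 0 \<or> be ~= 0" "m11 * al + m12 * be = e * al" "m21 * al + m22 * be = e * be"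
proof (cases "m12 = 0 & m11 = e")
 case False
 show ?thesis by (rule that[of m12 "e - m11"]) (use False assms in \<open>auto simp: algebra_simps\<close>)
next
 case True
 then have T: "m12 = 0" "m11 = e" by auto
 show ?thesis
 proof (cases "m21 = 0 & m22 = e")
  case False
  show ?thesis by (rule that[of "e - m22" m21]) (use False T in \<open>auto simp: algebra_simps\<close>)
 next
  case True
  show ?thesis by (rule that[of 1 0]) (use True T in auto)
 qed
qed

section \<open>Resolvent and spectrum of a fibre\<close>

context periodic_SL
begin

abbreviation ef :: "real => complex" where "ef t \<equiv> exp (\<i> * of_real t)"

lemma ef_cos: "ef t + ef (- t) = 2 * of_real (cos t)"
 by (simp add: cos_of_real[symmetric] cos_exp_eq field_simps exp_minus)

lemma ef_inv: "ef t * ef (- t) = 1" by (simp flip: exp_add)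

lemma space_Ma: "space Ma = {0<..<a}" by (simp add: Ma_def)

text \<open>Variation of constants solves the differential equation, which leaves the two boundary
  conditions as equations for the initial data \<open>al\<close>, \<open>be\<close>.\<close>

lemma op_minus_fiber_iff:
 "(f, h) \<in> op_minus (A_fiber t) z \<longleftrightarrow> f \<in> L2 Ma & h \<in> L2 Ma &
  (\<exists>al be. (AE x in Ma. f x = usol z al be h x) & usol z al be h a = ef t * al & usol' z al be h a = ef t * be)"
proof
 assume "(f, h) \<in> op_minus (A_fiber t) z"
 then obtain h' where h: "h = (%x. h' x - z * f x)" "(f, h') \<in> A_fiber t" by (auto simp: op_minus_def)
 obtain u v where uv: "f \<in> L2 Ma" "h' \<in> L2 Ma" "AE x in Ma. f x = u x" "quasi_derivative_on {0..a} u v"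
  "AE x in Ma. h' x = sl_expr u v x" "u a = ef t * u 0" "v a = ef t * v 0" using h(2) by (auto simp: A_fiber_def)
 have hL: "h \<in> L2 Ma" unfolding h(1) using uv(1,2) by (intro L2_diff L2_cmult)
 have hp: "hper h" by (rule L2_hper(1)[OF hL])
 have "AE x in Ma. sl_expr u v x = z * u x + h x" using uv(3,5) by eventually_elim (auto simp: h(1))
 then have "lin_sol 0 a rr (ss z) (gg h) u v"
  using quasi_derivative_on_iff[of 0 a h u v z] a_pos hp uv(4) by (simp add: AE_Ma AE_lebesgue_on_Ioo_iff hper_def)
 note u = usol_unique[OF hp this]
 have 0: "0 \<in> {0..a}" "a \<in> {0..a}" using a_pos by auto
 have "AE x in Ma. x \<in> {0<..<a}" using AE_space[of Ma] by (simp add: space_Ma)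
 then have "AE x in Ma. f x = usol z (u 0) (v 0) h x" using uv(3)
 proof eventually_elim
  case (elim x)
  then show ?case using u(1)[of x] by auto
 qed
 then show "f \<in> L2 Ma & h \<in> L2 Ma &
  (\<exists>al be. (AE x in Ma. f x = usol z al be h x) & usol z al be h a = ef t * al & usol' z al be h a = ef t * be)"
  using uv u[OF 0(2)] hL by (intro conjI exI[of _ "u 0"] exI[of _ "v 0"]) auto
next
 assume "f \<in> L2 Ma & h \<in> L2 Ma &
  (\<exists>al be. (AE x in Ma. f x = usol z al be h x) & usol z al be h a = ef t * al & usol' z al be h a = ef t * be)"
 then obtain al be where fh: "f \<in> L2 Ma" "h \<in> L2 Ma" "AE x in Ma. f x = usol z al be h x"
  "usol z al be h a = ef t * al" "usol' z al be h a = ef t * be" by blast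
 have hp: "hper h" by (rule L2_hper(1)[OF fh(2)])
 have q: "quasi_derivative_on {0..a} (usol z al be h) (usol' z al be h)"
  "AE x in Ma. sl_expr (usol z al be h) (usol' z al be h) x = z * usol z al be h x + h x"
  using quasi_derivative_on_iff[of 0 a h "usol z al be h" "usol' z al be h" z] usol_sol[OF hp] a_pos hp
  by (simp_all add: AE_Ma AE_lebesgue_on_Ioo_iff hper_def)
 have "AE x in Ma. h x + z * f x = sl_expr (usol z al be h) (usol' z al be h) x"
  using q(2) fh(3) by eventually_elim simp
 then have "\<exists>u v. (AE x in Ma. f x = u x) & quasi_derivative_on {0..a} u v & (AE x in Ma. h x + z * f x = sl_expr u v x) &
   u a = ef t * u 0 & v a = ef t * v 0"
  by - (rule exI[of _ "usol z al be h"], rule exI[of _ "usol' z al be h"], use fh q in simp)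
 moreover have "(%x. h x + z * f x) \<in> L2 Ma" using fh by (intro L2_add L2_cmult)
 ultimately have "(f, %x. h x + z * f x) \<in> A_fiber t" using fh(1) by (simp add: A_fiber_def)
 then show "(f, h) \<in> op_minus (A_fiber t) z" unfolding op_minus_def by force
qed

abbreviation Dtf :: "real => complex => complex" where "Dtf t z \<equiv> 2 * of_real (cos t) - D z"

text \<open>\<open>na\<close> and \<open>nb\<close> are the components of \<open>M - e^(-it)\<close>
  applied to the vector \<open>(I1, - I0)\<close>. Divided by \<open>Dtf t z\<close> they are the
  initial data of the resolvent applied to \<open>h\<close>.\<close>

definition na :: "real => complex => cfun => complex" where
 "na t z h = (phi z a - ef (- t)) * I1 z h a - psi z a * I0 z h a"
definition nb :: "real => complex => cfun => complex" where
 "nb t z h = p_phi' z a * I1 z h a - (p_psi' z a - ef (- t)) * I0 z h a"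

lemma det_a: "phi z a * p_psi' z a - psi z a * p_phi' z a = 1"
 using det1[of a z] a_pos by simp

lemma fiber_bvp:
 assumes "Dtf t z ~= 0"
 shows "usol z al be h a = ef t * al & usol' z al be h a = ef t * be \<longleftrightarrow> al = na t z h / Dtf t z & be = nb t z h / Dtf t z"
 using twobytwo_solve[OF det_a[of z] ef_inv[of t] _ assms, of al "I1 z h a" be "- I0 z h a"] ef_cos[of t]
 by (simp add: usol_def usol'_def na_def nb_def D_def)

definition rsol :: "real => complex => cfun => cfun" where
 "rsol t z h = usol z (na t z h / Dtf t z) (nb t z h / Dtf t z) h"

lemma rsol:
 assumes "Dtf t z ~= 0" "h \<in> L2 Ma"
 shows "(f, h) \<in> op_minus (A_fiber t) z \<longleftrightarrow> f \<in> L2 Ma & (AE x in Ma. f x = rsol t z h x)"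
 using assms fiber_bvp[OF assms(1)] unfolding op_minus_fiber_iff rsol_def by auto

lemma rsol_mem:
 assumes "Dtf t z ~= 0" "h \<in> L2 Ma"
 shows "(rsol t z h, h) \<in> op_minus (A_fiber t) z"
 using rsol[OF assms] usol_L2[OF L2_hper(1)[OF assms(2)]] by (auto simp: rsol_def)

text \<open>The inverse of the monodromy matrix applied to the final values of the solution with
  zero initial data. In this way bounds and holomorphy of \<open>I0\<close>, \<open>I1\<close> are
  inherited from \<open>usol\<close>.\<close>

lemma I01_eq:
 "I1 z h a = p_psi' z a * usol z 0 0 h a - psi z a * usol' z 0 0 h a"
 "I0 z h a = p_phi' z a * usol z 0 0 h a - phi z a * usol' z 0 0 h a"
 using det_a[of z] unfolding usol_def usol'_def by (simp, algebra)+

lemma entries_bound: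
 assumes "norm z <= R" "x \<in> {0..a}"
 shows "norm (phi z x) <= cB R" "norm (p_phi' z x) <= cB R" "norm (psi z x) <= cB R" "norm (p_psi' z x) <= cB R"
 using usol_bound[OF hper_zero assms(2,1), of 1 0] usol_bound[OF hper_zero assms(2,1), of 0 1]
  norm_ge_zero[of "phi z x"] norm_ge_zero[of "p_phi' z x"] norm_ge_zero[of "psi z x"] norm_ge_zero[of "p_psi' z x"]
 unfolding phi_usol[symmetric] psi_usol[symmetric] by (simp_all add: gn_def, linarith+)

lemma I01_bound:
 assumes "norm z <= R" "hper h"
 shows "norm (I1 z h a) <= (cB R)^2 * gn h" "norm (I0 z h a) <= (cB R)^2 * gn h"
proof -
 have a: "a \<in> {0..a}" using a_pos by simp
 have b: "norm (usol z 0 0 h a) + norm (usol' z 0 0 h a) <= cB R * gn h" using usol_bound[OF assms(2) a assms(1), of 0 0] by simp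
 have key: "norm (c1 * usol z 0 0 h a - c2 * usol' z 0 0 h a) <= (cB R)^2 * gn h" if c: "norm c1 <= cB R" "norm c2 <= cB R" for c1 c2
 proof -
  have "norm (c1 * usol z 0 0 h a - c2 * usol' z 0 0 h a) <= norm c1 * norm (usol z 0 0 h a) + norm c2 * norm (usol' z 0 0 h a)"
   by (metis norm_mult norm_triangle_ineq4)
  also have "... <= cB R * norm (usol z 0 0 h a) + cB R * norm (usol' z 0 0 h a)"
   by (intro add_mono mult_right_mono c) auto
  also have "... = cB R * (norm (usol z 0 0 h a) + norm (usol' z 0 0 h a))" by (simp add: distrib_left)
  also have "... <= cB R * (cB R * gn h)" using b cB_pos[of R] by (intro mult_left_mono) auto
  finally show ?thesis by (simp add: power2_eq_square mult.assoc)
 qed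
 show "norm (I1 z h a) <= (cB R)^2 * gn h" "norm (I0 z h a) <= (cB R)^2 * gn h"
  unfolding I01_eq by (intro key entries_bound[OF assms(1) a])+
qed

lemma usol_l2_bound:
 assumes "hper h" "norm z <= R"
 shows "nrm (usol z al be h) <= cB R * (norm al + norm be + gn h) * sqrt Wn"
proof (rule bounded_L2(2)[OF continuous_measurable_La[OF usol_continuous(1)[OF assms(1)]]])
 fix x assume "x \<in> {0<..<a}"
 then show "norm (usol z al be h x) <= cB R * (norm al + norm be + gn h)"
  using usol_bound[OF assms(1) _ assms(2), of x al be] norm_ge_zero[of "usol' z al be h x"] by (simp, linarith)
qed (use cB_pos[of R] gn_nonneg[OF assms(1)] in auto)

lemma fiber_resolvent_set:
 assumes "Dtf t z ~= 0"
 shows "z \<in> resolvent_set Ma (A_fiber t)"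
proof -
 define R where "R = norm z"
 define K where "K = (norm (phi z a - ef (- t)) + norm (psi z a)) * ((cB R)^2 * sqrt Wn) / norm (Dtf t z)
  + (norm (p_phi' z a) + norm (p_psi' z a - ef (- t))) * ((cB R)^2 * sqrt Wn) / norm (Dtf t z)"
 have bd: "nrm f <= cB R * (K + sqrt Wn) * sqrt Wn * nrm h" if "(f, h) \<in> op_minus (A_fiber t) z" for f h
 proof -
  have hL: "h \<in> L2 Ma" using that by (simp add: op_minus_fiber_iff)
  have f: "f \<in> L2 Ma" "AE x in Ma. f x = rsol t z h x" using rsol[OF assms hL] that by auto
  have hp: "hper h" "gn h <= sqrt Wn * nrm h" by (rule L2_hper[OF hL])+
  define X where "X = (cB R)^2 * sqrt Wn * nrm h"
  have "(cB R)^2 * gn h <= X" using hp(2) by (simp add: X_def mult.assoc mult_left_mono)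
  then have I: "norm (I1 z h a) <= X" "norm (I0 z h a) <= X"
   using I01_bound[of z R h] hp(1) by (auto simp: R_def intro: order_trans)
  have comb: "norm (c1 * I1 z h a - c2 * I0 z h a) <= (norm c1 + norm c2) * X" for c1 c2
  proof -
   have "norm (c1 * I1 z h a - c2 * I0 z h a) <= norm c1 * norm (I1 z h a) + norm c2 * norm (I0 z h a)"
    by (metis norm_mult norm_triangle_ineq4)
   also have "... <= norm c1 * X + norm c2 * X" using I by (intro add_mono mult_left_mono) auto
   finally show ?thesis by (simp add: distrib_right)
  qed
  have "norm (na t z h / Dtf t z) <= (norm (phi z a - ef (- t)) + norm (psi z a)) * X / norm (Dtf t z)"
   "norm (nb t z h / Dtf t z) <= (norm (p_phi' z a) + norm (p_psi' z a - ef (- t))) * X / norm (Dtf t z)"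
   unfolding na_def nb_def norm_divide by (intro divide_right_mono comb; simp)+
  then have "norm (na t z h / Dtf t z) + norm (nb t z h / Dtf t z) <= K * nrm h"
   by (simp add: K_def X_def algebra_simps)
  then have le: "norm (na t z h / Dtf t z) + norm (nb t z h / Dtf t z) + gn h <= (K + sqrt Wn) * nrm h"
   using hp(2) by (simp add: algebra_simps)
  have "nrm f = nrm (rsol t z h)"
   by (rule l2_norm_cong_AE[OF f(2)]) (use f usol_L2[OF hp(1)] in \<open>auto simp: rsol_def L2D\<close>)
  also have "... <= cB R * (norm (na t z h / Dtf t z) + norm (nb t z h / Dtf t z) + gn h) * sqrt Wn"
   unfolding rsol_def by (rule usol_l2_bound[OF hp(1)]) (simp add: R_def)
  also have "... <= cB R * ((K + sqrt Wn) * nrm h) * sqrt Wn"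
   using le cB_pos[of R] Wn_nonneg by (intro mult_right_mono mult_left_mono) auto
  finally show ?thesis by (simp add: ac_simps)
 qed
 show ?thesis unfolding resolvent_set_def
  using rsol_mem[OF assms] bd by blast
qed

lemma fiber_spectrum: "op_spectrum Ma (A_fiber t) = {z. Dtf t z = 0}"
proof
 show "op_spectrum Ma (A_fiber t) <= {z. Dtf t z = 0}" using fiber_resolvent_set by (auto simp: op_spectrum_def)
 show "{z. Dtf t z = 0} <= op_spectrum Ma (A_fiber t)"
 proof clarify
  fix z assume z: "Dtf t z = 0"
  \<comment> \<open>\<open>ef t\<close> is an eigenvalue of the monodromy matrix, because the trace
    is \<open>ef t + ef (- t)\<close> and the determinant is 1.\<close>
  have "(phi z a - ef t) * (p_psi' z a - ef t) = psi z a * p_phi' z a"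
   using z det_a[of z] ef_cos[of t] ef_inv[of t] unfolding D_def by algebra
  then obtain al be where ab: "al ~= 0 \<or> be ~= 0" "phi z a * al + psi z a * be = ef t * al" "p_phi' z a * al + p_psi' z a * be = ef t * be"
   by (rule twobytwo_eigenvector)
  define u where "u = usol z al be (%_. 0)"
  have mem: "(u, %_. 0) \<in> op_minus (A_fiber t) z"
   unfolding op_minus_fiber_iff using usol_L2[OF hper_zero] ab(2,3)
   by (intro conjI exI[of _ al] exI[of _ be]) (auto simp: u_def usol_zero)
  have nz: "nrm u ~= 0"
  proof
   assume "nrm u = 0"
   then have "al * phi z x + be * psi z x = 0" if "x \<in> {0..a}" for x
    using Ma_zero_continuous[OF usol_continuous(1)[OF hper_zero] _ that, of z al be] by (simp add: u_def usol_zero mult.commute)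
   then show False using phi_psi_independent[of al z be] ab(1) by blast
  qed
  have n0: "nrm (%_. 0) = 0" by (simp add: l2_norm_def)
  have "z \<notin> resolvent_set Ma (A_fiber t)"
  proof
   assume "z \<in> resolvent_set Ma (A_fiber t)"
   then obtain C where "\<forall>(f, h)\<in>op_minus (A_fiber t) z. nrm f <= C * nrm h"
    unfolding resolvent_set_def by auto
   then have "nrm u <= C * nrm (%_. 0)" using mem by blast
   then show False using nz n0 l2_norm_nonneg[of Ma u] by simp
  qed
  then show "z \<in> op_spectrum Ma (A_fiber t)" by (simp add: op_spectrum_def)
 qed
qed

text \<open>The form of the resolvent of \<open>A_fiber t\<close> is \<open>Num / (2 cos t - D)\<close> plus an entire function, so that \<open>Num / D'\<close> gives the form of the Riesz projection at a simple zero of \<open>2 cos t - D\<close>.\<close>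
definition Num :: "real => complex => cfun => cfun => complex" where
 "Num t z f h = na t z f * l2_inner Ma (phi z) h + nb t z f * l2_inner Ma (psi z) h"

lemma phi_L2: "phi z \<in> L2 Ma" and psi_L2: "psi z \<in> L2 Ma"
 by (intro continuous_L2 phi_continuous psi_continuous)+

text \<open>\<open>op_resolvent\<close> picks some representative of the solution; all of them agree
  almost everywhere, and the scalar product does not distinguish them.\<close>

lemma resolvent_inner:
 assumes z: "Dtf t z ~= 0" and fh: "f \<in> L2 Ma" "h \<in> L2 Ma"
 shows "l2_inner Ma (op_resolvent (A_fiber t) z f) h = Num t z f h / Dtf t z + l2_inner Ma (usol z 0 0 f) h"
proof -
 have hp: "hper f" by (rule L2_hper(1)[OF fh(1)])
 have "(op_resolvent (A_fiber t) z f, f) \<in> op_minus (A_fiber t) z"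
  unfolding op_resolvent_def by (rule someI[of _ "rsol t z f"]) (rule rsol_mem[OF z fh(1)])
 then have r: "op_resolvent (A_fiber t) z f \<in> L2 Ma" "AE x in Ma. op_resolvent (A_fiber t) z f x = rsol t z f x"
  using rsol[OF z fh(1)] by auto
 have "l2_inner Ma (op_resolvent (A_fiber t) z f) h = l2_inner Ma (rsol t z f) h"
  by (rule l2_inner_cong_AE[OF r(2)]) (use r fh usol_L2[OF hp] in \<open>auto simp: rsol_def L2D\<close>)
 also have "rsol t z f = (%x. 1 * ((na t z f / Dtf t z) * phi z x + (nb t z f / Dtf t z) * psi z x) + 1 * usol z 0 0 f x)"
  by (auto simp: rsol_def usol_def algebra_simps)
 also have "l2_inner Ma ... h = 1 * (na t z f / Dtf t z * l2_inner Ma (phi z) h + nb t z f / Dtf t z * l2_inner Ma (psi z) h) + 1 * l2_inner Ma (usol z 0 0 f) h"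
  by (subst l2_inner_comb[OF _ usol_L2[OF hp] fh(2)], intro L2_add L2_cmult phi_L2 psi_L2,
    subst l2_inner_comb[OF phi_L2 psi_L2 fh(2)], rule refl)
 finally show ?thesis by (simp add: Num_def add_divide_distrib)
qed

lemma Num_holomorphic:
 assumes "f \<in> L2 Ma" "h \<in> L2 Ma"
 shows "(%z. Num t z f h) holomorphic_on S"
proof -
 have a: "a \<in> {0..a}" using a_pos by simp
 have hp: "hper f" by (rule L2_hper(1)[OF assms(1)])
 show ?thesis
  unfolding Num_def na_def nb_def I01_eq unfolding phi_usol psi_usol
  by (intro holomorphic_intros entries_holomorphic hp hper_zero a l2_inner_holomorphic assms(2))
qed

text \<open>The first factor is the sum of the moduli of the entries of \<open>M - e^(-it)\<close>.
  Near a regular critical point it has to compensate the small denominator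
  \<open>deriv D\<close>.\<close>

lemma Num_bound:
 assumes fh: "f \<in> L2 Ma" "h \<in> L2 Ma" and z: "norm z <= R"
 shows "norm (Num t z f h) <= (norm (phi z a - ef (- t)) + norm (psi z a) + norm (p_phi' z a) + norm (p_psi' z a - ef (- t)))
  * ((cB R)^3 * Wn) * nrm f * nrm h"
proof -
 define X where "X = (cB R)^2 * sqrt Wn * nrm f"
 define Y where "Y = cB R * sqrt Wn * nrm h"
 have X0: "X >= 0" using Wn_nonneg by (simp add: X_def)
 have hp: "hper f" "gn f <= sqrt Wn * nrm f" by (rule L2_hper[OF fh(1)])+
 have "(cB R)^2 * gn f <= X" using hp(2) by (simp add: X_def mult.assoc mult_left_mono)
 then have I: "norm (I1 z f a) <= X" "norm (I0 z f a) <= X"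
  using I01_bound[OF z hp(1)] by (auto intro: order_trans)
 have comb: "norm (c1 * I1 z f a - c2 * I0 z f a) <= (norm c1 + norm c2) * X" for c1 c2
 proof -
  have "norm (c1 * I1 z f a - c2 * I0 z f a) <= norm c1 * norm (I1 z f a) + norm c2 * norm (I0 z f a)"
   by (metis norm_mult norm_triangle_ineq4)
  also have "... <= norm c1 * X + norm c2 * X" using I by (intro add_mono mult_left_mono) auto
  finally show ?thesis by (simp add: distrib_right)
 qed
 have ip: "norm (l2_inner Ma (phi z) h) <= Y" "norm (l2_inner Ma (psi z) h) <= Y"
 proof -
  have "nrm (phi z) <= cB R * sqrt Wn" "nrm (psi z) <= cB R * sqrt Wn"
   using entries_bound[OF z] cB_pos[of R]
   by (intro bounded_L2(2) continuous_measurable_La phi_continuous psi_continuous; simp)+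
  then have "nrm (phi z) * nrm h <= Y" "nrm (psi z) * nrm h <= Y"
   unfolding Y_def by (intro mult_right_mono; simp)+
  then show "norm (l2_inner Ma (phi z) h) <= Y" "norm (l2_inner Ma (psi z) h) <= Y"
   using l2_inner_bound[OF phi_L2 fh(2), of z] l2_inner_bound[OF psi_L2 fh(2), of z] by linarith+
 qed
 have "norm (Num t z f h) <= norm (na t z f) * norm (l2_inner Ma (phi z) h) + norm (nb t z f) * norm (l2_inner Ma (psi z) h)"
  unfolding Num_def by (metis norm_mult norm_triangle_ineq)
 also have "... <= ((norm (phi z a - ef (- t)) + norm (psi z a)) * X) * Y + ((norm (p_phi' z a) + norm (p_psi' z a - ef (- t))) * X) * Y"
  using comb ip X0 unfolding na_def nb_def by (intro add_mono mult_mono) auto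
 also have "... = (norm (phi z a - ef (- t)) + norm (psi z a) + norm (p_phi' z a) + norm (p_psi' z a - ef (- t))) * (X * Y)"
  by (simp add: algebra_simps)
 also have "X * Y = ((cB R)^3 * Wn) * nrm f * nrm h"
  using Wn_nonneg by (simp add: X_def Y_def power3_eq_cube power2_eq_square)
 finally show ?thesis by (simp add: mult.assoc)
qed

lemma Dtf_holomorphic: "Dtf t holomorphic_on S"
 by (intro holomorphic_intros D_holomorphic)

lemma finite_fiber_spectrum:
 assumes nc: "~ D constant_on UNIV"
 shows "finite {z \<in> cball c r. Dtf t z = 0}"
proof (rule holomorphic_compact_finite_zeros[of _ UNIV])
 show "~ Dtf t constant_on UNIV"
 proof
  assume "Dtf t constant_on UNIV"
  then obtain k where k: "!!z. Dtf t z = k" by (auto simp: constant_on_def)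
  have "D z = 2 * of_real (cos t) - k" for z unfolding k[of z, symmetric] by simp
  with nc show False by (auto simp: constant_on_def)
 qed
qed (auto intro: Dtf_holomorphic)

text \<open>A simple pole: the denominator \<open>2 cos t - D\<close> has derivative
  \<open>- deriv D\<close>, which explains the sign, and the second summand is entire. The sign
  cancels against the one in the definition of the Riesz projection.\<close>

lemma residue_fiber:
 assumes nc: "~ D constant_on UNIV" and fh: "f \<in> L2 Ma" "h \<in> L2 Ma" and ze: "Dtf t ze = 0" and d: "deriv D ze ~= 0"
 shows "residue (%z. Num t z f h / Dtf t z + l2_inner Ma (usol z 0 0 f) h) ze = - (Num t ze f h / deriv D ze)"
proof -
 have hp: "hper f" by (rule L2_hper(1)[OF fh(1)])
 define S where "S = {z \<in> cball ze 1. Dtf t z = 0} - {ze}"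
 have fS: "finite S" unfolding S_def using finite_fiber_spectrum[OF nc] by auto
 have op: "open (ball ze 1 - S)" using fS by (intro open_Diff finite_imp_closed) auto
 have pS: "ze \<in> ball ze 1 - S" by (auto simp: S_def)
 have nz: "Dtf t z ~= 0" if "z \<in> ball ze 1 - S - {ze}" for z using that by (auto simp: S_def)
 have NE: "(%z. Num t z f h) holomorphic_on UNIV" "(%z. l2_inner Ma (usol z 0 0 f) h) holomorphic_on UNIV"
  by (rule Num_holomorphic[OF fh] l2_inner_holomorphic[OF hp fh(2)])+
 show ?thesis
 proof (rule residue_simple'[OF op pS])
  show "(%z. Num t z f h / Dtf t z + l2_inner Ma (usol z 0 0 f) h) holomorphic_on ball ze 1 - S - {ze}"
   by (intro holomorphic_on_add holomorphic_on_divide Dtf_holomorphic nz holomorphic_on_subset[OF NE(1)] holomorphic_on_subset[OF NE(2)]) auto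
  have "(D has_field_derivative deriv D ze) (at ze)"
   using D_has_field_derivative[of ze] DERIV_imp_deriv by metis
  then have "((%z. (D z - D ze) / (z - ze)) \<longlongrightarrow> deriv D ze) (at ze)" by (simp add: has_field_derivative_iff)
  then have "((%z. - ((D z - D ze) / (z - ze))) \<longlongrightarrow> - deriv D ze) (at ze)" by (rule tendsto_minus)
  then have l1: "((%z. Dtf t z / (z - ze)) \<longlongrightarrow> - deriv D ze) (at ze)"
   by (rule Lim_transform_eventually) (use ze in \<open>auto simp: eventually_at_filter diff_divide_distrib\<close>)
  have c: "isCont (%z. Num t z f h) ze" "isCont (%z. l2_inner Ma (usol z 0 0 f) h) ze"
   using NE[THEN holomorphic_on_imp_continuous_on] by (simp_all add: continuous_on_eq_continuous_at)
  have "((%z. Num t z f h / (Dtf t z / (z - ze)) + l2_inner Ma (usol z 0 0 f) h * (z - ze)) \<longlongrightarrow>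
   Num t ze f h / (- deriv D ze) + l2_inner Ma (usol ze 0 0 f) h * (ze - ze)) (at ze)"
   using c d by (intro tendsto_intros l1) (auto simp: isCont_def)
  then show "((%w. (Num t w f h / Dtf t w + l2_inner Ma (usol w 0 0 f) h) * (w - ze)) \<longlongrightarrow> - (Num t ze f h / deriv D ze)) (at ze)"
   by (simp add: algebra_simps)
 qed
qed

section \<open>Riesz projections of a fibre\<close>

lemma sum_list_eq_sum_nth: "(\<Sum>c\<leftarrow>cs. F c) = (\<Sum>i<length cs. F (cs ! i))"
 by (simp add: sum_list_sum_nth atLeast0LessThan)

text \<open>The spectrum of a fibre is discrete but not necessarily finite. All paths of the cycle
  lie in one ball, outside which the winding numbers vanish, so \<open>S\<close> lies in that ball
  and is finite. The residue theorem involves all zeros \<open>pts\<close> in the ball; those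
  outside \<open>S\<close> have total winding number 0.\<close>

lemma riesz_formula:
 assumes nc: "~ D constant_on UNIV" and cs: "separating_cycle Ma (A_fiber t) S cs"
  and S: "S <= {z. Dtf t z = 0}" "!!ze. ze \<in> S ==> deriv D ze ~= 0"
  and fh: "f \<in> L2 Ma" "h \<in> L2 Ma"
 shows "finite S" and
  "- (1 / (2 * of_real pi * \<i>)) * (\<Sum>c\<leftarrow>cs. contour_integral c (%z. l2_inner Ma (op_resolvent (A_fiber t) z f) h))
   = (\<Sum>ze\<in>S. Num t ze f h / deriv D ze)"
proof -
 have hp: "hper f" by (rule L2_hper(1)[OF fh(1)])
 have c: "valid_path c" "pathfinish c = pathstart c" "path_image c <= resolvent_set Ma (A_fiber t)" if "c \<in> set cs" for c
  using cs that by (auto simp: separating_cycle_def)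
 have wn: "(\<Sum>c\<leftarrow>cs. winding_number c z) = (if z \<in> S then 1 else 0)" if "Dtf t z = 0" for z
  using cs that by (auto simp: separating_cycle_def fiber_spectrum)
 have "compact (\<Union>c\<in>set cs. path_image c)" using c(1) by (intro compact_UN) (auto simp: compact_valid_path_image)
 then obtain r where r: "(\<Union>c\<in>set cs. path_image c) <= ball 0 r" using bounded_subset_ballD[OF compact_imp_bounded] by metis
 have cr: "path_image c <= ball 0 r" if "c \<in> set cs" for c using r that by auto
 have w0: "winding_number c z = 0" if "c \<in> set cs" "z \<notin> ball 0 r" for c z
  by (rule winding_number_zero_outside[OF valid_path_imp_path[OF c(1)[OF that(1)]] convex_ball c(2)[OF that(1)] that(2) cr[OF that(1)]])
 define pts where "pts = {z \<in> ball 0 r. Dtf t z = 0}"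
 have fp: "finite pts" by (rule finite_subset[OF _ finite_fiber_spectrum[OF nc, of 0 r t]]) (auto simp: pts_def)
 have Sp: "S <= pts"
 proof
  fix ze assume ze: "ze \<in> S"
  have "ze \<in> ball 0 r"
  proof (rule ccontr)
   assume "ze \<notin> ball 0 r"
   then have "(\<Sum>c\<leftarrow>cs. winding_number c ze) = (\<Sum>c\<leftarrow>cs. 0)" using w0 by (intro arg_cong[of _ _ sum_list] map_cong) auto
   then show False using wn[of ze] ze S(1) by auto
  qed
  then show "ze \<in> pts" using ze S(1) by (auto simp: pts_def)
 qed
 then show fS: "finite S" using fp finite_subset by blast
 define G where "G = (%z. Num t z f h / Dtf t z + l2_inner Ma (usol z 0 0 f) h)"
 have Ghol: "G holomorphic_on ball 0 r - pts" unfolding G_def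
  by (intro holomorphic_on_add holomorphic_on_divide Dtf_holomorphic Num_holomorphic fh l2_inner_holomorphic hp) (auto simp: pts_def)
 have ci: "contour_integral c (%z. l2_inner Ma (op_resolvent (A_fiber t) z f) h) = 2 * of_real pi * \<i> * (\<Sum>ze\<in>pts. winding_number c ze * residue G ze)"
  if "c \<in> set cs" for c
 proof -
  have res: "Dtf t z ~= 0" if "z \<in> path_image c" for z
   using c(3)[OF \<open>c \<in> set cs\<close>] that fiber_spectrum[of t] by (auto simp: op_spectrum_def)
  have "contour_integral c (%z. l2_inner Ma (op_resolvent (A_fiber t) z f) h) = contour_integral c G"
   by (rule contour_integral_eq) (use resolvent_inner[OF res fh] in \<open>auto simp: G_def\<close>)
  also have "... = of_real (2 * pi) * \<i> * (\<Sum>ze\<in>pts. winding_number c ze * residue G ze)"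
   by (rule Residue_theorem[OF open_ball connected_ball fp Ghol c(1,2)[OF that]])
    (use that cr[OF that] res w0[OF that] in \<open>auto simp: pts_def\<close>)
  finally show ?thesis by simp
 qed
 have "(\<Sum>c\<leftarrow>cs. contour_integral c (%z. l2_inner Ma (op_resolvent (A_fiber t) z f) h))
  = (\<Sum>i<length cs. 2 * of_real pi * \<i> * (\<Sum>ze\<in>pts. winding_number (cs ! i) ze * residue G ze))"
  unfolding sum_list_eq_sum_nth by (rule sum.cong) (use ci in auto)
 also have "... = 2 * of_real pi * \<i> * (\<Sum>ze\<in>pts. \<Sum>i<length cs. winding_number (cs ! i) ze * residue G ze)"
  unfolding sum_distrib_left[symmetric] by (subst sum.swap) simp
 also have "(\<Sum>ze\<in>pts. \<Sum>i<length cs. winding_number (cs ! i) ze * residue G ze) = (\<Sum>ze\<in>pts. (\<Sum>c\<leftarrow>cs. winding_number c ze) * residue G ze)"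
  by (simp add: sum_list_eq_sum_nth sum_distrib_right)
 also have "... = (\<Sum>ze\<in>pts. if ze \<in> S then residue G ze else 0)"
  by (rule sum.cong) (auto simp: wn pts_def)
 also have "... = (\<Sum>ze\<in>S. residue G ze)" using fp Sp by (simp add: sum.If_cases Int_absorb1)
 also have "... = (\<Sum>ze\<in>S. - (Num t ze f h / deriv D ze))"
  unfolding G_def by (rule sum.cong) (use residue_fiber[OF nc fh] S in auto)
 finally show "- (1 / (2 * of_real pi * \<i>)) * (\<Sum>c\<leftarrow>cs. contour_integral c (%z. l2_inner Ma (op_resolvent (A_fiber t) z f) h))
   = (\<Sum>ze\<in>S. Num t ze f h / deriv D ze)" by (simp add: sum_negf)
qed

lemma separating_cycle_empty: "separating_cycle Ma (A_fiber t) {} []"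
 by (simp add: separating_cycle_def)

lemma separating_cycle_singleton:
 assumes nc: "~ D constant_on UNIV" and ze: "Dtf t ze = 0"
 obtains cs where "separating_cycle Ma (A_fiber t) {ze} cs"
proof -
 define S where "S = {z \<in> cball ze 1. Dtf t z = 0}"
 have "finite S" unfolding S_def by (rule finite_fiber_spectrum[OF nc])
 then obtain e where e: "e > 0" "!!x. x \<in> S ==> x ~= ze ==> e <= dist ze x" by (metis finite_set_avoid)
 \<comment> \<open>Below 1, so that all zeros on or inside the circle are in \<open>S\<close>, and
   below the distance \<open>e\<close> to the zeros other than \<open>ze\<close>.\<close>
 define r where "r = min 1 e / 2"
 have r: "r > 0" "r < 1" "r < e" using e by (auto simp: r_def)
 have iso: "z = ze" if "Dtf t z = 0" "dist ze z <= r" for z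
  using e(2)[of z] that r by (force simp: S_def)
 show ?thesis
 proof (rule that[of "[circlepath ze r]"])
  have "path_image (circlepath ze r) <= resolvent_set Ma (A_fiber t)"
  proof
   fix z assume "z \<in> path_image (circlepath ze r)"
   then have z: "dist ze z = r" using r by (simp add: path_image_circlepath)
   then have "Dtf t z ~= 0" using iso[of z] r by auto
   then show "z \<in> resolvent_set Ma (A_fiber t)" by (rule fiber_resolvent_set)
  qed
  moreover have "winding_number (circlepath ze r) z = (if z \<in> {ze} then 1 else 0)" if "Dtf t z = 0" for z
  proof (cases "z = ze")
   case True
   then show ?thesis using winding_number_circlepath_centre[OF r(1), of ze] by simp
  next
   case False
   then have "z \<notin> cball ze r" using iso[OF that] by auto
   then have "winding_number (circlepath ze r) z = 0"
    using r by (intro winding_number_zero_outside[of _ "cball ze r"]) (auto simp: path_image_circlepath)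
   then show ?thesis using False by simp
  qed
  ultimately show "separating_cycle Ma (A_fiber t) {ze} [circlepath ze r]"
   by (simp add: separating_cycle_def fiber_spectrum)
 qed
qed

definition Sp :: "real => complex set => complex set" where "Sp t Dt = {z \<in> Dt. Dtf t z = 0}"

lemma E_fiber_eq: "E_fiber t Dt = riesz_projection Ma (A_fiber t) (Sp t Dt)"
proof -
 have "op_spectrum Ma (A_fiber t) \<inter> Dt = Sp t Dt" by (auto simp: Sp_def fiber_spectrum)
 then show ?thesis by (simp add: E_fiber_def)
qed

lemma E_fiberD:
 assumes nc: "~ D constant_on UNIV" and d: "!!ze. ze \<in> Dt ==> deriv D ze ~= 0" and E: "(f, g) \<in> E_fiber t Dt"
 shows "f \<in> L2 Ma" "g \<in> L2 Ma" "finite (Sp t Dt)"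
  "!!h. h \<in> L2 Ma ==> l2_inner Ma g h = (\<Sum>ze\<in>Sp t Dt. Num t ze f h / deriv D ze)"
proof -
 obtain cs where cs: "separating_cycle Ma (A_fiber t) (Sp t Dt) cs" "f \<in> L2 Ma" "g \<in> L2 Ma"
  "!!h. h \<in> L2 Ma ==> l2_inner Ma g h = - (1 / (2 * of_real pi * \<i>)) * (\<Sum>c\<leftarrow>cs. contour_integral c (%z. l2_inner Ma (op_resolvent (A_fiber t) z f) h))"
  using E unfolding E_fiber_eq riesz_projection_def by auto
 have S: "Sp t Dt <= {z. Dtf t z = 0}" "!!ze. ze \<in> Sp t Dt ==> deriv D ze ~= 0" using d by (auto simp: Sp_def)
 note rf = riesz_formula[OF nc cs(1) S(1) _ cs(2)]
 show "f \<in> L2 Ma" "g \<in> L2 Ma" by (rule cs)+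
 show "finite (Sp t Dt)" by (rule rf(1)[OF _ L2_zero]) (rule S(2))
 show "l2_inner Ma g h = (\<Sum>ze\<in>Sp t Dt. Num t ze f h / deriv D ze)" if "h \<in> L2 Ma" for h
  using cs(4)[OF that] rf(2)[OF S(2) that] by simp
qed

text \<open>\<open>riesz_projection\<close> asks for a separating cycle. With at most one eigenvalue
  in \<open>Dt\<close>, the empty cycle or a small circle serves, and \<open>riesz_formula\<close>
  evaluates the integral.\<close>

lemma E_fiberI:
 assumes nc: "~ D constant_on UNIV" and d: "!!ze. ze \<in> Dt ==> deriv D ze ~= 0" and one: "Sp t Dt <= {ze}"
  and fg: "f \<in> L2 Ma" "g \<in> L2 Ma"
  and g: "!!h. h \<in> L2 Ma ==> l2_inner Ma g h = (\<Sum>ze\<in>Sp t Dt. Num t ze f h / deriv D ze)"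
 shows "(f, g) \<in> E_fiber t Dt"
proof -
 have S: "Sp t Dt <= {z. Dtf t z = 0}" "!!ze. ze \<in> Sp t Dt ==> deriv D ze ~= 0" using d by (auto simp: Sp_def)
 obtain cs where cs: "separating_cycle Ma (A_fiber t) (Sp t Dt) cs"
 proof (cases "Sp t Dt = {}")
  case True
  then show ?thesis using that separating_cycle_empty by metis
 next
  case False
  then have "Sp t Dt = {ze}" using one by auto
  moreover from this have "Dtf t ze = 0" using S(1) by auto
  ultimately show ?thesis using that separating_cycle_singleton[OF nc] by metis
 qed
 show ?thesis unfolding E_fiber_eq riesz_projection_def
  using cs fg g riesz_formula(2)[OF nc cs S(1) S(2) fg(1)] by auto
qed

end

section \<open>The root space of a fibre operator\<close>

text \<open>A nonzero singular matrix B has rank one, and its adjugate is a multiple of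
  \<open>x y^T\<close> with \<open>x\<close> in the kernel and \<open>y\<close> in the left kernel.
  The hypothesis \<open>der\<close> says that the trace of \<open>adj B\<close> times the matrix d
  is zero, that is \<open>y^T d x = 0\<close>, which is the solvability condition of
  \<open>B c = - d x\<close>. The cases produce \<open>x\<close> and \<open>c\<close>
  explicitly.\<close>

lemma twobytwo_generalized_eigenvector:
 fixes b11 b12 b21 b22 d11 d12 d21 d22 :: complex
 assumes det: "b11 * b22 = b12 * b21" and der: "d11 * b22 + b11 * d22 = d12 * b21 + b12 * d21"
  and nz: "~ (b11 = 0 & b12 = 0 & b21 = 0 & b22 = 0)"
 obtains x1 x2 c1 c2 where "x1 ~= 0 \<or> x2 ~= 0" "b11 * x1 + b12 * x2 = 0" "b21 * x1 + b22 * x2 = 0"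
  "b11 * c1 + b12 * c2 + (d11 * x1 + d12 * x2) = 0" "b21 * c1 + b22 * c2 + (d21 * x1 + d22 * x2) = 0"
proof (cases "b12 = 0")
 case False
 define X1 where "X1 = d11 * b12 - d12 * b11"
 define X2 where "X2 = d21 * b12 - d22 * b11"
 have "b22 * X1 = b12 * X2" using det der unfolding X1_def X2_def by algebra
 then have "b22 * (- X1 / b12) = - X2" using False by (simp add: field_simps)
 moreover have "b12 * (- X1 / b12) = - X1" using False by simp
 ultimately show ?thesis
  by (intro that[of b12 "- b11" 0 "- X1 / b12"]) (use False det in \<open>auto simp: X1_def X2_def algebra_simps\<close>)
next
 case b12: True
 show ?thesis
 proof (cases "b11 = 0")
  case False
  then have "b22 = 0" using det b12 by auto
  moreover have "b21 * (- d12 / b11) = - d22" using der b12 False \<open>b22 = 0\<close> by (simp add: field_simps)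
  ultimately show ?thesis
   by (intro that[of 0 1 "- d12 / b11" 0]) (use False b12 in auto)
 next
  case b11: True
  show ?thesis
  proof (cases "b22 = 0")
   case False
   have "d11 * b22 - d12 * b21 = 0" using der b11 b12 by simp
   moreover have "b22 * (- (d21 * b22 - d22 * b21) / b22) = - (d21 * b22 - d22 * b21)" using False by simp
   ultimately show ?thesis
    by (intro that[of b22 "- b21" 0 "- (d21 * b22 - d22 * b21) / b22"]) (use False b11 b12 in \<open>auto simp: algebra_simps\<close>)
  next
   case True
   then have "b21 ~= 0" using nz b11 b12 by simp
   then have "d12 = 0" using der b11 b12 True by simp
   then show ?thesis
    by (intro that[of 0 1 "- d22 / b21" 0]) (use \<open>b21 ~= 0\<close> b11 b12 True in auto)
  qed
 qed
qed

context periodic_SL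
begin

lemma hper_phi: "hper (phi z)" and hper_psi: "hper (psi z)"
 by (intro hper_continuous phi_continuous psi_continuous)+

text \<open>\<open>d11\<close>, \<open>d12\<close>, \<open>d21\<close>, \<open>d22\<close> are the
  entries of the derivative in \<open>z\<close> of the monodromy matrix; see
  \<open>entry_derivs\<close>.\<close>

definition d11 where "d11 z = usol z 0 0 (phi z) a"
definition d12 where "d12 z = usol z 0 0 (psi z) a"
definition d21 where "d21 z = usol' z 0 0 (phi z) a"
definition d22 where "d22 z = usol' z 0 0 (psi z) a"

lemma entry_derivs:
 "((%z. phi z a) has_field_derivative d11 z) (at z)" "((%z. psi z a) has_field_derivative d12 z) (at z)"
 "((%z. p_phi' z a) has_field_derivative d21 z) (at z)" "((%z. p_psi' z a) has_field_derivative d22 z) (at z)"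
proof -
 have a: "a \<in> {0..a}" using a_pos by simp
 show "((%z. phi z a) has_field_derivative d11 z) (at z)" "((%z. p_phi' z a) has_field_derivative d21 z) (at z)"
  using usol_has_field_derivative[OF hper_zero a, of 1 0 z] by (simp_all add: d11_def d21_def phi_usol[symmetric])
 show "((%z. psi z a) has_field_derivative d12 z) (at z)" "((%z. p_psi' z a) has_field_derivative d22 z) (at z)"
  using usol_has_field_derivative[OF hper_zero a, of 0 1 z] by (simp_all add: d12_def d22_def psi_usol[symmetric])
qed

lemma deriv_D: "deriv D z = d11 z + d22 z"
 using DERIV_add[OF entry_derivs(1,4)] by (intro DERIV_imp_deriv) (simp add: D_def[abs_def])

lemma entries_holo: "(%z. phi z a) holomorphic_on UNIV" "(%z. psi z a) holomorphic_on UNIV"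
 "(%z. p_phi' z a) holomorphic_on UNIV" "(%z. p_psi' z a) holomorphic_on UNIV"
 by (rule holomorphic_on_from_derivative, rule entry_derivs)+

text \<open>Differentiation of \<open>det M = 1\<close>.\<close>

lemma det_deriv: "d11 z * p_psi' z a + phi z a * d22 z = d12 z * p_phi' z a + psi z a * d21 z"
proof -
 have "((%z. phi z a * p_psi' z a - psi z a * p_phi' z a) has_field_derivative
  (d11 z * p_psi' z a + d22 z * phi z a) - (d12 z * p_phi' z a + d21 z * psi z a)) (at z)"
  by (intro DERIV_diff DERIV_mult entry_derivs)
 then have "((%z. 1) has_field_derivative (d11 z * p_psi' z a + d22 z * phi z a) - (d12 z * p_phi' z a + d21 z * psi z a)) (at z)"
  by (simp add: det_a)
 then have "(d11 z * p_psi' z a + d22 z * phi z a) - (d12 z * p_phi' z a + d21 z * psi z a) = 0"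
  using DERIV_unique DERIV_const by blast
 then show ?thesis by (simp add: algebra_simps)
qed

text \<open>Second derivative of \<open>det M = 1\<close> at a point where M is the scalar
  \<open>e\<close>: it reads \<open>e * tr M'' + 2 * det M' = 0\<close>.\<close>

lemma det_second_deriv:
 assumes e: "phi z a = e" "p_psi' z a = e" "psi z a = 0" "p_phi' z a = 0"
 shows "e * (deriv ^^ 2) D z = - 2 * (d11 z * d22 z - d12 z * d21 z)"
proof -
 have d: "d11 = deriv (%z. phi z a)" "d12 = deriv (%z. psi z a)" "d21 = deriv (%z. p_phi' z a)" "d22 = deriv (%z. p_psi' z a)"
  by (rule ext, rule DERIV_imp_deriv[symmetric], rule entry_derivs)+
 have dd: "(d11 has_field_derivative deriv d11 z) (at z)" "(d12 has_field_derivative deriv d12 z) (at z)"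
  "(d21 has_field_derivative deriv d21 z) (at z)" "(d22 has_field_derivative deriv d22 z) (at z)" for z
  unfolding d by (rule holomorphic_derivI[OF holomorphic_deriv[OF entries_holo(1) open_UNIV] open_UNIV UNIV_I]
   holomorphic_derivI[OF holomorphic_deriv[OF entries_holo(2) open_UNIV] open_UNIV UNIV_I]
   holomorphic_derivI[OF holomorphic_deriv[OF entries_holo(3) open_UNIV] open_UNIV UNIV_I]
   holomorphic_derivI[OF holomorphic_deriv[OF entries_holo(4) open_UNIV] open_UNIV UNIV_I])+
 have "((%z. (d11 z * p_psi' z a + phi z a * d22 z) - (d12 z * p_phi' z a + psi z a * d21 z)) has_field_derivative
  ((deriv d11 z * p_psi' z a + d22 z * d11 z) + (d11 z * d22 z + deriv d22 z * phi z a))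
  - ((deriv d12 z * p_phi' z a + d21 z * d12 z) + (d12 z * d21 z + deriv d21 z * psi z a))) (at z)"
  by (intro DERIV_diff DERIV_add DERIV_mult entry_derivs dd)
 then have "((%_. 0) has_field_derivative
  ((deriv d11 z * p_psi' z a + d22 z * d11 z) + (d11 z * d22 z + deriv d22 z * phi z a))
  - ((deriv d12 z * p_phi' z a + d21 z * d12 z) + (d12 z * d21 z + deriv d21 z * psi z a))) (at z)"
  by (simp only: det_deriv diff_self)
 then have "((deriv d11 z * p_psi' z a + d22 z * d11 z) + (d11 z * d22 z + deriv d22 z * phi z a))
  - ((deriv d12 z * p_phi' z a + d21 z * d12 z) + (d12 z * d21 z + deriv d21 z * psi z a)) = 0"
  by (rule DERIV_unique[OF _ DERIV_const])
 note D2 = this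
 have "(deriv ^^ 2) D z = deriv d11 z + deriv d22 z"
 proof -
  have "deriv D = (%z. d11 z + d22 z)" by (auto simp: deriv_D)
  then have "(deriv ^^ 2) D z = deriv (%z. d11 z + d22 z) z" by (simp add: numeral_2_eq_2)
  also have "... = deriv d11 z + deriv d22 z" by (intro DERIV_imp_deriv DERIV_add dd)
  finally show ?thesis .
 qed
 then show ?thesis using D2 by (simp add: e algebra_simps)
qed

lemma usol_usol_a:
 "usol z 0 0 (usol z al be (%_. 0)) a = d11 z * al + d12 z * be"
 "usol' z 0 0 (usol z al be (%_. 0)) a = d21 z * al + d22 z * be"
proof -
 have a: "a \<in> {0..a}" using a_pos by simp
 have e: "usol z al be (%_. 0) = (%x. al * phi z x + be * psi z x)" by (auto simp: usol_zero mult.commute)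
 show "usol z 0 0 (usol z al be (%_. 0)) a = d11 z * al + d12 z * be"
  "usol' z 0 0 (usol z al be (%_. 0)) a = d21 z * al + d22 z * be"
  using usol_comb[OF hper_phi hper_psi a, of z al 0 be 0 0 0] unfolding e
  by (simp_all add: d11_def d12_def d21_def d22_def mult.commute)
qed

text \<open>Needed for compositions of graphs: the intermediate function may be replaced by the
  continuous solution that represents it.\<close>

lemma op_minus_fiber_cong_right:
 assumes "(f, g) \<in> op_minus (A_fiber t) z" "AE x in Ma. g x = g' x" "g' \<in> L2 Ma"
 shows "(f, g') \<in> op_minus (A_fiber t) z"
proof -
 obtain al be where fg: "f \<in> L2 Ma" "AE x in Ma. f x = usol z al be g x" "usol z al be g a = ef t * al" "usol' z al be g a = ef t * be"
  using assms(1) unfolding op_minus_fiber_iff by auto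
 obtain N where N: "negligible N" "\<forall>x\<in>{0<..<a} - N. g x = g' x" using assms(2) by (auto simp: AE_Ma_iff)
 have I: "I0 z g x = I0 z g' x" "I1 z g x = I1 z g' x" if "x <= a" for x
  unfolding I0_def I1_def
  by (rule integral_spike[of "N Un {0, a}"]; use N that in \<open>auto simp: negligible_insert\<close>)+
 have u: "usol z al be g x = usol z al be g' x" "usol' z al be g x = usol' z al be g' x" if "x <= a" for x
  using I[OF that] by (simp_all add: usol_def usol'_def)
 have "AE x in Ma. x \<in> {0<..<a}" using AE_space[of Ma] by (simp add: space_Ma)
 then have "AE x in Ma. f x = usol z al be g' x" using fg(2)
 proof eventually_elim
  case (elim x)
  then show ?case using u(1)[of x] by auto
 qed
 then have "\<exists>al be. (AE x in Ma. f x = usol z al be g' x) & usol z al be g' a = ef t * al & usol' z al be g' a = ef t * be"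
  using fg u[of a] by - (rule exI[of _ al], rule exI[of _ be], simp)
 then show ?thesis unfolding op_minus_fiber_iff using fg(1) assms(3) by simp
qed

text \<open>The operator is single valued: the difference \<open>u\<close> of the two solutions
  vanishes, hence so does its quasi-derivative, and then the equation leaves w g = 0 almost
  everywhere.\<close>

lemma op_minus_fiber_unique_right:
 assumes "(f, g) \<in> op_minus (A_fiber t) z" "(f, %_. 0) \<in> op_minus (A_fiber t) z"
 shows "AE x in Ma. g x = 0"
proof -
 obtain al be where 1: "g \<in> L2 Ma" "AE x in Ma. f x = usol z al be g x" using assms(1) unfolding op_minus_fiber_iff by auto
 obtain ga de where 2: "AE x in Ma. f x = usol z ga de (%_. 0) x" using assms(2) unfolding op_minus_fiber_iff by auto
 have hp: "hper g" by (rule L2_hper(1)[OF 1(1)])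
 define u v where "u = (%x. 1 * usol z al be g x + (-1) * usol z ga de (%_. 0) x)"
  and "v = (%x. 1 * usol' z al be g x + (-1) * usol' z ga de (%_. 0) x)"
 have "lin_sol 0 a rr (ss z) (%x. 1 * gg g x + (-1) * gg (%_. 0) x) u v"
  unfolding u_def v_def by (rule lin_sol_comb[OF hper_sys[OF hp] hper_sys[OF hper_zero] usol_sol[OF hp] usol_sol[OF hper_zero]])
 then have sol: "lin_sol 0 a rr (ss z) (gg g) u v" by simp
 have "AE x in Ma. u x = 0" using 1(2) 2 by eventually_elim (simp add: u_def)
 then obtain N where N: "negligible N" "!!x. x \<in> {0<..<a} - N ==> u x = 0" unfolding AE_Ma_iff by blast
 have u0: "u x = 0" if "x \<in> {0..a}" for x
  using continuous_zero_off_negligible[OF lin_solD(1)[OF sol] N that a_pos] .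
 obtain N1 where N1: "negligible N1" "!!x. x \<in> {0<..<a} - N1 ==> (u has_vector_derivative rr x * v x) (at x)"
  "!!x. x \<in> {0<..<a} - N1 ==> (v has_vector_derivative ss z x * u x + gg g x) (at x)"
  by (rule lin_sys.lin_sol_deriv[OF hper_sys[OF hp] sol], rule that)
 obtain N0 where N0: "negligible N0" "!!x. x \<notin> N0 ==> w x ~= 0 & p x > 0" by (rule ae_good, rule that)
 have v0: "v x = 0" if "x \<in> {0..a}" for x
 proof (rule continuous_zero_off_negligible[OF lin_solD(2)[OF sol] _ _ that a_pos])
  show "negligible (N1 Un N0)" using N1 N0 by auto
  fix y assume y: "y \<in> {0<..<a} - (N1 Un N0)"
  have "((%_. 0) has_vector_derivative rr y * v y) (at y)"
   by (rule has_vector_derivative_transform_within_open[OF N1(2), of _ "{0<..<a}"]) (use y u0 in auto)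
  then have "rr y * v y = 0" using vector_derivative_unique_at has_vector_derivative_const by blast
  then show "v y = 0" using N0(2)[of y] y by (simp add: rr_def)
 qed
 have "g y = 0" if y: "y \<in> {0<..<a} - (N1 Un N0)" for y
 proof -
  have "((%_. 0) has_vector_derivative ss z y * u y + gg g y) (at y)"
   by (rule has_vector_derivative_transform_within_open[OF N1(3), of _ "{0<..<a}"]) (use y v0 in auto)
  then have "ss z y * u y + gg g y = 0" using vector_derivative_unique_at has_vector_derivative_const by blast
  then show "g y = 0" using N0(2)[of y] y u0[of y] by (simp add: gg_def cw_def)
 qed
 then show ?thesis unfolding AE_Ma_iff using N1(1) N0(1) by (intro exI[of _ "N1 Un N0"]) auto
qed

lemma kernel_iff:
 assumes t: "Dtf t z = 0" and crit: "deriv D z = 0"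
 shows "op_ker (op_minus (A_fiber t) z O op_minus (A_fiber t) z) = op_ker (op_minus (A_fiber t) z)
  \<longleftrightarrow> D z \<in> {-2, 2} & psi z a = 0 & p_phi' z a = 0 & (deriv ^^ 2) D z ~= 0"
proof -
 define T where "T = op_minus (A_fiber t) z"
 define e where "e = ef t"
 have ez: "e ~= 0" by (simp add: e_def)
 have ee: "e * ef (- t) = 1" "e + ef (- t) = D z" using ef_inv[of t] ef_cos[of t] t by (simp_all add: e_def)
 define b11 b22 where "b11 = phi z a - e" and "b22 = p_psi' z a - e"
 \<comment> \<open>\<open>e\<close> is an eigenvalue of M, so \<open>M - e\<close>, with diagonal
   \<open>b11\<close>, \<open>b22\<close>, is singular.\<close>
 have detb: "b11 * b22 = psi z a * p_phi' z a"
  using det_a[of z] ee unfolding D_def b11_def b22_def by algebra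
 have tr: "d11 z + d22 z = 0" using crit by (simp add: deriv_D)
 \<comment> \<open>This is \<open>det_deriv\<close> with M replaced by \<open>M - e\<close>. The
   change is \<open>e * tr M'\<close>, which is zero at a critical point.\<close>
 have der: "d11 z * b22 + b11 * d22 z = d12 z * p_phi' z a + psi z a * d21 z"
  using det_deriv[of z] tr unfolding b11_def b22_def by algebra
 \<comment> \<open>The boundary conditions for a generalized eigenfunction. If \<open>f\<close> is
   mapped to \<open>g\<close> and \<open>g\<close> to 0, then the data \<open>x\<close> of
   \<open>g\<close> satisfy \<open>(M - e) x = 0\<close>, and the data \<open>c\<close> of
   \<open>f\<close> satisfy \<open>(M - e) c + M' x = 0\<close>, because M' is the effect of the
   right-hand side \<open>g\<close> at \<open>a\<close>.\<close>
 define gen where "gen \<longleftrightarrow> (\<exists>x1 x2 c1 c2. (x1 ~= 0 \<or> x2 ~= 0) & b11 * x1 + psi z a * x2 = 0 & p_phi' z a * x1 + b22 * x2 = 0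
  & b11 * c1 + psi z a * c2 + (d11 z * x1 + d12 z * x2) = 0 & p_phi' z a * c1 + b22 * c2 + (d21 z * x1 + d22 z * x2) = 0)"
 have usplit: "usol z c1 c2 (usol z x1 x2 (%_. 0)) a = phi z a * c1 + psi z a * c2 + (d11 z * x1 + d12 z * x2)"
  "usol' z c1 c2 (usol z x1 x2 (%_. 0)) a = p_phi' z a * c1 + p_psi' z a * c2 + (d21 z * x1 + d22 z * x2)" for c1 c2 x1 x2
  using usol_usol_a[of z x1 x2] by (simp_all add: usol_def usol'_def algebra_simps)
 have zz: "(%_. 0, %_. 0) \<in> T" unfolding T_def op_minus_fiber_iff
  by (intro conjI L2_zero exI[of _ 0]) (simp_all add: usol_zero)
 have sub: "op_ker T <= op_ker (T O T)" using zz by (auto simp: op_ker_def)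
 have eq_iff: "op_ker (T O T) = op_ker T \<longleftrightarrow> ~ gen"
 proof
  assume eq: "op_ker (T O T) = op_ker T"
  show "~ gen"
  proof
   assume gen
   then obtain x1 x2 c1 c2 where x: "x1 ~= 0 \<or> x2 ~= 0" "b11 * x1 + psi z a * x2 = 0" "p_phi' z a * x1 + b22 * x2 = 0"
    "b11 * c1 + psi z a * c2 + (d11 z * x1 + d12 z * x2) = 0" "p_phi' z a * c1 + b22 * c2 + (d21 z * x1 + d22 z * x2) = 0"
    unfolding gen_def by blast
   define g where "g = usol z x1 x2 (%_. 0)"
   define f where "f = usol z c1 c2 g"
   have gL: "g \<in> L2 Ma" unfolding g_def by (rule usol_L2[OF hper_zero])
   have gT: "(g, %_. 0) \<in> T" unfolding T_def op_minus_fiber_iff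
    by (intro conjI L2_zero gL, rule exI[of _ x1], rule exI[of _ x2])
     (use x(2,3) in \<open>auto simp: g_def usol_zero b11_def b22_def e_def algebra_simps\<close>)
   have fT: "(f, g) \<in> T" unfolding T_def op_minus_fiber_iff
    by (intro conjI gL, simp add: f_def usol_L2 L2_hper(1)[OF gL], rule exI[of _ c1], rule exI[of _ c2])
     (use x(4,5) in \<open>simp add: f_def g_def usplit b11_def b22_def e_def algebra_simps\<close>)
   have "f \<in> op_ker T" using eq gT fT by (auto simp: op_ker_def)
   then have "AE x in Ma. g x = 0" using fT unfolding T_def by (intro op_minus_fiber_unique_right[of f]) (auto simp: op_ker_def)
   then have "nrm g = 0" using l2_norm_zero_iff[OF gL] by simp
   then have "x1 * phi z x + x2 * psi z x = 0" if "x \<in> {0..a}" for x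
    using Ma_zero_continuous[OF usol_continuous(1)[OF hper_zero] _ that, of z x1 x2] by (simp add: g_def usol_zero mult.commute)
   then show False using phi_psi_independent[of x1 z x2] x(1) by blast
  qed
 next
  assume ng: "~ gen"
  have "f \<in> op_ker T" if fk: "f \<in> op_ker (T O T)" for f
  proof -
   obtain g where g: "(f, g) \<in> T" "(g, %_. 0) \<in> T" using fk by (auto simp: op_ker_def)
   obtain x1 x2 where x: "AE x in Ma. g x = usol z x1 x2 (%_. 0) x"
     "usol z x1 x2 (%_. 0) a = e * x1" "usol' z x1 x2 (%_. 0) a = e * x2"
    using g(2) unfolding T_def op_minus_fiber_iff e_def by auto
   have f2: "(f, usol z x1 x2 (%_. 0)) \<in> T"
    using op_minus_fiber_cong_right[OF g(1)[unfolded T_def] x(1) usol_L2[OF hper_zero]] by (simp add: T_def)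
   then obtain c1 c2 where c: "usol z c1 c2 (usol z x1 x2 (%_. 0)) a = e * c1" "usol' z c1 c2 (usol z x1 x2 (%_. 0)) a = e * c2"
    unfolding T_def op_minus_fiber_iff e_def by auto
   have "x1 = 0 & x2 = 0"
   proof (rule ccontr)
    assume "~ ?thesis"
    then have gen unfolding gen_def using x(2,3) c
     by - (rule exI[of _ x1], rule exI[of _ x2], rule exI[of _ c1], rule exI[of _ c2],
      auto simp: usplit usol_zero b11_def b22_def algebra_simps)
    then show False using ng by simp
   qed
   then have "usol z x1 x2 (%_. 0) = (%_. 0)" by (auto simp: usol_zero)
   then show ?thesis using f2 by (simp add: op_ker_def)
  qed
  then show "op_ker (T O T) = op_ker T" using sub by auto
 qed
 \<comment> \<open>If \<open>D z = 2 * s\<close> with \<open>s * s = 1\<close>, then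
   \<open>e\<close> and, for diagonal M, both diagonal entries are roots of
   \<open>X^2 - D X + 1 = (X - s)^2\<close>.\<close>
 have M: "D z \<in> {-2, 2} & psi z a = 0 & p_phi' z a = 0 \<longleftrightarrow> b11 = 0 & psi z a = 0 & p_phi' z a = 0 & b22 = 0"
 proof
  assume L: "D z \<in> {-2, 2} & psi z a = 0 & p_phi' z a = 0"
  have e1: "e * e - D z * e + 1 = 0" using ee by algebra
  have m1: "phi z a * phi z a - D z * phi z a + 1 = 0" "p_psi' z a * p_psi' z a - D z * p_psi' z a + 1 = 0"
   using det_a[of z] L unfolding D_def by (simp, algebra)+
  obtain s where s: "D z = 2 * s" "s * s = 1" using L by (auto intro: that[of "-1"] that[of 1])
  have sq: "x = s" if "x * x - D z * x + 1 = 0" for x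
  proof -
   have "(x - s) * (x - s) = 0" using that s by algebra
   then show ?thesis by simp
  qed
  show "b11 = 0 & psi z a = 0 & p_phi' z a = 0 & b22 = 0" using sq[OF e1] sq[OF m1(1)] sq[OF m1(2)] L by (simp add: b11_def b22_def)
 next
  assume R: "b11 = 0 & psi z a = 0 & p_phi' z a = 0 & b22 = 0"
  then have "e * e = 1" "D z = 2 * e" using det_a[of z] by (auto simp: b11_def b22_def D_def)
  then have "e = 1 \<or> e = - 1" using square_eq_1_iff[of e] by simp
  then show "D z \<in> {-2, 2} & psi z a = 0 & p_phi' z a = 0" using R \<open>D z = 2 * e\<close> by auto
 qed
 have "~ gen \<longleftrightarrow> (b11 = 0 & psi z a = 0 & p_phi' z a = 0 & b22 = 0) & (deriv ^^ 2) D z ~= 0"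
 proof (cases "b11 = 0 & psi z a = 0 & p_phi' z a = 0 & b22 = 0")
  case True
  \<comment> \<open>For \<open>M = e\<close> the conditions in \<open>gen\<close> reduce to
    \<open>M' x = 0\<close>. A nonzero \<open>x\<close> exists iff \<open>det M' = 0\<close>, that
    is iff the second derivative of \<open>D\<close> vanishes.\<close>
  have "e * (deriv ^^ 2) D z = - 2 * (d11 z * d22 z - d12 z * d21 z)"
   by (rule det_second_deriv) (use True in \<open>auto simp: b11_def b22_def\<close>)
  then have "(deriv ^^ 2) D z = 0 \<longleftrightarrow> d11 z * d22 z = d12 z * d21 z" using ez
   by (metis eq_iff_diff_eq_0 mult_eq_0_iff mult_zero_right neg_equal_0_iff_equal zero_neq_numeral)
  moreover have "gen \<longleftrightarrow> d11 z * d22 z = d12 z * d21 z"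
  proof
   assume gen
   then obtain x1 x2 where x: "x1 ~= 0 \<or> x2 ~= 0" "d11 z * x1 + d12 z * x2 = 0" "d21 z * x1 + d22 z * x2 = 0"
    unfolding gen_def using True by auto
   have "x1 * (d11 z * d22 z - d12 z * d21 z) = 0" "x2 * (d11 z * d22 z - d12 z * d21 z) = 0" using x(2,3) by algebra+
   then show "d11 z * d22 z = d12 z * d21 z" using x(1) by auto
  next
   assume dd: "d11 z * d22 z = d12 z * d21 z"
   obtain x1 x2 where x: "x1 ~= 0 \<or> x2 ~= 0" "d11 z * x1 + d12 z * x2 = 0 * x1" "d21 z * x1 + d22 z * x2 = 0 * x2"
    by (rule twobytwo_eigenvector[of "d11 z" 0 "d22 z" "d12 z" "d21 z"]) (use dd in auto)
   then show gen unfolding gen_def using True by auto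
  qed
  ultimately show ?thesis using True by simp
 next
  case False
  have gen
  proof (rule twobytwo_generalized_eigenvector[OF detb der])
   show "~ (b11 = 0 & psi z a = 0 & p_phi' z a = 0 & b22 = 0)" by (rule False)
  qed (unfold gen_def, blast)
  then show ?thesis using False by blast
 qed
 then show ?thesis using eq_iff M unfolding T_def by blast
qed

end

section \<open>The spectrum of the operator on the line\<close>

lemma lebesgue_measurable_translation: "(%x::real. x + c) \<in> lebesgue \<rightarrow>\<^sub>M lebesgue"
proof -
 have "(%x::real. c + (\<Sum>j\<in>Basis. (1 * (x \<bullet> j)) *\<^sub>R j)) \<in> lebesgue \<rightarrow>\<^sub>M lebesgue"
  by (rule lebesgue_affine_measurable) auto
 then show ?thesis by (simp add: add.commute)
qed

lemma borel_measurable_lebesgue_translate: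
 "f \<in> borel_measurable lebesgue ==> (%x::real. f (x + c)) \<in> borel_measurable lebesgue"
 by (rule measurable_compose[OF lebesgue_measurable_translation])

text \<open>The square of the norm with values in [0, \<infinity>], so that membership in
  \<open>L2\<close> can be concluded from the convergence of sums over periods.\<close>

definition nn2 :: "real measure => cfun => ennreal" where
 "nn2 M f = (\<integral>\<^sup>+x. ennreal ((norm (f x))^2) \<partial>M)"

lemma L2_iff_nn2: "f \<in> L2 M \<longleftrightarrow> f \<in> borel_measurable M & nn2 M f < \<infinity>"
proof -
 have "integrable M (%x. (norm (f x))^2) \<longleftrightarrow> nn2 M f < \<infinity>" if "f \<in> borel_measurable M"
  using that unfolding nn2_def by (subst integrable_iff_bounded) auto
 then show ?thesis by (auto simp: L2_def)
qed

lemma nn2_eq_l2_norm: "f \<in> L2 M ==> nn2 M f = ennreal ((l2_norm M f)^2)"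
 unfolding nn2_def l2_norm_sq by (rule nn_integral_eq_integral[OF L2D(2)]) auto

section \<open>Decomposition of the line into periods\<close>

context periodic_SL
begin

lemma indicator_times_measurable:
 fixes F :: "real => ennreal"
 shows "S \<in> sets lebesgue ==> F \<in> borel_measurable lebesgue ==> (%x. indicator S x * F x) \<in> borel_measurable lebesgue"
 by (intro borel_measurable_times_ennreal borel_measurable_indicator)

lemma nn_integral_cell:
 assumes F: "F \<in> borel_measurable lebesgue"
 shows "(\<integral>\<^sup>+x. F (x + c) \<partial>La) = (\<integral>\<^sup>+x. indicator {c<..<c + a} x * F x \<partial>lebesgue)"
proof -
 have "(\<integral>\<^sup>+x. indicator {c<..<c + a} x * F x \<partial>lebesgue) = (\<integral>\<^sup>+x. indicator {c<..<c + a} (c + 1 * x) * F (c + 1 * x) \<partial>lebesgue)"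
  using nn_integral_real_affine_lebesgue[of "%x. indicator {c<..<c + a} x * F x" 1 c]
   indicator_times_measurable[OF _ F, of "{c<..<c + a}"] by simp
 also have "... = (\<integral>\<^sup>+x. F (x + c) * indicator {0<..<a} x \<partial>lebesgue)"
  by (rule nn_integral_cong) (auto simp: indicator_def add.commute)
 also have "... = (\<integral>\<^sup>+x. F (x + c) \<partial>La)"
  using borel_measurable_lebesgue_translate[OF F] by (subst nn_integral_restrict_space) auto
 finally show ?thesis by simp
qed

lemma cell_disjoint: "disjoint_family_on (%n::int. {of_int n * a<..<of_int n * a + a}) S"
proof -
 have "n >= m + 1 ==> {of_int n * a<..<of_int n * a + a} \<inter> {of_int m * a<..<of_int m * a + a} = {}" for m n :: int
 proof -
  assume "n >= m + 1"
  then have "of_int n * a >= of_int (m + 1) * a" using a_pos by (intro mult_right_mono) (simp_all only: of_int_le_iff)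
  then show ?thesis by (auto simp: algebra_simps)
 qed
 then show ?thesis unfolding disjoint_family_on_def by (metis Int_commute linorder_neqE_linordered_idom zless_imp_add1_zle)
qed

text \<open>Monotone convergence over the union of the open cells with index from -N to N; the
  multiples of \<open>a\<close>, which belong to no cell, form a null set. The sums are symmetric
  like the partial sums of the Gelfand transform.\<close>

lemma cells_LIMSEQ:
 assumes F: "F \<in> borel_measurable lebesgue"
 shows "(%N. \<Sum>n = - int N..int N. \<integral>\<^sup>+x. F (x + of_int n * a) \<partial>La) \<longlonglongrightarrow> (\<integral>\<^sup>+x. F x \<partial>lebesgue)"
proof -
 define C where "C = (%n::int. {of_int n * a<..<of_int n * a + a})"
 define U where "U = (%N::nat. \<Union>n\<in>{- int N..int N}. C n)"
 have eq: "(\<Sum>n = - int N..int N. \<integral>\<^sup>+x. F (x + of_int n * a) \<partial>La) = (\<integral>\<^sup>+x. indicator (U N) x * F x \<partial>lebesgue)" for N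
 proof -
  have "(\<Sum>n = - int N..int N. \<integral>\<^sup>+x. F (x + of_int n * a) \<partial>La) = (\<Sum>n = - int N..int N. \<integral>\<^sup>+x. indicator (C n) x * F x \<partial>lebesgue)"
   unfolding C_def by (intro sum.cong refl nn_integral_cell F)
  also have "... = (\<integral>\<^sup>+x. (\<Sum>n = - int N..int N. indicator (C n) x * F x) \<partial>lebesgue)"
   by (intro nn_integral_sum[symmetric] indicator_times_measurable F) (auto simp: C_def)
  also have "... = (\<integral>\<^sup>+x. indicator (U N) x * F x \<partial>lebesgue)"
   using cell_disjoint[of "{- int N..int N}"] unfolding U_def C_def[symmetric]
   by (simp add: indicator_UN_disjoint sum_distrib_right)
  finally show ?thesis .
 qed
 have mono: "U N <= U M" if "N <= M" for N M unfolding U_def using that by (intro UN_mono) auto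
 have monoS: "x \<in> U (Suc N)" if "x \<in> U N" for N x using mono[of N "Suc N"] that by auto
 have "(%N. \<integral>\<^sup>+x. indicator (U N) x * F x \<partial>lebesgue) \<longlonglongrightarrow> (\<integral>\<^sup>+x. (SUP N. indicator (U N) x * F x) \<partial>lebesgue)"
 proof (rule nn_integral_LIMSEQ)
  show "incseq (%N x. indicator (U N) x * F x)"
   using monoS by (intro incseq_SucI le_funI mult_right_mono) (auto simp: indicator_def)
  show "(%x. indicator (U N) x * F x) \<in> borel_measurable lebesgue" for N
   by (intro indicator_times_measurable F) (auto simp: U_def C_def)
  show "(%N. indicator (U N) x * F x) \<longlonglongrightarrow> (SUP N. indicator (U N) x * F x)" for x
   using monoS by (intro LIMSEQ_SUP incseq_SucI mult_right_mono) (auto simp: indicator_def)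
 qed
 also have "(\<integral>\<^sup>+x. (SUP N. indicator (U N) x * F x) \<partial>lebesgue) = (\<integral>\<^sup>+x. F x \<partial>lebesgue)"
 proof (rule nn_integral_cong_AE)
  have "AE x in lebesgue. x \<notin> range (%n::int. of_int n * a)"
   unfolding AE_lebesgue_iff_negligible by (intro exI[of _ "range (%n::int. of_int n * a)"]) (auto intro: negligible_countable)
  then show "AE x in lebesgue. (SUP N. indicator (U N) x * F x) = F x"
  proof eventually_elim
   case (elim x)
   define n where "n = \<lfloor>x / a\<rfloor>"
   have "of_int n <= x / a" "x / a < of_int n + 1" unfolding n_def by linarith+
   then have "of_int n * a <= x" "x < of_int n * a + a" using a_pos by (simp_all add: field_simps)
   moreover have "of_int n * a ~= x" using elim by auto
   ultimately have "x \<in> C n" by (auto simp: C_def)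
   then have "x \<in> U (nat \<bar>n\<bar>)" by (force simp: U_def)
   then have "indicator (U (nat \<bar>n\<bar>)) x * F x = F x" by simp
   then have "F x <= (SUP N. indicator (U N) x * F x)" by (metis SUP_upper UNIV_I)
   moreover have "(SUP N. indicator (U N) x * F x) <= F x" by (intro SUP_least) (auto simp: indicator_def)
   ultimately show ?case by auto
  qed
 qed
 finally show ?thesis by (simp add: eq)
qed

definition cell :: "int => cfun => cfun" where "cell n f = (%x. f (x + of_int n * a))"

lemma measurable_MR: "borel_measurable MR = borel_measurable lebesgue"
 unfolding MR_def by (rule measurable_cong_sets) auto

lemma AE_MR: "(AE x in MR. P x) \<longleftrightarrow> (AE x in lebesgue. P x)"
proof -
 have "(%x. ennreal \<bar>w x\<bar>) \<in> borel_measurable lebesgue" by (rule measurable_compose[OF w_measurable]) measurable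
 then have "(AE x in MR. P x) \<longleftrightarrow> (AE x in lebesgue. 0 < ennreal \<bar>w x\<bar> --> P x)"
  unfolding MR_def by (rule AE_density)
 then show ?thesis using w_nonzero by auto
qed

lemma cell_measurable:
 assumes "f \<in> borel_measurable lebesgue"
 shows "cell n f \<in> borel_measurable Ma"
 unfolding measurable_Ma cell_def by (rule measurable_restrict_space1[OF borel_measurable_lebesgue_translate[OF assms]])

lemma nn2_cells:
 assumes f: "f \<in> borel_measurable lebesgue"
 shows "(%N. \<Sum>n = - int N..int N. nn2 Ma (cell n f)) \<longlonglongrightarrow> nn2 MR f"
proof -
 define F where "F = (%x. ennreal \<bar>w x\<bar> * ennreal ((norm (f x))^2))"
 have mw: "(%x. ennreal \<bar>w x\<bar>) \<in> borel_measurable lebesgue" by (rule measurable_compose[OF w_measurable]) measurable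
 have mf: "(%x. ennreal ((norm (f x))^2)) \<in> borel_measurable lebesgue" by (rule measurable_compose[OF f]) measurable
 have F: "F \<in> borel_measurable lebesgue" unfolding F_def by (intro borel_measurable_times_ennreal mw mf)
 have "nn2 MR f = (\<integral>\<^sup>+x. F x \<partial>lebesgue)"
  unfolding nn2_def MR_def F_def by (rule nn_integral_density[OF mw mf])
 moreover have "nn2 Ma (cell n f) = (\<integral>\<^sup>+x. F (x + of_int n * a) \<partial>La)" for n
  unfolding nn2_def Ma_def F_def
  using cell_measurable[OF f, of n] unfolding measurable_Ma
  by (subst nn_integral_density) (auto simp: cell_def periodic_int)
 ultimately show ?thesis using cells_LIMSEQ[OF F] by simp
qed

lemma L2_MR_cell:
 assumes "f \<in> L2 MR"
 shows "cell n f \<in> L2 Ma" "(\<Sum>n = - int N..int N. (nrm (cell n f))^2) <= (l2_norm MR f)^2"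
  "(%N. \<Sum>n = - int N..int N. (nrm (cell n f))^2) \<longlonglongrightarrow> (l2_norm MR f)^2"
proof -
 have f: "f \<in> borel_measurable lebesgue" using L2D(1)[OF assms] by (simp add: measurable_MR)
 note lim = nn2_cells[OF f]
 have inc: "incseq (%N. \<Sum>n = - int N..int N. nn2 Ma (cell n f))"
  by (intro incseq_SucI sum_mono2) auto
 have le: "(\<Sum>n = - int N..int N. nn2 Ma (cell n f)) <= nn2 MR f" for N by (rule incseq_le[OF inc lim])
 have fin: "nn2 MR f < \<infinity>" using assms by (simp add: L2_iff_nn2)
 have c: "cell n f \<in> L2 Ma" for n
 proof -
  have "nn2 Ma (cell n f) <= (\<Sum>n = - int (nat \<bar>n\<bar>)..int (nat \<bar>n\<bar>). nn2 Ma (cell n f))"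
   by (intro member_le_sum) auto
  then have "nn2 Ma (cell n f) < \<infinity>" using le[of "nat \<bar>n\<bar>"] fin by (meson le_less_trans)
  then show ?thesis using cell_measurable[OF f] by (simp add: L2_iff_nn2)
 qed
 show "cell n f \<in> L2 Ma" by (rule c)
 have eq: "(\<Sum>n = - int N..int N. nn2 Ma (cell n f)) = ennreal (\<Sum>n = - int N..int N. (nrm (cell n f))^2)" for N
  by (simp add: nn2_eq_l2_norm[OF c] sum_ennreal)
 show "(\<Sum>n = - int N..int N. (nrm (cell n f))^2) <= (l2_norm MR f)^2"
  using le[of N] unfolding eq nn2_eq_l2_norm[OF assms] by (simp add: ennreal_le_iff)
 show "(%N. \<Sum>n = - int N..int N. (nrm (cell n f))^2) \<longlonglongrightarrow> (l2_norm MR f)^2"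
  using lim unfolding eq nn2_eq_l2_norm[OF assms] by (subst (asm) tendsto_ennreal_iff) (auto intro!: always_eventually sum_nonneg)
qed

lemma L2_MR_I:
 assumes f: "f \<in> borel_measurable lebesgue" and c: "!!n. cell n f \<in> L2 Ma"
  and B: "!!N. (\<Sum>n = - int N..int N. (nrm (cell n f))^2) <= B"
 shows "f \<in> L2 MR" "(l2_norm MR f)^2 <= B"
proof -
 have eq: "(\<Sum>n = - int N..int N. nn2 Ma (cell n f)) = ennreal (\<Sum>n = - int N..int N. (nrm (cell n f))^2)" for N
  by (simp add: nn2_eq_l2_norm[OF c] sum_ennreal)
 have "nn2 MR f <= ennreal B"
  by (rule LIMSEQ_le_const2[OF nn2_cells[OF f]]) (use B in \<open>auto simp: eq intro!: ennreal_leI\<close>)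
 then have "nn2 MR f < \<infinity>" by (metis ennreal_less_top infinity_ennreal_def le_less_trans)
 then show L: "f \<in> L2 MR" using f by (simp add: L2_iff_nn2 measurable_MR)
 show "(l2_norm MR f)^2 <= B"
  by (rule LIMSEQ_le_const2[OF L2_MR_cell(3)[OF L]]) (use B in auto)
qed

lemma cells_absolutely_integrable:
 fixes f :: cfun
 assumes f: "!!n::int. (%x. f (x + of_int n * a)) absolutely_integrable_on {0..a}"
 shows "f absolutely_integrable_on {c..d}"
proof -
 have one: "f absolutely_integrable_on {of_int n * a..of_int n * a + a}" for n :: int
  using absolutely_integrable_shift_real[OF f[of n], of "- (of_int n * a)"] by (simp add: add.commute)
 have U: "f absolutely_integrable_on (\<Union>n\<in>{- int N..int N}. {of_int n * a..of_int n * a + a})" for N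
  by (rule set_integrable_UN) (use one in auto)
 obtain N :: nat where N: "real N * a >= max \<bar>c\<bar> \<bar>d\<bar>" using a_pos reals_Archimedean3 less_imp_le by blast
 have "{c..d} <= (\<Union>n\<in>{- int N..int N}. {of_int n * a..of_int n * a + a})"
 proof
  fix x assume "x \<in> {c..d}"
  then have x: "- (real N * a) <= x" "x <= real N * a" using N by auto
  define n where "n = \<lfloor>x / a\<rfloor>"
  have n: "of_int n <= x / a" "x / a < of_int n + 1" unfolding n_def by linarith+
  have "- real N <= x / a" "x / a <= real N" using x a_pos by (simp_all add: field_simps)
  then have "- int N <= n" "n <= int N" unfolding n_def by (simp_all add: le_floor_iff floor_le_iff)
  moreover have "of_int n * a <= x" "x <= of_int n * a + a" using n a_pos by (simp_all add: field_simps)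
  ultimately show "x \<in> (\<Union>n\<in>{- int N..int N}. {of_int n * a..of_int n * a + a})" by auto
 qed
 then show ?thesis by (intro set_integrable_subset[OF U[of N]]) auto
qed

lemma L2_MR_hloc:
 assumes "h \<in> L2 MR"
 shows "hloc h"
 unfolding hloc_def
proof (intro allI)
 fix c d
 show "gg h absolutely_integrable_on {c..d}"
 proof (rule cells_absolutely_integrable)
  fix n :: int
  have "hper (cell n h)" by (rule L2_hper(1)[OF L2_MR_cell(1)[OF assms]])
  then show "(%x. gg h (x + of_int n * a)) absolutely_integrable_on {0..a}"
   by (simp add: hper_def gg_def[abs_def] cell_def cw_def periodic_int)
 qed
qed

lemma op_minus_A_iff:
 "(f, h) \<in> op_minus A z \<longleftrightarrow> f \<in> L2 MR & h \<in> L2 MR & (\<exists>u v. (AE x in MR. f x = u x) & gsol z h u v)"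
proof
 assume "(f, h) \<in> op_minus A z"
 then obtain h' where h: "h = (%x. h' x - z * f x)" "(f, h') \<in> A" by (auto simp: op_minus_def)
 obtain u v where uv: "f \<in> L2 MR" "h' \<in> L2 MR" "AE x in MR. f x = u x" "quasi_derivative_loc u v"
  "AE x in MR. h' x = sl_expr u v x" using h(2) by (auto simp: A_def)
 have hL: "h \<in> L2 MR" unfolding h(1) using uv(1,2) by (intro L2_diff L2_cmult)
 have "AE x in MR. sl_expr u v x = z * u x + h x" using uv(3,5) by eventually_elim (auto simp: h(1))
 then have "gsol z h u v" using gsol_iff[OF L2_MR_hloc[OF hL], of u v z] uv(4) by (simp add: AE_MR)
 then show "f \<in> L2 MR & h \<in> L2 MR & (\<exists>u v. (AE x in MR. f x = u x) & gsol z h u v)" using uv hL by blast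
next
 assume "f \<in> L2 MR & h \<in> L2 MR & (\<exists>u v. (AE x in MR. f x = u x) & gsol z h u v)"
 then obtain u v where uv: "f \<in> L2 MR" "h \<in> L2 MR" "AE x in MR. f x = u x" "gsol z h u v" by blast
 have q: "quasi_derivative_loc u v" "AE x in MR. sl_expr u v x = z * u x + h x"
  using gsol_iff[OF L2_MR_hloc[OF uv(2)], of u v z] uv(4) by (simp_all add: AE_MR)
 have "AE x in MR. h x + z * f x = sl_expr u v x" using q(2) uv(3) by eventually_elim simp
 then have "(f, %x. h x + z * f x) \<in> A" unfolding A_def using uv q by (auto intro!: L2_add L2_cmult)
 then show "(f, h) \<in> op_minus A z" unfolding op_minus_def by force
qed

lemma gsol_cell:
 assumes h: "h \<in> L2 MR" and s: "gsol z h u v" and x: "x \<in> {0..a}"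
 shows "u (x + of_int n * a) = usol z (u (of_int n * a)) (v (of_int n * a)) (cell n h) x"
  "v (x + of_int n * a) = usol' z (u (of_int n * a)) (v (of_int n * a)) (cell n h) x"
proof -
 have "lin_sol 0 a rr (ss z) (gg (cell n h)) (%x. u (x + of_int n * a)) (%x. v (x + of_int n * a))"
  using gsol_sub[OF gsol_shift[OF s, of n], of 0 a] a_pos by (simp add: cell_def)
 from usol_unique[OF L2_hper(1)[OF L2_MR_cell(1)[OF h]] this x]
 show "u (x + of_int n * a) = usol z (u (of_int n * a)) (v (of_int n * a)) (cell n h) x"
  "v (x + of_int n * a) = usol' z (u (of_int n * a)) (v (of_int n * a)) (cell n h) x" by simp_all
qed

end

section \<open>Square summable two-sided sequences and linear recursions\<close>

definition SQ :: "(int => real) => real => bool" where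
 "SQ s B \<longleftrightarrow> (\<forall>N::nat. (\<Sum>n = - int N..int N. (s n)^2) <= B)"

lemma SQ_comb:
 assumes "SQ s B" "SQ t C" "!!n. \<bar>u n\<bar> <= al * \<bar>s n\<bar> + be * \<bar>t n\<bar>"
 shows "SQ u (2 * al^2 * B + 2 * be^2 * C)"
 unfolding SQ_def
proof
 fix N :: nat
 have le: "(u n)^2 <= 2 * al^2 * (s n)^2 + 2 * be^2 * (t n)^2" for n
 proof -
  have "(u n)^2 <= (al * \<bar>s n\<bar> + be * \<bar>t n\<bar>)^2"
   using power_mono[OF assms(3)[of n] abs_ge_zero, of 2] by simp
  also have "... <= 2 * (al * \<bar>s n\<bar>)^2 + 2 * (be * \<bar>t n\<bar>)^2"
   using sum_squares_bound[of "al * \<bar>s n\<bar>" "be * \<bar>t n\<bar>"] by (simp add: power2_sum)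
  finally show ?thesis by (simp add: power_mult_distrib)
 qed
 have "(\<Sum>n = - int N..int N. (u n)^2) <= (\<Sum>n = - int N..int N. 2 * al^2 * (s n)^2 + 2 * be^2 * (t n)^2)"
  by (rule sum_mono) (rule le)
 also have "... = 2 * al^2 * (\<Sum>n = - int N..int N. (s n)^2) + 2 * be^2 * (\<Sum>n = - int N..int N. (t n)^2)"
  by (simp add: sum.distrib sum_distrib_left)
 also have "... <= 2 * al^2 * B + 2 * be^2 * C"
  using assms(1,2) by (intro add_mono mult_left_mono) (auto simp: SQ_def)
 finally show "(\<Sum>n = - int N..int N. (u n)^2) <= 2 * al^2 * B + 2 * be^2 * C" .
qed

lemma SQ_elem:
 assumes "SQ s B"
 shows "(s n)^2 <= B"
proof -
 have "(s n)^2 <= (\<Sum>n = - int (nat \<bar>n\<bar>)..int (nat \<bar>n\<bar>). (s n)^2)" by (rule member_le_sum) auto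
 also have "... <= B" using assms unfolding SQ_def by blast
 finally show ?thesis .
qed

lemma SQ_uminus: "SQ s B ==> SQ (%n. s (- n)) B"
 unfolding SQ_def
proof
 fix N :: nat assume a: "\<forall>N::nat. (\<Sum>n = - int N..int N. (s n)^2) <= B"
 have "(\<Sum>n = - int N..int N. (s (- n))^2) = (\<Sum>n = - int N..int N. (s n)^2)"
  by (rule sum.reindex_bij_witness[of _ uminus uminus]) auto
 then show "(\<Sum>n = - int N..int N. (s (- n))^2) <= B" using a by simp
qed

lemma SQ_shift: "SQ s B ==> SQ (%n. s (n + k)) B"
 unfolding SQ_def
proof
 fix N :: nat assume a: "\<forall>N::nat. (\<Sum>n = - int N..int N. (s n)^2) <= B"
 have "(\<Sum>n = - int N..int N. (s (n + k))^2) = (\<Sum>n = - int N + k..int N + k. (s n)^2)"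
  by (rule sum.reindex_bij_witness[of _ "%n. n - k" "%n. n + k"]) auto
 also have "... <= (\<Sum>n = - int (N + nat \<bar>k\<bar>)..int (N + nat \<bar>k\<bar>). (s n)^2)"
  by (rule sum_mono2) auto
 finally show "(\<Sum>n = - int N..int N. (s (n + k))^2) <= B" using a order_trans by blast
qed

text \<open>Squaring the recursion with suitable weights leaves the factor \<open>r < 1\<close> in
  front of the square of \<open>et n\<close>, so that summation lets the left-hand side absorb all
  but one boundary term.\<close>

lemma contraction_recursion_step:
 fixes et be :: "int => complex"
 assumes r: "norm rh = r" "0 < r" "r < 1" and rec: "!!n. et (n + 1) = rh * (et n + be n)"
 shows "(1 - r) * (\<Sum>n = - int N..int N. (norm (et n))^2)
  <= (norm (et (- int N)))^2 + r^2 / (1 - r) * (\<Sum>n = - int N..int N. (norm (be n))^2)"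
proof -
 have step: "(norm (et (n + 1)))^2 <= r * (norm (et n))^2 + r^2 / (1 - r) * (norm (be n))^2" for n
 proof -
  define x y where "x = norm (et n)" and "y = norm (be n)"
  have "norm (et (n + 1)) <= r * (x + y)"
   using r(2) norm_triangle_ineq[of "et n" "be n"] by (simp add: rec norm_mult r(1) x_def y_def)
  then have "(norm (et (n + 1)))^2 <= (r * (x + y))^2" by (rule power_mono) simp
  also have "... <= r * x^2 + r^2 / (1 - r) * y^2"
  proof -
   \<comment> \<open>The weighted inequality \<open>(x + y)^2 <= x^2 / r + y^2 / (1 - r)\<close>,
     written with the square that makes it an equality.\<close>
   have "(1 - r) * (r * (x + y))^2 + r * ((1 - r) * x - r * y)^2 = (1 - r) * (r * x^2) + r^2 * y^2"
    by (simp add: power2_eq_square algebra_simps)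
   then have "(1 - r) * (r * (x + y))^2 <= (1 - r) * (r * x^2) + r^2 * y^2"
    using r(2) zero_le_power2[of "(1 - r) * x - r * y"] by (smt (verit) mult_nonneg_nonneg)
   also have "... = (1 - r) * (r * x^2 + r^2 / (1 - r) * y^2)" using r(3) by (simp add: field_simps)
   finally show ?thesis using r(3) by simp
  qed
  finally show ?thesis by (simp add: x_def y_def)
 qed
 have "(\<Sum>n = - int N..int N. (norm (et (n + 1)))^2)
  <= (\<Sum>n = - int N..int N. r * (norm (et n))^2 + r^2 / (1 - r) * (norm (be n))^2)" by (rule sum_mono) (rule step)
 also have "... = r * (\<Sum>n = - int N..int N. (norm (et n))^2) + r^2 / (1 - r) * (\<Sum>n = - int N..int N. (norm (be n))^2)"
  by (simp add: sum.distrib sum_distrib_left)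
 finally have 1: "(\<Sum>n = - int N..int N. (norm (et (n + 1)))^2) <= ..." .
 have "(\<Sum>n = - int N..int N. (norm (et (n + 1)))^2) = (\<Sum>n = - int N + 1..int N + 1. (norm (et n))^2)"
  by (rule sum.reindex_bij_witness[of _ "%n. n - 1" "%n. n + 1"]) auto
 moreover have "(\<Sum>n = - int N..int N. (norm (et n))^2) <= (\<Sum>n\<in>insert (- int N) {- int N + 1..int N + 1}. (norm (et n))^2)"
  by (rule sum_mono2) auto
 moreover have "(\<Sum>n\<in>insert (- int N) {- int N + 1..int N + 1}. (norm (et n))^2)
  = (norm (et (- int N)))^2 + (\<Sum>n = - int N + 1..int N + 1. (norm (et n))^2)" by (subst sum.insert) auto
 ultimately show ?thesis using 1 by (simp add: algebra_simps)
qed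

text \<open>The mere existence of the bound \<open>S\<close> makes the boundary term
  \<open>et (- N)\<close> tend to 0, and the resulting bound no longer contains \<open>S\<close>.
  This is the a priori estimate behind the boundedness of the resolvent on the line.\<close>

lemma contraction_recursion_bound:
 fixes et be :: "int => complex"
 assumes r: "norm rh = r" "0 < r" "r < 1" and rec: "!!n. et (n + 1) = rh * (et n + be n)"
  and S: "SQ (%n. norm (et n)) S" and B: "SQ (%n. norm (be n)) B"
 shows "SQ (%n. norm (et n)) (r^2 / (1 - r)^2 * B)"
 unfolding SQ_def
proof
 fix N :: nat
 have "summable (%m. (norm (et (- int m)))^2)"
 proof (rule bounded_imp_summable)
  fix K
  have "(\<Sum>m\<le>K. (norm (et (- int m)))^2) = (\<Sum>n\<in>(%m. - int m) ` {..K}. (norm (et n))^2)"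
   by (subst sum.reindex) (auto simp: inj_on_def)
  also have "... <= (\<Sum>n = - int K..int K. (norm (et n))^2)" by (rule sum_mono2) auto
  also have "... <= S" using S by (simp add: SQ_def)
  finally show "(\<Sum>m\<le>K. (norm (et (- int m)))^2) <= S" .
 qed simp
 then have lim: "(%m. (norm (et (- int m)))^2) \<longlonglongrightarrow> 0" by (rule summable_LIMSEQ_zero)
 have *: "(1 - r) * (\<Sum>n = - int N..int N. (norm (et n))^2) <= 0 + r^2 / (1 - r) * B"
 proof (rule LIMSEQ_le_const[OF tendsto_add[OF lim tendsto_const]], intro exI[of _ N] allI impI)
  fix m assume "N <= m"
  then have "(1 - r) * (\<Sum>n = - int N..int N. (norm (et n))^2) <= (1 - r) * (\<Sum>n = - int m..int m. (norm (et n))^2)"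
   using r(3) by (intro mult_left_mono sum_mono2) auto
  also have "... <= (norm (et (- int m)))^2 + r^2 / (1 - r) * (\<Sum>n = - int m..int m. (norm (be n))^2)"
   by (rule contraction_recursion_step[where et = et and be = be, OF r rec])
  also have "... <= (norm (et (- int m)))^2 + r^2 / (1 - r) * B"
   using B r by (intro add_left_mono mult_left_mono) (auto simp: SQ_def)
  finally show "(1 - r) * (\<Sum>n = - int N..int N. (norm (et n))^2) <= (norm (et (- int m)))^2 + r^2 / (1 - r) * B" .
 qed
 show "(\<Sum>n = - int N..int N. (norm (et n))^2) <= r^2 / (1 - r)^2 * B"
 proof -
  have "r^2 / (1 - r)^2 * B = (r^2 / (1 - r) * B) / (1 - r)" by (simp add: power2_eq_square[of "1 - r"])
  moreover have "(\<Sum>n = - int N..int N. (norm (et n))^2) <= (r^2 / (1 - r) * B) / (1 - r)"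
   using r(3) * by (subst pos_le_divide_eq) (simp_all add: mult.commute)
  ultimately show ?thesis by (simp only:)
 qed
qed

text \<open>The solution that stays bounded at minus infinity: the recursion is unrolled backwards
  into a series dominated by a geometric one.\<close>

lemma contraction_recursion_exists:
 fixes be :: "int => complex"
 assumes r: "norm rh = r" "0 < r" "r < 1" and B: "SQ (%n. norm (be n)) B"
 obtains et S where "!!n. et (n + 1) = rh * (et n + be n)" "SQ (%n. norm (et n)) S"
proof -
 define et where "et = (%n::int. \<Sum>j. rh ^ Suc j * be (n - 1 - int j))"
 have b: "norm (be n) <= sqrt B" for n using SQ_elem[OF B, of n] by (simp add: real_le_rsqrt)
 have bd: "norm (rh ^ Suc j * be (n - 1 - int j)) <= r ^ Suc j * sqrt B" for n j
  unfolding norm_mult norm_power r(1) using b r(2) by (intro mult_left_mono) auto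
 have sg: "summable (%j. r ^ Suc j * sqrt B)"
  using r by (intro summable_mult2) (subst summable_Suc_iff, simp add: summable_geometric)
 have sm: "summable (%j. rh ^ Suc j * be (n - 1 - int j))" for n
  by (rule summable_comparison_test'[OF sg, of 0]) (rule bd)
 have rec: "et (n + 1) = rh * (et n + be n)" for n
 proof -
  have "et (n + 1) = (\<Sum>j. rh ^ Suc (Suc j) * be (n + 1 - 1 - int (Suc j))) + rh ^ Suc 0 * be (n + 1 - 1 - int 0)"
   unfolding et_def using suminf_split_head[OF sm[of "n + 1"]] by simp
  also have "(\<Sum>j. rh ^ Suc (Suc j) * be (n + 1 - 1 - int (Suc j))) = (\<Sum>j. rh * (rh ^ Suc j * be (n - 1 - int j)))"
   by (intro arg_cong[of _ _ suminf] ext) (simp add: algebra_simps)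
  also have "... = rh * et n" unfolding et_def by (rule suminf_mult[OF sm])
  finally show ?thesis by (simp add: algebra_simps)
 qed
 define C where "C = (\<Sum>j. r ^ Suc j * sqrt B)"
 have etC: "norm (et n) <= C" for n
 proof -
  have sn: "summable (%j. norm (rh ^ Suc j * be (n - 1 - int j)))"
   by (rule summable_comparison_test'[OF sg, of 0]) (use bd in auto)
  have "norm (et n) <= (\<Sum>j. norm (rh ^ Suc j * be (n - 1 - int j)))" unfolding et_def by (rule summable_norm[OF sn])
  also have "... <= C" unfolding C_def by (rule suminf_le[OF bd sn sg])
  finally show ?thesis .
 qed
 have "SQ (%n. norm (et n)) ((C^2 + r^2 / (1 - r) * B) / (1 - r))"
  unfolding SQ_def
 proof
  fix N :: nat
  have "(1 - r) * (\<Sum>n = - int N..int N. (norm (et n))^2)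
   <= (norm (et (- int N)))^2 + r^2 / (1 - r) * (\<Sum>n = - int N..int N. (norm (be n))^2)"
   by (rule contraction_recursion_step[where et = et and be = be, OF r rec])
  also have "... <= C^2 + r^2 / (1 - r) * B"
   using B r etC by (intro add_mono mult_left_mono power_mono) (auto simp: SQ_def)
  finally show "(\<Sum>n = - int N..int N. (norm (et n))^2) <= (C^2 + r^2 / (1 - r) * B) / (1 - r)"
   using r(3) by (subst pos_le_divide_eq) (simp_all add: mult.commute)
 qed
 then show ?thesis using that rec by blast
qed

text \<open>The roots of \<open>X^2 - d * X + 1\<close> have product 1. If one had modulus 1, the
  other would be its conjugate and \<open>d\<close> would be twice its real part, hence in
  [-2, 2].\<close>

lemma eigenvalue_inside:
 fixes d :: complex
 assumes "~ (\<exists>x::real. - 2 <= x & x <= 2 & d = of_real x)"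
 obtains rh rh' where "rh * rh' = 1" "rh + rh' = d" "0 < norm rh" "norm rh < 1"
proof -
 define s where "s = csqrt (d^2 - 4)"
 have s2: "s * s = d^2 - 4" by (simp add: s_def flip: power2_eq_square)
 define x y where "x = (d + s) / 2" and "y = (d - s) / 2"
 have xy: "x * y = 1" "x + y = d" using s2 by (simp_all add: x_def y_def field_simps power2_eq_square)
 have n: "norm x * norm y = 1" using xy(1) by (metis norm_mult norm_one)
 have "norm x ~= 1"
 proof
  assume "norm x = 1"
  then have "x * cnj x = 1" by (simp add: complex_norm_square[symmetric])
  then have "y = cnj x" using xy(1) by (metis mult.assoc mult.commute mult.right_neutral)
  then have "d = of_real (2 * Re x)" using xy(2) by (simp add: complex_eq_iff)
  moreover have "\<bar>Re x\<bar> <= 1" using abs_Re_le_cmod[of x] \<open>norm x = 1\<close> by simp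
  ultimately have "- 2 <= 2 * Re x" "2 * Re x <= 2" "d = of_real (2 * Re x)" by (simp_all add: abs_le_iff)
  then show False using assms by blast
 qed
 then consider "norm x < 1" | "norm x > 1" by linarith
 then show ?thesis
 proof cases
  case 1
  moreover have "norm x > 0" using n by (metis less_numeral_extra(1) mult_zero_left norm_ge_zero order_less_le)
  ultimately show ?thesis using that[of x y] xy by auto
 next
  case 2
  have "norm y > 0" using n by (metis less_numeral_extra(1) mult_zero_right norm_ge_zero order_less_le)
  moreover have "norm y < 1"
  proof (rule ccontr)
   assume "~ norm y < 1"
   then have "1 * 1 < norm x * norm y" using 2 by (intro mult_less_le_imp_less) auto
   then show False using n by simp
  qed
  ultimately show ?thesis using that[of y x] xy by (auto simp: mult.commute add.commute)
 qed
qed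

text \<open>Determinant 1 and trace in [-2, 2] make both eigenvalues unimodular. For a left
  eigenvector \<open>l\<close> the coordinate \<open>l1 * y1 + l2 * y2\<close> keeps its modulus
  along the orbit and tends to 0, so it vanishes; on the remaining line the step is multiplication
  by the other eigenvalue, and the same argument applies.\<close>

lemma orbit_tends_zero:
 fixes m11 m12 m21 m22 :: complex and y1 y2 :: "nat => complex"
 assumes det: "m11 * m22 - m12 * m21 = 1" and tr: "m11 + m22 = of_real x" "- 2 <= x" "x <= 2"
  and rec: "!!n. y1 (Suc n) = m11 * y1 n + m12 * y2 n" "!!n. y2 (Suc n) = m21 * y1 n + m22 * y2 n"
  and lim: "y1 \<longlonglongrightarrow> 0" "y2 \<longlonglongrightarrow> 0"
 shows "y1 0 = 0" "y2 0 = 0"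
proof -
 define t where "t = arccos (x / 2)"
 define e e' where "e = cis t" and "e' = cis (- t)"
 have ee: "e * e' = 1" "norm e = 1" "norm e' = 1" by (simp_all add: e_def e'_def cis_mult)
 have esum: "e + e' = m11 + m22" using tr by (simp add: e_def e'_def complex_eq_iff t_def)
 have const: "c = 0" if "!!n. s (Suc n) = k * s n" "norm k = 1" "s \<longlonglongrightarrow> 0" "c = s 0" for s :: "nat => complex" and k c
 proof -
  have "norm (s n) = norm (s 0)" for n by (induction n) (use that in \<open>auto simp: norm_mult\<close>)
  then have eq: "(%n. norm (s n)) = (%_. norm (s 0))" by (intro ext)
  then have "(%n. norm (s 0)) \<longlonglongrightarrow> 0" using tendsto_norm[OF that(3)] unfolding eq by simp
  then have "norm (s 0) = 0" by (simp only: LIMSEQ_const_iff)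
  then show ?thesis using that(4) by simp
 qed
 have "(m11 - e) * (m22 - e) = m21 * m12" using det ee(1) esum by algebra
 then obtain l1 l2 where l: "l1 ~= 0 \<or> l2 ~= 0" "m11 * l1 + m21 * l2 = e * l1" "m12 * l1 + m22 * l2 = e * l2"
  by (rule twobytwo_eigenvector)
 have l0: "l1 * y1 n + l2 * y2 n = 0" for n
 proof (rule const[of "%k. l1 * y1 (n + k) + l2 * y2 (n + k)" e])
  fix k
  show "l1 * y1 (n + Suc k) + l2 * y2 (n + Suc k) = e * (l1 * y1 (n + k) + l2 * y2 (n + k))"
   using l(2,3) unfolding add_Suc_right rec by algebra
  have "(%k. l1 * y1 (k + n) + l2 * y2 (k + n)) \<longlonglongrightarrow> l1 * 0 + l2 * 0"
   by (intro tendsto_intros LIMSEQ_ignore_initial_segment lim)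
  then show "(%k. l1 * y1 (n + k) + l2 * y2 (n + k)) \<longlonglongrightarrow> 0" by (simp add: add.commute)
 qed (use ee in auto)
 show "y1 0 = 0"
 proof (cases "l2 = 0")
  case True
  then show ?thesis using l0[of 0] l(1) by auto
 next
  case False
  have "y1 (Suc n) = e' * y1 n" for n
  proof -
   have "l2 * y1 (Suc n) = l2 * (e' * y1 n)" using l0[of n] l(3) esum rec(1)[of n] by algebra
   then show ?thesis using False by simp
  qed
  then show ?thesis by (rule const[OF _ ee(3) lim(1)]) simp
 qed
 show "y2 0 = 0"
 proof (cases "l1 = 0")
  case True
  then show ?thesis using l0[of 0] l(1) by auto
 next
  case False
  have "y2 (Suc n) = e' * y2 n" for n
  proof -
   have "l1 * y2 (Suc n) = l1 * (e' * y2 n)" using l0[of n] l(2) esum rec(2)[of n] by algebra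
   then show ?thesis using False by simp
  qed
  then show ?thesis by (rule const[OF _ ee(3) lim(2)]) simp
 qed
qed

lemma int_two_way_induct:
 assumes "P (0::int)" "!!n. P n ==> P (n + 1)" "!!n. P (n + 1) ==> P n"
 shows "P n"
proof (induction n rule: int_induct[of _ 0])
 case (step2 i)
 then show ?case using assms(3)[of "i - 1"] by simp
qed (use assms in auto)

section \<open>The spectrum on the line is the set where D lies in [-2, 2]\<close>

context periodic_SL
begin

lemma gsol_continuous:
 assumes "gsol z h u v"
 shows "continuous_on UNIV u"
proof -
 have "isCont u x" for x
 proof -
  have "continuous_on {x - 1..x + 1} u" using lin_solD(1)[OF gsol_sub[OF assms, of "x - 1" "x + 1"]] by simp
  then show ?thesis by (rule continuous_on_interior) auto
 qed
 then show ?thesis by (simp add: continuous_on_eq_continuous_at)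
qed

lemma gsol_measurable: "gsol z h u v ==> u \<in> borel_measurable lebesgue"
 by (intro measurable_completion) (simp add: borel_measurable_continuous_onI gsol_continuous)

lemma gsol_step:
 assumes h: "h \<in> L2 MR" and s: "gsol z h u v"
 shows "u (of_int (n + 1) * a) = phi z a * (u (of_int n * a) + I1 z (cell n h) a) + psi z a * (v (of_int n * a) + - I0 z (cell n h) a)"
  "v (of_int (n + 1) * a) = p_phi' z a * (u (of_int n * a) + I1 z (cell n h) a) + p_psi' z a * (v (of_int n * a) + - I0 z (cell n h) a)"
proof -
 have "a + of_int n * a = of_int (n + 1) * a" by (simp add: algebra_simps)
 then show "u (of_int (n + 1) * a) = phi z a * (u (of_int n * a) + I1 z (cell n h) a) + psi z a * (v (of_int n * a) + - I0 z (cell n h) a)"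
  "v (of_int (n + 1) * a) = p_phi' z a * (u (of_int n * a) + I1 z (cell n h) a) + p_psi' z a * (v (of_int n * a) + - I0 z (cell n h) a)"
  using gsol_cell[OF h s, of a n] a_pos by (simp_all add: usol_def usol'_def)
qed

lemma cell_gsol:
 assumes h: "h \<in> L2 MR" and s: "gsol z h u v"
 shows "nrm (cell n u) = nrm (usol z (u (of_int n * a)) (v (of_int n * a)) (cell n h))" "cell n u \<in> L2 Ma"
proof -
 have hp: "hper (cell n h)" by (rule L2_hper(1)[OF L2_MR_cell(1)[OF h]])
 have e: "cell n u x = usol z (u (of_int n * a)) (v (of_int n * a)) (cell n h) x" if "x \<in> {0<..<a}" for x
  using gsol_cell(1)[OF h s, of x n] that by (simp add: cell_def)
 have "AE x in Ma. cell n u x = usol z (u (of_int n * a)) (v (of_int n * a)) (cell n h) x"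
  using AE_space[of Ma] by eventually_elim (use e in \<open>auto simp: space_Ma\<close>)
 then show "nrm (cell n u) = nrm (usol z (u (of_int n * a)) (v (of_int n * a)) (cell n h))"
  by (rule l2_norm_cong_AE) (use cell_measurable[OF gsol_measurable[OF s]] usol_L2[OF hp] in \<open>auto simp: L2D\<close>)
 have c: "continuous_on {0..a} (cell n u)" unfolding cell_def
  by (intro continuous_on_compose2[OF gsol_continuous[OF s]] continuous_intros) auto
 then show "cell n u \<in> L2 Ma" by (rule continuous_L2)
qed

text \<open>On a cell, \<open>u\<close> is a combination of \<open>phi\<close> and
  \<open>psi\<close>, with the data at the left end as coefficients, plus a part controlled by
  \<open>h\<close>. Pairing with the functions of \<open>biorthogonal\<close> isolates each
  coefficient. The constant is the same for all cells, so square summability passes from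
  \<open>u\<close> to its data.\<close>

lemma cell_data_bound:
 obtains C where "C >= 0" "!!h u v n. h \<in> L2 MR ==> gsol z h u v ==>
  norm (u (of_int n * a)) <= C * nrm (cell n u) + C * nrm (cell n h) &
  norm (v (of_int n * a)) <= C * nrm (cell n u) + C * nrm (cell n h)"
proof -
 obtain k1 k2 where k: "continuous_on {0..a} k1" "continuous_on {0..a} k2"
  "l2_inner Ma (phi z) k1 = 1" "l2_inner Ma (psi z) k1 = 0"
  "l2_inner Ma (phi z) k2 = 0" "l2_inner Ma (psi z) k2 = 1" by (rule biorthogonal[of z])
 have kL: "k1 \<in> L2 Ma" "k2 \<in> L2 Ma" using k(1,2) by (auto intro: continuous_L2)
 define K where "K = max (nrm k1) (nrm k2)"
 have K0: "K >= 0" by (simp add: K_def le_max_iff_disj)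
 define R where "R = norm z"
 define Q where "Q = cB R * sqrt Wn * sqrt Wn"
 have Q0: "Q >= 0" using cB_pos[of R] Wn_nonneg by (simp add: Q_def)
 define C where "C = K * (1 + Q)"
 have CK: "K <= C" "K * Q <= C" "C >= 0" using K0 Q0 by (simp_all add: C_def algebra_simps)
 show ?thesis
 proof (rule that[OF CK(3)])
  fix h u v n assume h: "h \<in> L2 MR" and s: "gsol z h u v"
  define hn where "hn = cell n h"
  have hL: "hn \<in> L2 Ma" unfolding hn_def by (rule L2_MR_cell(1)[OF h])
  note hp = L2_hper[OF hL]
  define y1 y2 where "y1 = u (of_int n * a)" and "y2 = v (of_int n * a)"
  define U where "U = usol z y1 y2 hn"
  have UL: "U \<in> L2 Ma" "usol z 0 0 hn \<in> L2 Ma" unfolding U_def by (intro usol_L2 hp)+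
  have nU: "nrm U = nrm (cell n u)" using cell_gsol(1)[OF h s, of n] by (simp add: U_def y1_def y2_def hn_def)
  have Ueq: "U = (%x. 1 * (y1 * phi z x + y2 * psi z x) + 1 * usol z 0 0 hn x)" by (auto simp: U_def usol_def algebra_simps)
  have ip: "l2_inner Ma U k = y1 * l2_inner Ma (phi z) k + y2 * l2_inner Ma (psi z) k + l2_inner Ma (usol z 0 0 hn) k" if "k \<in> L2 Ma" for k
   unfolding Ueq using that
   by (subst l2_inner_comb[OF _ UL(2)], intro L2_add L2_cmult phi_L2 psi_L2, assumption, subst l2_inner_comb[OF phi_L2 psi_L2], assumption, simp)
  have n0: "nrm (usol z 0 0 hn) <= Q * nrm hn"
  proof -
   have "nrm (usol z 0 0 hn) <= cB R * (norm (0::complex) + norm (0::complex) + gn hn) * sqrt Wn"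
    by (rule usol_l2_bound[OF hp(1)]) (simp add: R_def)
   also have "... <= cB R * (sqrt Wn * nrm hn) * sqrt Wn"
    using hp(2) cB_pos[of R] Wn_nonneg by (intro mult_right_mono mult_left_mono) auto
   finally show ?thesis by (simp add: Q_def ac_simps)
  qed
  have bd: "norm y <= C * nrm (cell n u) + C * nrm hn"
   if "l2_inner Ma U k = y + l2_inner Ma (usol z 0 0 hn) k" "k \<in> L2 Ma" "nrm k <= K" for y k
  proof -
   have "norm y = norm (l2_inner Ma U k - l2_inner Ma (usol z 0 0 hn) k)" using that(1) by simp
   also have "... <= norm (l2_inner Ma U k) + norm (l2_inner Ma (usol z 0 0 hn) k)" by (rule norm_triangle_ineq4)
   also have "... <= nrm U * nrm k + nrm (usol z 0 0 hn) * nrm k"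
    by (intro add_mono l2_inner_bound UL that)
   also have "... <= nrm U * K + (Q * nrm hn) * K"
    using that(3) n0 Q0 by (intro add_mono mult_mono) auto
   also have "... <= C * nrm U + C * nrm hn"
    using mult_right_mono[OF CK(1), of "nrm U"] mult_right_mono[OF CK(2), of "nrm hn"] by (simp add: ac_simps)
   finally show ?thesis by (simp add: nU)
  qed
  show "norm (u (of_int n * a)) <= C * nrm (cell n u) + C * nrm (cell n h) &
  norm (v (of_int n * a)) <= C * nrm (cell n u) + C * nrm (cell n h)"
   using bd[of k1 y1] bd[of k2 y2] ip[OF kL(1)] ip[OF kL(2)] k kL by (simp add: K_def y1_def y2_def hn_def)
 qed
qed

lemma SQ_cell: "f \<in> L2 MR ==> SQ (%n. nrm (cell n f)) ((l2_norm MR f)^2)"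
 unfolding SQ_def using L2_MR_cell(2) by blast

text \<open>If \<open>D z\<close> is not in [-2, 2], the monodromy matrix has one eigenvalue inside
  and one outside the unit circle. In the coordinates given by left eigenvectors the data at the
  points n a obey two scalar recursions, one contracting to the right and one contracting when read
  from right to left. Their square summable solutions yield existence and boundedness of the
  resolvent.\<close>

lemma spectrum_in_band:
 assumes "z \<in> op_spectrum MR A"
 obtains x :: real where "- 2 <= x" "x <= 2" "D z = of_real x"
proof (rule ccontr)
 assume "~ thesis"
 then have nb: "~ (\<exists>x::real. - 2 <= x & x <= 2 & D z = of_real x)" using that by blast
 obtain rh rh' where rh: "rh * rh' = 1" "rh + rh' = D z" "0 < norm rh" "norm rh < 1" by (rule eigenvalue_inside[OF nb])
 define r where "r = norm rh"
 have r: "norm rh = r" "0 < r" "r < 1" using rh by (simp_all add: r_def)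
 have ne: "rh ~= rh'"
 proof
  assume "rh = rh'"
  then have "norm rh * norm rh = 1" using rh(1) by (metis norm_mult norm_one)
  then show False using mult_strict_mono[of "norm rh" 1 "norm rh" 1] rh(3,4) by simp
 qed
 note M = det_a[of z]
 define m11 m12 m21 m22 where "m11 = phi z a" and "m12 = psi z a" and "m21 = p_phi' z a" and "m22 = p_psi' z a"
 have det: "m11 * m22 - m12 * m21 = 1" using M by (simp add: m11_def m12_def m21_def m22_def)
 have tr: "rh + rh' = m11 + m22" using rh(2) by (simp add: D_def m11_def m22_def)
 have "(m11 - rh) * (m22 - rh) = m21 * m12" using det rh(1) tr by algebra
 then obtain l1 l2 where l: "l1 ~= 0 \<or> l2 ~= 0" "m11 * l1 + m21 * l2 = rh * l1" "m12 * l1 + m22 * l2 = rh * l2"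
  by (rule twobytwo_eigenvector)
 have "(m11 - rh') * (m22 - rh') = m21 * m12" using det rh(1) tr by algebra
 then obtain k1 k2 where k: "k1 ~= 0 \<or> k2 ~= 0" "m11 * k1 + m21 * k2 = rh' * k1" "m12 * k1 + m22 * k2 = rh' * k2"
  by (rule twobytwo_eigenvector)
 \<comment> \<open>The determinant of the two left eigenvectors, by which the data are recovered
   from the coordinates; it is nonzero because the eigenvalues differ.\<close>
 define de where "de = l1 * k2 - l2 * k1"
 have de: "de ~= 0"
 proof
  assume d0: "de = 0"
  have "(rh - rh') * (l1 * k1) = 0" "(rh - rh') * (l2 * k2) = 0" using d0 l(2,3) k(2,3) unfolding de_def by algebra+
  then have "l1 * k1 = 0" "l2 * k2 = 0" using ne by auto
  then show False using d0 l(1) k(1) unfolding de_def by auto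
 qed
 define b1 b2 where "b1 = (%h n. I1 z (cell n h) a)" and "b2 = (%h n. - I0 z (cell n h) a)"
 define R where "R = norm z"
 define Cb where "Cb = (cB R)^2 * sqrt Wn"
 have b: "norm (b1 h n) <= Cb * nrm (cell n h)" "norm (b2 h n) <= Cb * nrm (cell n h)" if "h \<in> L2 MR" for h n
 proof -
  note hp = L2_hper[OF L2_MR_cell(1)[OF that, of n]]
  have "(cB R)^2 * gn (cell n h) <= Cb * nrm (cell n h)"
   unfolding Cb_def mult.assoc using hp(2) by (intro mult_left_mono) auto
  then show "norm (b1 h n) <= Cb * nrm (cell n h)" "norm (b2 h n) <= Cb * nrm (cell n h)"
   using I01_bound[of z R "cell n h"] hp(1) by (auto simp: b1_def b2_def R_def)
 qed
 define Lam where "Lam = norm l1 + norm l2 + norm k1 + norm k2"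
 have Lam: "norm l1 <= Lam" "norm l2 <= Lam" "norm k1 <= Lam" "norm k2 <= Lam" by (simp_all add: Lam_def)
 have lin: "norm (c1 * x1 + c2 * x2) <= Lam * \<bar>norm x1\<bar> + Lam * \<bar>norm x2\<bar>" if "norm c1 <= Lam" "norm c2 <= Lam" for c1 c2 x1 x2 :: complex
 proof -
  have "norm (c1 * x1 + c2 * x2) <= norm c1 * norm x1 + norm c2 * norm x2" by (metis norm_mult norm_triangle_ineq)
  also have "... <= Lam * norm x1 + Lam * norm x2" using that by (intro add_mono mult_right_mono) auto
  finally show ?thesis by simp
 qed
 define Kb where "Kb = 2 * Cb^2 + 2 * 0^2"
 define Kbe where "Kbe = 2 * Lam^2 * Kb + 2 * Lam^2 * Kb"
 define bel bek where "bel = (%h n. l1 * b1 h n + l2 * b2 h n)" and "bek = (%h n. k1 * b1 h n + k2 * b2 h n)"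
 have SQb: "SQ (%n. norm (b1 h n)) (Kb * (l2_norm MR h)^2)" "SQ (%n. norm (b2 h n)) (Kb * (l2_norm MR h)^2)" if "h \<in> L2 MR" for h
  using SQ_comb[OF SQ_cell[OF that] SQ_cell[OF that], of "%n. norm (b1 h n)" Cb 0]
   SQ_comb[OF SQ_cell[OF that] SQ_cell[OF that], of "%n. norm (b2 h n)" Cb 0] b[OF that] by (simp_all add: Kb_def)
 have SQbe: "SQ (%n. norm (bel h n)) (Kbe * (l2_norm MR h)^2)" "SQ (%n. norm (bek h n)) (Kbe * (l2_norm MR h)^2)" if "h \<in> L2 MR" for h
 proof -
  have e: "Kbe * (l2_norm MR h)^2 = 2 * Lam^2 * (Kb * (l2_norm MR h)^2) + 2 * Lam^2 * (Kb * (l2_norm MR h)^2)" by (simp add: Kbe_def algebra_simps)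
  show "SQ (%n. norm (bel h n)) (Kbe * (l2_norm MR h)^2)" "SQ (%n. norm (bek h n)) (Kbe * (l2_norm MR h)^2)"
   unfolding bel_def bek_def e by - (rule SQ_comb[OF SQb[OF that]], simp only: abs_norm_cancel, rule lin[unfolded abs_norm_cancel]; rule Lam)+
 qed
 \<comment> \<open>The inhomogeneity of the second recursion after the reversal
   \<open>m = - n\<close>: solved for the left neighbour, the factor \<open>rh'\<close> turns into
   \<open>rh\<close>. The shift by 1 is there because the step concerned leads from
   \<open>- m - 1\<close> to \<open>- m\<close>.\<close>
 define ga where "ga = (%h m. - bek h (- m - 1) / rh)"
 define Kga where "Kga = 2 * (1 / r)^2 * Kbe + 2 * 0^2 * Kbe"
 have SQga: "SQ (%n. norm (ga h n)) (Kga * (l2_norm MR h)^2)" if "h \<in> L2 MR" for h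
 proof -
  have s: "SQ (%n. norm (bek h (- n - 1))) (Kbe * (l2_norm MR h)^2)"
   using SQ_uminus[OF SQ_shift[OF SQbe(2)[OF that], of "- 1"]] by simp
  show ?thesis using SQ_comb[OF s s, of "%n. norm (ga h n)" "1 / r" 0] r(2) by (simp add: ga_def norm_divide r(1) Kga_def algebra_simps)
 qed
 define ca where "ca = r^2 / (1 - r)^2"
 have y_of: "y1 = (k2 * (l1 * y1 + l2 * y2) - l2 * (k1 * y1 + k2 * y2)) / de" "y2 = (l1 * (k1 * y1 + k2 * y2) - k1 * (l1 * y1 + l2 * y2)) / de" for y1 y2
  using de by (simp_all add: de_def field_simps)
 define Y where "Y = 2 * (Lam / norm de)^2 * (ca * Kbe) + 2 * (Lam / norm de)^2 * (ca * Kga)"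
 have rec_l: "l1 * Y1 + l2 * Y2 = rh * ((l1 * y1 + l2 * y2) + (l1 * c1 + l2 * c2))"
  and rec_k: "k1 * Y1 + k2 * Y2 = rh' * ((k1 * y1 + k2 * y2) + (k1 * c1 + k2 * c2))"
  if "Y1 = m11 * (y1 + c1) + m12 * (y2 + c2)" "Y2 = m21 * (y1 + c1) + m22 * (y2 + c2)" for Y1 Y2 y1 y2 c1 c2
  using that l(2,3) k(2,3) by algebra+
 define CU where "CU = cB R * sqrt Wn"
 have CU0: "CU >= 0" using cB_pos[of R] Wn_nonneg by (simp add: CU_def)
 define KU where "KU = 2 * CU^2 * (2 * 1^2 * Y + 2 * 1^2 * Y) + 2 * (CU * sqrt Wn)^2"
 have cell_u: "\<bar>nrm (cell n u)\<bar> <= CU * \<bar>norm (u (of_int n * a)) + norm (v (of_int n * a))\<bar> + (CU * sqrt Wn) * \<bar>nrm (cell n h)\<bar>"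
  if h: "h \<in> L2 MR" and s: "gsol z h u v" for h u v n
 proof -
  note hp = L2_hper[OF L2_MR_cell(1)[OF h, of n]]
  have "nrm (cell n u) <= cB R * (norm (u (of_int n * a)) + norm (v (of_int n * a)) + gn (cell n h)) * sqrt Wn"
   unfolding cell_gsol(1)[OF h s] by (rule usol_l2_bound[OF hp(1)]) (simp add: R_def)
  also have "... = CU * (norm (u (of_int n * a)) + norm (v (of_int n * a))) + CU * gn (cell n h)" by (simp add: CU_def algebra_simps)
  also have "CU * gn (cell n h) <= CU * (sqrt Wn * nrm (cell n h))" using hp(2) CU0 by (intro mult_left_mono)
  finally show ?thesis by (simp add: mult.assoc)
 qed
 \<comment> \<open>The a priori estimate: some \<open>S\<close> has to exist, but \<open>KU\<close>
   does not involve it.\<close>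
 have bound_u: "(l2_norm MR u)^2 <= KU * (l2_norm MR h)^2 & u \<in> L2 MR"
  if h: "h \<in> L2 MR" and s: "gsol z h u v" and S: "SQ (%n. norm (l1 * u (of_int n * a) + l2 * v (of_int n * a))) S"
   "SQ (%n. norm (k1 * u (of_int n * a) + k2 * v (of_int n * a))) S" for h u v S
 proof -
  define H where "H = (l2_norm MR h)^2"
  define et where "et = (%n. l1 * u (of_int n * a) + l2 * v (of_int n * a))"
  define ze where "ze = (%m. k1 * u (of_int (- m) * a) + k2 * v (of_int (- m) * a))"
  have st: "u (of_int (n + 1) * a) = m11 * (u (of_int n * a) + b1 h n) + m12 * (v (of_int n * a) + b2 h n)"
   "v (of_int (n + 1) * a) = m21 * (u (of_int n * a) + b1 h n) + m22 * (v (of_int n * a) + b2 h n)" for n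
   using gsol_step[OF h s, of n] by (simp_all add: m11_def m12_def m21_def m22_def b1_def b2_def)
  have r1: "et (n + 1) = rh * (et n + bel h n)" for n unfolding et_def bel_def by (rule rec_l[OF st])
  have r2: "ze (m + 1) = rh * (ze m + ga h m)" for m
  proof -
   have e1: "- (m + 1) + 1 = - m" "- m - 1 = - (m + 1)" by simp_all
   have "ze m = rh' * (ze (m + 1) + bek h (- m - 1))"
    using rec_k[OF st, of "- (m + 1)"] unfolding ze_def bek_def e1 .
   then have "rh * ze m = ze (m + 1) + bek h (- m - 1)" using rh(1) by algebra
   moreover have "rh ~= 0" using r by auto
   ultimately show ?thesis by (simp add: ga_def algebra_simps)
  qed
  have S1: "SQ (%n. norm (et n)) S" using S(1) by (simp add: et_def)
  have q1: "SQ (%n. norm (et n)) (ca * (Kbe * H))" unfolding ca_def H_def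
   by (rule contraction_recursion_bound[where et = et and be = "bel h", OF r r1 S1 SQbe(1)[OF h]])
  have S2: "SQ (%n. norm (ze n)) S" using SQ_uminus[OF S(2)] by (simp add: ze_def)
  have q2: "SQ (%n. norm (ze n)) (ca * (Kga * H))" unfolding ca_def H_def
   by (rule contraction_recursion_bound[where et = ze and be = "ga h", OF r r2 S2 SQga[OF h]])
  have q2': "SQ (%n. norm (ze (- n))) (ca * (Kga * H))" by (rule SQ_uminus[OF q2])
  have est: "norm ((c1 * x1 - c2 * x2) / de) <= Lam / norm de * \<bar>norm x1\<bar> + Lam / norm de * \<bar>norm x2\<bar>"
   if "norm c1 <= Lam" "norm c2 <= Lam" for c1 c2 x1 x2
   using divide_right_mono[OF lin[of c1 "- c2" x1 x2], of "norm de"] that by (simp add: norm_divide add_divide_distrib)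
  have uz: "norm (u (of_int n * a)) <= Lam / norm de * \<bar>norm (et n)\<bar> + Lam / norm de * \<bar>norm (ze (- n))\<bar>" for n
   using est[OF Lam(4,2), of "et n" "ze (- n)"] y_of(1)[of "u (of_int n * a)" "v (of_int n * a)"] by (simp add: et_def ze_def)
  have vz: "norm (v (of_int n * a)) <= Lam / norm de * \<bar>norm (et n)\<bar> + Lam / norm de * \<bar>norm (ze (- n))\<bar>" for n
   using est[OF Lam(1,3), of "ze (- n)" "et n"] y_of(2)[of "v (of_int n * a)" "u (of_int n * a)"] by (simp add: et_def ze_def)
  have YH: "2 * (Lam / norm de)^2 * (ca * (Kbe * H)) + 2 * (Lam / norm de)^2 * (ca * (Kga * H)) = Y * H" by (simp add: Y_def algebra_simps)
  have qu: "SQ (%n. norm (u (of_int n * a))) (Y * H)"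
   using SQ_comb[OF q1 q2', of "%n. norm (u (of_int n * a))" "Lam / norm de" "Lam / norm de"] uz unfolding YH by simp
  have qv: "SQ (%n. norm (v (of_int n * a))) (Y * H)"
   using SQ_comb[OF q1 q2', of "%n. norm (v (of_int n * a))" "Lam / norm de" "Lam / norm de"] vz unfolding YH by simp
  have quv: "SQ (%n. norm (u (of_int n * a)) + norm (v (of_int n * a))) (2 * 1^2 * (Y * H) + 2 * 1^2 * (Y * H))"
   by (rule SQ_comb[OF qu qv]) simp
  have "SQ (%n. nrm (cell n u)) (2 * CU^2 * (2 * 1^2 * (Y * H) + 2 * 1^2 * (Y * H)) + 2 * (CU * sqrt Wn)^2 * H)"
   unfolding H_def by (rule SQ_comb[OF quv[unfolded H_def] SQ_cell[OF h] cell_u[OF h s]])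
  moreover have "2 * CU^2 * (2 * 1^2 * (Y * H) + 2 * 1^2 * (Y * H)) + 2 * (CU * sqrt Wn)^2 * H = KU * H" by (simp add: KU_def algebra_simps)
  ultimately have "SQ (%n. nrm (cell n u)) (KU * H)" by simp
  then show ?thesis using L2_MR_I[OF gsol_measurable[OF s] cell_gsol(2)[OF h s], of "KU * H"] by (simp add: SQ_def H_def)
 qed
 have "z \<in> resolvent_set MR A"
  unfolding resolvent_set_def mem_Collect_eq
 proof (intro conjI ballI)
  fix h assume h: "h \<in> L2 MR"
  obtain et S1 where et: "!!n. et (n + 1) = rh * (et n + bel h n)" "SQ (%n. norm (et n)) S1"
   by (rule contraction_recursion_exists[OF r SQbe(1)[OF h]], rule that)
  obtain ze S2 where ze: "!!n. ze (n + 1) = rh * (ze n + ga h n)" "SQ (%n. norm (ze n)) S2"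
   by (rule contraction_recursion_exists[OF r SQga[OF h]], rule that)
  define y1 y2 where "y1 = (%n. (k2 * et n - l2 * ze (- n)) / de)" and "y2 = (%n. (l1 * ze (- n) - k1 * et n) / de)"
  have ly: "l1 * y1 n + l2 * y2 n = et n" "k1 * y1 n + k2 * y2 n = ze (- n)" for n
  proof -
   have "l1 * (k2 * et n - l2 * ze (- n)) + l2 * (l1 * ze (- n) - k1 * et n) = et n * de" by (simp add: de_def algebra_simps)
   then show "l1 * y1 n + l2 * y2 n = et n" using de by (simp add: y1_def y2_def flip: add_divide_distrib)
   have "k1 * (k2 * et n - l2 * ze (- n)) + k2 * (l1 * ze (- n) - k1 * et n) = ze (- n) * de" by (simp add: de_def algebra_simps)
   then show "k1 * y1 n + k2 * y2 n = ze (- n)" using de by (simp add: y1_def y2_def flip: add_divide_distrib)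
  qed
  have rk: "ze (- (n + 1)) = rh' * (ze (- n) + bek h n)" for n
  proof -
   have "ze (- n) = rh * ze (- (n + 1)) - bek h n" using ze(1)[of "- (n + 1)"] r(2) rh(3) by (auto simp add: ga_def algebra_simps)
   then show ?thesis using rh(1) by algebra
  qed
  obtain u v where s: "gsol z h u v" "u 0 = y1 0" "v 0 = y2 0" using gsol_exists[OF L2_MR_hloc[OF h]] by metis
  have st: "u (of_int (n + 1) * a) = m11 * (u (of_int n * a) + b1 h n) + m12 * (v (of_int n * a) + b2 h n)"
   "v (of_int (n + 1) * a) = m21 * (u (of_int n * a) + b1 h n) + m22 * (v (of_int n * a) + b2 h n)" for n
   using gsol_step[OF h s(1), of n] by (simp_all add: m11_def m12_def m21_def m22_def b1_def b2_def)
  \<comment> \<open>The true solution starts with the prescribed data at 0, and the recursions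
    propagate the equality in both directions; backwards one divides by \<open>rh\<close> and
    \<open>rh'\<close>.\<close>
  have ind: "l1 * u (of_int n * a) + l2 * v (of_int n * a) = et n & k1 * u (of_int n * a) + k2 * v (of_int n * a) = ze (- n)" for n
  proof (induction n rule: int_two_way_induct)
   case 1
   then show ?case using ly[of 0] s by simp
  next
   case (2 n)
   then show ?case using rec_l[OF st, of n] rec_k[OF st, of n] et(1)[of n] rk[of n] by (simp add: bel_def bek_def)
  next
   case (3 n)
   have "rh ~= 0" "rh' ~= 0" using rh(1) by auto
   then show ?case using 3 rec_l[OF st, of n] rec_k[OF st, of n] et(1)[of n] rk[of n] by (simp add: bel_def bek_def)
  qed
  have m: "SQ x (max S1 S2)" if "SQ x S1 \<or> SQ x S2" for x using that unfolding SQ_def by (meson max.cobounded1 max.cobounded2 order_trans)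
  have "SQ (%n. norm (l1 * u (of_int n * a) + l2 * v (of_int n * a))) (max S1 S2)"
   "SQ (%n. norm (k1 * u (of_int n * a) + k2 * v (of_int n * a))) (max S1 S2)"
   using ind et(2) SQ_uminus[OF ze(2)] by (intro m; simp)+
  from bound_u[OF h s(1) this] have "u \<in> L2 MR" by simp
  then show "\<exists>f. (f, h) \<in> op_minus A z" using h s(1) by (intro exI[of _ u]) (auto simp: op_minus_A_iff)
 next
  obtain C where C: "C >= 0" "!!h u v n. h \<in> L2 MR ==> gsol z h u v ==>
  norm (u (of_int n * a)) <= C * nrm (cell n u) + C * nrm (cell n h) &
  norm (v (of_int n * a)) <= C * nrm (cell n u) + C * nrm (cell n h)"
   by (rule cell_data_bound[of z], rule that)
  show "\<exists>C. \<forall>(f, h)\<in>op_minus A z. l2_norm MR f <= C * l2_norm MR h"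
  proof (intro exI[of _ "sqrt \<bar>KU\<bar>"] ballI, clarify)
   fix f h assume "(f, h) \<in> op_minus A z"
   then obtain u v where fh: "f \<in> L2 MR" "h \<in> L2 MR" "AE x in MR. f x = u x" "gsol z h u v" by (auto simp: op_minus_A_iff)
   have um: "u \<in> borel_measurable MR" using gsol_measurable[OF fh(4)] by (simp add: measurable_MR)
   have uL: "u \<in> L2 MR"
   proof -
    have "nn2 MR u = nn2 MR f" unfolding nn2_def by (rule nn_integral_cong_AE) (use fh(3) in auto)
    then show ?thesis using fh(1) um by (simp add: L2_iff_nn2)
   qed
   have eqn: "l2_norm MR f = l2_norm MR u" by (rule l2_norm_cong_AE[OF fh(3)]) (use fh(1) um in \<open>auto simp: L2D\<close>)
   have sq: "SQ (%n. norm (u (of_int n * a))) (2 * C^2 * (l2_norm MR u)^2 + 2 * C^2 * (l2_norm MR h)^2)"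
    "SQ (%n. norm (v (of_int n * a))) (2 * C^2 * (l2_norm MR u)^2 + 2 * C^2 * (l2_norm MR h)^2)"
    using C(2)[OF fh(2,4)] by (intro SQ_comb[OF SQ_cell[OF uL] SQ_cell[OF fh(2)]]; simp)+
   have "SQ (%n. norm (l1 * u (of_int n * a) + l2 * v (of_int n * a)))
     (2 * Lam^2 * (2 * C^2 * (l2_norm MR u)^2 + 2 * C^2 * (l2_norm MR h)^2) + 2 * Lam^2 * (2 * C^2 * (l2_norm MR u)^2 + 2 * C^2 * (l2_norm MR h)^2))"
    "SQ (%n. norm (k1 * u (of_int n * a) + k2 * v (of_int n * a)))
     (2 * Lam^2 * (2 * C^2 * (l2_norm MR u)^2 + 2 * C^2 * (l2_norm MR h)^2) + 2 * Lam^2 * (2 * C^2 * (l2_norm MR u)^2 + 2 * C^2 * (l2_norm MR h)^2))"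
    by - (rule SQ_comb[OF sq], simp only: abs_norm_cancel, rule lin[unfolded abs_norm_cancel]; rule Lam)+
   from bound_u[OF fh(2,4) this] have "(l2_norm MR u)^2 <= KU * (l2_norm MR h)^2" by simp
   also have "... <= (sqrt \<bar>KU\<bar> * l2_norm MR h)^2" by (simp add: power_mult_distrib mult_right_mono)
   finally show "l2_norm MR f <= sqrt \<bar>KU\<bar> * l2_norm MR h" unfolding eqn by (rule power2_le_imp_le) simp
  qed
 qed
 then show False using assms by (simp add: op_spectrum_def)
qed

text \<open>Turns the pairing with \<open>k\<close> for the weight \<open>|w|\<close> into the integrals \<open>I0\<close>, \<open>I1\<close> for \<open>w\<close>.\<close>
definition dual :: "cfun => cfun" where "dual k = (%x. of_real (sgn (w x)) * cnj (k x))"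

text \<open>The factor \<open>sgn (w x)\<close> has modulus 1 almost everywhere, so the norm is
  preserved, and it turns w into |w| in the integrals.\<close>

lemma dual:
 assumes "k \<in> L2 Ma"
 shows "dual k \<in> L2 Ma" "nrm (dual k) = nrm k"
  "I0 z (dual k) a = l2_inner Ma (phi z) k" "I1 z (dual k) a = l2_inner Ma (psi z) k"
proof -
 have k [measurable]: "k \<in> borel_measurable La" using L2D(1)[OF assms] by (simp add: measurable_Ma)
 have [measurable]: "(%x. cnj (k x)) \<in> borel_measurable La" by (rule borel_measurable_cnj'[OF k])
 have m: "dual k \<in> borel_measurable Ma" unfolding measurable_Ma dual_def by measurable
 have "AE x in Ma. w x ~= 0" unfolding AE_Ma using w_nonzero by (subst AE_restrict_space_iff) auto
 then have n: "AE x in Ma. norm (dual k x) = norm (k x)"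
  by eventually_elim (simp add: dual_def norm_mult sgn_real_def)
 have "nn2 Ma (dual k) = nn2 Ma k" unfolding nn2_def by (rule nn_integral_cong_AE) (use n in auto)
 then show dL: "dual k \<in> L2 Ma" using assms m by (simp add: L2_iff_nn2)
 have "nn2 Ma (dual k) = nn2 Ma k" by fact
 then have "(nrm (dual k))^2 = (nrm k)^2" by (simp add: nn2_eq_l2_norm assms dL)
 then show "nrm (dual k) = nrm k" by simp
 have sw: "cw x * dual k x * c = \<bar>w x\<bar> *\<^sub>R (c * cnj (k x))" for x c
 proof -
  have "cw x * of_real (sgn (w x)) = of_real \<bar>w x\<bar>" unfolding cw_def of_real_mult[symmetric] by (simp add: sgn_real_def)
  then show ?thesis by (simp add: dual_def scaleR_conv_of_real mult_ac)
 qed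
 have "l2_inner Ma f k = integral {0..a} (%x. \<bar>w x\<bar> *\<^sub>R (f x * cnj (k x)))" if f: "f \<in> L2 Ma" for f
 proof -
  have [measurable]: "f \<in> borel_measurable La" using L2D(1)[OF f] by (simp add: measurable_Ma)
  show ?thesis unfolding l2_inner_def by (rule integral_Ma[OF _ integrable_L2_mult(1)[OF f assms]]) measurable
 qed
 then show "I0 z (dual k) a = l2_inner Ma (phi z) k" "I1 z (dual k) a = l2_inner Ma (psi z) k"
  by (simp_all add: I0_def I1_def sw phi_L2 psi_L2)
qed

lemma L2_MR_extend:
 fixes k defines "H \<equiv> %x. if x \<in> {0<..<a} then k x else 0"
 assumes kL: "k \<in> L2 Ma"
 shows "H \<in> L2 MR"
  "x \<in> {0<..<a} ==> cell n H x = (if n = 0 then k x else 0)"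
proof -
 have k: "k \<in> borel_measurable La" using L2D(1)[OF kL] by (simp add: measurable_Ma)
 have ce: "cell n H x = (if n = 0 then k x else 0)" if x: "x \<in> {0<..<a}" for n x
 proof (cases "n = 0")
  case False
  have "~ (0 < x + of_int n * a & x + of_int n * a < a)"
  proof (cases "n > 0")
   case True
   then have "1 * a <= of_int n * a" using a_pos by (intro mult_right_mono) auto
   then show ?thesis using x unfolding greaterThanLessThan_iff by linarith
  next
   case f: False
   then have "of_int n * a <= - 1 * a" using False f a_pos by (intro mult_right_mono) auto
   then show ?thesis using x unfolding greaterThanLessThan_iff by linarith
  qed
  then show ?thesis using False by (auto simp: cell_def H_def)
 qed (use x in \<open>auto simp: cell_def H_def\<close>)
 then show "x \<in> {0<..<a} ==> cell n H x = (if n = 0 then k x else 0)" by blast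
 have m: "H \<in> borel_measurable lebesgue" unfolding H_def by (rule borel_measurable_if_I[OF k]) auto
 have cn: "cell n H \<in> L2 Ma & nrm (cell n H) = nrm (if n = 0 then k else (%_. 0))" for n
 proof -
  have e: "AE x in Ma. cell n H x = (if n = 0 then k else (%_. 0)) x" using AE_space[of Ma]
   by eventually_elim (simp add: space_Ma ce)
  have kk: "(if n = 0 then k else (%_. 0)) \<in> L2 Ma" using kL by (simp add: L2_zero)
  have "nn2 Ma (cell n H) = nn2 Ma (if n = 0 then k else (%_. 0))" unfolding nn2_def by (rule nn_integral_cong_AE) (use e in auto)
  moreover have cm: "cell n H \<in> borel_measurable Ma" by (rule cell_measurable[OF m])
  ultimately have "cell n H \<in> L2 Ma" using kk by (simp add: L2_iff_nn2)
  then show ?thesis using l2_norm_cong_AE[OF e cm] kk L2D(1) by blast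
 qed
 have "(\<Sum>n = - int N..int N. (nrm (cell n H))^2) <= (nrm k)^2" for N
 proof -
  have "(\<Sum>n = - int N..int N. (nrm (cell n H))^2) = (\<Sum>n\<in>{- int N..int N}. if n = 0 then (nrm k)^2 else 0)"
   by (rule sum.cong) (use cn in \<open>auto simp: l2_norm_def\<close>)
  then show ?thesis by (simp add: sum.delta)
 qed
 then show "H \<in> L2 MR" using L2_MR_I(1)[OF m] cn by blast
qed

text \<open>The right-hand side \<open>h\<close> lives on the cell 0, with \<open>I0 = 1\<close> and
  \<open>I1 = 0\<close> there. A square-integrable solution has data tending to 0 at both ends, so
  by \<open>orbit_tends_zero\<close> they vanish at n = 1 and at n = 0. The step across the cell 0
  then maps \<open>(0, - 1)\<close> to 0, against \<open>det M = 1\<close>.\<close>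

lemma band_in_spectrum:
 assumes D: "D z = of_real x" "- 2 <= x" "x <= 2"
 shows "z \<in> op_spectrum MR A"
proof (rule ccontr)
 assume "z \<notin> op_spectrum MR A"
 then have r: "z \<in> resolvent_set MR A" by (simp add: op_spectrum_def)
 obtain k1 k2 where k: "continuous_on {0..a} k1" "continuous_on {0..a} k2"
  "l2_inner Ma (phi z) k1 = 1" "l2_inner Ma (psi z) k1 = 0"
  "l2_inner Ma (phi z) k2 = 0" "l2_inner Ma (psi z) k2 = 1" by (rule biorthogonal[of z])
 define h where "h = (%x. if x \<in> {0<..<a} then dual k1 x else 0)"
 have kL: "k1 \<in> L2 Ma" using k(1) by (rule continuous_L2)
 have hL: "h \<in> L2 MR" unfolding h_def by (rule L2_MR_extend(1)[OF dual(1)[OF kL]])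
 have ch: "cell n h x = (if n = 0 then dual k1 x else 0)" if "x \<in> {0<..<a}" for n x
  unfolding h_def by (rule L2_MR_extend(2)[OF dual(1)[OF kL] that])
 have I: "I0 z (cell n h) a = (if n = 0 then 1 else 0)" "I1 z (cell n h) a = 0" for n
 proof -
  have c: "integral {0..a} (%x. cw x * cell n h x * g x) = integral {0..a} (%x. cw x * (if n = 0 then dual k1 x else 0) * g x)" for g
   by (rule integral_spike[of "{0, a}"]) (use ch[of _ n] in auto)
  show "I0 z (cell n h) a = (if n = 0 then 1 else 0)" "I1 z (cell n h) a = 0"
   unfolding I0_def I1_def c using dual(3,4)[OF kL, of z] k(3,4) by (cases "n = 0"; simp add: I0_def I1_def)+
 qed
 obtain f where "(f, h) \<in> op_minus A z" using r hL unfolding resolvent_set_def by blast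
 then obtain u v where fu: "f \<in> L2 MR" "AE x in MR. f x = u x" and s: "gsol z h u v" by (auto simp: op_minus_A_iff)
 have uL: "u \<in> L2 MR"
 proof -
  have "nn2 MR u = nn2 MR f" unfolding nn2_def by (rule nn_integral_cong_AE) (use fu(2) in auto)
  then show ?thesis using fu(1) gsol_measurable[OF s] by (simp add: L2_iff_nn2 measurable_MR)
 qed
 obtain C where C: "C >= 0" "!!h u v n. h \<in> L2 MR ==> gsol z h u v ==>
  norm (u (of_int n * a)) <= C * nrm (cell n u) + C * nrm (cell n h) &
  norm (v (of_int n * a)) <= C * nrm (cell n u) + C * nrm (cell n h)"
  by (rule cell_data_bound[of z], rule that)
 \<comment> \<open>An injective index sequence meets each index at most once, so the bound in
   \<open>SQ\<close> also bounds the partial sums of squares along it.\<close>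
 have cz: "(%n. s (k n)) \<longlonglongrightarrow> 0" if S: "SQ s B" and k: "inj k" for s :: "int => real" and B and k :: "nat => int"
 proof -
  have "summable (%n. (s (k n))^2)"
  proof (rule bounded_imp_summable)
   fix N
   define M where "M = nat (Max ((%n. \<bar>k n\<bar>) ` {..N}))"
   have M: "\<bar>k n\<bar> <= int M" if "n <= N" for n
   proof -
    have 1: "\<bar>k n\<bar> <= Max ((%n. \<bar>k n\<bar>) ` {..N})" by (rule Max_ge) (use that in auto)
    then show ?thesis unfolding M_def nat_0_le[OF order_trans[OF abs_ge_zero 1]] .
   qed
   have "(\<Sum>n\<le>N. (s (k n))^2) = (\<Sum>n\<in>k ` {..N}. (s n)^2)"
    by (subst sum.reindex) (auto intro: inj_on_subset[OF k])
   also have "... <= (\<Sum>n = - int M..int M. (s n)^2)" by (rule sum_mono2) (auto dest: M simp: abs_le_iff)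
   also have "... <= B" using S by (simp add: SQ_def)
   finally show "(\<Sum>n\<le>N. (s (k n))^2) <= B" .
  qed simp
  then have "(%n. (s (k n))^2) \<longlonglongrightarrow> 0" by (rule summable_LIMSEQ_zero)
  then show ?thesis by simp
 qed
 define Y1 Y2 where "Y1 = (%n. u (of_int n * a))" and "Y2 = (%n. v (of_int n * a))"
 have Y0: "(%n. Y1 (k n)) \<longlonglongrightarrow> 0" "(%n. Y2 (k n)) \<longlonglongrightarrow> 0" if k: "inj k" for k :: "nat => int"
 proof -
  have "(%n. C * nrm (cell (k n) u) + C * nrm (cell (k n) h)) \<longlonglongrightarrow> C * 0 + C * 0"
   by (intro tendsto_intros cz[OF SQ_cell[OF uL] k] cz[OF SQ_cell[OF hL] k])
  then have l: "(%n. C * nrm (cell (k n) u) + C * nrm (cell (k n) h)) \<longlonglongrightarrow> 0" by simp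
  show "(%n. Y1 (k n)) \<longlonglongrightarrow> 0" "(%n. Y2 (k n)) \<longlonglongrightarrow> 0"
   by (rule Lim_null_comparison[OF _ l], use C(2)[OF hL s] in \<open>simp add: Y1_def Y2_def\<close>)+
 qed
 have st: "Y1 (n + 1) = phi z a * Y1 n + psi z a * (Y2 n - (if n = 0 then 1 else 0))"
  "Y2 (n + 1) = p_phi' z a * Y1 n + p_psi' z a * (Y2 n - (if n = 0 then 1 else 0))" for n
  using gsol_step[OF hL s, of n] by (simp_all add: Y1_def Y2_def I)
 have tr: "phi z a + p_psi' z a = of_real x" "p_psi' z a + phi z a = of_real x" using D(1) by (simp_all add: D_def add.commute)
 have i1: "inj (%n. int n + 1)" "inj (%n. - int n)" by (auto simp: inj_def)
 have fw: "Y1 (int (Suc n) + 1) = phi z a * Y1 (int n + 1) + psi z a * Y2 (int n + 1)"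
  "Y2 (int (Suc n) + 1) = p_phi' z a * Y1 (int n + 1) + p_psi' z a * Y2 (int n + 1)" for n
  using st[of "int n + 1"] by (simp_all add: add_ac)
 from orbit_tends_zero[where ?y1.0 = "%n. Y1 (int n + 1)" and ?y2.0 = "%n. Y2 (int n + 1)", OF det_a tr(1) D(2,3) fw Y0[OF i1(1)]]
 have e1: "Y1 1 = 0" "Y2 1 = 0" by simp_all
 \<comment> \<open>Backward steps use the inverse of M, which is its adjugate and has the same
   determinant and trace, so \<open>orbit_tends_zero\<close> applies again.\<close>
 have bk: "Y1 (- int (Suc n)) = p_psi' z a * Y1 (- int n) + (- psi z a) * Y2 (- int n)"
  "Y2 (- int (Suc n)) = (- p_phi' z a) * Y1 (- int n) + phi z a * Y2 (- int n)" for n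
 proof -
  have "- int (Suc n) + 1 = - int n" "(if - int (Suc n) = 0 then 1 else 0 :: complex) = 0" by auto
  note e = st[of "- int (Suc n)", unfolded this diff_0_right]
  have "Y1 (- int n) = phi z a * Y1 (- int (Suc n)) + psi z a * Y2 (- int (Suc n))"
   "Y2 (- int n) = p_phi' z a * Y1 (- int (Suc n)) + p_psi' z a * Y2 (- int (Suc n))"
   by (fact e)+
  then show "Y1 (- int (Suc n)) = p_psi' z a * Y1 (- int n) + (- psi z a) * Y2 (- int n)"
  "Y2 (- int (Suc n)) = (- p_phi' z a) * Y1 (- int n) + phi z a * Y2 (- int n)" using det_a[of z] by algebra+
 qed
 have "p_psi' z a * phi z a - (- psi z a) * (- p_phi' z a) = 1" using det_a[of z] by (simp add: mult.commute)
 from orbit_tends_zero[where ?y1.0 = "%n. Y1 (- int n)" and ?y2.0 = "%n. Y2 (- int n)", OF this tr(2) D(2,3) bk Y0[OF i1(2)]]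
 have e0: "Y1 0 = 0" "Y2 0 = 0" by simp_all
 have "psi z a = 0" "p_psi' z a = 0" using st[of 0] e0 e1 by simp_all
 then show False using det_a[of z] by simp
qed

end

section \<open>The Gelfand transform\<close>

abbreviation LI :: "real measure" where "LI \<equiv> lebesgue_on {- pi..pi}"
abbreviation ek :: "int => real => complex" where "ek n t \<equiv> exp (- \<i> * of_int n * of_real t)"

lemma continuous_LI:
 fixes f :: "real => 'b::euclidean_space"
 assumes "continuous_on {- pi..pi} f"
 shows "integrable LI f" "integral\<^sup>L LI f = integral {- pi..pi} f"
proof -
 have "f absolutely_integrable_on {- pi..pi}" by (rule absolutely_integrable_continuous_real[OF assms])
 then show i: "integrable LI f" unfolding set_integrable_def by (subst integrable_restrict_space) auto
 show "integral\<^sup>L LI f = integral {- pi..pi} f" by (rule lebesgue_integral_eq_integral[OF i]) simp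
qed

lemma integral_exp_int: "integral {- pi..pi} (%t. exp (\<i> * of_int k * of_real t)) = (if k = 0 then 2 * of_real pi else 0 :: complex)"
proof (cases "k = 0")
 case False
 have "((%t. exp (\<i> * of_int k * of_real t)) has_integral
   exp (\<i> * of_int k * of_real pi) / (\<i> * of_int k) - exp (\<i> * of_int k * of_real (- pi)) / (\<i> * of_int k)) {- pi..pi}"
  by (rule fundamental_theorem_of_calculus)
   (use False in \<open>auto intro!: derivative_eq_intros has_vector_derivative_real_field
    simp: has_real_derivative_iff_has_vector_derivative[symmetric] field_simps\<close>)
 moreover have "exp (\<i> * of_int k * of_real pi) = exp (\<i> * of_int k * of_real (- pi))"
  unfolding exp_eq by (rule exI[of _ k]) (simp add: algebra_simps)
 ultimately show ?thesis using False by (simp add: integral_unique)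
qed (simp add: scaleR_conv_of_real)

lemma has_integral_exp_int:
 "((%t. exp (\<i> * of_int k * of_real t)) has_integral (if k = 0 then 2 * of_real pi else 0 :: complex)) {- pi..pi}"
 unfolding integral_exp_int[symmetric] by (intro integrable_integral integrable_continuous_real continuous_intros)

lemma ek_mult_cnj: "ek n t * cnj (ek m t) = exp (\<i> * of_int (m - n) * of_real t)"
 by (simp add: exp_cnj exp_add[symmetric] algebra_simps)

lemma l2_inner_cnj: "l2_inner M f g = cnj (l2_inner M g f)"
 unfolding l2_inner_def using Bochner_Integration.integral_cnj[of M "%x. g x * cnj (f x)"] by (simp add: mult.commute)

lemma L2_sum: "finite S ==> (!!i. i \<in> S ==> c i \<in> L2 M) ==> (%x. \<Sum>i\<in>S. ga i * c i x) \<in> L2 M"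
 by (induction S rule: finite_induct) (simp_all add: L2_add L2_cmult)

lemma l2_inner_sum_left:
 assumes "finite S" "!!i. i \<in> S ==> c i \<in> L2 M" "h \<in> L2 M"
 shows "l2_inner M (%x. \<Sum>i\<in>S. ga i * c i x) h = (\<Sum>i\<in>S. ga i * l2_inner M (c i) h)"
 using assms(1,2)
proof (induction S rule: finite_induct)
 case (insert i S)
 have "l2_inner M (%x. ga i * c i x + 1 * (\<Sum>i\<in>S. ga i * c i x)) h
   = ga i * l2_inner M (c i) h + 1 * l2_inner M (%x. \<Sum>i\<in>S. ga i * c i x) h"
  by (rule l2_inner_comb) (use insert assms(3) in \<open>auto intro: L2_sum\<close>)
 then show ?case using insert by simp
qed (simp add: l2_inner_def)

lemma l2_norm_sum_sq:
 assumes "finite S" "!!i. i \<in> S ==> c i \<in> L2 M"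
 shows "of_real ((l2_norm M (%x. \<Sum>i\<in>S. ga i * c i x))^2) = (\<Sum>i\<in>S. \<Sum>j\<in>S. ga i * cnj (ga j) * l2_inner M (c i) (c j))"
proof -
 let ?T = "%x. \<Sum>i\<in>S. ga i * c i x"
 have T: "?T \<in> L2 M" using assms by (rule L2_sum)
 have "l2_inner M ?T ?T = (\<Sum>i\<in>S. ga i * l2_inner M (c i) ?T)" using assms T by (rule l2_inner_sum_left)
 also have "... = (\<Sum>i\<in>S. ga i * cnj (\<Sum>j\<in>S. ga j * l2_inner M (c j) (c i)))"
  by (intro sum.cong refl) (subst l2_inner_cnj, subst l2_inner_sum_left, use assms in auto)
 also have "... = (\<Sum>i\<in>S. \<Sum>j\<in>S. ga i * cnj (ga j) * l2_inner M (c i) (c j))"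
  by (simp add: sum_distrib_left mult.assoc l2_inner_cnj[symmetric])
 finally show ?thesis using l2_inner_self[OF T] by simp
qed

text \<open>The square of the norm is a finite sum of products of the coefficients with constants.
  Measurability in \<open>t\<close> of the norms below rests on this.\<close>

lemma l2_norm_sum_continuous:
 assumes "finite S" "!!i. i \<in> S ==> c i \<in> L2 M" "!!i. i \<in> S ==> continuous_on A (ga i)"
 shows "continuous_on A (%t. l2_norm M (%x. \<Sum>i\<in>S. ga i t * c i x))"
proof -
 have "continuous_on A (%t. Re (\<Sum>i\<in>S. \<Sum>j\<in>S. ga i t * cnj (ga j t) * l2_inner M (c i) (c j)))"
  by (intro continuous_intros assms(3))
 moreover have "Re (\<Sum>i\<in>S. \<Sum>j\<in>S. ga i t * cnj (ga j t) * l2_inner M (c i) (c j)) = (l2_norm M (%x. \<Sum>i\<in>S. ga i t * c i x))^2" for t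
  using arg_cong[where f = Re, OF l2_norm_sum_sq[OF assms(1,2), where ga = "%i. ga i t"]] unfolding Re_complex_of_real by (rule sym)
 ultimately have "continuous_on A (%t. (l2_norm M (%x. \<Sum>i\<in>S. ga i t * c i x))^2)" by (simp only:)
 then have "continuous_on A (%t. sqrt ((l2_norm M (%x. \<Sum>i\<in>S. ga i t * c i x))^2))" by (rule continuous_on_real_sqrt)
 then show ?thesis by simp
qed

text \<open>The partial sum of the Gelfand transform for arbitrary coefficient functions. With the
  cells of \<open>f\<close> it is \<open>gelfand_sum\<close>, and with Fourier coefficients in
  \<open>t\<close> it is the partial sum of a Fourier series.\<close>

definition tsum :: "nat => (int => cfun) => real => cfun" where
 "tsum N c t = (%x. of_real (1 / sqrt (2 * pi)) * (\<Sum>n = - int N..int N. ek n t * c n x))"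

lemma tsum_eq: "tsum N c t = (%x. \<Sum>n = - int N..int N. (of_real (1 / sqrt (2 * pi)) * ek n t) * c n x)"
 by (simp add: tsum_def sum_distrib_left mult.assoc)

lemma tsum_L2: "(!!n. c n \<in> L2 M) ==> tsum N c t \<in> L2 M"
 unfolding tsum_eq by (rule L2_sum) auto

lemma tsum_norm_continuous:
 assumes "!!n. c n \<in> L2 M" "k \<in> L2 M"
 shows "continuous_on A (%t. l2_norm M (%x. k x - tsum N c t x))"
proof -
 \<comment> \<open>The index \<open>None\<close> carries the function \<open>k\<close> with
   coefficient 1, so that the difference is again a finite combination.\<close>
 define ga where "ga = (%i t. case i of None => 1 | Some n => - (of_real (1 / sqrt (2 * pi)) * ek n t))"
 define d where "d = case_option k c"
 have s: "(\<Sum>i\<in>insert None (Some ` {- int N..int N}). ga i t * d i x) = k x - tsum N c t x" for t x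
  by (subst sum.insert) (auto simp: ga_def d_def tsum_eq sum.reindex sum_negf)
 have "continuous_on A (%t. l2_norm M (%x. \<Sum>i\<in>insert None (Some ` {- int N..int N}). ga i t * d i x))"
  by (rule l2_norm_sum_continuous)
   (use assms in \<open>auto simp: d_def ga_def split: option.splits intro!: continuous_intros\<close>)
 then show ?thesis unfolding s .
qed

text \<open>Integration over \<open>t\<close> removes the mixed terms of
  \<open>l2_norm_sum_sq\<close> by the orthogonality of the exponentials.\<close>

lemma tsum_parseval:
 assumes "!!n. c n \<in> L2 M"
 shows "(\<integral>\<^sup>+t. ennreal ((l2_norm M (tsum N c t))^2) \<partial>LI) = ennreal (\<Sum>n = - int N..int N. (l2_norm M (c n))^2)"
proof -
 define S where "S = {- int N..int N}"
 define J where "J = (%t. (l2_norm M (tsum N c t))^2)"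
 have fS: "finite S" by (simp add: S_def)
 have eq: "complex_of_real (J t) = (\<Sum>i\<in>S. \<Sum>j\<in>S. of_real (1 / (2 * pi)) * l2_inner M (c i) (c j) * exp (\<i> * of_int (j - i) * of_real t))" for t
 proof -
  have c: "complex_of_real (1 / sqrt (2 * pi)) * of_real (1 / sqrt (2 * pi)) = of_real (1 / (2 * pi))"
   unfolding of_real_mult[symmetric] by simp
  have p: "of_real (1 / sqrt (2 * pi)) * ek i t * cnj (of_real (1 / sqrt (2 * pi)) * ek j t) = of_real (1 / (2 * pi)) * (ek i t * cnj (ek j t))" for i j
   unfolding complex_cnj_mult complex_cnj_complex_of_real c[symmetric] by (simp only: mult_ac)
  have r: "complex_of_real (J t) = (\<Sum>i\<in>S. \<Sum>j\<in>S. of_real (1 / sqrt (2 * pi)) * ek i t * cnj (of_real (1 / sqrt (2 * pi)) * ek j t) * l2_inner M (c i) (c j))"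
   unfolding J_def tsum_eq S_def by (rule l2_norm_sum_sq) (simp_all add: assms)
  show ?thesis unfolding r p ek_mult_cnj by (simp only: mult_ac)
 qed
 have Jc: "continuous_on {- pi..pi} J"
  unfolding J_def tsum_eq using assms by (intro continuous_intros l2_norm_sum_continuous) auto
 have "of_real (integral {- pi..pi} J) = integral {- pi..pi} (%t. complex_of_real (J t))"
  using integral_linear[OF integrable_continuous_real[OF Jc] bounded_linear_of_real[where 'a = complex]] by (simp add: o_def)
 also have "... = (\<Sum>i\<in>S. \<Sum>j\<in>S. of_real (1 / (2 * pi)) * l2_inner M (c i) (c j) * (if j - i = 0 then 2 * of_real pi else 0))"
  unfolding eq by (intro integral_unique has_integral_sum fS has_integral_mult_right has_integral_exp_int)
 also have "... = (\<Sum>i\<in>S. \<Sum>j\<in>S. if i = j then of_real ((l2_norm M (c i))^2) else 0)"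
  by (intro sum.cong refl) (auto simp: l2_inner_self assms)
 also have "... = of_real (\<Sum>i\<in>S. (l2_norm M (c i))^2)" using fS by simp
 finally have e: "integral {- pi..pi} J = (\<Sum>i\<in>S. (l2_norm M (c i))^2)" by (simp only: of_real_eq_iff)
 have "(\<integral>\<^sup>+t. ennreal (J t) \<partial>LI) = ennreal (integral\<^sup>L LI J)"
  by (rule nn_integral_eq_integral[OF continuous_LI(1)[OF Jc]]) (simp add: J_def)
 then show ?thesis using continuous_LI(2)[OF Jc] e by (simp add: J_def S_def)
qed

lemma l2_norm_sq_le2:
 assumes "f \<in> L2 M" "g \<in> L2 M"
 shows "(l2_norm M f)^2 <= 2 * (l2_norm M g)^2 + 2 * (l2_norm M (%x. f x - g x))^2"
proof -
 note d = L2_diff[OF assms]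
 have "(\<integral>x. (norm (f x))^2 \<partial>M) <= (\<integral>x. 2 * (norm (g x))^2 + 2 * (norm (f x - g x))^2 \<partial>M)"
 proof (rule integral_mono)
  fix x
  have "(norm (f x))^2 <= (norm (g x) + norm (f x - g x))^2"
   using norm_triangle_ineq[of "g x" "f x - g x"] by (intro power_mono) auto
  also have "... <= 2 * (norm (g x))^2 + 2 * (norm (f x - g x))^2"
   using sum_squares_bound[of "norm (g x)" "norm (f x - g x)"] by (simp add: power2_sum)
  finally show "(norm (f x))^2 <= 2 * (norm (g x))^2 + 2 * (norm (f x - g x))^2" .
 qed (use L2D(2) assms d in auto)
 also have "... = 2 * (l2_norm M g)^2 + 2 * (l2_norm M (%x. f x - g x))^2"
  unfolding l2_norm_sq using L2D(2) assms d by simp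
 finally show ?thesis by (simp add: l2_norm_sq)
qed

lemma l2_norm_triangle:
 assumes "f \<in> L2 M" "g \<in> L2 M"
 shows "l2_norm M (%x. f x + g x) <= l2_norm M f + l2_norm M g"
proof -
 note s = L2_add[OF assms]
 have "l2_norm M (%x. f x + g x) <= l2_norm M f + l2_norm M g \<or> l2_norm M (%x. f x + g x) = 0"
 proof (rule l2_norm_le_of_inner[OF s])
  fix h assume h: "h \<in> L2 M"
  have "norm (l2_inner M (%x. 1 * f x + 1 * g x) h) <= norm (l2_inner M f h) + norm (l2_inner M g h)"
   unfolding l2_inner_comb[OF assms h] by (simp add: norm_triangle_ineq)
  also have "... <= (l2_norm M f + l2_norm M g) * l2_norm M h"
   using l2_inner_bound[OF assms(1) h] l2_inner_bound[OF assms(2) h] by (simp add: distrib_right)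
  finally show "norm (l2_inner M (%x. f x + g x) h) <= (l2_norm M f + l2_norm M g) * l2_norm M h" by simp
 qed
 then show ?thesis by auto
qed

lemma l2_norm_lipschitz:
 assumes "f \<in> L2 M" "g \<in> L2 M" "h \<in> L2 M"
 shows "\<bar>l2_norm M (%x. f x - h x) - l2_norm M (%x. g x - h x)\<bar> <= l2_norm M (%x. f x - g x)"
proof -
 have m: "l2_norm M (%x. g x - f x) = l2_norm M (%x. f x - g x)"
  by (simp add: l2_norm_def norm_minus_commute)
 have "l2_norm M (%x. f x - h x) <= l2_norm M (%x. f x - g x) + l2_norm M (%x. g x - h x)"
  using l2_norm_triangle[OF L2_diff[OF assms(1,2)] L2_diff[OF assms(2,3)]] by simp
 moreover have "l2_norm M (%x. g x - h x) <= l2_norm M (%x. g x - f x) + l2_norm M (%x. f x - h x)"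
  using l2_norm_triangle[OF L2_diff[OF assms(2,1)] L2_diff[OF assms(1,3)]] by simp
 ultimately show ?thesis using m by simp
qed

text \<open>Strong measurability provides simple functions that converge only almost everywhere.
  Their norms are extended by 0 outside the interval, and the completeness of Lebesgue measure on
  the line then gives measurability of the limit.\<close>

lemma bochner_norm_measurable:
 assumes F: "F \<in> bochner_L2 {- pi..pi} M"
  and H: "!!t. H t \<in> L2 M" "!!k. k \<in> L2 M ==> (%t. l2_norm M (%x. k x - H t x)) \<in> borel_measurable LI"
 shows "(%t. l2_norm M (%x. F t x - H t x)) \<in> borel_measurable LI"
proof -
 obtain s where s: "!!n. simple_function LI (s n)" "!!n. s n ` {- pi..pi} <= L2 M"
  "AE t in LI. (%n. l2_norm M (%x. F t x - s n t x)) \<longlonglongrightarrow> 0"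
  using F unfolding bochner_L2_def by blast
 have FL: "t \<in> {- pi..pi} ==> F t \<in> L2 M" for t using F by (simp add: bochner_L2_def)
 have m: "(%t. l2_norm M (%x. s n t x - H t x)) \<in> borel_measurable LI" for n
 proof (rule measurable_compose_countable'[of "s n ` {- pi..pi}" "%k t. l2_norm M (%x. k x - H t x)"])
  show "s n \<in> LI \<rightarrow>\<^sub>M count_space (s n ` {- pi..pi})"
   using simple_functionD(2)[OF s(1)[of n]] by (auto simp: measurable_def)
  show "countable (s n ` {- pi..pi})" using s(1)[of n] unfolding simple_function_def by (auto intro: countable_finite)
 qed (use H(2) s(2) in auto)
 have ae: "AE t in LI. (%n. l2_norm M (%x. s n t x - H t x)) \<longlonglongrightarrow> l2_norm M (%x. F t x - H t x)"
  using s(3) AE_space[of LI]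
 proof eventually_elim
  fix t assume l: "(%n. l2_norm M (%x. F t x - s n t x)) \<longlonglongrightarrow> 0" and t: "t \<in> space LI"
  have tI: "t \<in> {- pi..pi}" using t by simp
  have sL: "s n t \<in> L2 M" for n using s(2) tI by blast
  show "(%n. l2_norm M (%x. s n t x - H t x)) \<longlonglongrightarrow> l2_norm M (%x. F t x - H t x)"
  proof (rule LIM_zero_cancel, rule Lim_null_comparison[OF _ l], rule always_eventually, rule allI)
   fix n
   show "norm (l2_norm M (%x. s n t x - H t x) - l2_norm M (%x. F t x - H t x)) <= l2_norm M (%x. F t x - s n t x)"
    using l2_norm_lipschitz[OF FL[OF tI] sL H(1), of t n] by (simp add: abs_minus_commute)
  qed
 qed
 define m0 where "m0 = (%n t. if t \<in> {- pi..pi} then l2_norm M (%x. s n t x - H t x) else 0)"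
 define f0 where "f0 = (%t. if t \<in> {- pi..pi} then l2_norm M (%x. F t x - H t x) else 0)"
 have "m0 n \<in> borel_measurable lebesgue" for n unfolding m0_def by (rule borel_measurable_if_I[OF m]) simp
 then have l: "(%t. lim (%n. m0 n t)) \<in> borel_measurable lebesgue" by (rule borel_measurable_lim_metric)
 have "AE t in lebesgue. t \<in> {- pi..pi} --> (%n. l2_norm M (%x. s n t x - H t x)) \<longlonglongrightarrow> l2_norm M (%x. F t x - H t x)"
  using ae by (subst (asm) AE_restrict_space_iff) auto
 then have "AE t in lebesgue. lim (%n. m0 n t) = f0 t"
  by eventually_elim (auto simp: m0_def f0_def intro: limI)
 from borel_measurable_AE[OF l this] have "f0 \<in> borel_measurable LI" by (rule measurable_restrict_space1)
 then show ?thesis by (rule measurable_cong[THEN iffD1, rotated]) (simp add: f0_def)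
qed

section \<open>Norm comparison for the Gelfand transform\<close>

context periodic_SL
begin

lemma gelfand_sum_eq: "gelfand_sum N f t = tsum N (%n. cell n f) t"
 by (simp add: gelfand_sum_def tsum_def cell_def)

text \<open>\<open>F t\<close> is compared with the partial sum \<open>S N t\<close>, whose norm is
  known from Parseval's identity; the error \<open>eps N\<close> tends to 0. Splitting the square of
  a sum costs the factor 2 on either side.\<close>

lemma gelfand_norm_bounds:
 assumes "(f, F) \<in> gelfand"
 shows "(\<integral>\<^sup>+t. ennreal ((nrm (F t))^2) \<partial>LI) <= 2 * ennreal ((l2_norm MR f)^2)"
  "ennreal ((l2_norm MR f)^2) <= 2 * (\<integral>\<^sup>+t. ennreal ((nrm (F t))^2) \<partial>LI)"
proof -
 have f: "f \<in> L2 MR" and F: "F \<in> bochner_L2 {- pi..pi} Ma"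
  and l: "(%N. \<integral>\<^sup>+t. ennreal ((nrm (%x. F t x - gelfand_sum N f t x))^2) \<partial>LI) \<longlonglongrightarrow> 0"
  using assms by (auto simp: gelfand_def)
 define S where "S = (%N t. tsum N (%n. cell n f) t)"
 define eps where "eps = (%N. \<integral>\<^sup>+t. ennreal ((nrm (%x. F t x - S N t x))^2) \<partial>LI)"
 define X where "X = (\<integral>\<^sup>+t. ennreal ((nrm (F t))^2) \<partial>LI)"
 define P where "P = (%N::nat. \<Sum>n = - int N..int N. (nrm (cell n f))^2)"
 have eps: "eps \<longlonglongrightarrow> 0" using l by (simp add: eps_def S_def gelfand_sum_eq)
 have SL: "S N t \<in> L2 Ma" for N t unfolding S_def by (rule tsum_L2) (rule L2_MR_cell(1)[OF f])
 have FL: "F t \<in> L2 Ma" if "t \<in> space LI" for t using F that by (simp add: bochner_L2_def)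
 have par: "(\<integral>\<^sup>+t. ennreal ((nrm (S N t))^2) \<partial>LI) = ennreal (P N)" for N
  unfolding S_def P_def by (rule tsum_parseval) (rule L2_MR_cell(1)[OF f])
 have PL: "P \<longlonglongrightarrow> (l2_norm MR f)^2" "P N <= (l2_norm MR f)^2" for N
  unfolding P_def by (rule L2_MR_cell[OF f])+
 have mS: "(%t. nrm (%x. k x - S N t x)) \<in> borel_measurable LI" if "k \<in> L2 Ma" for k N
  unfolding S_def by (rule continuous_imp_measurable_on_sets_lebesgue[OF tsum_norm_continuous]) (simp_all add: L2_MR_cell(1)[OF f] that)
 have mS0 [measurable]: "(%t. nrm (S N t)) \<in> borel_measurable LI" for N
  using mS[of "%_. 0" N] by (simp add: l2_norm_def)
 have mFS [measurable]: "(%t. nrm (%x. F t x - S N t x)) \<in> borel_measurable LI" for N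
  by (rule bochner_norm_measurable[OF F SL mS])
 have mF [measurable]: "(%t. nrm (F t)) \<in> borel_measurable LI"
  using bochner_norm_measurable[OF F, of "%_ _. 0"] by simp
 have two: "(\<integral>\<^sup>+t. ennreal (u t) \<partial>LI) <= 2 * (\<integral>\<^sup>+t. ennreal (v t) \<partial>LI) + 2 * (\<integral>\<^sup>+t. ennreal (r t) \<partial>LI)"
  if "!!t. t \<in> space LI ==> u t <= 2 * v t + 2 * r t" "!!t. v t >= 0" "!!t. r t >= 0"
   and [measurable]: "v \<in> borel_measurable LI" "r \<in> borel_measurable LI" for u v r :: "real => real"
 proof -
  have "(\<integral>\<^sup>+t. ennreal (u t) \<partial>LI) <= (\<integral>\<^sup>+t. 2 * ennreal (v t) + 2 * ennreal (r t) \<partial>LI)"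
  proof (rule nn_integral_mono)
   fix t assume "t \<in> space LI"
   then have "ennreal (u t) <= ennreal (2 * v t + 2 * r t)" by (intro ennreal_leI that)
   also have "... = 2 * ennreal (v t) + 2 * ennreal (r t)" using that(2,3)[of t] by (simp add: ennreal_plus ennreal_mult)
   finally show "ennreal (u t) <= 2 * ennreal (v t) + 2 * ennreal (r t)" .
  qed
  also have "... = 2 * (\<integral>\<^sup>+t. ennreal (v t) \<partial>LI) + 2 * (\<integral>\<^sup>+t. ennreal (r t) \<partial>LI)"
   by (simp add: nn_integral_add nn_integral_cmult)
  finally show ?thesis .
 qed
 have le1: "X <= 2 * ennreal (P N) + 2 * eps N" for N
  unfolding X_def eps_def par[symmetric] by (rule two) (auto intro!: l2_norm_sq_le2 FL SL simp del: space_restrict_space2)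
 have le2: "ennreal (P N) <= 2 * X + 2 * eps N" for N
  unfolding X_def eps_def par[symmetric]
 proof (rule two)
  fix t assume "t \<in> space LI"
  then have "(nrm (S N t))^2 <= 2 * (nrm (F t))^2 + 2 * (nrm (%x. S N t x - F t x))^2"
   by (intro l2_norm_sq_le2 SL FL)
  then show "(nrm (S N t))^2 <= 2 * (nrm (F t))^2 + 2 * (nrm (%x. F t x - S N t x))^2"
   by (simp add: l2_norm_def norm_minus_commute)
 qed auto
 have eps2: "(%N. 2 * eps N) \<longlonglongrightarrow> 2 * 0" by (rule ennreal_tendsto_cmult[OF _ eps]) simp
 have "(%N. 2 * ennreal ((l2_norm MR f)^2) + 2 * eps N) \<longlonglongrightarrow> 2 * ennreal ((l2_norm MR f)^2) + 2 * 0"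
  by (rule tendsto_add[OF tendsto_const eps2])
 moreover have "X <= 2 * ennreal ((l2_norm MR f)^2) + 2 * eps N" for N
  by (rule order_trans[OF le1[of N]]) (intro add_right_mono mult_left_mono ennreal_leI PL(2), simp)
 ultimately have "X <= 2 * ennreal ((l2_norm MR f)^2) + 2 * 0" by (intro LIMSEQ_le_const) auto
 then show "(\<integral>\<^sup>+t. ennreal ((nrm (F t))^2) \<partial>LI) <= 2 * ennreal ((l2_norm MR f)^2)" by (simp add: X_def)
 have "(%N. 2 * X + 2 * eps N) \<longlonglongrightarrow> 2 * X + 2 * 0" by (rule tendsto_add[OF tendsto_const eps2])
 moreover have "(%N. ennreal (P N)) \<longlonglongrightarrow> ennreal ((l2_norm MR f)^2)" by (intro tendsto_ennrealI PL)
 ultimately have "ennreal ((l2_norm MR f)^2) <= 2 * X + 2 * 0" using le2 by (intro LIMSEQ_le) auto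
 then show "ennreal ((l2_norm MR f)^2) <= 2 * (\<integral>\<^sup>+t. ennreal ((nrm (F t))^2) \<partial>LI)" by (simp add: X_def)
qed

end

section \<open>Fourier coefficients in t and the inverse transform of continuous functions\<close>

definition fcoef :: "(real => cfun) => int => cfun" where
 "fcoef H n x = of_real (1 / sqrt (2 * pi)) * integral {- pi..pi} (%t. cnj (ek n t) * H t x)"

lemma sqrt_2pi: "complex_of_real (1 / sqrt (2 * pi)) * (of_real (1 / sqrt (2 * pi)) * (2 * of_real pi)) = 1"
proof -
 have "1 / sqrt (2 * pi) * (1 / sqrt (2 * pi) * (2 * pi)) = 1" by simp
 then have "complex_of_real (1 / sqrt (2 * pi) * (1 / sqrt (2 * pi) * (2 * pi))) = 1" by (simp only: of_real_1)
 then show ?thesis by (simp only: of_real_mult of_real_numeral)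
qed

text \<open>Let \<open>b\<close> be the sum and \<open>s\<close> the Fourier sum of
  \<open>h\<close>. The squared norm of \<open>s\<close> and the scalar product of \<open>s\<close>
  with \<open>h\<close> are both \<open>b\<close>, so Cauchy-Schwarz bounds \<open>b\<close> by the
  squared norm of \<open>h\<close>.\<close>

lemma bessel:
 assumes c: "continuous_on {- pi..pi} (%t. H t x)" and B: "!!t. t \<in> {- pi..pi} ==> norm (H t x) <= B"
 shows "(\<Sum>n = - int N..int N. (norm (fcoef H n x))^2) <= 2 * pi * B^2"
proof -
 define h where "h = (%t. H t x)"
 define S where "S = {- int N..int N}"
 \<comment> \<open>The counting measure on one point turns the vector valued
   \<open>tsum_parseval\<close> into its scalar case.\<close>
 define P :: "real measure" where "P = count_space {0}"
 define b where "b = (\<Sum>n\<in>S. (norm (fcoef H n x))^2)"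
 define s where "s = (%t. \<Sum>n\<in>S. (of_real (1 / sqrt (2 * pi)) * fcoef H n x) * ek n t)"
 have L2c: "continuous_on {- pi..pi} f ==> f \<in> L2 LI" for f :: cfun
  unfolding L2_def by (auto intro!: continuous_imp_measurable_on_sets_lebesgue continuous_LI(1) continuous_intros)
 have hL: "h \<in> L2 LI" using c by (auto simp: h_def intro: L2c)
 have eL: "ek n \<in> L2 LI" for n by (rule L2c) (intro continuous_intros)
 have sL: "s \<in> L2 LI" unfolding s_def by (rule L2c) (intro continuous_intros)
 have b0: "b >= 0" by (simp add: b_def sum_nonneg)
 have kP: "(%_. k) \<in> L2 P" for k by (auto simp: L2_def P_def integrable_count_space)
 have nP: "l2_norm P f = norm (f 0)" for f
  by (simp add: l2_norm_def P_def lebesgue_integral_count_space_finite)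
 have st: "tsum N (%n _. fcoef H n x) t = (%_. s t)" for t
  by (simp add: tsum_def s_def S_def sum_distrib_left mult_ac)
 have "(\<integral>\<^sup>+t. ennreal ((norm (s t))^2) \<partial>LI) = ennreal b"
  using tsum_parseval[of "%n _. fcoef H n x" P N] unfolding st by (simp add: kP nP b_def S_def)
 moreover have "(\<integral>\<^sup>+t. ennreal ((norm (s t))^2) \<partial>LI) = ennreal ((l2_norm LI s)^2)"
  using nn2_eq_l2_norm[OF sL] by (simp add: nn2_def)
 ultimately have sn: "(l2_norm LI s)^2 = b" using b0 by simp
 have he: "l2_inner LI (ek n) h = cnj (of_real (sqrt (2 * pi)) * fcoef H n x)" for n
 proof -
  have "l2_inner LI h (ek n) = integral {- pi..pi} (%t. h t * cnj (ek n t))"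
   unfolding l2_inner_def by (rule continuous_LI(2)) (use c in \<open>auto simp: h_def intro!: continuous_intros\<close>)
  also have "... = of_real (sqrt (2 * pi)) * fcoef H n x"
   by (simp add: fcoef_def h_def mult.commute)
  finally show ?thesis by (subst l2_inner_cnj) simp
 qed
 have "l2_inner LI s h = (\<Sum>n\<in>S. (of_real (1 / sqrt (2 * pi)) * fcoef H n x) * l2_inner LI (ek n) h)"
  unfolding s_def by (rule l2_inner_sum_left) (use eL hL in \<open>auto simp: S_def\<close>)
 also have "... = (\<Sum>n\<in>S. fcoef H n x * cnj (fcoef H n x))" unfolding he by simp
 also have "... = of_real b" unfolding b_def of_real_sum complex_norm_square ..
 finally have "b <= l2_norm LI s * l2_norm LI h" using l2_inner_bound[OF sL hL] b0 by simp
 then have "b^2 <= (l2_norm LI s * l2_norm LI h)^2" using b0 by (rule power_mono)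
 then have "b * b <= b * (l2_norm LI h)^2" unfolding power_mult_distrib sn by (simp only: power2_eq_square[of b])
 then have "b <= (l2_norm LI h)^2" using b0 by (cases "b = 0") (auto simp: mult_le_cancel_left)
 also have "... = integral {- pi..pi} (%t. (norm (h t))^2)"
  unfolding l2_norm_sq by (rule continuous_LI(2)) (use c in \<open>auto simp: h_def intro!: continuous_intros\<close>)
 also have "... <= integral {- pi..pi} (%t. B^2)"
  by (rule Henstock_Kurzweil_Integration.integral_le)
   (use c B in \<open>auto simp: h_def intro!: integrable_continuous_real continuous_intros power_mono\<close>)
 also have "... = 2 * pi * B^2" by simp
 finally show ?thesis by (simp add: b_def S_def)
qed

inductive trig_poly :: "(real => cfun) => bool" where
 trig_mono: "trig_poly (%t x. c x * ek k t)"
| trig_add: "trig_poly f ==> trig_poly g ==> trig_poly (%t x. f t x + g t x)"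

lemma trig_poly_mult:
 assumes "trig_poly f" "trig_poly g"
 shows "trig_poly (%t x. f t x * g t x)"
 using assms(1)
proof (induction rule: trig_poly.induct)
 case (trig_mono c k)
 show ?case using assms(2)
 proof (induction rule: trig_poly.induct)
  case (trig_mono d l)
  have "(%t x. c x * ek k t * (d x * ek l t)) = (%t x. (c x * d x) * ek (k + l) t)"
   by (auto simp: fun_eq_iff exp_add[symmetric] algebra_simps)
  then show ?case using trig_poly.trig_mono[of "%x. c x * d x" "k + l"] by simp
 next
  case (trig_add f g)
  then show ?case using trig_poly.trig_add by (simp add: distrib_left)
 qed
next
 case (trig_add f g)
 then show ?case using trig_poly.trig_add by (simp add: distrib_right)
qed

text \<open>By orthogonality, from the degree on the partial Fourier sums are the trigonometric
  polynomial itself. Convergence for continuous functions is reduced to this case.\<close>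

lemma trig_poly_reproduce:
 assumes "trig_poly f"
 shows "(\<forall>x. continuous_on {- pi..pi} (%t. f t x)) & (\<exists>d. \<forall>N\<ge>d. \<forall>t x. tsum N (fcoef f) t x = f t x)"
 using assms
proof (induction rule: trig_poly.induct)
 case (trig_mono c k)
 have co: "fcoef (%t x. c x * ek k t) n x = (if n = k then of_real (1 / sqrt (2 * pi)) * (2 * of_real pi) * c x else 0)" for n x
 proof -
  have "(%t. cnj (ek n t) * (c x * ek k t)) = (%t. c x * exp (\<i> * of_int (n - k) * of_real t))"
   using ek_mult_cnj[of k _ n] by (simp add: mult_ac fun_eq_iff)
  then show ?thesis unfolding fcoef_def by (simp add: integral_exp_int[of "n - k", simplified])
 qed
 have "tsum N (fcoef (%t x. c x * ek k t)) t x = c x * ek k t" if "N >= nat \<bar>k\<bar>" for N t x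
 proof -
  have "(\<Sum>n = - int N..int N. ek n t * fcoef (%t x. c x * ek k t) n x)
    = (\<Sum>n = - int N..int N. if n = k then ek k t * (of_real (1 / sqrt (2 * pi)) * (2 * of_real pi) * c x) else 0)"
   by (intro sum.cong refl) (subst co, simp)
  also have "... = ek k t * (of_real (1 / sqrt (2 * pi)) * (2 * of_real pi) * c x)" using that by (subst sum.delta) auto
  finally have "tsum N (fcoef (%t x. c x * ek k t)) t x
   = (of_real (1 / sqrt (2 * pi)) * (of_real (1 / sqrt (2 * pi)) * (2 * of_real pi))) * (c x * ek k t)"
   by (simp only: tsum_def mult_ac)
  then show ?thesis by (simp only: sqrt_2pi mult_1)
 qed
 then show ?case by (auto intro!: continuous_intros)
next
 case (trig_add f g)
 then obtain d e where d: "\<forall>N\<ge>d. \<forall>t x. tsum N (fcoef f) t x = f t x" and e: "\<forall>N\<ge>e. \<forall>t x. tsum N (fcoef g) t x = g t x" by blast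
 have c: "continuous_on {- pi..pi} (%t. f t x)" "continuous_on {- pi..pi} (%t. g t x)" for x using trig_add by blast+
 have "fcoef (%t x. f t x + g t x) n x = fcoef f n x + fcoef g n x" for n x
  unfolding fcoef_def distrib_left
  by (subst Henstock_Kurzweil_Integration.integral_add)
   (use c in \<open>auto simp: distrib_left intro!: integrable_continuous_real continuous_intros\<close>)
 then have "tsum N (fcoef (%t x. f t x + g t x)) t x = tsum N (fcoef f) t x + tsum N (fcoef g) t x" for N t x
  by (simp add: tsum_def sum.distrib distrib_left)
 then show ?case using c d e by (auto intro!: continuous_intros exI[of _ "max d e"])
qed

text \<open>A polynomial in \<open>cos t\<close>, \<open>sin t\<close> and \<open>x\<close> is a
  trigonometric polynomial in \<open>t\<close>. A linear functional is split by the basis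
  \<open>1\<close>, \<open>\<i>\<close> of the plane and the third axis, and cosine and sine are
  written by exponentials.\<close>

lemma trig_poly_polynomial:
 assumes "real_polynomial_function g"
 shows "trig_poly (%t x. of_real (g (cis t, x :: real)))"
 using assms
proof (induction rule: real_polynomial_function.induct)
 case (linear f)
 define A B C where "A = f (1, 0)" and "B = f (\<i>, 0)" and "C = f (0, 1)"
 have "f (cis t, x) = C * x + (A * cos t + B * sin t)" for t x
 proof -
  have "(cis t, x) = cos t *\<^sub>R (1, 0) + (sin t *\<^sub>R (\<i>, 0) + x *\<^sub>R (0, 1))" by (simp add: complex_eq_iff)
  then have "f (cis t, x) = f (cos t *\<^sub>R (1, 0) + (sin t *\<^sub>R (\<i>, 0) + x *\<^sub>R (0, 1)))" by simp
  also have "... = cos t * A + (sin t * B + x * C)"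
   by (simp only: bounded_linear.linear[OF linear] linear_add linear_scale A_def B_def C_def real_scaleR_def)
  finally show ?thesis by (simp add: algebra_simps)
 qed
 moreover have "complex_of_real (A * cos t + B * sin t) = (of_real A - \<i> * of_real B) / 2 * ek (- 1) t + (of_real A + \<i> * of_real B) / 2 * ek 1 t" for t
  by (simp add: cos_of_real[symmetric] sin_of_real[symmetric] cos_exp_eq sin_exp_eq field_simps)
 ultimately have "(%t x. complex_of_real (f (cis t, x))) = (%t x. of_real (C * x) * ek 0 t +
  ((of_real A - \<i> * of_real B) / 2 * ek (- 1) t + (of_real A + \<i> * of_real B) / 2 * ek 1 t))" by (simp add: fun_eq_iff)
 then show ?case by (simp only:) (intro trig_add trig_mono)
next
 case (const c)
 then show ?case using trig_mono[of "%_. of_real c" 0] by simp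
next
 case (add f g)
 then show ?case using trig_add by simp
next
 case (mult f g)
 then show ?case using trig_poly_mult by simp
qed

text \<open>Stone-Weierstrass on the cylinder formed by the unit circle and \<open>{0..a}\<close>.
  As the values at \<open>- pi\<close> and \<open>pi\<close> agree, \<open>G\<close> descends to a
  function \<open>f\<close> there. \<open>f\<close> is continuous because its graph is compact,
  being a continuous image of the rectangle.\<close>

lemma trig_poly_approx:
 assumes c: "continuous_on ({- pi..pi} \<times> {0..a}) (%(t, x). G t x)" and per: "!!x. x \<in> {0..a} ==> G (- pi) x = G pi x" and e: "e > 0"
 obtains P where "trig_poly P" "continuous_on UNIV (%(t, x). P t x)" "!!t x. t \<in> {- pi..pi} ==> x \<in> {0..a} ==> norm (G t x - P t x) < (e :: real)"
proof -
 define R where "R = {- pi..pi} \<times> {0..a}"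
 define S where "S = (sphere 0 1 :: complex set) \<times> {0..a}"
 define f where "f = (%(z, x). G (Arg z) x)"
 have fG: "f (cis t, x) = G t x" if "t \<in> {- pi..pi}" "x \<in> {0..a}" for t x
 proof (cases "t = - pi")
  case True
  then have "cis t = cis pi" by (simp add: complex_eq_iff)
  moreover have "Arg (cis pi) = pi" by (rule Arg_cis) auto
  ultimately show ?thesis using True per that by (simp only: f_def split_conv)
 qed (use that in \<open>simp add: f_def Arg_cis\<close>)
 have cR: "compact R" unfolding R_def by (intro compact_Times compact_Icc)
 have cT: "compact ((%(t, x). G t x) ` R)" using c cR unfolding R_def by (rule compact_continuous_image)
 have param: "\<exists>t. t \<in> {- pi..pi} & z = cis t" if "z \<in> sphere 0 1" for z
  using that Arg_bounded[of z] rcis_cmod_Arg[of z] by (intro exI[of _ "Arg z"]) (auto simp: rcis_def)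
 have img: "(%p. (p, f p)) ` S = (%(t, x). ((cis t, x), G t x)) ` R"
 proof (intro equalityI subsetI)
  fix y assume "y \<in> (%p. (p, f p)) ` S"
  then obtain z x where "z \<in> sphere 0 1" "x \<in> {0..a}" "y = ((z, x), f (z, x))" by (auto simp: S_def)
  moreover then obtain t where "t \<in> {- pi..pi}" "z = cis t" using param by blast
  ultimately show "y \<in> (%(t, x). ((cis t, x), G t x)) ` R" using fG by (intro image_eqI[of _ _ "(t, x)"]) (auto simp: R_def)
 next
  fix y assume "y \<in> (%(t, x). ((cis t, x), G t x)) ` R"
  then obtain t x where "t \<in> {- pi..pi}" "x \<in> {0..a}" "y = ((cis t, x), G t x)" by (auto simp: R_def)
  then show "y \<in> (%p. (p, f p)) ` S" using fG by (intro image_eqI[of _ _ "(cis t, x)"]) (auto simp: S_def)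
 qed
 have "continuous_on R (%(t, x). ((cis t, x), G t x))"
  using c unfolding R_def case_prod_unfold by (intro continuous_intros)
 then have "compact ((%p. (p, f p)) ` S)" unfolding img using cR by (rule compact_continuous_image)
 then have "closed ((%p. (p, f p)) ` S)" by (rule compact_imp_closed)
 moreover have fS: "f \<in> S \<rightarrow> (%(t, x). G t x) ` R"
 proof
  fix y assume "y \<in> S"
  then obtain z x where "z \<in> sphere 0 1" "x \<in> {0..a}" "y = (z, x)" by (auto simp: S_def)
  moreover then obtain t where "t \<in> {- pi..pi}" "z = cis t" using param by blast
  ultimately show "f y \<in> (%(t, x). G t x) ` R" using fG by (intro image_eqI[of _ _ "(t, x)"]) (auto simp: R_def)
 qed
 ultimately have "continuous_on S f"
  by (intro continuous_from_closed_graph[OF cT]) (auto intro!: closed_subset)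
 moreover have "compact S" unfolding S_def by (intro compact_Times compact_sphere compact_Icc)
 ultimately obtain g where g: "polynomial_function g" "!!y. y \<in> S ==> norm (f y - g y) < e"
  using Stone_Weierstrass_polynomial_function[of S f e] e by blast
 define P where "P = (%t x. g (cis t, x :: real))"
 have re: "real_polynomial_function (%y. Re (g y))" "real_polynomial_function (%y. Im (g y))"
  using g(1) bounded_linear_Re bounded_linear_Im unfolding polynomial_function_def by (auto simp: o_def)
 have Peq: "P = (%t x. of_real (Re (g (cis t, x))) + (\<i> * ek 0 t) * of_real (Im (g (cis t, x))))"
  by (simp add: P_def fun_eq_iff complex_eq[symmetric])
 show ?thesis
 proof (rule that)
  show "trig_poly P" unfolding Peq by (intro trig_add trig_poly_mult trig_mono trig_poly_polynomial re)
  show "continuous_on UNIV (%(t, x). P t x)"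
   unfolding P_def case_prod_unfold
   by (intro continuous_on_compose2[OF continuous_on_polymonial_function[OF g(1)], of UNIV] continuous_intros) auto
  show "norm (G t x - P t x) < e" if "t \<in> {- pi..pi}" "x \<in> {0..a}" for t x
   using g(2)[of "(cis t, x)"] fG[OF that] that by (simp add: S_def P_def)
 qed
qed

lemma l2_norm_cong_space: "(!!x. x \<in> space M ==> f x = g x) ==> l2_norm M f = l2_norm M g"
 unfolding l2_norm_def by (simp cong: Bochner_Integration.integral_cong)

context periodic_SL
begin

abbreviation (input) rectangle :: "(real \<times> real) set" where "rectangle \<equiv> {- pi..pi} \<times> {0..a}"

lemma rect_slice:
 assumes "continuous_on rectangle (%(t, x). H t x)"
 shows "x \<in> {0..a} ==> continuous_on {- pi..pi} (%t. H t x)" "t \<in> {- pi..pi} ==> continuous_on {0..a} (H t)"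
proof -
 have "continuous_on {- pi..pi} (%t. (%(t, x). H t x) (t, x))" if "x \<in> {0..a}"
  by (rule continuous_on_compose2[OF assms]) (use that in \<open>auto intro!: continuous_intros\<close>)
 then show "x \<in> {0..a} ==> continuous_on {- pi..pi} (%t. H t x)" by simp
 have "continuous_on {0..a} (%x. (%(t, x). H t x) (t, x))" if "t \<in> {- pi..pi}"
  by (rule continuous_on_compose2[OF assms]) (use that in \<open>auto intro!: continuous_intros\<close>)
 then show "t \<in> {- pi..pi} ==> continuous_on {0..a} (H t)" by simp
qed

lemma fcoef_continuous:
 assumes "continuous_on rectangle (%(t, x). H t x)"
 shows "continuous_on {0..a} (fcoef H n)"
proof -
 have "continuous_on ({0..a} \<times> cbox (- pi) pi) (%y. (%(t, x). H t x) (snd y, fst y))"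
  by (rule continuous_on_compose2[OF assms]) (auto intro!: continuous_intros)
 then have "continuous_on ({0..a} \<times> cbox (- pi) pi) (%(x, t). cnj (ek n t) * H t x)"
  unfolding case_prod_unfold by (intro continuous_intros) simp
 from integral_continuous_on_param[OF this] show ?thesis
  unfolding fcoef_def by (intro continuous_intros) simp
qed

text \<open>Bessel's inequality for each \<open>x\<close>, integrated over the period.\<close>

lemma fcoef_norms:
 assumes c: "continuous_on rectangle (%(t, x). H t x)"
  and B: "B >= 0" "!!t x. t \<in> {- pi..pi} ==> x \<in> {0..a} ==> norm (H t x) <= B"
 shows "fcoef H n \<in> L2 Ma" "(\<Sum>n = - int N..int N. (nrm (fcoef H n))^2) <= 2 * pi * B^2 * Wn"
proof -
 show cL: "fcoef H n \<in> L2 Ma" for n by (rule continuous_L2[OF fcoef_continuous[OF c]])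
 define K where "K = sqrt (2 * pi) * B"
 have K0: "K >= 0" using B(1) by (simp add: K_def)
 have K: "(%_. of_real K) \<in> L2 Ma" "nrm (%_. of_real K) <= K * sqrt Wn"
  using bounded_L2[of "%_. of_real K" K] K0 by auto
 have "(\<Sum>n = - int N..int N. (nrm (fcoef H n))^2) = (\<integral>x. (\<Sum>n = - int N..int N. (norm (fcoef H n x))^2) \<partial>Ma)"
  unfolding l2_norm_sq by (rule Bochner_Integration.integral_sum[symmetric]) (rule L2D(2)[OF cL])
 also have "... <= (\<integral>x. (norm (complex_of_real K))^2 \<partial>Ma)"
 proof (rule integral_mono)
  fix x assume "x \<in> space Ma"
  then have "x \<in> {0..a}" by (simp add: space_Ma)
  then have "(\<Sum>n = - int N..int N. (norm (fcoef H n x))^2) <= 2 * pi * B^2"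
   using bessel[of H x B N] rect_slice(1)[OF c] B(2) by blast
  also have "... = (norm (complex_of_real K))^2" using B(1) by (simp add: K_def power_mult_distrib norm_mult)
  finally show "(\<Sum>n = - int N..int N. (norm (fcoef H n x))^2) <= (norm (complex_of_real K))^2" .
 next
  show "integrable Ma (%x. \<Sum>n = - int N..int N. (norm (fcoef H n x))^2)"
   by (rule Bochner_Integration.integrable_sum) (rule L2D(2)[OF cL])
  show "integrable Ma (%x. (norm (complex_of_real K))^2)" by (rule L2D(2)[OF K(1)])
 qed
 also have "... = (nrm (%_. of_real K))^2" by (simp only: l2_norm_sq)
 also have "... <= (K * sqrt Wn)^2" using K(2) by (rule power_mono) simp
 also have "... = 2 * pi * B^2 * Wn" using Wn_nonneg by (simp add: K_def power_mult_distrib)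
 finally show "(\<Sum>n = - int N..int N. (nrm (fcoef H n))^2) <= 2 * pi * B^2 * Wn" .
qed

lemma rect_bounded:
 assumes "continuous_on rectangle (%(t, x). H t x)"
 obtains B where "B >= (0::real)" "!!t x. t \<in> {- pi..pi} ==> x \<in> {0..a} ==> norm (H t x :: complex) <= B"
proof -
 have "bounded ((%(t, x). H t x) ` rectangle)"
  by (intro compact_imp_bounded compact_continuous_image assms compact_Times compact_Icc)
 then obtain B where "B > 0" "!!y. y \<in> (%(t, x). H t x) ` rectangle ==> norm y <= B" by (meson bounded_pos)
 then show ?thesis using that[of B] by force
qed

text \<open>The simple functions take the value of \<open>G\<close> at the grid point
  \<open>g n t\<close>, which is within \<open>2 * pi / (1 + n)\<close> of \<open>t\<close>; uniform
  continuity gives the convergence.\<close>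

lemma rect_bochner:
 assumes c: "continuous_on rectangle (%(t, x). G t x)"
 shows "G \<in> bochner_L2 {- pi..pi} Ma"
 unfolding bochner_L2_def mem_Collect_eq
proof (intro conjI ballI)
 show GL: "t \<in> {- pi..pi} ==> G t \<in> L2 Ma" for t by (rule continuous_L2[OF rect_slice(2)[OF c]])
 define g where "g = (%n t. - pi + 2 * pi * (of_int \<lfloor>(t + pi) / (2 * pi) * (1 + real n)\<rfloor> / (1 + real n)))"
 have gI: "g n t \<in> {- pi..pi}" "\<bar>t - g n t\<bar> <= 2 * pi / (1 + real n)" if t: "t \<in> {- pi..pi}" for n t
 proof -
  define y where "y = (t + pi) / (2 * pi)"
  have y: "0 <= y" "y <= 1" "t = - pi + 2 * pi * y" using t pi_gt_zero by (auto simp: y_def field_simps)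
  define k where "k = \<lfloor>y * (1 + real n)\<rfloor>"
  have k: "of_int k <= y * (1 + real n)" "y * (1 + real n) <= of_int k + 1" unfolding k_def by linarith+
  have k0: "k >= 0" using y(1) by (simp add: k_def)
  define r where "r = of_int k / (1 + real n)"
  have rn: "r * (1 + real n) = of_int k" by (simp add: r_def)
  have "(y - r) * (1 + real n) <= 1" using k(2) by (simp only: left_diff_distrib rn)
  then have r: "0 <= r" "r <= y" "y - r <= 1 / (1 + real n)"
   using k(1) k0 by (simp_all add: r_def pos_le_divide_eq pos_divide_le_eq)
  have gr: "g n t = - pi + 2 * pi * r" by (simp add: g_def r_def k_def y_def)
  have "2 * pi * r <= 2 * pi * 1" using r y by (intro mult_left_mono) auto
  then show "g n t \<in> {- pi..pi}" using r(1) by (simp add: gr)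
  have "t - g n t = 2 * pi * (y - r)" unfolding gr using y(3) by (simp add: algebra_simps)
  then have "\<bar>t - g n t\<bar> = 2 * pi * (y - r)" using r(2) by simp
  also have "... <= 2 * pi * (1 / (1 + real n))" using r(3) by (intro mult_left_mono) auto
  finally show "\<bar>t - g n t\<bar> <= 2 * pi / (1 + real n)" by simp
 qed
 have gs: "simple_function LI (g n)" for n
 proof (rule simple_function_borel_measurable)
  have "g n \<in> borel_measurable lebesgue" unfolding g_def by (intro measurable_completion) measurable
  then show "g n \<in> borel_measurable LI" by (rule measurable_restrict_space1)
  have "g n ` space LI <= (%k. - pi + 2 * pi * (of_int k / (1 + real n))) ` {0..1 + int n}"
  proof
   fix y assume "y \<in> g n ` space LI"
   then obtain t where t: "t \<in> {- pi..pi}" "y = g n t" by auto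
   have y: "0 <= (t + pi) / (2 * pi)" "(t + pi) / (2 * pi) <= 1" using t(1) pi_gt_zero by (auto simp: field_simps)
   have "0 <= \<lfloor>(t + pi) / (2 * pi) * (1 + real n)\<rfloor>" unfolding zero_le_floor by (rule mult_nonneg_nonneg[OF y(1)]) simp
   moreover have "(t + pi) / (2 * pi) * (1 + real n) <= 1 * (1 + real n)" using y(2) by (intro mult_right_mono) auto
   then have "\<lfloor>(t + pi) / (2 * pi) * (1 + real n)\<rfloor> <= 1 + int n" unfolding floor_le_iff by (rule le_less_trans) simp
   ultimately show "y \<in> (%k. - pi + 2 * pi * (of_int k / (1 + real n))) ` {0..1 + int n}" by (auto simp: t(2) g_def)
  qed
  then show "finite (g n ` space LI)" by (rule finite_subset) simp
 qed
 have conv: "(%n. nrm (%x. G t x - G (g n t) x)) \<longlonglongrightarrow> 0" if t: "t \<in> {- pi..pi}" for t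
 proof (rule LIMSEQ_I)
  fix r :: real assume r: "r > 0"
  define e where "e = r / (2 * (1 + sqrt Wn))"
  have W2: "0 < 2 * (1 + sqrt Wn)" by (intro mult_pos_pos add_pos_nonneg real_sqrt_ge_zero Wn_nonneg) auto
  have e0: "e > 0" unfolding e_def using r W2 by (rule divide_pos_pos)
  have "uniformly_continuous_on rectangle (%(t, x). G t x)"
   by (rule compact_uniformly_continuous[OF c]) (intro compact_Times compact_Icc)
  then obtain d where d: "d > 0" "!!y y'. y \<in> rectangle ==> y' \<in> rectangle ==> dist y' y < d ==>
    dist ((%(t, x). G t x) y') ((%(t, x). G t x) y) < e"
   using e0 unfolding uniformly_continuous_on_def by metis
  obtain n0 :: nat where n0: "2 * pi / d < real n0" using reals_Archimedean2 by blast
  have "norm (nrm (%x. G t x - G (g n t) x) - 0) < r" if n: "n >= n0" for n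
  proof -
   have "2 * pi / d < 1 + real n" using n0 n by linarith
   then have "2 * pi / (1 + real n) < d" using d(1) by (simp add: field_simps)
   then have tg: "\<bar>t - g n t\<bar> < d" using gI(2)[OF t, of n] by linarith
   have "norm (G t x - G (g n t) x) <= e" if "x \<in> {0<..<a}" for x
    using d(2)[of "(g n t, x)" "(t, x)"] tg that t gI(1)[OF t, of n] by (auto simp: dist_Pair_Pair dist_norm)
   moreover have "(%x. G t x - G (g n t) x) \<in> borel_measurable La"
    using L2D(1)[OF L2_diff[OF GL[OF t] GL[OF gI(1)[OF t]]], of n] by (simp add: measurable_Ma)
   ultimately have "nrm (%x. G t x - G (g n t) x) <= e * sqrt Wn" using e0 by (intro bounded_L2(2)) auto
   also have "... < e * (2 * (1 + sqrt Wn))" using e0 W2 by (intro mult_strict_left_mono) auto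
   also have "... = r" using W2 unfolding e_def by (subst nonzero_eq_divide_eq[symmetric]) auto
   finally show ?thesis by simp
  qed
  then show "\<exists>n0. \<forall>n\<ge>n0. norm (nrm (%x. G t x - G (g n t) x) - 0) < r" by blast
 qed
 show "\<exists>s. (\<forall>n::nat. simple_function LI (s n) & s n ` {- pi..pi} <= L2 Ma) &
  (AE t in LI. (%n. nrm (%x. G t x - s n t x)) \<longlonglongrightarrow> 0)"
 proof (intro exI[of _ "%n t. G (g n t)"] conjI allI)
  show "simple_function LI (%t. G (g n t))" for n using simple_function_compose[OF gs, of G] by (simp add: o_def)
  show "(%t. G (g n t)) ` {- pi..pi} <= L2 Ma" for n using gI(1) GL by blast
  show "AE t in LI. (%n. nrm (%x. G t x - G (g n t) x)) \<longlonglongrightarrow> 0"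
   using AE_space[of LI] by eventually_elim (use conv in auto)
 qed
 obtain B where B: "B >= 0" "!!t x. t \<in> {- pi..pi} ==> x \<in> {0..a} ==> norm (G t x) <= B" by (rule rect_bounded[OF c], rule that)
 have "(\<integral>\<^sup>+t. ennreal ((nrm (G t))^2) \<partial>LI) <= (\<integral>\<^sup>+t. ennreal ((B * sqrt Wn)^2) \<partial>LI)"
 proof (intro nn_integral_mono ennreal_leI power_mono)
  fix t assume "t \<in> space LI"
  then have t: "t \<in> {- pi..pi}" by simp
  show "nrm (G t) <= B * sqrt Wn"
   using B t L2D(1)[OF GL[OF t]] by (intro bounded_L2(2)) (auto simp: measurable_Ma)
 qed simp
 also have "... < \<infinity>" by (simp add: emeasure_restrict_space ennreal_mult_less_top)
 finally show "(\<integral>\<^sup>+t. ennreal ((nrm (G t))^2) \<partial>LI) < \<infinity>" .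
qed

text \<open>The function \<open>g\<close> is assembled from the Fourier coefficients of
  \<open>G\<close>. Their sums converge in mean because \<open>G\<close> is uniformly within
  \<open>e\<close> of a trigonometric polynomial, which its Fourier sums reproduce, while Bessel's
  inequality controls the Fourier sums of the difference.\<close>

lemma gelfand_surj:
 assumes c: "continuous_on rectangle (%(t, x). G t x)" and per: "!!x. x \<in> {0..a} ==> G (- pi) x = G pi x"
 obtains g where "(g, G) \<in> gelfand"
proof -
 obtain B where B: "B >= 0" "!!t x. t \<in> {- pi..pi} ==> x \<in> {0..a} ==> norm (G t x) <= B" by (rule rect_bounded[OF c], rule that)
 \<comment> \<open>On the open cell with index n this is \<open>fcoef G n\<close>. The truncation
   keeps the argument in \<open>{0..a}\<close>, where \<open>fcoef G n\<close> is continuous, so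
   that measurability follows for each value of the floor.\<close>
 define g where "g = (%y. fcoef G \<lfloor>y / a\<rfloor> (max 0 (min a (y - of_int \<lfloor>y / a\<rfloor> * a))))"
 have ge: "cell n g x = fcoef G n x" if "x \<in> {0<..<a}" for n x
 proof -
  have "\<lfloor>(x + of_int n * a) / a\<rfloor> = n" using that a_pos by (intro floor_unique) (auto simp: field_simps)
  then show ?thesis using that by (simp add: cell_def g_def)
 qed
 have gm: "g \<in> borel_measurable lebesgue"
 proof (intro measurable_completion)
  show "g \<in> borel_measurable lborel" unfolding g_def
  proof (rule measurable_compose_countable[where f = "%i y. fcoef G i (max 0 (min a (y - of_int i * a)))"])
   fix i :: int
   have "continuous_on UNIV (%y. fcoef G i (max 0 (min a (y - of_int i * a))))"
    by (rule continuous_on_compose2[OF fcoef_continuous[OF c]]) (use a_pos in \<open>auto intro!: continuous_intros\<close>)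
   then show "(%y. fcoef G i (max 0 (min a (y - of_int i * a)))) \<in> borel_measurable lborel"
    by (simp add: borel_measurable_continuous_onI)
  qed measurable
 qed
 have cg: "cell n g \<in> L2 Ma" "nrm (cell n g) = nrm (fcoef G n)" for n
 proof -
  show "nrm (cell n g) = nrm (fcoef G n)" by (rule l2_norm_cong_space) (simp add: ge space_Ma)
  have "nn2 Ma (cell n g) = nn2 Ma (fcoef G n)" unfolding nn2_def by (rule nn_integral_cong) (simp add: ge space_Ma)
  then show "cell n g \<in> L2 Ma" using fcoef_norms(1)[OF c B] cell_measurable[OF gm] by (simp add: L2_iff_nn2)
 qed
 have gL: "g \<in> L2 MR"
  by (rule L2_MR_I(1)[OF gm cg(1)]) (unfold cg(2), rule fcoef_norms(2)[OF c B])
 have norm_eq: "nrm (%x. G t x - gelfand_sum N g t x) = nrm (%x. G t x - tsum N (fcoef G) t x)" for N t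
  by (rule l2_norm_cong_space) (simp add: gelfand_sum_eq tsum_def ge space_Ma)
 \<comment> \<open>The terms \<open>2 * (nrm (H t))^2\<close> and \<open>2 * (nrm (T t))^2\<close>
   contribute \<open>4 * pi * e^2 * Wn\<close> each, the first by the length of the interval, the
   second by Parseval and \<open>fcoef_norms\<close>.\<close>
 have est: "\<exists>d. \<forall>N\<ge>d. (\<integral>\<^sup>+t. ennreal ((nrm (%x. G t x - tsum N (fcoef G) t x))^2) \<partial>LI) <= ennreal (8 * pi * e^2 * Wn)"
  if e: "e > 0" for e
 proof -
  obtain P where P: "trig_poly P" "continuous_on UNIV (%(t, x). P t x)" "!!t x. t \<in> {- pi..pi} ==> x \<in> {0..a} ==> norm (G t x - P t x) < e"
   by (rule trig_poly_approx[OF c per e], assumption, rule that)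
  obtain d where d: "!!N t x. N >= d ==> tsum N (fcoef P) t x = P t x" using trig_poly_reproduce[OF P(1)] by blast
  have Pc: "continuous_on rectangle (%(t, x). P t x)" using P(2) by (rule continuous_on_subset) simp
  define H where "H = (%t x. G t x - P t x)"
  have Hc: "continuous_on rectangle (%(t, x). H t x)" using continuous_on_diff[OF c Pc] by (simp add: H_def case_prod_unfold)
  have HB: "t \<in> {- pi..pi} ==> x \<in> {0..a} ==> norm (H t x) <= e" for t x using P(3) by (simp add: H_def less_imp_le)
  note e0 = less_imp_le[OF e]
  have co: "fcoef H n x = fcoef G n x - fcoef P n x" if "x \<in> {0..a}" for n x
  proof -
   have "integral {- pi..pi} (%t. cnj (ek n t) * H t x) = integral {- pi..pi} (%t. cnj (ek n t) * G t x) - integral {- pi..pi} (%t. cnj (ek n t) * P t x)"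
    unfolding H_def right_diff_distrib
    by (intro Henstock_Kurzweil_Integration.integral_diff integrable_continuous_real continuous_intros rect_slice(1)[OF c that] rect_slice(1)[OF Pc that])
   then show ?thesis by (simp add: fcoef_def right_diff_distrib)
  qed
  have "(\<integral>\<^sup>+t. ennreal ((nrm (%x. G t x - tsum N (fcoef G) t x))^2) \<partial>LI) <= ennreal (8 * pi * e^2 * Wn)" if N: "N >= d" for N
  proof -
   define T where "T = tsum N (fcoef H)"
   have TL: "T t \<in> L2 Ma" for t unfolding T_def by (rule tsum_L2) (rule fcoef_norms(1)[OF Hc e0 HB])
   have HL: "H t \<in> L2 Ma" "nrm (H t) <= e * sqrt Wn" if t: "t \<in> {- pi..pi}" for t
   proof -
    show L: "H t \<in> L2 Ma" by (rule continuous_L2[OF rect_slice(2)[OF Hc t]])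
    show "nrm (H t) <= e * sqrt Wn"
     using e0 HB t L2D(1)[OF L] by (intro bounded_L2(2)) (auto simp: measurable_Ma)
   qed
   have eq: "nrm (%x. G t x - tsum N (fcoef G) t x) = nrm (%x. H t x - T t x)" for t
   proof (rule l2_norm_cong_space)
    fix x assume "x \<in> space Ma"
    then have x: "x \<in> {0..a}" by (simp add: space_Ma)
    have "T t x = tsum N (fcoef G) t x - tsum N (fcoef P) t x"
     unfolding T_def tsum_def by (simp add: co[OF x] right_diff_distrib sum_subtractf diff_divide_distrib)
    then show "G t x - tsum N (fcoef G) t x = H t x - T t x" by (simp add: H_def d[OF N])
   qed
   have mT [measurable]: "(%t. nrm (T t)) \<in> borel_measurable LI"
    using tsum_norm_continuous[of "fcoef H" Ma "%_. 0" "{- pi..pi}" N, OF fcoef_norms(1)[OF Hc e0 HB]]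
    by (intro continuous_imp_measurable_on_sets_lebesgue) (auto simp: l2_norm_def T_def)
   have cm: "ennreal A * ennreal B + 2 * ennreal C = ennreal (A * B + 2 * C)" if "A >= 0" "B >= 0" "C >= 0" for A B C
    using that by (simp add: ennreal_plus ennreal_mult)
   have tp: "(\<integral>\<^sup>+t. ennreal ((nrm (T t))^2) \<partial>LI) = ennreal (\<Sum>n = - int N..int N. (nrm (fcoef H n))^2)"
    unfolding T_def by (rule tsum_parseval) (rule fcoef_norms(1)[OF Hc e0 HB])
   have "(\<integral>\<^sup>+t. ennreal ((nrm (%x. H t x - T t x))^2) \<partial>LI)
    <= (\<integral>\<^sup>+t. ennreal (2 * (e^2 * Wn)) + 2 * ennreal ((nrm (T t))^2) \<partial>LI)"
   proof (rule nn_integral_mono)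
    fix t assume "t \<in> space LI"
    then have t: "t \<in> {- pi..pi}" by simp
    have "(nrm (%x. H t x - T t x))^2 <= 2 * (nrm (H t))^2 + 2 * (nrm (%x. (H t x - T t x) - H t x))^2"
     by (intro l2_norm_sq_le2 L2_diff HL TL t)
    also have "nrm (%x. (H t x - T t x) - H t x) = nrm (T t)" by (simp add: l2_norm_def)
    also have "(nrm (H t))^2 <= (e * sqrt Wn)^2" using HL(2)[OF t] by (rule power_mono) simp
    finally have "(nrm (%x. H t x - T t x))^2 <= 2 * (e^2 * Wn) + 2 * (nrm (T t))^2"
     using Wn_nonneg by (simp add: power_mult_distrib)
    then have "ennreal ((nrm (%x. H t x - T t x))^2) <= ennreal (2 * (e^2 * Wn) + 2 * (nrm (T t))^2)" by (rule ennreal_leI)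
    then show "ennreal ((nrm (%x. H t x - T t x))^2) <= ennreal (2 * (e^2 * Wn)) + 2 * ennreal ((nrm (T t))^2)"
     using Wn_nonneg by (simp add: ennreal_plus ennreal_mult)
   qed
   also have "... = ennreal (2 * (e^2 * Wn)) * ennreal (2 * pi) + 2 * ennreal (\<Sum>n = - int N..int N. (nrm (fcoef H n))^2)"
    by (simp add: tp nn_integral_add nn_integral_cmult emeasure_restrict_space)
   also have "... <= ennreal (2 * (e^2 * Wn)) * ennreal (2 * pi) + 2 * ennreal (2 * pi * e^2 * Wn)"
    by (intro add_left_mono mult_left_mono ennreal_leI fcoef_norms(2)[OF Hc e0 HB]) simp_all
   also have "... = ennreal (2 * (e^2 * Wn) * (2 * pi) + 2 * (2 * pi * e^2 * Wn))"
    by (rule cm) (use Wn_nonneg in auto)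
   also have "2 * (e^2 * Wn) * (2 * pi) + 2 * (2 * pi * e^2 * Wn) = 8 * pi * e^2 * Wn" by simp
   finally show ?thesis unfolding eq .
  qed
  then show ?thesis by blast
 qed
 have "(%N. \<integral>\<^sup>+t. ennreal ((nrm (%x. G t x - gelfand_sum N g t x))^2) \<partial>LI) \<longlonglongrightarrow> 0"
  unfolding norm_eq
 proof (rule order_tendstoI)
  fix y :: ennreal assume y: "0 < y"
  \<comment> \<open>\<open>y\<close> may be infinite; \<open>y'\<close> is a positive real number
    not exceeding it.\<close>
  define y' where "y' = min 1 (enn2real (min 1 y))"
  have y': "0 < y'" "ennreal y' <= y"
   using y by (cases y; auto simp: y'_def min_def ennreal_leI enn2real_positive_iff split: if_splits)+
  define e where "e = sqrt (y' / (2 * (8 * pi * (Wn + 1))))"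
  have "8 * pi * (Wn + 1) > 0" using Wn_nonneg by simp
  then have e: "e > 0" "e^2 = y' / (2 * (8 * pi * (Wn + 1)))" using y'(1) by (auto simp: e_def)
  have "8 * pi * e^2 * Wn <= e^2 * (8 * pi * (Wn + 1))" by (simp add: algebra_simps)
  also have "... = y' / 2" unfolding e(2) using \<open>8 * pi * (Wn + 1) > 0\<close> by (metis (no_types) divide_divide_eq_left divide_eq_eq less_irrefl mult.commute)
  also have "... < y'" using y'(1) by simp
  finally have lt: "ennreal (8 * pi * e^2 * Wn) < y" using y'(2) Wn_nonneg by (meson ennreal_lessI less_le_trans y'(1))
  obtain d where "\<forall>N\<ge>d. (\<integral>\<^sup>+t. ennreal ((nrm (%x. G t x - tsum N (fcoef G) t x))^2) \<partial>LI) <= ennreal (8 * pi * e^2 * Wn)"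
   using est[OF e(1)] by blast
  then show "\<forall>\<^sub>F N in sequentially. (\<integral>\<^sup>+t. ennreal ((nrm (%x. G t x - tsum N (fcoef G) t x))^2) \<partial>LI) < y"
   unfolding eventually_sequentially using lt by (meson le_less_trans)
 qed simp
 then have "(g, G) \<in> gelfand" using gL rect_bochner[OF c] by (simp add: gelfand_def)
 then show ?thesis by (rule that)
qed

end

section \<open>Norms of the spectral function near a critical point\<close>

text \<open>The order \<open>k\<close> of the zero of \<open>f - f xi\<close> and a k-th root
  \<open>h\<close> of this function with a simple zero at \<open>xi\<close>. On a smaller disc
  \<open>h\<close> is injective, so its derivative has no zeros there.\<close>

lemma local_power_form:
 assumes f: "f holomorphic_on UNIV" and nc: "~ f constant_on UNIV"
 obtains k r g h where "k > 0" "r > (0::real)" "(deriv ^^ k) f xi ~= 0" "!!i. 0 < i ==> i < k ==> (deriv ^^ i) f xi = 0"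
  "h holomorphic_on ball xi r" "continuous_on (ball xi r) g" "inj_on h (ball xi r)"
  "!!z. z \<in> ball xi r ==> f z = f xi + h z ^ k & h z = (z - xi) * g z & g z ~= 0 & deriv h z ~= 0
    & deriv f z = of_nat k * h z ^ (k - 1) * deriv h z"
proof -
 have "\<exists>k. k > 0 & (deriv ^^ k) f xi ~= 0"
 proof (rule ccontr)
  assume "\<nexists>k. k > 0 & (deriv ^^ k) f xi ~= 0"
  then have nd: "n > 0 ==> (deriv ^^ n) f xi = 0" for n by blast
  have "f z = f xi" for z
   by (rule holomorphic_fun_eq_const_on_connected[OF f open_UNIV connected_UNIV nd UNIV_I UNIV_I])
  then show False using nc unfolding constant_on_def by blast
 qed
 define k where "k = (LEAST k. k > 0 & (deriv ^^ k) f xi ~= 0)"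
 have k: "k > 0" "(deriv ^^ k) f xi ~= 0" using LeastI_ex[OF \<open>\<exists>k. _\<close>] by (simp_all add: k_def)
 have kl: "(deriv ^^ i) f xi = 0" if "0 < i" "i < k" for i using not_less_Least[of i] that unfolding k_def by blast
 obtain g r where g: "0 < r" "g holomorphic_on ball xi r" "!!w. w \<in> ball xi r ==> f w - f xi = ((w - xi) * g w) ^ k" "!!w. w \<in> ball xi r ==> g w ~= 0"
  using holomorphic_factor_order_of_zero_strong[OF f open_UNIV UNIV_I k(1,2) kl] by metis
 define h where "h = (%z. (z - xi) * g z)"
 have hh: "h holomorphic_on ball xi r" unfolding h_def by (intro holomorphic_intros g)
 have "deriv h xi = g xi"
 proof (rule DERIV_imp_deriv)
  have "(g has_field_derivative deriv g xi) (at xi)" by (rule holomorphic_derivI[OF g(2)]) (use g(1) in auto)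
  then show "(h has_field_derivative g xi) (at xi)" unfolding h_def by (auto intro!: derivative_eq_intros)
 qed
 then have "deriv h xi ~= 0" using g(1,4) by simp
 then obtain s where s: "s > 0" "ball xi s <= ball xi r" "inj_on h (ball xi s)"
  using has_complex_derivative_locally_injective[OF hh _ open_ball] g(1) by (metis centre_in_ball)
 have hs: "h holomorphic_on ball xi s" using hh s(2) by (rule holomorphic_on_subset)
 show ?thesis
 proof (rule that[OF k(1) s(1) k(2) kl hs _ s(3)])
  show "continuous_on (ball xi s) g" using holomorphic_on_imp_continuous_on[OF g(2)] s(2) by (rule continuous_on_subset)
  fix z assume z: "z \<in> ball xi s"
  then have zr: "z \<in> ball xi r" using s(2) by blast
  have hz: "(h has_field_derivative deriv h z) (at z)" by (rule holomorphic_derivI[OF hs open_ball z])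
  have fe: "f y = f xi + h y ^ k" if "y \<in> ball xi s" for y using g(3)[of y] that s(2) by (force simp: h_def algebra_simps)
  have "((%y. f xi + h y ^ k) has_field_derivative of_nat k * h z ^ (k - 1) * deriv h z) (at z)"
   by (rule derivative_eq_intros hz refl)+ (simp add: mult_ac)
  then have "(f has_field_derivative of_nat k * h z ^ (k - 1) * deriv h z) (at z)"
   by (rule has_field_derivative_transform_within_open[OF _ open_ball z]) (simp add: fe)
  then show "f z = f xi + h z ^ k & h z = (z - xi) * g z & g z ~= 0 & deriv h z ~= 0 & deriv f z = of_nat k * h z ^ (k - 1) * deriv h z"
   using fe[OF z] g(4)[OF zr] holomorphic_injective_imp_regular[OF hs open_ball s(3) z] by (simp add: h_def DERIV_imp_deriv)
 qed
qed

section \<open>Boundedness of the spectral function at a scalar monodromy matrix\<close>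

context periodic_SL
begin

lemma entries_lipschitz:
 obtains L where "L >= 0" "!!z mu x. norm z <= R ==> norm mu <= R ==> x \<in> {0..a} ==>
  norm (phi z x - phi mu x) <= L * norm (z - mu) & norm (p_phi' z x - p_phi' mu x) <= L * norm (z - mu) &
  norm (psi z x - psi mu x) <= L * norm (z - mu) & norm (p_psi' z x - p_psi' mu x) <= L * norm (z - mu)"
proof -
 define L where "L = cB R * (Wn * cB R)"
 show ?thesis
 proof (rule that[of L])
  show "L >= 0" using cB_pos[of R] Wn_nonneg by (simp add: L_def)
  fix z mu :: complex and x :: real assume *: "norm z <= R" "norm mu <= R" "x \<in> {0..a}"
  have l: "norm (phi z x - phi mu x) + norm (p_phi' z x - p_phi' mu x) <= L * norm (z - mu)"
   "norm (psi z x - psi mu x) + norm (p_psi' z x - p_psi' mu x) <= L * norm (z - mu)"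
   using usol_lipschitz[OF hper_zero *(3,1,2), of 1 0] usol_lipschitz[OF hper_zero *(3,1,2), of 0 1]
   by (simp_all add: usol_def usol'_def I0_def I1_def gn_def gg_def L_def mult.commute)
  show "norm (phi z x - phi mu x) <= L * norm (z - mu) & norm (p_phi' z x - p_phi' mu x) <= L * norm (z - mu) &
  norm (psi z x - psi mu x) <= L * norm (z - mu) & norm (p_psi' z x - p_psi' mu x) <= L * norm (z - mu)"
   using l norm_ge_zero[of "phi z x - phi mu x"] norm_ge_zero[of "psi z x - psi mu x"] norm_ge_zero[of "p_phi' z x - p_phi' mu x"] norm_ge_zero[of "p_psi' z x - p_psi' mu x"]
   by linarith
 qed
qed

text \<open>At most two eigenvalues with projections bounded by \<open>C\<close> give the bound
  \<open>2 * C\<close> in each fibre. The two Gelfand estimates contribute a factor 2 each to the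
  squares, hence \<open>4 * C\<close> in all.\<close>

lemma E_norm_le:
 assumes nc: "~ D constant_on UNIV" and C: "C >= 0"
  and d: "!!ze. ze \<in> Dt ==> deriv D ze ~= 0"
  and N: "!!t ze f h. ze \<in> Sp t Dt ==> f \<in> L2 Ma ==> h \<in> L2 Ma ==> norm (Num t ze f h / deriv D ze) <= C * nrm f * nrm h"
  and card: "!!t. card (Sp t Dt) <= 2"
 shows "op_norm MR (E Dt) <= ennreal (4 * C)"
 unfolding op_norm_def
proof (rule SUP_least, clarify)
 fix f g assume fg: "(f, g) \<in> E Dt" "l2_norm MR f <= 1"
 then obtain F G where FG: "(f, F) \<in> gelfand" "(g, G) \<in> gelfand" "AE t in LI. (F t, G t) \<in> E_fiber t Dt"
  by (auto simp: E_def)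
 have mF: "(%t. nrm (F t)) \<in> borel_measurable LI"
  using bochner_norm_measurable[of F Ma "%_ _. 0"] FG(1) by (simp add: gelfand_def)
 have le: "nrm v <= 2 * C * nrm u" if uv: "(u, v) \<in> E_fiber t Dt" for t u v
 proof -
  note E = E_fiberD[OF nc _ uv]
  have e: "u \<in> L2 Ma" "v \<in> L2 Ma" by (rule E, rule d, assumption)+
  have "nrm v <= 2 * C * nrm u \<or> nrm v = 0"
  proof (rule l2_norm_le_of_inner[OF e(2)])
   fix h assume h: "h \<in> L2 Ma"
   have "norm (l2_inner Ma v h) <= (\<Sum>ze\<in>Sp t Dt. norm (Num t ze u h / deriv D ze))"
    by (subst E(4)[OF _ h], rule d, assumption, rule norm_sum)
   also have "... <= of_nat (card (Sp t Dt)) * (C * nrm u * nrm h)"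
    by (rule sum_bounded_above) (rule N[OF _ e(1) h])
   also have "... <= 2 * (C * nrm u * nrm h)" using card[of t] C by (intro mult_right_mono) auto
   finally show "norm (l2_inner Ma v h) <= 2 * C * nrm u * nrm h" by simp
  qed
  then show ?thesis using C by auto
 qed
 have "ennreal ((l2_norm MR g)^2) <= 2 * (\<integral>\<^sup>+t. ennreal ((nrm (G t))^2) \<partial>LI)" by (rule gelfand_norm_bounds[OF FG(2)])
 also have "(\<integral>\<^sup>+t. ennreal ((nrm (G t))^2) \<partial>LI) <= (\<integral>\<^sup>+t. ennreal (4 * C^2) * ennreal ((nrm (F t))^2) \<partial>LI)"
 proof (rule nn_integral_mono_AE, use FG(3) in eventually_elim)
  fix t assume "(F t, G t) \<in> E_fiber t Dt"
  then have "(nrm (G t))^2 <= (2 * C * nrm (F t))^2" using le by (intro power_mono) auto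
  then show "ennreal ((nrm (G t))^2) <= ennreal (4 * C^2) * ennreal ((nrm (F t))^2)"
   by (simp add: ennreal_mult[symmetric] power_mult_distrib ennreal_leI)
 qed
 also have "... = ennreal (4 * C^2) * (\<integral>\<^sup>+t. ennreal ((nrm (F t))^2) \<partial>LI)"
  using mF by (intro nn_integral_cmult) measurable
 also have "(\<integral>\<^sup>+t. ennreal ((nrm (F t))^2) \<partial>LI) <= 2 * ennreal ((l2_norm MR f)^2)" by (rule gelfand_norm_bounds[OF FG(1)])
 also have "ennreal ((l2_norm MR f)^2) <= 1" using fg(2) by (simp add: power_le_one)
 finally have X: "ennreal ((l2_norm MR g)^2) <= 2 * (ennreal (4 * C^2) * (2 * 1))"
  by (simp add: mult_left_mono)
 have "2 * (ennreal (4 * C^2) * (2 * 1)) = ennreal (4 * C^2) * (2 * 2)" by (simp only: mult_1_right mult.left_commute)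
 also have "... = ennreal (4 * C^2 * 4)" by (subst ennreal_mult) simp_all
 finally have "ennreal ((l2_norm MR g)^2) <= ennreal (4 * C^2 * 4)" using X by (simp only:)
 then have "(l2_norm MR g)^2 <= 4 * C^2 * 4" by (rule ennreal_le_iff[THEN iffD1, rotated]) simp
 then have "(l2_norm MR g)^2 <= (4 * C)^2" unfolding power_mult_distrib by simp
 then have "l2_norm MR g <= 4 * C" by (rule power2_le_imp_le) (use C in simp)
 then show "ennreal (l2_norm MR g) <= ennreal (4 * C)" by (rule ennreal_leI)
qed

lemma regular_if:
 assumes crit: "z0 \<in> critical_points" and D0: "D z0 \<in> {-2, 2}" "psi z0 a = 0" "p_phi' z0 a = 0" and d2: "(deriv ^^ 2) D z0 ~= 0"
 shows "regular_critical_point z0"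
proof -
 have d1: "deriv D z0 = 0" using crit by (simp add: critical_points_def)
 have nc: "~ D constant_on UNIV"
 proof
  assume "D constant_on UNIV"
  then obtain k where "D = (%_. k)" by (auto simp: constant_on_def)
  then show False using d2 by (simp add: numeral_2_eq_2)
 qed
 obtain k r g h where kr: "k > 0" "r > 0" "(deriv ^^ k) D z0 ~= 0" "!!i. 0 < i ==> i < k ==> (deriv ^^ i) D z0 = 0"
  "h holomorphic_on ball z0 r" "continuous_on (ball z0 r) g" "inj_on h (ball z0 r)"
  and pf: "!!z. z \<in> ball z0 r ==> D z = D z0 + h z ^ k & h z = (z - z0) * g z & g z ~= 0 & deriv h z ~= 0
    & deriv D z = of_nat k * h z ^ (k - 1) * deriv h z"
  by (rule local_power_form[OF D_holomorphic nc, of z0], rule that)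
 have "k = 2"
 proof -
  have "~ 2 < k" using kr(4)[of 2] d2 by auto
  moreover have "k ~= 1" using kr(3) d1 by auto
  ultimately show ?thesis using kr(1) by simp
 qed
 note pf = pf[unfolded this]
 define sig where "sig = D z0 / 2"
 have sig: "sig \<in> {1, -1}" "D z0 = 2 * sig" using D0(1) by (auto simp: sig_def)
 have "phi z0 a * p_psi' z0 a = 1" "phi z0 a + p_psi' z0 a = 2 * sig" "sig * sig = 1" using det_a[of z0] D0(2) sig by (auto simp: D_def)
 then have "(phi z0 a - sig) * (phi z0 a - sig) = 0" by algebra
 then have e0: "phi z0 a = sig" "p_psi' z0 a = sig" using \<open>phi z0 a + p_psi' z0 a = 2 * sig\<close> by auto
 define s where "s = r / 2"
 have s: "0 < s" "cball z0 s <= ball z0 r" using kr(2) by (auto simp: s_def)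
 \<comment> \<open>A positive lower bound \<open>mu\<close> of |g| and |h'| on the compact disc
   makes the comparison of |h| with |z - z0| and with |deriv D| uniform.\<close>
 define m where "m z = min (norm (g z)) (norm (deriv h z))" for z
 have "continuous_on (cball z0 s) m"
  unfolding m_def using s(2) by (intro continuous_intros continuous_on_subset[OF kr(6)]
   continuous_on_subset[OF holomorphic_on_imp_continuous_on[OF holomorphic_deriv[OF kr(5) open_ball]]]) auto
 then obtain y where y: "y \<in> cball z0 s" "!!z. z \<in> cball z0 s ==> m y <= m z"
  using continuous_attains_inf[of "cball z0 s" m] s(1) by auto
 define mu where "mu = m y"
 have mu: "mu > 0" using pf[of y] y(1) s(2) by (auto simp: mu_def m_def)
 have gm: "mu <= norm (g z)" "mu <= norm (deriv h z)" if "z \<in> cball z0 s" for z using y(2)[OF that] by (auto simp: mu_def m_def)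
 define R where "R = norm z0 + s"
 have R: "norm z <= R" if "z \<in> cball z0 s" for z
  using that norm_triangle_sub[of z z0] by (simp add: R_def dist_norm norm_minus_commute)
 obtain L where L: "L >= 0" "!!z mu x. norm z <= R ==> norm mu <= R ==> x \<in> {0..a} ==>
  norm (phi z x - phi mu x) <= L * norm (z - mu) & norm (p_phi' z x - p_phi' mu x) <= L * norm (z - mu) &
  norm (psi z x - psi mu x) <= L * norm (z - mu) & norm (p_psi' z x - p_psi' mu x) <= L * norm (z - mu)"
  by (rule entries_lipschitz[of R], rule that)
 define Q where "Q = (cB R)^3 * Wn"
 have Q0: "Q >= 0" using cB_pos[of R] Wn_nonneg by (simp add: Q_def)
 \<comment> \<open>With \<open>H = norm (h ze)\<close>, the moduli of the entries of
   \<open>M - e^(-it)\<close> add up to at most \<open>(4 * (L / mu) + 2) * H\<close>, and the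
   derivative of \<open>D\<close> is at least \<open>2 * H * mu\<close> in modulus. \<open>Q\<close>
   is the constant of \<open>Num_bound\<close>.\<close>
 define C where "C = (4 * (L / mu) + 2) / (2 * mu) * Q"
 have C0: "C >= 0" using L(1) mu Q0 by (simp add: C_def)
 have main: "norm (Num t ze u v / deriv D ze) <= C * nrm u * nrm v"
  if ze: "ze \<in> cball z0 s" "Dtf t ze = 0" and dz: "deriv D ze ~= 0" and uv: "u \<in> L2 Ma" "v \<in> L2 Ma" for t ze u v
 proof -
  define H where "H = norm (h ze)"
  have zer: "ze \<in> ball z0 r" using ze(1) s(2) by blast
  note p = pf[OF zer]
  have dist: "norm (ze - z0) <= H / mu"
  proof -
   have "mu * norm (ze - z0) <= norm (g ze) * norm (ze - z0)" using gm(1)[OF ze(1)] by (rule mult_right_mono) simp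
   also have "... = H" using p by (simp add: H_def norm_mult mult.commute)
   finally show ?thesis using mu by (simp add: field_simps)
  qed
  \<comment> \<open>For a point of the unit circle and \<open>sig = 1\<close> or
    \<open>sig = -1\<close> one has \<open>|e^(-it) - sig|^2 = |2 cos t - 2 sig|\<close>, and at an
    eigenvalue the right-hand side is \<open>|h ze|^2\<close>. So the Floquet multiplier is exactly
    as close to \<open>sig\<close> as \<open>h ze\<close> is to 0.\<close>
  have ht: "norm (ef (- t) - sig) = H"
  proof -
   have c: "2 * of_real (cos t) = 2 * sig + h ze ^ 2" using ze(2) p sig(2) by simp
   have "(norm (ef (- t) - sig))^2 = norm (2 * of_real (cos t) - 2 * sig)"
   proof -
    have e: "ef (- t) = Complex (cos t) (- sin t)" by (simp add: complex_eq_iff Re_exp Im_exp)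
    have sc: "(cos t)^2 + (sin t)^2 = 1" by simp
    from sig(1) consider "sig = 1" | "sig = -1" by auto
    then show ?thesis
    proof cases
     case 1
     have "norm (2 * of_real (cos t) - 2 * (1::complex)) = norm (complex_of_real (2 * cos t - 2))" by simp
     also have "... = 2 - 2 * cos t" unfolding norm_of_real using cos_le_one[of t] by simp
     also have "... = (norm (Complex (cos t) (- sin t) - 1))^2" unfolding cmod_power2 using sc by (simp add: power2_eq_square algebra_simps)
     finally show ?thesis unfolding 1 e by (rule sym)
    next
     case 2
     have "norm (2 * of_real (cos t) - 2 * (- 1::complex)) = norm (complex_of_real (2 * cos t + 2))" by simp
     also have "... = 2 + 2 * cos t" unfolding norm_of_real using cos_ge_minus_one[of t] by linarith
     also have "... = (norm (Complex (cos t) (- sin t) - - 1))^2" unfolding cmod_power2 using sc by (simp add: power2_eq_square algebra_simps)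
     finally show ?thesis unfolding 2 e by (rule sym)
    qed
   qed
   also have "... = H^2" by (simp add: c H_def norm_power)
   finally show ?thesis by (simp add: H_def)
  qed
  have ent: "norm (phi ze a - sig) <= L * (H / mu)" "norm (psi ze a) <= L * (H / mu)" "norm (p_phi' ze a) <= L * (H / mu)" "norm (p_psi' ze a - sig) <= L * (H / mu)"
   using L(2)[OF R[OF ze(1)] R[of z0], of a] a_pos s(1) e0 D0(2,3) mult_left_mono[OF dist L(1)] by auto
  have dd: "norm (phi ze a - ef (- t)) <= L * (H / mu) + H" "norm (p_psi' ze a - ef (- t)) <= L * (H / mu) + H"
   using ent(1,4) ht norm_triangle_ineq4[of "phi ze a - sig" "ef (- t) - sig"] norm_triangle_ineq4[of "p_psi' ze a - sig" "ef (- t) - sig"] by simp_all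
  have sum: "norm (phi ze a - ef (- t)) + norm (psi ze a) + norm (p_phi' ze a) + norm (p_psi' ze a - ef (- t)) <= (4 * (L / mu) + 2) * H"
  proof -
   have "(4 * (L / mu) + 2) * H = 4 * (L * (H / mu)) + 2 * H" by (simp add: distrib_right)
   then show ?thesis using dd ent(2,3) by linarith
  qed
  have "norm (deriv D ze) = 2 * H * norm (deriv h ze)" using p by (simp add: H_def norm_mult)
  then have Dl: "2 * H * mu <= norm (deriv D ze)" using gm(2)[OF ze(1)] by (simp add: H_def mult_left_mono)
  have "norm (Num t ze u v) <= ((4 * (L / mu) + 2) * H) * Q * nrm u * nrm v"
   using Num_bound[OF uv R[OF ze(1)], of t, folded Q_def]
   by (rule order_trans) (intro mult_right_mono sum Q0 l2_norm_nonneg)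
  also have "... = C * (2 * H * mu) * (nrm u * nrm v)" using mu by (simp add: C_def)
  also have "... <= C * norm (deriv D ze) * (nrm u * nrm v)" using Dl C0 by (intro mult_right_mono mult_left_mono) auto
  finally show ?thesis using dz by (simp add: norm_divide field_simps)
 qed
 have bound: "op_norm MR (E Dt) <= ennreal (4 * C)" if reg: "!!ze. ze \<in> Dt ==> deriv D ze ~= 0" and sub: "Dt <= ball z0 s" for Dt
 proof (rule E_norm_le[OF nc C0 reg])
  fix t
  have S: "ze \<in> Sp t Dt ==> ze \<in> cball z0 s & Dtf t ze = 0 & deriv D ze ~= 0" for ze using sub reg by (auto simp: Sp_def)
  then show "norm (Num t ze u v / deriv D ze) <= C * nrm u * nrm v" if "ze \<in> Sp t Dt" "u \<in> L2 Ma" "v \<in> L2 Ma" for ze u v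
   using main that by blast
  \<comment> \<open>In the coordinate \<open>h\<close> the spectrum of the fibre near
    \<open>z0\<close> consists of solutions of \<open>h^2 = y^2\<close>; as \<open>h\<close> is
    injective, there are at most two.\<close>
  define y where "y = csqrt (2 * of_real (cos t) - D z0)"
  have "h ` Sp t Dt <= {y, - y}"
  proof (rule image_subsetI)
   fix ze assume "ze \<in> Sp t Dt"
   then have z: "ze \<in> ball z0 r" "Dtf t ze = 0" using S s(2) by blast+
   have "D ze = D z0 + h ze ^ 2" using pf[OF z(1)] by blast
   moreover have "y ^ 2 = 2 * of_real (cos t) - D z0" by (simp add: y_def)
   ultimately have "h ze ^ 2 = y ^ 2" using z(2) by algebra
   then show "h ze \<in> {y, - y}" by (simp add: power2_eq_iff)
  qed
  then have "card (h ` Sp t Dt) <= card {y, - y}" by (intro card_mono) auto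
  also have "... <= 2" by (simp add: card_insert_if)
  also have "card (h ` Sp t Dt) = card (Sp t Dt)"
   using S s(2) by (intro card_image inj_on_subset[OF kr(7)]) blast
  finally show "card (Sp t Dt) <= 2" .
 qed
 have cl: "closure (ball z0 s) \<inter> critical_points = {z0}"
 proof -
  have "deriv D z ~= 0" if "z \<in> cball z0 s" "z ~= z0" for z
  proof -
   have "z \<in> ball z0 r" using that(1) s(2) by blast
   from pf[OF this] show ?thesis using that(2) by auto
  qed
  then have "z = z0" if "z \<in> cball z0 s" "z \<in> critical_points" for z using that unfolding critical_points_def by blast
  moreover have "closure (ball z0 s) = cball z0 s" using s(1) by simp
  ultimately show ?thesis using crit s(1) by auto
 qed
 have "(SUP (J, c) \<in> {(J, c). regular_spectral_curve J c & z0 \<in> top_of_set (op_spectrum MR A) frontier_of (c ` J)}.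
     SUP Dt \<in> {Dt \<in> B0 (c ` J). Dt <= ball z0 s}. op_norm MR (E Dt)) <= ennreal (4 * C)"
  by (intro SUP_least) (auto intro!: SUP_least bound simp: regular_spectral_curve_def B0_def)
 then have "(SUP (J, c) \<in> {(J, c). regular_spectral_curve J c & z0 \<in> top_of_set (op_spectrum MR A) frontier_of (c ` J)}.
     SUP Dt \<in> {Dt \<in> B0 (c ` J). Dt <= ball z0 s}. op_norm MR (E Dt)) < \<infinity>"
  by (rule le_less_trans) simp
 then show ?thesis
  unfolding regular_critical_point_def using crit cl s(1)
  by (intro conjI exI[of _ "ball z0 s"]) auto
qed

section \<open>From bounds for the spectral function to bounds for single fibres\<close>

lemma sgn_mult_norm:
 assumes "u \<in> L2 Ma"
 shows "(%x. of_real (sgn (w x)) * u x) \<in> L2 Ma" "nrm (%x. of_real (sgn (w x)) * u x) = nrm u"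
proof -
 have m: "(%x. cnj (u x)) \<in> borel_measurable Ma" using L2D(1)[OF assms] by (rule borel_measurable_cnj')
 have L: "(%x. cnj (u x)) \<in> L2 Ma" using assms m by (simp add: L2_def)
 show "(%x. of_real (sgn (w x)) * u x) \<in> L2 Ma" "nrm (%x. of_real (sgn (w x)) * u x) = nrm u"
  using dual(1,2)[OF L] by (simp_all add: dual_def l2_norm_def)
qed

lemma w_periodic_int: "w (x + of_int n * a) = w x"
proof (induction n rule: int_two_way_induct)
 case (2 n)
 then show ?case using w_periodic[of "x + of_int n * a"] by (simp add: algebra_simps)
next
 case (3 n)
 then show ?case using w_periodic[of "x + of_int n * a"] by (simp add: algebra_simps)
qed simp

text \<open>The test functions \<open>dual k\<close> contain the factor \<open>sgn w\<close>, which
  need not be continuous, so they are out of reach of \<open>gelfand_surj\<close>. Multiplication by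
  the periodic function \<open>sgn w\<close> commutes with the Gelfand transform and preserves all
  norms.\<close>

lemma gelfand_mult_sgn:
 assumes "(g, G) \<in> gelfand"
 shows "((%x. of_real (sgn (w x)) * g x), (%t x. of_real (sgn (w x)) * G t x)) \<in> gelfand"
proof -
 define S where "S = (%u x. complex_of_real (sgn (w x)) * (u x :: complex))"
 have g: "g \<in> L2 MR" and G: "G \<in> bochner_L2 {- pi..pi} Ma"
  and l: "(%N. \<integral>\<^sup>+t. ennreal ((nrm (%x. G t x - gelfand_sum N g t x))^2) \<partial>LI) \<longlonglongrightarrow> 0"
  using assms by (auto simp: gelfand_def)
 have GL: "t \<in> {- pi..pi} ==> G t \<in> L2 Ma" for t using G by (simp add: bochner_L2_def)
 have S1: "u \<in> L2 Ma ==> S u \<in> L2 Ma" "u \<in> L2 Ma ==> nrm (S u) = nrm u" for u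
  unfolding S_def by (rule sgn_mult_norm; assumption)+
 have Sd: "(%x. S u x - S v x) = S (%x. u x - v x)" for u v by (simp add: S_def right_diff_distrib fun_eq_iff)
 have Sn: "nrm (%x. S u x - S v x) = nrm (%x. u x - v x)" if "u \<in> L2 Ma" "v \<in> L2 Ma" for u v
  unfolding Sd by (rule S1(2)[OF L2_diff[OF that]])
 have SR: "S g \<in> L2 MR"
 proof -
  have "w \<in> borel_measurable MR" using w_measurable by (simp add: measurable_MR)
  then have "S g \<in> borel_measurable MR" unfolding S_def using L2D(1)[OF g] by measurable
  moreover have "nn2 MR (S g) = nn2 MR g" unfolding nn2_def
  proof (rule nn_integral_cong_AE)
   have "AE x in MR. w x ~= 0" using w_nonzero by (simp add: AE_MR)
   then show "AE x in MR. ennreal ((norm (S g x))^2) = ennreal ((norm (g x))^2)"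
    by eventually_elim (simp add: S_def norm_mult sgn_real_def)
  qed
  ultimately show ?thesis using g by (simp add: L2_iff_nn2)
 qed
 have SB: "(%t. S (G t)) \<in> bochner_L2 {- pi..pi} Ma"
 proof -
  obtain s where s: "!!n. simple_function LI (s n)" "!!n. s n ` {- pi..pi} <= L2 Ma"
   "AE t in LI. (%n. nrm (%x. G t x - s n t x)) \<longlonglongrightarrow> 0" using G unfolding bochner_L2_def by blast
  have "AE t in LI. (%n. nrm (%x. S (G t) x - S (s n t) x)) \<longlonglongrightarrow> 0"
   using s(3) AE_space[of LI]
  proof eventually_elim
   fix t assume *: "(%n. nrm (%x. G t x - s n t x)) \<longlonglongrightarrow> 0" "t \<in> space LI"
   then have t: "t \<in> {- pi..pi}" by simp
   have "s n t \<in> L2 Ma" for n using s(2) t by blast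
   then show "(%n. nrm (%x. S (G t) x - S (s n t) x)) \<longlonglongrightarrow> 0" using *(1) by (simp add: Sn GL[OF t])
  qed
  moreover have "simple_function LI (%t. S (s n t))" for n using simple_function_compose[OF s(1), of S] by (simp add: o_def)
  moreover have "(%t. S (s n t)) ` {- pi..pi} <= L2 Ma" for n using s(2)[of n] S1(1) by blast
  moreover have "(\<integral>\<^sup>+t. ennreal ((nrm (S (G t)))^2) \<partial>LI) = (\<integral>\<^sup>+t. ennreal ((nrm (G t))^2) \<partial>LI)"
   by (rule nn_integral_cong) (simp add: S1(2) GL)
  ultimately show ?thesis using G S1(1) unfolding bochner_L2_def mem_Collect_eq
   by (intro conjI ballI exI[of _ "%n t. S (s n t)"]) auto
 qed
 have gs: "gelfand_sum N (S g) t = S (gelfand_sum N g t)" for N t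
  unfolding gelfand_sum_def S_def w_periodic_int sum_distrib_left by (intro ext sum.cong refl) (simp only: mult_ac)
 have gL: "gelfand_sum N g t \<in> L2 Ma" for N t
  unfolding gelfand_sum_eq by (rule tsum_L2) (rule L2_MR_cell(1)[OF g])
 have "(\<integral>\<^sup>+t. ennreal ((nrm (%x. S (G t) x - gelfand_sum N (S g) t x))^2) \<partial>LI)
  = (\<integral>\<^sup>+t. ennreal ((nrm (%x. G t x - gelfand_sum N g t x))^2) \<partial>LI)" for N
  by (rule nn_integral_cong) (simp add: gs Sn GL gL)
 then have "(S g, %t. S (G t)) \<in> gelfand" using l SR SB by (simp add: gelfand_def)
 then show ?thesis by (simp add: S_def)
qed

text \<open>Continuity in \<open>x\<close> for each \<open>z\<close> is combined with the Lipschitz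
  estimate in \<open>z\<close>, which is uniform in \<open>x\<close>.\<close>

lemma phi_psi_joint_continuous:
 "continuous_on (UNIV \<times> {0..a}) (%(z, x). phi z x)" "continuous_on (UNIV \<times> {0..a}) (%(z, x). psi z x)"
proof -
 have gen: "continuous_on (UNIV \<times> {0..a}) (%(z, x). f z x)"
  if c: "!!z. continuous_on {0..a} (f z)"
   and L: "!!R. \<exists>L\<ge>0. \<forall>z mu x. norm z <= R --> norm mu <= R --> x \<in> {0..a} --> norm (f z x - f mu x) <= L * norm (z - mu)"
  for f :: "complex => cfun"
  unfolding continuous_on_iff
 proof (intro ballI allI impI)
  fix y :: "complex \<times> real" and e :: real assume y: "y \<in> UNIV \<times> {0..a}" and e: "0 < e"
  obtain z x where zx: "y = (z, x)" "x \<in> {0..a}" using y by (cases y) auto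
  obtain L where L: "L >= 0" "!!z' mu x. norm z' <= norm z + 1 ==> norm mu <= norm z + 1 ==> x \<in> {0..a} ==> norm (f z' x - f mu x) <= L * norm (z' - mu)"
   using L[of "norm z + 1"] by blast
  obtain d where d: "d > 0" "!!x'. x' \<in> {0..a} ==> dist x' x < d ==> dist (f z x') (f z x) < e / 2"
   using c[of z, unfolded continuous_on_iff] zx(2) e half_gt_zero by metis
  define de where "de = min 1 (min d (e / (2 * (L + 1))))"
  have de: "de > 0" "de <= 1" "de <= d" "de <= e / (2 * (L + 1))" using d(1) e L(1) by (auto simp: de_def)
  show "\<exists>d>0. \<forall>y'\<in>UNIV \<times> {0..a}. dist y' y < d --> dist ((%(z, x). f z x) y') ((%(z, x). f z x) y) < e"
  proof (intro exI[of _ de] conjI ballI impI de(1))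
   fix y' assume y': "y' \<in> UNIV \<times> {0..a}" "dist y' y < de"
   obtain z' x' where zx': "y' = (z', x')" "x' \<in> {0..a}" using y'(1) by (cases y') auto
   have ds: "dist z' z < de" "dist x' x < de"
    using y'(2) dist_fst_le[of y' y] dist_snd_le[of y' y] by (simp_all add: zx zx')
   have "norm z' <= norm z + 1" using ds(1) de(2) norm_triangle_sub[of z' z] by (simp add: dist_norm)
   then have "norm (f z' x' - f z x') <= L * norm (z' - z)" using L(2)[of z' z x'] zx'(2) by simp
   also have "... <= (L + 1) * norm (z' - z)" by (simp add: mult_right_mono)
   also have "... <= (L + 1) * (e / (2 * (L + 1)))" using ds(1) de(4) L(1) by (intro mult_left_mono) (auto simp: dist_norm)
   also have "... = e / 2" using L(1) by (simp add: field_simps)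
   finally have "dist (f z' x') (f z x') <= e / 2" by (simp add: dist_norm)
   moreover have "dist (f z x') (f z x) < e / 2" using d(2) zx'(2) ds(2) de(3) by simp
   ultimately have "dist (f z' x') (f z x) < e" using dist_triangle[of "f z' x'" "f z x" "f z x'"] by linarith
   then show "dist ((%(z, x). f z x) y') ((%(z, x). f z x) y) < e" by (simp add: zx zx')
  qed
 qed
 show "continuous_on (UNIV \<times> {0..a}) (%(z, x). phi z x)"
  by (rule gen[OF phi_continuous]) (metis entries_lipschitz)
 show "continuous_on (UNIV \<times> {0..a}) (%(z, x). psi z x)"
  by (rule gen[OF psi_continuous]) (metis entries_lipschitz)
qed

lemma Num_cmult: "Num t z (%x. c * f x) h = c * Num t z f h"
proof -
 have "I0 z (%x. c * f x) a = c * I0 z f a" "I1 z (%x. c * f x) a = c * I1 z f a"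
  unfolding I0_def I1_def Henstock_Kurzweil_Integration.integral_mult_right[symmetric] by (simp_all add: mult_ac)
 then show ?thesis by (simp add: Num_def na_def nb_def algebra_simps)
qed

lemma na_nb_continuous:
 assumes "f \<in> L2 Ma" "continuous_on S T" "continuous_on S Z"
 shows "continuous_on S (%t. na (T t) (Z t) f)" "continuous_on S (%t. nb (T t) (Z t) f)"
proof -
 have a: "a \<in> {0..a}" using a_pos by simp
 have hp: "hper f" by (rule L2_hper(1)[OF assms(1)])
 note e = entries_holo[THEN holomorphic_on_imp_continuous_on]
 have "(%z. I1 z f a) holomorphic_on UNIV" "(%z. I0 z f a) holomorphic_on UNIV"
  unfolding I01_eq by (intro holomorphic_intros entries_holo entries_holomorphic hp a)+
 note i = this[THEN holomorphic_on_imp_continuous_on]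
 have cz: "continuous_on UNIV u ==> continuous_on S (%t. u (Z t))" for u :: "complex => complex"
  by (rule continuous_on_compose2[OF _ assms(3)]) auto
 show "continuous_on S (%t. na (T t) (Z t) f)" "continuous_on S (%t. nb (T t) (Z t) f)"
  unfolding na_def nb_def by (intro continuous_intros assms(2) e[THEN cz] i[THEN cz])+
qed

lemma deriv_D_continuous: "continuous_on S (deriv D)"
 by (rule holomorphic_on_imp_continuous_on[OF holomorphic_on_subset[OF holomorphic_deriv[OF D_holomorphic open_UNIV]]]) simp

text \<open>Bounds for \<open>E\<close> on all short arcs around \<open>Z t1\<close> bound the Riesz
  projection of the single fibre \<open>t1\<close>. If the claim failed, it would fail by continuity
  on an interval \<open>J\<close> around \<open>t1\<close>, and \<open>E\<close> would enlarge too
  much a function whose transform is a hat function on \<open>J\<close> times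
  \<open>dual k\<close>.\<close>

lemma fiber_bound:
 assumes nc: "~ D constant_on UNIV" and t: "0 < t1 - ta0" "t1 + ta0 < pi" "ta0 > 0"
  and Z: "continuous_on {t1 - ta0..t1 + ta0} Z" "!!t. t \<in> {t1 - ta0..t1 + ta0} ==> Dtf t (Z t) = 0 & deriv D (Z t) ~= 0"
  and K: "K >= 1" "!!ta. 0 < ta ==> ta <= ta0 ==> op_norm MR (E (Z ` {t1 - ta..t1 + ta})) <= ennreal K"
  and k: "continuous_on {0..a} k" and h: "h \<in> L2 Ma"
 shows "norm (Num t1 (Z t1) (dual k) h / deriv D (Z t1)) <= 3 * K * (nrm h + 1) * (nrm k + 1)"
proof (rule ccontr)
 \<comment> \<open>The factor 3 has to outweigh the Gelfand estimates: the contradiction at the end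
   is \<open>9 / 2 * K^2 <= 2 * K^2\<close>. The added 1 keeps the norms of \<open>h\<close> and
   \<open>k\<close> away from zero.\<close>
 define C where "C = 3 * K * (nrm h + 1) * (nrm k + 1)"
 define f where "f = dual k"
 have kL: "k \<in> L2 Ma" by (rule continuous_L2[OF k])
 have fL: "f \<in> L2 Ma" "nrm f = nrm k" unfolding f_def by (rule dual[OF kL])+
 define al be where "al = (%t. na t (Z t) f / deriv D (Z t))" and "be = (%t. nb t (Z t) f / deriv D (Z t))"
 define I0 where "I0 = {t1 - ta0..t1 + ta0}"
 have alc: "continuous_on I0 al" "continuous_on I0 be"
  unfolding al_def be_def I0_def
  by (intro continuous_intros na_nb_continuous fL Z(1) continuous_on_compose2[OF deriv_D_continuous[of UNIV] Z(1)], use Z(2) in auto)+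
 have qeq: "Num t (Z t) f h' / deriv D (Z t) = al t * l2_inner Ma (phi (Z t)) h' + be t * l2_inner Ma (psi (Z t)) h'" for t h'
  by (simp add: Num_def al_def be_def add_divide_distrib)
 have ipc: "continuous_on I0 (%t. l2_inner Ma (phi (Z t)) h)" "continuous_on I0 (%t. l2_inner Ma (psi (Z t)) h)"
  unfolding phi_usol psi_usol
  by (rule continuous_on_compose2[OF holomorphic_on_imp_continuous_on[OF l2_inner_holomorphic[OF hper_zero h, where S = UNIV]] Z(1)[folded I0_def]], simp)+
 have qc: "continuous_on I0 (%t. norm (Num t (Z t) f h / deriv D (Z t)))"
  unfolding qeq by (intro continuous_intros alc ipc)
 assume "~ ?thesis"
 then have "C < norm (Num t1 (Z t1) f h / deriv D (Z t1))" by (simp add: C_def f_def)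
 moreover have t1: "t1 \<in> I0" using t by (simp add: I0_def)
 ultimately obtain d where d: "d > 0" "!!t. t \<in> I0 ==> dist t t1 < d ==> C < norm (Num t (Z t) f h / deriv D (Z t))"
 proof -
  define e where "e = norm (Num t1 (Z t1) f h / deriv D (Z t1)) - C"
  assume "C < norm (Num t1 (Z t1) f h / deriv D (Z t1))"
  then have "e > 0" by (simp add: e_def)
  then obtain d where "d > 0" "!!t. t \<in> I0 ==> dist t t1 < d ==> dist (norm (Num t (Z t) f h / deriv D (Z t))) (norm (Num t1 (Z t1) f h / deriv D (Z t1))) < e"
   using qc t1 unfolding continuous_on_iff by blast
  then show ?thesis using that[of d] unfolding e_def dist_real_def by fastforce
 qed
 define ta where "ta = min ta0 (d / 2)"
 have ta: "0 < ta" "ta <= ta0" using t d(1) by (auto simp: ta_def)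
 define J where "J = {t1 - ta..t1 + ta}"
 have JI: "J <= I0" using ta by (auto simp: J_def I0_def)
 have big: "C < norm (Num t (Z t) f h / deriv D (Z t))" if "t \<in> J" for t
  using that JI d(1) by (intro d(2)) (auto simp: J_def ta_def dist_real_def)
 \<comment> \<open>\<open>T\<close> retracts the line to \<open>J\<close>, where \<open>Z\<close> is
   under control. It serves to write \<open>G\<close> for all \<open>t\<close>; outside
   \<open>J\<close> the hat function \<open>th\<close> vanishes, and on \<open>J\<close> the
   retraction is the identity.\<close>
 define T where "T = (%t. max (t1 - ta) (min (t1 + ta) t))"
 define th where "th = (%t. max 0 (1 - \<bar>t - t1\<bar> / ta))"
 have TJ: "T t \<in> J" for t using ta by (auto simp: T_def J_def)
 have Tid: "T t = t" if "t \<in> J" for t using that by (auto simp: T_def J_def)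
 have th0: "th t = 0" if "t \<notin> J" for t using that ta(1) by (auto simp: th_def J_def field_simps max_def abs_if split: if_splits)
 have thp: "th t >= 0" for t by (simp add: th_def)
 have thc: "continuous_on A th" for A unfolding th_def using ta(1) by (intro continuous_intros) auto
 have Tc: "continuous_on A T" for A unfolding T_def by (intro continuous_intros)
 have TI: "T t \<in> I0" for t using TJ JI by blast
 \<comment> \<open>The interval \<open>J\<close> lies in (0, pi). Thus the functions of
   \<open>t\<close> below vanish at both ends of the Brillouin interval, as
   \<open>gelfand_surj\<close> requires, and \<open>cos\<close> is injective on
   \<open>J\<close>.\<close>
 have Jpi: "- pi \<notin> J" "pi \<notin> J" using t ta pi_gt_zero by (auto simp: J_def)
 define X where "X = integral {- pi..pi} (%t. (th t)^2)"
 have Xth: "(\<integral>\<^sup>+t. ennreal (B * (th t)^2) \<partial>LI) = ennreal (B * X)" if "B >= 0" for B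
 proof -
  have c: "continuous_on {- pi..pi} (%t. B * (th t)^2)" by (intro continuous_intros thc)
  have "(\<integral>\<^sup>+t. ennreal (B * (th t)^2) \<partial>LI) = ennreal (integral\<^sup>L LI (%t. B * (th t)^2))"
   by (rule nn_integral_eq_integral[OF continuous_LI(1)[OF c]]) (use that in simp)
  then show ?thesis unfolding continuous_LI(2)[OF c] by (simp add: X_def)
 qed
 have X: "X > 0"
 proof -
  have i: "(%t. (th t)^2) integrable_on {- pi..pi}" by (intro integrable_continuous_real continuous_intros thc)
  have "X >= 0" unfolding X_def by (rule Henstock_Kurzweil_Integration.integral_nonneg[OF i]) simp
  moreover have "X ~= 0"
  proof
   assume "X = 0"
   then have "((%t. (th t)^2) has_integral 0) (cbox (- pi) pi)" using integrable_integral[OF i] by (simp add: X_def)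
   moreover have "continuous_on (cbox (- pi) pi) (%t. (th t)^2)" by (intro continuous_intros thc)
   ultimately have "(th t1)^2 = 0" using t ta by (intro has_integral_0_cbox_imp_0[of "- pi" pi "%t. (th t)^2"]) auto
   then show False by (simp add: th_def)
  qed
  ultimately show ?thesis by simp
 qed
 \<comment> \<open>Normalisation: the squared norm of \<open>F\<close>, integrated over
   \<open>t\<close>, is at most 1/2, so that the Gelfand estimate gives \<open>f1\<close> norm at
   most 1.\<close>
 define ka where "ka = 1 / ((nrm k + 1) * sqrt (2 * X))"
 have k1: "nrm k + 1 > 0" "nrm h + 1 > 0" by (simp_all add: add_nonneg_pos)
 have ka: "ka > 0" using X k1 by (simp add: ka_def)
 have kaX: "(ka * (nrm k + 1))^2 * X = 1 / 2"
 proof -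
  have "ka * (nrm k + 1) = 1 / sqrt (2 * X)" using k1 by (simp add: ka_def)
  then show ?thesis using X by (simp add: power_divide)
 qed
 define c where "c = (%t. complex_of_real (ka * th t))"
 have cc: "continuous_on A c" for A unfolding c_def by (intro continuous_intros thc)
 have c0: "t \<notin> J ==> c t = 0" for t using th0 by (simp add: c_def)
 have cn: "norm (c t) = ka * th t" for t using ka thp[of t] by (simp add: c_def norm_mult)
 define F where "F = (%t x. c t * f x)"
 define G where "G = (%t x. c t * (al (T t) * phi (Z (T t)) x + be (T t) * psi (Z (T t)) x))"
 have comp: "continuous_on rectangle (%y. u (T (fst y)))" if "continuous_on I0 u" for u :: "real => complex"
  by (rule continuous_on_compose2[OF that]) (auto intro!: continuous_on_compose2[OF Tc[of UNIV]] continuous_intros TI)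
 have Fc: "continuous_on rectangle (%(t, x). c t * cnj (k x))"
  unfolding case_prod_unfold
  by (intro continuous_intros continuous_on_compose2[OF cc[of UNIV]] continuous_on_compose2[OF k]) auto
 have Gc: "continuous_on rectangle (%(t, x). G t x)"
 proof -
  have zc: "continuous_on rectangle (%y. (Z (T (fst y)), snd y))" by (intro continuous_intros comp Z(1)[folded I0_def])
  have p: "continuous_on rectangle (%y. (%(z, x). phi z x) (Z (T (fst y)), snd y))"
   by (rule continuous_on_compose2[OF phi_psi_joint_continuous(1) zc]) auto
  have p': "continuous_on rectangle (%y. (%(z, x). psi z x) (Z (T (fst y)), snd y))"
   by (rule continuous_on_compose2[OF phi_psi_joint_continuous(2) zc]) auto
  have cr: "continuous_on rectangle (%y. c (fst y))"
   by (rule continuous_on_compose2[OF cc[of UNIV]]) (auto intro!: continuous_intros)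
  show ?thesis unfolding G_def case_prod_unfold
   by (intro continuous_on_mult continuous_on_add cr comp alc p[unfolded split_conv] p'[unfolded split_conv])
 qed
 obtain g0 where g0: "(g0, %t x. c t * cnj (k x)) \<in> gelfand"
  by (rule gelfand_surj[OF Fc]) (use c0 Jpi in auto)
 define f1 where "f1 = (%x. of_real (sgn (w x)) * g0 x)"
 have f1: "(f1, F) \<in> gelfand"
 proof -
  have "(%t x. of_real (sgn (w x)) * (c t * cnj (k x))) = F" by (simp add: F_def f_def dual_def fun_eq_iff)
  then show ?thesis using gelfand_mult_sgn[OF g0] by (simp add: f1_def)
 qed
 obtain g where g: "(g, G) \<in> gelfand"
  by (rule gelfand_surj[OF Gc]) (use c0 Jpi in \<open>auto simp: G_def\<close>)
 define Dt where "Dt = Z ` J"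
 have dD: "ze \<in> Dt ==> deriv D ze ~= 0" for ze using Z(2) JI by (auto simp: Dt_def I0_def)
 have ZD: "D (Z t) = 2 * of_real (cos t)" if "t \<in> J" for t using Z(2)[of t] that JI by (auto simp: I0_def)
 have J0: "0 <= t" "t <= pi" if "t \<in> J" for t using that t ta by (auto simp: J_def)
 have SpJ: "Sp t Dt = {Z t}" if "t \<in> J" for t
 proof
  show "Sp t Dt <= {Z t}"
  proof
   fix ze assume "ze \<in> Sp t Dt"
   then obtain s where s: "s \<in> J" "ze = Z s" "Dtf t ze = 0" by (auto simp: Sp_def Dt_def)
   then have "complex_of_real (cos t) = of_real (cos s)" using ZD[of s] by simp
   then have "s = t" using J0[OF that] J0[OF s(1)] cos_inj_pi[of s t] by (simp add: of_real_eq_iff)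
   then show "ze \<in> {Z t}" using s by simp
  qed
  show "{Z t} <= Sp t Dt" using that ZD[OF that] by (auto simp: Sp_def Dt_def)
 qed
 \<comment> \<open>Fibres with \<open>t\<close> outside \<open>J\<close>, such as the reflected
   ones, may also have spectrum in \<open>Dt\<close>. It is then the spectrum of a fibre over
   \<open>J\<close>, a single point, and \<open>c t = 0\<close> there.\<close>
 have Spx: "\<exists>ze. Sp t Dt <= {ze}" for t
 proof (cases "Sp t Dt = {}")
  case False
  then obtain s where s: "s \<in> J" "Dtf t (Z s) = 0" by (auto simp: Sp_def Dt_def)
  then have "cos t = cos s" using ZD[of s] by (simp add: of_real_eq_iff)
  then have "Sp t Dt = Sp s Dt" by (simp add: Sp_def)
  then show ?thesis using SpJ[OF s(1)] by auto
 qed auto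
 have mem: "(F t, G t) \<in> E_fiber t Dt" for t
 proof -
  obtain ze where ze: "Sp t Dt <= {ze}" using Spx by blast
  have FL: "F t \<in> L2 Ma" unfolding F_def by (rule L2_cmult[OF fL(1)])
  have GL: "G t \<in> L2 Ma" unfolding G_def by (intro L2_cmult L2_add phi_L2 psi_L2)
  have ip: "l2_inner Ma (G t) h' = c t * (Num (T t) (Z (T t)) f h' / deriv D (Z (T t)))" if "h' \<in> L2 Ma" for h'
  proof -
   have "l2_inner Ma (G t) h' = l2_inner Ma (%x. (c t * al (T t)) * phi (Z (T t)) x + (c t * be (T t)) * psi (Z (T t)) x) h'"
    unfolding G_def by (simp only: distrib_left mult.assoc)
   also have "... = c t * al (T t) * l2_inner Ma (phi (Z (T t))) h' + c t * be (T t) * l2_inner Ma (psi (Z (T t))) h'"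
    by (rule l2_inner_comb[OF phi_L2 psi_L2 that])
   finally show ?thesis unfolding qeq by (simp only: distrib_left mult.assoc)
  qed
  show ?thesis
  proof (rule E_fiberI[OF nc _ ze FL GL])
   fix h' assume h': "h' \<in> L2 Ma"
   show "l2_inner Ma (G t) h' = (\<Sum>ze\<in>Sp t Dt. Num t ze (F t) h' / deriv D ze)"
   proof (cases "t \<in> J")
    case True
    then show ?thesis unfolding ip[OF h'] F_def Num_cmult by (simp add: SpJ Tid)
   next
    case False
    then show ?thesis unfolding ip[OF h'] F_def Num_cmult by (simp add: c0)
   qed
  qed (rule dD)
 qed
 have "(f1, g) \<in> E Dt" unfolding E_def using f1 g mem by blast
 moreover have "l2_norm MR f1 <= 1"
 proof -
  have "(\<integral>\<^sup>+t. ennreal ((nrm (F t))^2) \<partial>LI) <= (\<integral>\<^sup>+t. ennreal ((ka * (nrm k + 1))^2 * (th t)^2) \<partial>LI)"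
  proof (intro nn_integral_mono ennreal_leI)
   fix t
   have "nrm (F t) <= ka * th t * (nrm k + 1)"
    unfolding F_def l2_norm_cmult cn fL(2) using ka thp[of t] by (intro mult_left_mono) auto
   then have "(nrm (F t))^2 <= (ka * th t * (nrm k + 1))^2" by (rule power_mono) simp
   then show "(nrm (F t))^2 <= (ka * (nrm k + 1))^2 * (th t)^2" by (simp only: power_mult_distrib mult_ac)
  qed
  also have "... = ennreal (1 / 2)" by (subst Xth) (simp_all only: kaX zero_le_power2)
  finally have "2 * (\<integral>\<^sup>+t. ennreal ((nrm (F t))^2) \<partial>LI) <= 2 * ennreal (1 / 2)" by (rule mult_left_mono) simp
  also have "2 * ennreal (1 / 2) = ennreal (2 * (1 / 2))" by (subst ennreal_mult) simp_all
  finally have "ennreal ((l2_norm MR f1)^2) <= ennreal (2 * (1 / 2))" by (rule order_trans[OF gelfand_norm_bounds(2)[OF f1]])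
  then have "(l2_norm MR f1)^2 <= 1^2" by simp
  then show ?thesis by (rule power2_le_imp_le) simp
 qed
 ultimately have "ennreal (l2_norm MR g) <= op_norm MR (E Dt)"
  unfolding op_norm_def by (intro SUP_upper2[of "(f1, g)"]) auto
 also have "... <= ennreal K" unfolding Dt_def J_def by (rule K(2)[OF ta])
 finally have gK: "l2_norm MR g <= K" using K(1) by simp
 have "ennreal (9 / 2 * K^2) = ennreal ((3 * K * (ka * (nrm k + 1)))^2 * X)"
 proof -
  have "(3 * K * (ka * (nrm k + 1)))^2 * X = (3 * K)^2 * ((ka * (nrm k + 1))^2 * X)"
   by (simp only: power_mult_distrib mult.assoc)
  also have "... = (3 * K)^2 * (1 / 2)" by (simp only: kaX)
  also have "... = 9 / 2 * K^2" by (simp add: power_mult_distrib)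
  finally show ?thesis by (simp only:)
 qed
 also have "... = (\<integral>\<^sup>+t. ennreal ((3 * K * (ka * (nrm k + 1)))^2 * (th t)^2) \<partial>LI)" by (rule Xth[symmetric]) simp
 also have "... <= (\<integral>\<^sup>+t. ennreal ((nrm (G t))^2) \<partial>LI)"
 proof (intro nn_integral_mono ennreal_leI)
  fix t
  have "3 * K * (ka * (nrm k + 1)) * th t <= nrm (G t)"
  proof (cases "t \<in> J")
   case True
   have GL: "G t \<in> L2 Ma" unfolding G_def by (intro L2_cmult L2_add phi_L2 psi_L2)
   have "l2_inner Ma (G t) h = c t * (Num t (Z t) f h / deriv D (Z t))"
    using E_fiberD(4)[OF nc _ mem[of t] h] dD by (simp add: SpJ[OF True] F_def Num_cmult)
   then have "ka * th t * norm (Num t (Z t) f h / deriv D (Z t)) = norm (l2_inner Ma (G t) h)"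
    by (simp only: norm_mult cn)
   also have "... <= nrm (G t) * nrm h" by (rule l2_inner_bound[OF GL h])
   also have "... <= nrm (G t) * (nrm h + 1)" by (intro mult_left_mono) auto
   finally have "ka * th t * norm (Num t (Z t) f h / deriv D (Z t)) <= nrm (G t) * (nrm h + 1)" .
   moreover have "ka * th t * C <= ka * th t * norm (Num t (Z t) f h / deriv D (Z t))"
    by (intro mult_left_mono less_imp_le[OF big[OF True]] mult_nonneg_nonneg thp) (use ka in simp)
   ultimately have "ka * th t * C <= nrm (G t) * (nrm h + 1)" by (rule order_trans[rotated])
   then have "(3 * K * (ka * (nrm k + 1)) * th t) * (nrm h + 1) <= nrm (G t) * (nrm h + 1)"
    unfolding C_def by (simp only: mult_ac)
   then show ?thesis using k1(2) by (rule mult_right_le_imp_le)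
  qed (simp add: th0)
  then have "(3 * K * (ka * (nrm k + 1)) * th t)^2 <= (nrm (G t))^2"
   by (rule power_mono) (use K(1) ka thp[of t] in auto)
  then show "(3 * K * (ka * (nrm k + 1)))^2 * (th t)^2 <= (nrm (G t))^2" by (simp only: power_mult_distrib)
 qed
 also have "... <= 2 * ennreal ((l2_norm MR g)^2)" by (rule gelfand_norm_bounds(1)[OF g])
 also have "... <= 2 * ennreal (K^2)" using gK by (intro mult_left_mono ennreal_leI power_mono) auto
 also have "... = ennreal (2 * K^2)" by (subst ennreal_mult) simp_all
 finally have "9 / 2 * K^2 <= 2 * K^2" by (rule ennreal_le_iff[THEN iffD1, rotated]) simp
 then show False using K(1) by simp
qed

end

text \<open>The four expressions are the values of the bilinear form of \<open>n\<close> on the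
  pairs of \<open>(A, B)\<close>, \<open>(C, E)\<close> with \<open>(B, - A)\<close>,
  \<open>(E, - C)\<close>. Inverting both families costs \<open>1 / p^2\<close>, at most 4 in
  modulus, and two factors 4 from combinations with entries of modulus at most 2, hence 64.\<close>

lemma matrix_recover:
 fixes n11 n12 n21 n22 A B C E :: complex
 defines "p \<equiv> A * E - B * C"
 assumes AE: "norm A <= 2" "norm B <= 2" "norm C <= 2" "norm E <= 2" and p: "norm p >= 1 / 2"
  and X: "norm ((n11 * B - n12 * A) * A + (n21 * B - n22 * A) * B) <= X" "norm ((n11 * B - n12 * A) * C + (n21 * B - n22 * A) * E) <= X"
   "norm ((n11 * E - n12 * C) * A + (n21 * E - n22 * C) * B) <= X" "norm ((n11 * E - n12 * C) * C + (n21 * E - n22 * C) * E) <= X"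
 shows "norm n11 <= 64 * X" "norm n12 <= 64 * X" "norm n21 <= 64 * X" "norm n22 <= 64 * X"
proof -
 have X0: "X >= 0" using X(1) norm_ge_zero order_trans by blast
 have two: "norm (u * v - y * z) <= 4 * R" if "norm u <= 2" "norm y <= 2" "norm v <= R" "norm z <= R" "2 * R <= 2 * R" for u v y z :: complex and R
 proof -
  have "norm (u * v - y * z) <= norm u * norm v + norm y * norm z" by (metis norm_mult norm_triangle_ineq4)
  also have "... <= 2 * R + 2 * R" using that by (intro add_mono mult_mono) auto
  finally show ?thesis by simp
 qed
 have key: "norm m <= 64 * X" if m: "p * p * m = u * (a1 * x1 - a2 * x2) - v * (a1 * x3 - a2 * x4)"
  and "norm u <= 2" "norm v <= 2" "norm a1 <= 2" "norm a2 <= 2" "norm x1 <= X" "norm x2 <= X" "norm x3 <= X" "norm x4 <= X" for m u v a1 a2 x1 x2 x3 x4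
 proof -
  have "norm (p * p * m) <= 4 * (4 * X)" unfolding m by (intro two that) auto
  moreover have "1 / 2 * (1 / 2) * norm m <= norm p * norm p * norm m" using p by (intro mult_right_mono mult_mono) auto
  ultimately show ?thesis by (simp add: norm_mult)
 qed
 show "norm n11 <= 64 * X"
  by (rule key[of _ A E _ B _ C, OF _ AE(1,3,4,2) X(3,4,1,2)]) (unfold p_def, algebra)
 show "norm n12 <= 64 * X"
  by (rule key[of _ B E _ B _ E, OF _ AE(2,4,4,2) X(3,4,1,2)]) (unfold p_def, algebra)
 show "norm n21 <= 64 * X"
  by (rule key[of _ A A _ C _ C, OF _ AE(1,3,1,3) X(4,3,2,1)]) (unfold p_def, algebra)
 show "norm n22 <= 64 * X"
  by (rule key[of _ B A _ C _ E, OF _ AE(2,4,1,3) X(4,3,2,1)]) (unfold p_def, algebra)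
qed

context periodic_SL
begin

text \<open>Once \<open>I0\<close> and \<open>I1\<close> are scalar products with \<open>k\<close>,
  the form \<open>Num\<close> has the shape treated in \<open>matrix_recover\<close>, with
  \<open>n = M - e^(-it)\<close>.\<close>

lemma Num_dual:
 assumes "k \<in> L2 Ma"
 shows "Num t z (dual k) h = ((phi z a - ef (- t)) * l2_inner Ma (psi z) k - psi z a * l2_inner Ma (phi z) k) * l2_inner Ma (phi z) h
  + (p_phi' z a * l2_inner Ma (psi z) k - (p_psi' z a - ef (- t)) * l2_inner Ma (phi z) k) * l2_inner Ma (psi z) h"
 by (simp add: Num_def na_def nb_def dual(3,4)[OF assms])

lemma regular_only_if:
 assumes reg: "regular_critical_point z0"
 shows "D z0 \<in> {-2, 2} & psi z0 a = 0 & p_phi' z0 a = 0 & (deriv ^^ 2) D z0 ~= 0"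
proof -
 obtain U where U: "open U" "z0 \<in> U" "closure U \<inter> critical_points = {z0}" and crit: "z0 \<in> critical_points"
  and fin: "(SUP (J, c) \<in> {(J, c). regular_spectral_curve J c &
             z0 \<in> top_of_set (op_spectrum MR A) frontier_of (c ` J)}.
     SUP Dt \<in> {Dt \<in> B0 (c ` J). Dt <= U}. op_norm MR (E Dt)) < \<infinity>" (is "?S < _")
  using reg unfolding regular_critical_point_def by blast
 define K where "K = max 1 (enn2real ?S)"
 have K1: "K >= 1" by (simp add: K_def)
 have SK: "?S <= ennreal K"
 proof -
  have "?S = ennreal (enn2real ?S)" using fin by simp
  also have "... <= ennreal K" unfolding K_def by (intro ennreal_leI) simp
  finally show ?thesis .
 qed
 have bnd: "op_norm MR (E Dt) <= ennreal K"
  if "regular_spectral_curve J c" "z0 \<in> top_of_set (op_spectrum MR A) frontier_of (c ` J)" "Dt \<in> B0 (c ` J)" "Dt <= U" for J c Dt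
 proof -
  have "op_norm MR (E Dt) <= (SUP Dt \<in> {Dt \<in> B0 (c ` J). Dt <= U}. op_norm MR (E Dt))"
   using that by (intro SUP_upper) auto
  also have "... <= ?S" using that by (intro SUP_upper2[of "(J, c)"]) auto
  finally show ?thesis using SK by (rule order_trans)
 qed
 have d1: "deriv D z0 = 0" and zs: "z0 \<in> op_spectrum MR A" using crit by (auto simp: critical_points_def)
 obtain x0 where x0: "- 2 <= x0" "x0 <= 2" "D z0 = of_real x0" by (rule spectrum_in_band[OF zs])
 \<comment> \<open>For a constant \<open>D\<close> every point would be critical, and the open set
   \<open>U\<close> would be the single point \<open>z0\<close>.\<close>
 have nc: "~ D constant_on UNIV"
 proof
  assume "D constant_on UNIV"
  then have "D = (%_. of_real x0)" using x0(3) by (force simp: constant_on_def)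
  then have "critical_points = UNIV" using band_in_spectrum[OF _ x0(1,2)] by (auto simp: critical_points_def)
  then have "U = {z0}" using U(2,3) closure_subset[of U] by auto
  then show False using U(1) not_open_singleton[of z0] by simp
 qed
 obtain k r g h where kr: "k > 0" "r > 0" "(deriv ^^ k) D z0 ~= 0" "!!i. 0 < i ==> i < k ==> (deriv ^^ i) D z0 = 0"
  "h holomorphic_on ball z0 r" "continuous_on (ball z0 r) g" "inj_on h (ball z0 r)"
  and pf: "!!z. z \<in> ball z0 r ==> D z = D z0 + h z ^ k & h z = (z - z0) * g z & g z ~= 0 & deriv h z ~= 0
    & deriv D z = of_nat k * h z ^ (k - 1) * deriv h z"
  by (rule local_power_form[OF D_holomorphic nc, of z0], rule that)
 obtain rU where rU: "rU > 0" "ball z0 rU <= U" using U(1,2) by (meson open_contains_ball)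
 define B where "B = ball z0 (min r rU)"
 have B: "open B" "z0 \<in> B" "B <= ball z0 r" "B <= U" using rU kr(2) by (auto simp: B_def)
 have hB: "h holomorphic_on B" "inj_on h B" using kr(5,7) B(3) by (auto intro: holomorphic_on_subset inj_on_subset)
 obtain G where G: "G holomorphic_on (h ` B)" "!!z. z \<in> B ==> G (h z) = z"
  by (rule holomorphic_has_inverse[OF hB(1) B(1) hB(2)], rule that)
 have oh: "open (h ` B)" by (rule open_mapping_thm3[OF hB(1) B(1) hB(2)])
 have h0: "h z0 = 0" using pf[of z0] kr(2) by simp
 have G0: "G 0 = z0" using G(2)[OF B(2)] h0 by simp
 have "0 \<in> h ` B" using B(2) h0 by force
 then obtain r1 where r1: "r1 > 0" "ball 0 r1 <= h ` B" using oh by (meson open_contains_ball)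
 \<comment> \<open>The sign makes \<open>x0 + et * s ^ k\<close> move into the interior of [-2, 2],
   even if \<open>x0\<close> is an end of it. With a k-th root \<open>om\<close> of this sign,
   \<open>D\<close> stays real along the ray of direction \<open>om\<close> in the coordinate
   \<open>h\<close>.\<close>
 define et :: real where "et = (if x0 <= 0 then 1 else - 1)"
 have et: "et * et = 1" by (simp add: et_def)
 obtain om :: complex where om: "norm om = 1" "om ^ k = of_real et"
 proof
  show "norm (cis (if x0 <= 0 then 0 else pi / k)) = 1" by simp
  show "cis (if x0 <= 0 then 0 else pi / k) ^ k = of_real et" using Complex.DeMoivre[of "pi / k" k] kr(1) by (auto simp: et_def)
 qed
 \<comment> \<open>The bound 1 keeps \<open>s ^ k\<close> below 1, so that \<open>xs s\<close> lies
   strictly between -2 and 2.\<close>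
 define s0 where "s0 = min r1 1"
 define J where "J = {0<..<s0}"
 define c where "c = (%s::real. G (of_real s * om))"
 have hc: "h (c s) = of_real s * om & c s \<in> B" if "s \<in> J" for s
 proof -
  have "of_real s * om \<in> ball 0 r1" using that om(1) by (simp add: J_def s0_def norm_mult)
  then obtain z where "z \<in> B" "of_real s * om = h z" using r1(2) by blast
  then show ?thesis using G(2) by (simp add: c_def)
 qed
 define xs where "xs = (%s. x0 + et * s ^ k)"
 have Dc: "D (c s) = of_real (xs s)" if "s \<in> J" for s
  using pf[of "c s"] hc[OF that] B(3) om(2) x0(3) by (auto simp: xs_def power_mult_distrib mult.commute)
 have xs: "- 2 < xs s" "xs s < 2" if "s \<in> J" for s
 proof -
  have "0 < s ^ k" "s ^ k < 1" using that kr(1) by (auto simp: J_def s0_def power_less_one_iff)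
  then show "- 2 < xs s" "xs s < 2" using x0 by (auto simp: xs_def et_def)
 qed
 have dDc: "deriv D (c s) ~= 0" if s: "s \<in> J" for s
 proof -
  have "h (c s) ~= 0" using hc[OF s] s om(1) by (auto simp: J_def)
  moreover have "c s \<in> ball z0 r" using hc[OF s] B(3) by blast
  ultimately show ?thesis using pf[of "c s"] kr(1) by simp
 qed
 have Jm: "of_real s * om \<in> h ` B" if "s \<in> J" for s using hc[OF that] by (metis image_eqI)
 have cc: "continuous_on J c"
  unfolding c_def by (rule continuous_on_compose2[OF holomorphic_on_imp_continuous_on[OF G(1)]]) (auto intro!: continuous_intros Jm)
 have "analytic_curve J c"
  unfolding analytic_curve_def
 proof (intro conjI ballI)
  show "is_interval J" by (simp add: J_def is_interval_oo)
  show "continuous_on J c" by (rule cc)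
  show "inj_on c J"
  proof (rule inj_onI)
   fix s s' assume "s \<in> J" "s' \<in> J" "c s = c s'"
   then have "of_real s * om = of_real s' * om" using hc by metis
   then show "s = s'" using om(1) by auto
  qed
  fix s assume "s \<in> interior J"
  then have s: "s \<in> J" using interior_subset by blast
  obtain d where d: "d > 0" "ball (of_real s * om) d <= h ` B" using oh Jm[OF s] by (meson open_contains_ball)
  have Gd: "G holomorphic_on ball (of_real s * om) d" using G(1) d(2) by (rule holomorphic_on_subset)
  show "real_analytic_at c s"
   unfolding real_analytic_at_def
  proof (intro exI[of _ "%n. (deriv ^^ n) G (of_real s * om) / fact n * om ^ n"] exI[of _ d] conjI d(1) allI impI)
   fix y assume y: "\<bar>y - s\<bar> < d"
   have e: "of_real y * om - of_real s * om = of_real (y - s) * om" by (simp add: algebra_simps)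
   have "norm (of_real y * om - of_real s * om) < d" unfolding e norm_mult om(1) norm_of_real using y by simp
   then have "of_real y * om \<in> ball (of_real s * om) d" by (simp add: dist_norm norm_minus_commute)
   from holomorphic_power_series[OF Gd this]
   have "(%n. (deriv ^^ n) G (of_real s * om) / fact n * (of_real (y - s) * om) ^ n) sums c y" unfolding e c_def .
   then show "(%n. (deriv ^^ n) G (of_real s * om) / fact n * om ^ n * of_real (y - s) ^ n) sums c y"
    unfolding power_mult_distrib by (simp only: mult_ac)
  qed
 qed
 then have rc: "regular_spectral_curve J c"
  unfolding regular_spectral_curve_def using band_in_spectrum[OF Dc] xs dDc by (auto simp: less_imp_le)
 define F where "F = at_right (0::real)"
 have ev: "eventually (%s. s \<in> J) F"
  unfolding F_def J_def using r1(1) by (intro eventually_at_right_real) (simp add: s0_def)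
 have sl: "((%s. s) \<longlongrightarrow> 0) F" unfolding F_def by (rule tendsto_ident_at)
 have "isCont G 0" using G(1) oh \<open>0 \<in> h ` B\<close> by (meson continuous_on_eq_continuous_at holomorphic_on_imp_continuous_on)
 moreover have "((%s. of_real s * om) \<longlongrightarrow> of_real 0 * om) F" by (intro tendsto_intros sl)
 ultimately have cl: "(c \<longlongrightarrow> z0) F" unfolding c_def by (intro isCont_tendsto_compose[of 0 G, unfolded G0]) simp_all
 have nb: "F ~= bot" by (simp add: F_def)
 \<comment> \<open>The curve has \<open>z0\<close> as a limit but does not contain it, since
   \<open>deriv D\<close> has no zero on the curve.\<close>
 have fr: "z0 \<in> top_of_set (op_spectrum MR A) frontier_of (c ` J)"
 proof -
  have sub: "c ` J <= op_spectrum MR A" using rc by (simp add: regular_spectral_curve_def)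
  have "z0 \<in> closure (c ` J)"
   unfolding closure_approachable
  proof (intro allI impI)
   fix e :: real assume "0 < e"
   then have "eventually (%s. dist (c s) z0 < e) F" using cl by (simp add: tendsto_iff)
   then have "eventually (%s. dist (c s) z0 < e & s \<in> J) F" using ev by (rule eventually_conj)
   from eventually_happens'[OF nb this] obtain s where "dist (c s) z0 < e" "s \<in> J" by blast
   then show "\<exists>y\<in>c ` J. dist y z0 < e" by blast
  qed
  then have "z0 \<in> top_of_set (op_spectrum MR A) closure_of (c ` J)"
   using zs sub by (simp add: closure_of_subtopology Int_absorb1)
  moreover have "z0 \<notin> top_of_set (op_spectrum MR A) interior_of (c ` J)"
   using interior_of_subset[of "top_of_set (op_spectrum MR A)" "c ` J"] dDc d1 by auto
  ultimately show ?thesis by (simp add: frontier_of_def)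
 qed
 define ts where "ts = (%s. arccos (xs s / 2))"
 have ts: "0 < ts s" "ts s < pi" "2 * cos (ts s) = xs s" if "s \<in> J" for s
  using arccos_lt_bounded[of "xs s / 2"] xs[OF that] by (simp_all add: ts_def cos_arccos)
 have fb: "norm (Num (ts s) (c s) (dual k') h' / deriv D (c s)) <= 3 * K * (nrm h' + 1) * (nrm k' + 1)"
  if s: "s \<in> J" and k': "continuous_on {0..a} k'" and h': "h' \<in> L2 Ma" for s k' h'
 proof -
  \<comment> \<open>A local inverse of \<open>ts\<close>: near \<open>ts s\<close> the curve is
    parametrised by the quasimomentum, as \<open>fiber_bound\<close> expects.\<close>
  define sv where "sv = (%t. root k (et * (2 * cos t - x0)))"
  have svc: "continuous_on S sv" for S unfolding sv_def by (intro continuous_intros)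
  have "et * (2 * cos (ts s) - x0) = s ^ k" unfolding ts(3)[OF s] xs_def using et by (simp add: mult.assoc[symmetric])
  then have sv0: "sv (ts s) = s" using s kr(1) by (simp add: sv_def J_def real_root_power_cancel)
  have "open (sv -` J)" by (rule open_vimage) (auto simp: J_def svc)
  then obtain d where d: "d > 0" "ball (ts s) d <= sv -` J" using sv0 s by (metis open_contains_ball vimage_eq)
  define ta0 where "ta0 = min d (min (ts s) (pi - ts s)) / 2"
  have "0 < 2 * ta0" "2 * ta0 <= d" "2 * ta0 <= ts s" "2 * ta0 <= pi - ts s" using d(1) ts[OF s] by (simp_all add: ta0_def)
  then have ta0: "ta0 > 0" "0 < ts s - ta0" "ts s + ta0 < pi" "ta0 < d" by linarith+
  have svJ: "sv t \<in> J" if "t \<in> {ts s - ta0..ts s + ta0}" for t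
  proof -
   have "t \<in> ball (ts s) d" using that ta0(4) by (auto simp: dist_real_def)
   then show ?thesis using d(2) by blast
  qed
  have DZ: "D (c (sv t)) = 2 * of_real (cos t)" if "t \<in> {ts s - ta0..ts s + ta0}" for t
  proof -
   have p: "0 < sv t" using svJ[OF that] by (simp add: J_def)
   then have "0 <= et * (2 * cos t - x0)" using kr(1) by (simp add: sv_def)
   then have "sv t ^ k = et * (2 * cos t - x0)" using kr(1) by (simp add: sv_def real_root_pow_pos2)
   then have "xs (sv t) = 2 * cos t" using et by (simp add: xs_def mult.assoc[symmetric])
   then show ?thesis using Dc[OF svJ[OF that]] by simp
  qed
  have Zc: "continuous_on {ts s - ta0..ts s + ta0} (%t. c (sv t))"
   by (rule continuous_on_compose2[OF cc svc]) (use svJ in auto)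
  have "norm (Num (ts s) (c (sv (ts s))) (dual k') h' / deriv D (c (sv (ts s)))) <= 3 * K * (nrm h' + 1) * (nrm k' + 1)"
  proof (rule fiber_bound[OF nc ta0(2,3,1) Zc _ K1 _ k' h'])
   show "Dtf t (c (sv t)) = 0 & deriv D (c (sv t)) ~= 0" if "t \<in> {ts s - ta0..ts s + ta0}" for t
    using DZ[OF that] dDc[OF svJ[OF that]] by simp
   fix ta assume ta: "0 < ta" "ta <= ta0"
   define Dt where "Dt = (%t. c (sv t)) ` {ts s - ta..ts s + ta}"
   have sub: "{ts s - ta..ts s + ta} <= {ts s - ta0..ts s + ta0}" using ta by auto
   have "compact Dt" unfolding Dt_def by (intro compact_continuous_image continuous_on_subset[OF Zc sub] compact_Icc)
   then have cl: "closed Dt" by (rule compact_imp_closed)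
   have cJ: "Dt <= c ` J" using svJ sub by (auto simp: Dt_def)
   have "Dt \<in> B0 (c ` J)" using cl cJ by (simp add: B0_def closure_closed)
   moreover have "Dt <= U" using cJ hc B(4) by auto
   ultimately show "op_norm MR (E ((%t. c (sv t)) ` {ts s - ta..ts s + ta})) <= ennreal K" unfolding Dt_def by (rule bnd[OF rc fr])
  qed
  then show ?thesis by (simp only: sv0)
 qed
 obtain k1 k2 where k: "continuous_on {0..a} k1" "continuous_on {0..a} k2"
  "l2_inner Ma (phi z0) k1 = 1" "l2_inner Ma (psi z0) k1 = 0"
  "l2_inner Ma (phi z0) k2 = 0" "l2_inner Ma (psi z0) k2 = 1" by (rule biorthogonal[of z0])
 have kL: "k1 \<in> L2 Ma" "k2 \<in> L2 Ma" using k(1,2) by (auto intro: continuous_L2)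
 define M where "M = max (nrm k1) (nrm k2) + 1"
 have M0: "M >= 0" using l2_norm_nonneg[of Ma k1] by (simp add: M_def le_max_iff_disj)
 define C where "C = 3 * K * M * M"
 have nb': "norm (Num (ts s) (c s) (dual k') h') <= C * norm (deriv D (c s))"
  if "s \<in> J" "k' \<in> {k1, k2}" "h' \<in> {k1, k2}" for s k' h'
 proof -
  have "nrm k' + 1 <= M" "nrm h' + 1 <= M" using that by (auto simp: M_def)
  then have "3 * K * (nrm h' + 1) * (nrm k' + 1) <= C"
   unfolding C_def using K1 M0 by (intro mult_mono mult_nonneg_nonneg) auto
  moreover have "norm (Num (ts s) (c s) (dual k') h' / deriv D (c s)) <= 3 * K * (nrm h' + 1) * (nrm k' + 1)"
   by (rule fb[OF that(1)]) (use that k kL in auto)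
  ultimately have "norm (Num (ts s) (c s) (dual k') h' / deriv D (c s)) <= C" by linarith
  then show ?thesis using dDc[OF that(1)] by (simp add: norm_divide divide_le_eq)
 qed
 have ipl: "((%s. l2_inner Ma (phi (c s)) k') \<longlongrightarrow> l2_inner Ma (phi z0) k') F" "((%s. l2_inner Ma (psi (c s)) k') \<longlongrightarrow> l2_inner Ma (psi z0) k') F"
  if "k' \<in> L2 Ma" for k'
  unfolding phi_usol psi_usol
  by (rule isCont_tendsto_compose[OF _ cl],
   rule continuous_on_interior[OF holomorphic_on_imp_continuous_on[OF l2_inner_holomorphic[OF hper_zero that, where S = UNIV]]], simp)+
 have entl: "((%s. u (c s)) \<longlongrightarrow> u z0) F" if "u holomorphic_on UNIV" for u
  by (rule isCont_tendsto_compose[OF continuous_on_interior[OF holomorphic_on_imp_continuous_on[OF that]] cl]) simp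
 \<comment> \<open>The dual basis belongs to \<open>z0\<close>; at \<open>c s\<close> the pairings
   with it tend to the unit matrix, so for small \<open>s\<close> they satisfy the hypotheses of
   \<open>matrix_recover\<close>.\<close>
 define A11 A12 A21 A22 where "A11 = (%s. l2_inner Ma (phi (c s)) k1)" and "A12 = (%s. l2_inner Ma (psi (c s)) k1)"
  and "A21 = (%s. l2_inner Ma (phi (c s)) k2)" and "A22 = (%s. l2_inner Ma (psi (c s)) k2)"
 have Al: "(A11 \<longlongrightarrow> 1) F" "(A12 \<longlongrightarrow> 0) F" "(A21 \<longlongrightarrow> 0) F" "(A22 \<longlongrightarrow> 1) F"
  using ipl[OF kL(1)] ipl[OF kL(2)] k by (simp_all add: A11_def A12_def A21_def A22_def)
 have dl: "((%s. A11 s * A22 s - A12 s * A21 s) \<longlongrightarrow> 1 * 1 - 0 * 0) F" by (intro tendsto_intros Al)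
 have small: "eventually (%s. norm (u s) <= 2) F" if "(u \<longlongrightarrow> l) F" "norm l < 2" for u and l :: complex
  using order_tendstoD(2)[OF tendsto_norm[OF that(1)] that(2)] by eventually_elim simp
 have "eventually (%s. norm (A11 s * A22 s - A12 s * A21 s) > 1 / 2) F"
  by (rule order_tendstoD(1)[OF tendsto_norm[OF dl]]) simp
 have sm: "eventually (%s. norm (A11 s) <= 2) F" "eventually (%s. norm (A12 s) <= 2) F" "eventually (%s. norm (A21 s) <= 2) F" "eventually (%s. norm (A22 s) <= 2) F"
  using small[OF Al(1)] small[OF Al(2)] small[OF Al(3)] small[OF Al(4)] by simp_all
 \<comment> \<open>The bound for all entries of \<open>M - e^(-it)\<close> along the curve,
   proportional to \<open>deriv D\<close>; 64 is the constant of
   \<open>matrix_recover\<close>.\<close>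
 define N where "N = (%s. 64 * (C * norm (deriv D (c s))))"
 define e where "e = (%s. ef (- ts s))"
 have n: "eventually (%s. s \<in> J & norm (phi (c s) a - e s) <= N s & norm (psi (c s) a) <= N s & norm (p_phi' (c s) a) <= N s & norm (p_psi' (c s) a - e s) <= N s) F"
  using ev \<open>eventually (%s. norm (A11 s * A22 s - A12 s * A21 s) > 1 / 2) F\<close>
   sm
 proof eventually_elim
  case (elim s)
  have X: "norm (Num (ts s) (c s) (dual k') h') <= C * norm (deriv D (c s))" if "k' \<in> {k1, k2}" "h' \<in> {k1, k2}" for k' h'
   using nb'[OF elim(1) that] .
  have le: "norm (A11 s) <= 2" "norm (A12 s) <= 2" "norm (A21 s) <= 2" "norm (A22 s) <= 2" "norm (A11 s * A22 s - A12 s * A21 s) >= 1 / 2"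
   using elim by auto
  have 1: "norm (((phi (c s) a - e s) * A12 s - psi (c s) a * A11 s) * A11 s + (p_phi' (c s) a * A12 s - (p_psi' (c s) a - e s) * A11 s) * A12 s) <= C * norm (deriv D (c s))"
   "norm (((phi (c s) a - e s) * A12 s - psi (c s) a * A11 s) * A21 s + (p_phi' (c s) a * A12 s - (p_psi' (c s) a - e s) * A11 s) * A22 s) <= C * norm (deriv D (c s))"
   "norm (((phi (c s) a - e s) * A22 s - psi (c s) a * A21 s) * A11 s + (p_phi' (c s) a * A22 s - (p_psi' (c s) a - e s) * A21 s) * A12 s) <= C * norm (deriv D (c s))"
   "norm (((phi (c s) a - e s) * A22 s - psi (c s) a * A21 s) * A21 s + (p_phi' (c s) a * A22 s - (p_psi' (c s) a - e s) * A21 s) * A22 s) <= C * norm (deriv D (c s))"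
   using X[of k1 k1] X[of k1 k2] X[of k2 k1] X[of k2 k2]
   unfolding Num_dual[OF kL(1)] Num_dual[OF kL(2)] A11_def A12_def A21_def A22_def e_def by simp_all
  from matrix_recover[OF le 1] show ?case using elim(1) by (simp only: N_def simp_thms)
 qed
 have dDl: "((%s. deriv D (c s)) \<longlongrightarrow> 0) F"
  using isCont_tendsto_compose[OF continuous_on_interior[OF deriv_D_continuous[of UNIV]] cl] d1 by simp
 have "(N \<longlongrightarrow> 64 * (C * norm (0::complex))) F" unfolding N_def by (intro tendsto_intros dDl)
 then have Nl: "(N \<longlongrightarrow> 0) F" by simp
 \<comment> \<open>The factor 2 leaves room for the difference of the two diagonal entries, in which
   \<open>e s\<close> cancels.\<close>
 have zero: "u z0 = 0" if "u holomorphic_on UNIV" "eventually (%s. norm (u (c s)) <= 2 * N s) F" for u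
 proof -
  have "((%s. 2 * N s) \<longlongrightarrow> 2 * 0) F" by (intro tendsto_intros Nl)
  then have "((%s. u (c s)) \<longlongrightarrow> 0) F" using that(2) by (intro Lim_null_comparison[OF _ \<open>((%s. 2 * N s) \<longlongrightarrow> 2 * 0) F\<close>[simplified]]) auto
  then show ?thesis using tendsto_unique[OF nb entl[OF that(1)]] by blast
 qed
 have N0: "N s >= 0" for s using K1 M0 by (simp add: N_def C_def)
 have dbl: "x <= N s ==> x <= 2 * N s" for x s using N0[of s] by linarith
 have "eventually (%s. norm (psi (c s) a) <= 2 * N s) F" "eventually (%s. norm (p_phi' (c s) a) <= 2 * N s) F"
  using n by (eventually_elim, blast intro: dbl)+
 then have p0: "psi z0 a = 0" and q0: "p_phi' z0 a = 0"
  using zero[OF entries_holo(2)] zero[OF entries_holo(3)] by blast+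
 have "(%z. phi z a - p_psi' z a) z0 = 0"
 proof (rule zero)
  show "(%z. phi z a - p_psi' z a) holomorphic_on UNIV" by (intro holomorphic_intros entries_holo)
  show "eventually (%s. norm (phi (c s) a - p_psi' (c s) a) <= 2 * N s) F"
   using n
  proof eventually_elim
   case (elim s)
   have "norm (phi (c s) a - p_psi' (c s) a) <= norm (phi (c s) a - e s) + norm (p_psi' (c s) a - e s)"
    using norm_triangle_ineq4[of "phi (c s) a - e s" "p_psi' (c s) a - e s"] by simp
   moreover have "norm (phi (c s) a - e s) <= N s" "norm (p_psi' (c s) a - e s) <= N s" using elim by blast+
   ultimately show ?case by linarith
  qed
 qed
 then have "phi z0 a = p_psi' z0 a" by simp
 then have "phi z0 a * phi z0 a = 1" "D z0 = 2 * phi z0 a" using det_a[of z0] p0 by (simp_all add: D_def)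
 then have D0: "D z0 \<in> {-2, 2}" by (auto simp: square_eq_1_iff)
 \<comment> \<open>With \<open>y = s * om\<close>, the trace of \<open>M - e^(-it)\<close> has
   square \<open>y^k * (2 * D z0 + y^k)\<close> and modulus at most \<open>2 * N s\<close>, which is
   of order \<open>s^(k - 1)\<close>. After division by \<open>s^k\<close> the right-hand side is of
   order \<open>s^(k - 2)\<close>, and for \<open>k > 2\<close> the limit would give
   \<open>D z0 = 0\<close>.\<close>
 have "k < 3"
 proof (rule ccontr)
  assume "~ k < 3"
  then have k3: "k - 2 > 0" by simp
  have hl: "((%s. deriv h (c s)) \<longlongrightarrow> deriv h z0) F"
  proof (rule isCont_tendsto_compose[OF _ cl])
   have "continuous_on (ball z0 r) (deriv h)" by (rule holomorphic_on_imp_continuous_on[OF holomorphic_deriv[OF kr(5) open_ball]])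
   then show "isCont (deriv h) z0" using kr(2) by (simp add: continuous_on_eq_continuous_at)
  qed
  define Q where "Q = (128 * C * k)^2"
  have "((%s. norm (2 * D z0 + (of_real s * om) ^ k)) \<longlongrightarrow> norm (2 * D z0 + (of_real 0 * om) ^ k)) F"
   by (intro tendsto_intros sl)
  moreover have "((%s. Q * (s ^ (k - 2) * (norm (deriv h (c s)))^2)) \<longlongrightarrow> Q * (0 ^ (k - 2) * (norm (deriv h z0))^2)) F"
   by (intro tendsto_intros sl hl)
  moreover have "eventually (%s. norm (2 * D z0 + (of_real s * om) ^ k) <= Q * (s ^ (k - 2) * (norm (deriv h (c s)))^2)) F"
   using n
  proof eventually_elim
   case (elim s)
   then have s: "s \<in> J" "s > 0" by (auto simp: J_def)
   define y where "y = of_real s * om"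
   have y: "norm y = s" using s(2) om(1) by (simp add: y_def norm_mult)
   have cB: "c s \<in> ball z0 r" "h (c s) = y" using hc[OF s(1)] B(3) by (auto simp: y_def)
   have De: "D (c s) = D z0 + y ^ k" "deriv D (c s) = of_nat k * y ^ (k - 1) * deriv h (c s)" using pf[OF cB(1)] cB(2) by simp_all
   have ee: "ef (ts s) * e s = 1" "ef (ts s) + e s = D (c s)"
    using ef_inv[of "ts s"] ef_cos[of "ts s"] Dc[OF s(1), folded ts(3)[OF s(1)]] by (simp_all add: e_def)
   have "norm ((phi (c s) a - e s) + (p_psi' (c s) a - e s)) <= 2 * N s"
    using elim norm_triangle_ineq[of "phi (c s) a - e s" "p_psi' (c s) a - e s"] by simp
   then have "(norm (D (c s) - 2 * e s))^2 <= (2 * N s)^2" by (intro power_mono) (simp_all add: D_def algebra_simps)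
   moreover have "(D (c s) - 2 * e s)^2 = y ^ k * (2 * D z0 + y ^ k)"
   proof -
    \<comment> \<open>As \<open>eps\<close> and \<open>eps'\<close> are the roots of
      \<open>X^2 - d * X + 1\<close>, the left-hand side is the discriminant
      \<open>d^2 - 4\<close>.\<close>
    have alg: "(d - 2 * eps)^2 = Y * (2 * d0 + Y)" if "d0^2 = 4" "eps' * eps = 1" "eps' + eps = d" "d = d0 + Y" for d d0 Y eps eps' :: complex
    proof -
     have "eps' = d0 + Y - eps" using that(3,4) by (simp add: algebra_simps)
     then have e2: "(d0 + Y) * eps - eps * eps = 1" using that(2) by (simp add: left_diff_distrib)
     have "(d - 2 * eps)^2 = (d0 + Y)^2 - 4 * ((d0 + Y) * eps - eps * eps)"
      unfolding that(4) by (simp add: power2_eq_square algebra_simps)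
     then show ?thesis unfolding e2 power2_sum that(1) by (simp add: power2_eq_square algebra_simps)
    qed
    have "(D z0)^2 = 4" using D0 by auto
    then show ?thesis by (rule alg[OF _ ee De(1)])
   qed
   ultimately have "s ^ k * norm (2 * D z0 + y ^ k) <= (2 * N s)^2" using y by (metis norm_mult norm_power)
   also have "2 * N s = (128 * C * k) * s ^ (k - 1) * norm (deriv h (c s))"
    unfolding N_def De(2) by (simp add: norm_mult norm_power y)
   also have "(...)^2 = Q * (s ^ (k - 1))^2 * (norm (deriv h (c s)))^2" unfolding Q_def by (simp only: power_mult_distrib)
   also have "(s ^ (k - 1))^2 = s ^ k * s ^ (k - 2)"
    using k3 unfolding power_mult[symmetric] power_add[symmetric] by (intro arg_cong[of _ _ "%n. s ^ n"]) simp
   finally have "s ^ k * norm (2 * D z0 + y ^ k) <= s ^ k * (Q * (s ^ (k - 2) * (norm (deriv h (c s)))^2))" by (simp only: mult_ac)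
   then show ?case using s(2) by (simp add: y_def)
  qed
  ultimately have "norm (2 * D z0 + (of_real 0 * om) ^ k) <= Q * (0 ^ (k - 2) * (norm (deriv h z0))^2)"
   using nb by (intro tendsto_le)
  then have "norm (2 * D z0) <= 0" using k3 kr(1) by (simp add: zero_power)
  then show False using D0 by auto
 qed
 moreover have "k ~= 1" using kr(3) d1 by auto
 ultimately have "k = 2" using kr(1) by linarith
 then show ?thesis using D0 p0 q0 kr(3) by simp
qed

end

theorem theorem4p6:
  fixes a :: real and w p q :: "real \<Rightarrow> real" and z0 :: complex and t0 :: real
  assumes "periodic_SL a w p q"
    and "z0 \<in> periodic_SL.critical_points a w p q"
    and "t0 = arccos (Re (periodic_SL.D a w p q z0) / 2)"
  shows
    "(periodic_SL.regular_critical_point a w p q z0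
      \<longleftrightarrow>
      periodic_SL.D a w p q z0 \<in> {-2, 2} \<and>
      periodic_SL.psi w p q z0 a = 0 \<and> periodic_SL.p_phi' w p q z0 a = 0 \<and>
      (deriv ^^ 2) (periodic_SL.D a w p q) z0 \<noteq> 0)
     \<and>
     (periodic_SL.D a w p q z0 \<in> {-2, 2} \<and>
      periodic_SL.psi w p q z0 a = 0 \<and> periodic_SL.p_phi' w p q z0 a = 0 \<and>
      (deriv ^^ 2) (periodic_SL.D a w p q) z0 \<noteq> 0
      \<longleftrightarrow>
      op_ker (op_minus (periodic_SL.A_fiber a w p q t0) z0
              O op_minus (periodic_SL.A_fiber a w p q t0) z0)
      = op_ker (op_minus (periodic_SL.A_fiber a w p q t0) z0))"
proof -
 interpret periodic_SL a w p q by (rule assms(1))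
 have crit: "deriv D z0 = 0" "z0 \<in> op_spectrum MR A" using assms(2) by (auto simp: critical_points_def)
 \<comment> \<open>The spectrum lies in the band, so \<open>D z0\<close> is real and in [-2, 2].
   Hence the \<open>Re\<close> and the \<open>arccos\<close> in the definition of \<open>t0\<close>
   lose nothing, and \<open>z0\<close> is in the spectrum of the fibre \<open>t0\<close>.\<close>
 obtain x where x: "- 2 \<le> x" "x \<le> 2" "D z0 = of_real x" by (rule spectrum_in_band[OF crit(2)])
 then have "2 * cos t0 = x" using assms(3) by simp
 then have "complex_of_real (2 * cos t0) = D z0" by (simp only: x(3))
 then have "2 * of_real (cos t0) - D z0 = 0" by simp
 from kernel_iff[OF this crit(1)] show ?thesis using regular_if[OF assms(2)] regular_only_if by blast
qed

end
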